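(* Let $\Theta$ be a finite connected graph with no valence $1$ vertices and let $f\colon\Theta\to\Theta$ be an expanding irreducible train track map. Let $f_*\colon \pi_1(\Theta)\to\pi_1(\Theta)$ be the free group endomorphism represented by $f$, let $Q=\pi_1(\Theta)/\bigcup_{k\ge 1}\ker(f_*^k)$ be its stable quotient, and let $\phi\colon Q\to Q$ be the injective endomorphism induced by $f_*$. Then there exist a finite graph $\bar\Theta$ with $\pi_1(\bar\Theta)\cong Q$ and with no valence $1$ vertices, and an expanding irreducible train track map $\bar f\colon\bar\Theta\to\bar\Theta$ such that $\bar f_*=\phi$ up to post-composition with an inner automorphism of $Q$ (under an identification $\pi_1(\bar\Theta)\cong Q$). Furthermore, there exist graph maps $\bar p\colon\bar\Theta\to\Theta$ and $\Phi\colon\Theta\to\bar\Theta$ such that \begin{itemize} \item $\bar f\,\Phi=\Phi f$ and $\bar p\,\bar f=f\,\bar p$, and \item $\bar p\,\Phi=f^K$ and $\Phi\,\bar p=\bar f^K$ for some $K\ge 1$. \end{itemize}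
   Context: A graph is a $1$-dimensional CW complex; valence $2$ vertices are allowed. A graph map between graphs is a continuous map sending vertices to vertices and sending each edge along an edge path, i.e. each edge has a finite subdivision such that every open subinterval is mapped homeomorphically onto an open edge. The combinatorial length of the image edge path is its number of edges. For a graph map $f\colon\Theta\to\Theta$, the $(e',e)$-entry of the transition matrix $A(f)$ is the total number of occurrences of $e^{\pm1}$ in the edge path $f(e')$. The map $f$ is irreducible if for every ordered pair $(e',e)$ of edges there is $t\ge1$ such that the $(e',e)$-entry of $A(f)^t$ is positive. The map $f$ is expanding if for each edge $e$ the combinatorial length of $f^n(e)$ tends to $\infty$ as $n\to\infty$. A train track map is a graph map $f\colon\Theta\to\Theta$ such that $f$ is surjective and, for every edge $e$ and every $n\ge1$, the restriction $f^n|_e$ is an immersion (locally injective). It is not required to be a homotopy equivalence. The endomorphism $f_*$ is well defined up to composition with inner automorphisms of $\pi_1(\Theta)$ (by choosing a basepoint and a path from it to its image). The subgroup $\bigcup_{k\ge1}\ker(f_*^k)$ is normal and does not depend on this choice; $f_*$ descends to an injective endomorphism of the quotient $Q$, which is a free group. *)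

theory Defs
  imports "HOL-Analysis.Analysis" "HOL-Algebra.Coset"
begin

section \<open>Finite graphs as CW complexes\<close>

text \<open>
  Edges are the open 1-cells, represented as sets of points; each comes with a chosen
  characteristic map defined on the unit interval. The choice orients the edge; up to the order in
  which an edge path is listed, no notion below depends on it.
\<close>

record 'a cw_graph =
  gtop :: "'a topology"
  verts :: "'a set"
  edges :: "'a set set"
  charmap :: "'a set \<Rightarrow> real \<Rightarrow> 'a"

text \<open>
  As there are only finitely many cells and the space is Hausdorff, closure-finiteness and the weak
  topology are automatic. A graph without edges is allowed.
\<close>

definition finite_graph :: "'a cw_graph \<Rightarrow> bool" where
  "finite_graph G \<longleftrightarrow>
     Hausdorff_space (gtop G) \<and>
     finite (verts G) \<and> finite (edges G) \<and>
     topspace (gtop G) = verts G \<union> \<Union>(edges G) \<and>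
     disjoint (edges G) \<and> verts G \<inter> \<Union>(edges G) = {} \<and>
     (\<forall>e\<in>edges G.
        continuous_map (top_of_set {0..1}) (gtop G) (charmap G e) \<and>
        charmap G e 0 \<in> verts G \<and> charmap G e 1 \<in> verts G \<and>
        homeomorphic_map (top_of_set {0<..<1}) (subtopology (gtop G) e) (charmap G e))"

text \<open>A loop contributes 2 to the valence of its vertex.\<close>

definition valence :: "'a cw_graph \<Rightarrow> 'a \<Rightarrow> nat" where
  "valence G v = card {e \<in> edges G. charmap G e 0 = v} + card {e \<in> edges G. charmap G e 1 = v}"

definition no_valence_one :: "'a cw_graph \<Rightarrow> bool" where
  "no_valence_one G \<longleftrightarrow> (\<forall>v\<in>verts G. valence G v \<noteq> 1)"

section \<open>Graph maps\<close>

text \<open>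
  \<open>ts\<close> lists the points \<open>0 = t\<^sub>0 < \<dots> < t\<^sub>m = 1\<close> of a subdivision of the edge \<open>e\<close> such that \<open>f\<close> maps
  every open subinterval homeomorphically onto an open edge of \<open>H\<close>. By continuity the
  subdivision points are then exactly those mapped to vertices, so \<open>ts\<close> is unique if it exists.
\<close>

definition edge_subdivision ::
  "'a cw_graph \<Rightarrow> 'b cw_graph \<Rightarrow> ('a \<Rightarrow> 'b) \<Rightarrow> 'a set \<Rightarrow> real list \<Rightarrow> bool" where
  "edge_subdivision G H f e ts \<longleftrightarrow>
     ts \<noteq> [] \<and> sorted_wrt (<) ts \<and> hd ts = 0 \<and> last ts = 1 \<and>
     (\<forall>i. Suc i < length ts \<longrightarrow>
        (\<exists>d\<in>edges H. homeomorphic_map (top_of_set {ts ! i<..<ts ! Suc i})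
                        (subtopology (gtop H) d) (f \<circ> charmap G e)))"

definition graph_map :: "'a cw_graph \<Rightarrow> 'b cw_graph \<Rightarrow> ('a \<Rightarrow> 'b) \<Rightarrow> bool" where
  "graph_map G H f \<longleftrightarrow>
     continuous_map (gtop G) (gtop H) f \<and> f ` verts G \<subseteq> verts H \<and>
     (\<forall>e\<in>edges G. \<exists>ts. edge_subdivision G H f e ts)"

text \<open>The edges traversed by \<open>f(e)\<close>, in order and regardless of direction.\<close>

definition edge_path ::
  "'a cw_graph \<Rightarrow> 'b cw_graph \<Rightarrow> ('a \<Rightarrow> 'b) \<Rightarrow> 'a set \<Rightarrow> 'b set list" where
  "edge_path G H f e =
     (let ts = (THE ts. edge_subdivision G H f e ts)
      in map (\<lambda>i. (f \<circ> charmap G e) ` {ts ! i<..<ts ! Suc i}) [0..<length ts - 1])"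

definition transition_matrix ::
  "'a cw_graph \<Rightarrow> ('a \<Rightarrow> 'a) \<Rightarrow> 'a set \<Rightarrow> 'a set \<Rightarrow> nat" where
  "transition_matrix G f e' e = count_list (edge_path G G f e') e"

text \<open>Powers of a square matrix with index set \<open>I\<close>.\<close>

primrec matrix_power :: "'i set \<Rightarrow> ('i \<Rightarrow> 'i \<Rightarrow> nat) \<Rightarrow> nat \<Rightarrow> 'i \<Rightarrow> 'i \<Rightarrow> nat" where
  "matrix_power I A 0 = (\<lambda>i j. if i = j then 1 else 0)"
| "matrix_power I A (Suc n) = (\<lambda>i j. \<Sum>k\<in>I. matrix_power I A n i k * A k j)"

definition irreducible_map :: "'a cw_graph \<Rightarrow> ('a \<Rightarrow> 'a) \<Rightarrow> bool" where
  "irreducible_map G f \<longleftrightarrow>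
     (\<forall>e'\<in>edges G. \<forall>e\<in>edges G. \<exists>t\<ge>1. matrix_power (edges G) (transition_matrix G f) t e' e > 0)"

definition expanding_map :: "'a cw_graph \<Rightarrow> ('a \<Rightarrow> 'a) \<Rightarrow> bool" where
  "expanding_map G f \<longleftrightarrow>
     (\<forall>e\<in>edges G. filterlim (\<lambda>n. length (edge_path G G (f ^^ n) e)) at_top sequentially)"

text \<open>
  Local injectivity of \<open>f\<^sup>n\<close> along an edge is tested in the characteristic map on the closed
  interval. Thus, for an edge that is a loop, it does not concern the turn at its vertex.
\<close>

definition train_track_map :: "'a cw_graph \<Rightarrow> ('a \<Rightarrow> 'a) \<Rightarrow> bool" where
  "train_track_map G f \<longleftrightarrow>
     graph_map G G f \<and> f ` topspace (gtop G) = topspace (gtop G) \<and>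
     (\<forall>e\<in>edges G. \<forall>n\<ge>1. \<forall>t\<in>{0..1}. \<exists>r>0.
        inj_on ((f ^^ n) \<circ> charmap G e) ({0..1} \<inter> ball t r))"

section \<open>The fundamental group\<close>

text \<open>
  The library's path operations and \<open>homotopic_paths\<close> are tied to topological type classes; these
  are the same notions for an abstract topology.
\<close>

definition path_join :: "(real \<Rightarrow> 'a) \<Rightarrow> (real \<Rightarrow> 'a) \<Rightarrow> real \<Rightarrow> 'a" where
  "path_join p q = (\<lambda>t. if t \<le> 1/2 then p (2 * t) else q (2 * t - 1))"

definition path_reverse :: "(real \<Rightarrow> 'a) \<Rightarrow> real \<Rightarrow> 'a" where
  "path_reverse p = (\<lambda>t. p (1 - t))"

definition path_homotopic :: "'a topology \<Rightarrow> (real \<Rightarrow> 'a) \<Rightarrow> (real \<Rightarrow> 'a) \<Rightarrow> bool" where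
  "path_homotopic X p q \<longleftrightarrow>
     homotopic_with (\<lambda>r. r 0 = p 0 \<and> r 1 = p 1) (top_of_set {0..1}) X p q"

definition path_class :: "'a topology \<Rightarrow> (real \<Rightarrow> 'a) \<Rightarrow> (real \<Rightarrow> 'a) set" where
  "path_class X p = {q. path_homotopic X p q}"

definition path_from_to :: "'a topology \<Rightarrow> 'a \<Rightarrow> 'a \<Rightarrow> (real \<Rightarrow> 'a) \<Rightarrow> bool" where
  "path_from_to X x y p \<longleftrightarrow> pathin X p \<and> p 0 = x \<and> p 1 = y"

text \<open>
  Operations on path classes are written as unions over all representatives; the result is again a
  single class, because the operations respect homotopy.
\<close>

definition pi1 :: "'a topology \<Rightarrow> 'a \<Rightarrow> (real \<Rightarrow> 'a) set monoid" where
  "pi1 X x =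
     \<lparr>carrier = path_class X ` {p. path_from_to X x x p},
      mult = (\<lambda>A B. \<Union>p\<in>A. \<Union>q\<in>B. path_class X (path_join p q)),
      one = path_class X (\<lambda>_. x)\<rparr>"

text \<open>
  The endomorphism of \<open>pi1 X x\<close> represented by a self-map \<open>f\<close> of \<open>X\<close>, computed with a path
  \<open>\<sigma>\<close> from \<open>x\<close> to \<open>f x\<close>.
\<close>

definition pi1_endo ::
  "'a topology \<Rightarrow> (real \<Rightarrow> 'a) \<Rightarrow> ('a \<Rightarrow> 'a) \<Rightarrow> (real \<Rightarrow> 'a) set \<Rightarrow> (real \<Rightarrow> 'a) set" where
  "pi1_endo X \<sigma> f A =
     (\<Union>p\<in>A. path_class X (path_join (path_join \<sigma> (f \<circ> p)) (path_reverse \<sigma>)))"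

section \<open>The stable quotient of an endomorphism\<close>

definition stable_kernel :: "('g, 'm) monoid_scheme \<Rightarrow> ('g \<Rightarrow> 'g) \<Rightarrow> 'g set" where
  "stable_kernel G h = (\<Union>k\<in>{1..}. kernel G G (h ^^ k))"

definition stable_quotient :: "('g, 'm) monoid_scheme \<Rightarrow> ('g \<Rightarrow> 'g) \<Rightarrow> 'g set monoid" where
  "stable_quotient G h = G Mod stable_kernel G h"

text \<open>The induced map sends the coset of \<open>a\<close> to the coset of \<open>h a\<close>.\<close>

definition stable_endo :: "('g, 'm) monoid_scheme \<Rightarrow> ('g \<Rightarrow> 'g) \<Rightarrow> 'g set \<Rightarrow> 'g set" where
  "stable_endo G h C = the_elem ((\<lambda>a. stable_kernel G h #>\<^bsub>G\<^esub> h a) ` C)"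

end

(* Fix k and identify two points of Theta when they are joined by a path that f^k maps to a null-homotopic
   loop. The quotient Theta' is a finite graph: its vertices are the classes of the points that f^k maps to
   vertices, and its edges are the classes of the maximal arcs over an edge, one for each way in which f^k
   folds arcs together. The map f^k factors as p o Phi, where Phi is the class map and p is injective on
   path classes because it is locally injective on edge words, and f descends to f' with Phi p = f'^k.
   Edge subdivisions can be read off after composing with p, so f' inherits the train track property,
   expansion and irreducibility. Since Phi is surjective on pi_1 with kernel ker(f_*^k), it remains to
   choose k so that the kernels of the powers of f_* have stabilized.

   Homotopy classes are detected by holonomies: an edge labelling by permutations of a finite set extends to
   a flat local cocycle, its holonomy along a path is a homotopy invariant, and every nonempty reduced edge
   word has nontrivial holonomy for some labelling. The holonomy representations of Theta' by permutations
   of n letters form a decreasing sequence in k, and there are |S_n|^b of them, where b = E - V + 1 is the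
   first Betti number of Theta'. For k with b minimal, the representations, hence the kernels, do not
   change any more. *)
theory Submission
  imports Defs
begin

section \<open>Paths in an abstract topological space\<close>

text \<open>Ascending chains of normal subgroups of a free group need not stop, so stabilization of
  the kernels uses more than finite generation. The images of the powers of the endomorphism are
  free of finite rank and map onto one another; once the rank is constant, these surjections are
  isomorphisms because finitely generated free groups are Hopfian. Counting representations in
  finite symmetric groups is Mal'cev's argument for this, with residual finiteness supplied by the
  detection of reduced words. Labels in an abelian group would see homology only, hence the
  noncommutative holonomy. Identifying points by the homotopy condition performs a maximal sequence
  of Stallings folds in one stroke: nothing has to be chosen, and the self-map descends because it
  commutes with its powers. The price is that the classes have to be shown to form a finite graph.
  Its edges are read off from the arcs lying over edges, it carries the weak topology of its
  characteristic maps, and finiteness comes from the finite fibres of a graph map along each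
  edge.\<close>

lemma path_homotopicD:
  assumes "path_homotopic X p q"
  shows "pathin X p" "pathin X q" "q 0 = p 0" "q 1 = p 1"
  using homotopic_with_imp_continuous_maps[OF assms[unfolded path_homotopic_def]]
    homotopic_with_imp_property[OF assms[unfolded path_homotopic_def]]
  by (auto simp: pathin_def)

lemma path_homotopic_refl: "pathin X p \<Longrightarrow> path_homotopic X p p"
  by (simp add: path_homotopic_def pathin_def)

lemma path_homotopic_sym:
  assumes "path_homotopic X p q"
  shows "path_homotopic X q p"
  using homotopic_with_symD[OF assms[unfolded path_homotopic_def]]
  unfolding path_homotopic_def path_homotopicD(3,4)[OF assms] .

lemma path_homotopic_trans [trans]:
  assumes "path_homotopic X p q" "path_homotopic X q r"
  shows "path_homotopic X p r"
  using homotopic_with_trans[OF assms(1)[unfolded path_homotopic_def]]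
    assms(2)[unfolded path_homotopic_def path_homotopicD(3,4)[OF assms(1)]]
  unfolding path_homotopic_def .

lemma path_homotopic_image:
  assumes "path_homotopic X p q" "continuous_map X Y f"
  shows "path_homotopic Y (f \<circ> p) (f \<circ> q)"
  using assms unfolding path_homotopic_def
  by (auto intro: homotopic_with_compose_continuous_map_left)

lemma path_homotopic_eq:
  assumes "pathin X p" "\<And>t. t \<in> {0..1} \<Longrightarrow> p t = q t"
  shows "path_homotopic X p q"
  unfolding path_homotopic_def
  using assms by (intro homotopic_with_equal) (auto simp: pathin_def)

lemma pathin_compose_real:
  assumes "continuous_map (top_of_set C) X h" "continuous_on {0..1} r" "r ` {0..1} \<subseteq> C"
  shows "pathin X (h \<circ> r)"
  unfolding pathin_def
  by (rule continuous_map_compose[OF _ assms(1)]) (use assms in auto)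

text \<open>All reparametrization homotopies come from this one: the straight-line homotopy in a convex
  parameter domain.\<close>

lemma path_homotopic_convex:
  fixes C :: "'b::real_normed_vector set"
  assumes h: "continuous_map (top_of_set C) X h" and C: "convex C"
    and r: "continuous_on {0..1} r" "r ` {0..1} \<subseteq> C"
    and s: "continuous_on {0..1} s" "s ` {0..1} \<subseteq> C"
    and e: "r 0 = s 0" "r 1 = s 1"
  shows "path_homotopic X (h \<circ> r) (h \<circ> s)"
proof -
  have "homotopic_with (\<lambda>k. k 0 = r 0 \<and> k 1 = r 1) (top_of_set {0..1}) (top_of_set C) r s"
    unfolding homotopic_with_def
  proof (intro exI conjI allI ballI)
    let ?h = "\<lambda>z. (1 - fst z) *\<^sub>R r (snd z) + fst z *\<^sub>R s (snd z)"
    have "?h z \<in> C" if "z \<in> {0..1} \<times> {0..1}" for z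
      using that r s C by (auto simp: image_subset_iff convex_alt)
    moreover have "continuous_on ({0..1} \<times> {0..1}) ?h"
      by (intro continuous_intros continuous_on_compose2[OF r(1)] continuous_on_compose2[OF s(1)]) auto
    ultimately show "continuous_map (prod_topology (top_of_set {0..1}) (top_of_set {0..1})) (top_of_set C) ?h"
      by auto
    show "?h (t, 0) = r 0" "?h (t, 1) = r 1" for t
      using e by (simp_all flip: scaleR_add_left)
  qed auto
  then show ?thesis
    unfolding path_homotopic_def
    by (rule homotopic_with_compose_continuous_map_left[OF _ h]) auto
qed

lemma path_homotopic_reparam:
  assumes "pathin X p"
    and "continuous_on {0..1} r" "r ` {0..1} \<subseteq> {0..1}"
    and "continuous_on {0..1} s" "s ` {0..1} \<subseteq> {0..1}"
    and "r 0 = s 0" "r 1 = s 1"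
  shows "path_homotopic X (p \<circ> r) (p \<circ> s)"
  using path_homotopic_convex[of "{0..1::real}" X p r s] assms by (auto simp: pathin_def)

lemma path_join_simps [simp]: "path_join p q 0 = p 0" "path_join p q 1 = q 1"
  by (simp_all add: path_join_def)

lemma path_reverse_simps [simp]: "path_reverse p 0 = p 1" "path_reverse p 1 = p 0"
  by (simp_all add: path_reverse_def)

lemma comp_path_join: "f \<circ> path_join p q = path_join (f \<circ> p) (f \<circ> q)"
  by (auto simp: path_join_def)

lemma comp_path_reverse: "f \<circ> path_reverse p = path_reverse (f \<circ> p)"
  by (auto simp: path_reverse_def)

lemma comp_path_const: "f \<circ> (\<lambda>_. x) = (\<lambda>_. f x)"
  by auto

text \<open>The parameter space \<open>Z\<close> lets one proof serve twice: with a single point it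
  joins two paths, with the unit interval it joins two homotopies.\<close>

lemma continuous_map_path_join:
  assumes p: "continuous_map (prod_topology Z (top_of_set {0..1})) X (\<lambda>(z, t). p z t)"
    and q: "continuous_map (prod_topology Z (top_of_set {0..1})) X (\<lambda>(z, t). q z t)"
    and e: "\<And>z. z \<in> topspace Z \<Longrightarrow> p z 1 = q z 0"
  shows "continuous_map (prod_topology Z (top_of_set {0..1})) X (\<lambda>(z, t). path_join (p z) (q z) t)"
proof -
  let ?W = "prod_topology Z (top_of_set {0..1::real})"
  have fst: "continuous_map (subtopology ?W S) Z fst" for S
    by (intro continuous_map_from_subtopology continuous_map_fst)
  have snd: "continuous_map (subtopology ?W S) euclideanreal snd" for S
    using continuous_map_from_subtopology[OF continuous_map_snd[of Z "top_of_set {0..1::real}"]]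
    by (metis continuous_map_into_fulltopology)
  have 1: "continuous_map ?W X (\<lambda>w. if snd w \<le> 1/2 then p (fst w) (2 * snd w) else q (fst w) (2 * snd w - 1))"
  proof (rule continuous_map_cases_le)
    show "continuous_map ?W euclideanreal snd"
      using snd[of UNIV] by simp
    let ?S = "{x \<in> topspace ?W. snd x \<le> 1 / 2}"
    have "continuous_map (subtopology ?W ?S) ?W (\<lambda>w. (fst w, 2 * snd w))"
      by (auto simp: continuous_map_pairwise o_def fst continuous_map_in_subtopology
          intro!: continuous_map_real_mult snd)
    from continuous_map_compose[OF this p]
    show "continuous_map (subtopology ?W ?S) X (\<lambda>w. p (fst w) (2 * snd w))"
      by (simp add: o_def)
  next
    show "continuous_map ?W euclideanreal (\<lambda>x. 1 / 2)" by simp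
  next
    let ?S = "{x \<in> topspace ?W. 1 / 2 \<le> snd x}"
    have "continuous_map (subtopology ?W ?S) ?W (\<lambda>w. (fst w, 2 * snd w - 1))"
      by (auto simp: continuous_map_pairwise o_def fst continuous_map_in_subtopology
          intro!: continuous_map_real_mult continuous_map_diff snd)
    from continuous_map_compose[OF this q]
    show "continuous_map (subtopology ?W ?S) X (\<lambda>w. q (fst w) (2 * snd w - 1))"
      by (simp add: o_def)
  next
    fix w assume "w \<in> topspace ?W" "snd w = 1/2"
    then have "2 * snd w = 1" "2 * snd w - 1 = 0" "fst w \<in> topspace Z"
      by auto
    then show "p (fst w) (2 * snd w) = q (fst w) (2 * snd w - 1)"
      using e[of "fst w"] by (simp only:)
  qed
  show ?thesis
    using 1 by (simp add: path_join_def case_prod_unfold)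
qed

lemma continuous_map_snd_iff:
  assumes "continuous_map Y X p"
  shows "continuous_map (prod_topology Z Y) X (\<lambda>(z, t). p t)"
  using continuous_map_compose[OF continuous_map_snd[of Z Y] assms] by (simp add: o_def case_prod_unfold)

lemma pathin_join:
  assumes "pathin X p" "pathin X q" "p 1 = q 0"
  shows "pathin X (path_join p q)"
proof -
  let ?Z = "top_of_set {0::real}"
  have 1: "continuous_map (prod_topology ?Z (top_of_set {0..1})) X (\<lambda>(z, t). path_join p q t)"
    using assms unfolding pathin_def by (intro continuous_map_path_join continuous_map_snd_iff) auto
  have 2: "continuous_map (top_of_set {0..1}) (prod_topology ?Z (top_of_set {0..1})) (\<lambda>t. (0, t))"
    by (auto simp: continuous_map_pairwise o_def simp del: prod_topology_subtopology_eu)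
  show ?thesis
    using continuous_map_compose[OF 2 1] by (simp add: pathin_def o_def)
qed

lemma pathin_reverse:
  assumes "pathin X p"
  shows "pathin X (path_reverse p)"
proof -
  have "pathin X (p \<circ> (\<lambda>t. 1 - t))"
    using assms by (intro pathin_compose_real[of "{0..1}"]) (auto simp: pathin_def intro!: continuous_intros)
  then show ?thesis by (simp add: path_reverse_def o_def)
qed

lemma path_homotopic_join:
  fixes X :: "'a topology"
  assumes "path_homotopic X p p'" "path_homotopic X q q'" "p 1 = q 0"
  shows "path_homotopic X (path_join p q) (path_join p' q')"
proof -
  from assms(1) obtain h :: "real \<times> real \<Rightarrow> 'a" where h: "continuous_map (prod_topology (top_of_set {0..1}) (top_of_set {0..1})) X h"
    "\<And>x. h (0, x) = p x" "\<And>x. h (1, x) = p' x" "\<And>t. t \<in> {0..1} \<Longrightarrow> h (t, 0) = p 0 \<and> h (t, 1) = p 1"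
    unfolding path_homotopic_def homotopic_with_def by blast
  from assms(2) obtain k :: "real \<times> real \<Rightarrow> 'a" where k: "continuous_map (prod_topology (top_of_set {0..1}) (top_of_set {0..1})) X k"
    "\<And>x. k (0, x) = q x" "\<And>x. k (1, x) = q' x" "\<And>t. t \<in> {0..1} \<Longrightarrow> k (t, 0) = q 0 \<and> k (t, 1) = q 1"
    unfolding path_homotopic_def homotopic_with_def by blast
  have "continuous_map (prod_topology (top_of_set {0..1}) (top_of_set {0..1})) X
      (\<lambda>(s, t). path_join (\<lambda>t. h (s, t)) (\<lambda>t. k (s, t)) t)"
    by (rule continuous_map_path_join)
      (use h k assms(3) in \<open>auto simp del: prod_topology_subtopology_eu\<close>)
  then show ?thesis
    unfolding path_homotopic_def homotopic_with_def
    by (intro exI[of _ "\<lambda>(s, t). path_join (\<lambda>t. h (s, t)) (\<lambda>t. k (s, t)) t"])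
      (use h k in auto)
qed

lemma path_homotopic_reverse:
  assumes "path_homotopic X p q"
  shows "path_homotopic X (path_reverse p) (path_reverse q)"
proof -
  have "homotopic_with (\<lambda>r. r 0 = p 1 \<and> r 1 = p 0) (top_of_set {0..1}) X (p \<circ> (\<lambda>t. 1 - t)) (q \<circ> (\<lambda>t. 1 - t))"
    by (rule homotopic_with_compose_continuous_map_right[OF assms[unfolded path_homotopic_def]])
      (auto intro!: continuous_intros)
  then show ?thesis
    by (simp add: path_homotopic_def path_reverse_def o_def)
qed

lemma path_homotopic_assoc:
  assumes "pathin X p" "pathin X q" "pathin X r" "p 1 = q 0" "q 1 = r 0"
  shows "path_homotopic X (path_join (path_join p q) r) (path_join p (path_join q r))"
proof -
  \<comment> \<open>Piecewise linear, sending \<open>1/2\<close> to \<open>1/4\<close> and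
    \<open>3/4\<close> to \<open>1/2\<close>, the break points of the two bracketings. Its slopes
    increase, so it is the maximum of its three branches, which makes it visibly continuous.\<close>
  define s :: "real \<Rightarrow> real" where "s t = (if t \<le> 1/2 then t / 2 else if t \<le> 3/4 then t - 1/4 else 2 * t - 1)" for t
  have s: "s t = max (max (t/2) (t - 1/4)) (2 * t - 1)" for t
    by (auto simp: s_def max_def)
  let ?P = "path_join (path_join p q) r"
  have 1: "path_homotopic X (?P \<circ> id) (?P \<circ> s)"
    using assms by (intro path_homotopic_reparam pathin_join) (auto simp: s intro!: continuous_intros)
  have "path_join (path_join p q) r (s t) = path_join p (path_join q r) t" for t
  proof -
    consider "t \<le> 1/2" | "1/2 < t" "t \<le> 3/4" | "3/4 < t" by linarith
    then show ?thesis
    proof cases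
      case 2
      then have "s t \<le> 1/2" "\<not> 2 * s t \<le> 1/2" "2 * (2 * s t) - 1 = 2 * (2 * t - 1)" "2 * t - 1 \<le> 1/2" "\<not> t \<le> 1/2"
        by (auto simp: s_def)
      then show ?thesis
        by (simp only: path_join_def if_True if_False)
    next
      case 3
      then have "\<not> s t \<le> 1/2" "2 * s t - 1 = 2 * (2 * t - 1) - 1" "\<not> 2 * t - 1 \<le> 1/2" "\<not> t \<le> 1/2"
        by (auto simp: s_def)
      then show ?thesis
        by (simp only: path_join_def if_True if_False)
    qed (simp add: path_join_def s_def)
  qed
  then have "?P \<circ> s = path_join p (path_join q r)"
    by (auto simp: fun_eq_iff)
  with 1 show ?thesis by simp
qed

lemma path_homotopic_const_right:
  assumes "pathin X p" "p 1 = x"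
  shows "path_homotopic X (path_join p (\<lambda>_. x)) p"
proof -
  have 1: "path_homotopic X (p \<circ> (\<lambda>t. min (2 * t) 1)) (p \<circ> id)"
    using assms by (intro path_homotopic_reparam) (auto intro!: continuous_intros)
  have 2: "p \<circ> (\<lambda>t. min (2 * t) 1) = path_join p (\<lambda>_. x)"
    using assms by (auto simp: path_join_def min_def fun_eq_iff)
  show ?thesis
    using 1 unfolding 2 by simp
qed

lemma path_homotopic_const_left:
  assumes "pathin X p" "p 0 = x"
  shows "path_homotopic X (path_join (\<lambda>_. x) p) p"
proof -
  have 1: "path_homotopic X (p \<circ> (\<lambda>t. max 0 (2 * t - 1))) (p \<circ> id)"
    using assms by (intro path_homotopic_reparam) (auto intro!: continuous_intros)
  have 2: "p \<circ> (\<lambda>t. max 0 (2 * t - 1)) = path_join (\<lambda>_. x) p"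
  proof
    show "(p \<circ> (\<lambda>t. max 0 (2 * t - 1))) t = path_join (\<lambda>_. x) p t" for t
      using assms by (cases "t \<le> 1/2") (auto simp: path_join_def max_absorb1 max_absorb2)
  qed
  show ?thesis
    using 1 unfolding 2 by simp
qed

lemma path_homotopic_reverse_right:
  assumes "pathin X p"
  shows "path_homotopic X (path_join p (path_reverse p)) (\<lambda>_. p 0)"
proof -
  \<comment> \<open>Out and back is \<open>p\<close> along the tent function, which contracts within
    the interval to \<open>0\<close>.\<close>
  have 1: "path_homotopic X (p \<circ> (\<lambda>t. min (2 * t) (2 - 2 * t))) (p \<circ> (\<lambda>t. 0))"
    using assms by (intro path_homotopic_reparam) (auto intro!: continuous_intros simp: min_le_iff_disj)
  have 2: "p \<circ> (\<lambda>t. min (2 * t) (2 - 2 * t)) = path_join p (path_reverse p)"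
    by (auto simp: path_join_def path_reverse_def min_def fun_eq_iff intro!: arg_cong[where f=p])
  show ?thesis
    using 1 unfolding 2 by (simp add: o_def)
qed

lemma path_reverse_reverse [simp]: "path_reverse (path_reverse p) = p"
  by (simp add: path_reverse_def)

lemma path_homotopic_reverse_left:
  assumes "pathin X p"
  shows "path_homotopic X (path_join (path_reverse p) p) (\<lambda>_. p 1)"
  using path_homotopic_reverse_right[OF pathin_reverse[OF assms]] by simp

text \<open>The bounds may come in either order, so that returning along a path is a subpath as
  well.\<close>

definition subpath :: "real \<Rightarrow> real \<Rightarrow> (real \<Rightarrow> 'a) \<Rightarrow> real \<Rightarrow> 'a" where
  "subpath a b p = (\<lambda>t. p (a + t * (b - a)))"

lemma subpath_simps [simp]: "subpath a b p 0 = p a" "subpath a b p 1 = p b"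
  by (simp_all add: subpath_def)

lemma comp_subpath: "f \<circ> subpath a b p = subpath a b (f \<circ> p)"
  by (auto simp: subpath_def)

lemma subpath_01 [simp]: "subpath 0 1 p = p"
  by (simp add: subpath_def)

lemma segment_param_in:
  assumes "a \<in> {c..d}" "b \<in> {c..d}" "t \<in> {0..1::real}"
  shows "a + t * (b - a) \<in> {c..d}"
proof -
  have "a + t * (b - a) = (1 - t) *\<^sub>R a + t *\<^sub>R b"
    by (simp add: algebra_simps)
  also have "\<dots> \<in> {c..d}"
    using assms convex_real_interval(5)[of c d] by (simp only: convex_alt) auto
  finally show ?thesis .
qed

lemma pathin_subpath:
  assumes "pathin X p" "a \<in> {0..1}" "b \<in> {0..1}"
  shows "pathin X (subpath a b p)"
proof -
  have "pathin X (p \<circ> (\<lambda>t. a + t * (b - a)))"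
  proof (rule pathin_compose_real)
    show "continuous_map (top_of_set {0..1}) X p"
      using assms(1) by (simp add: pathin_def)
    show "(\<lambda>t. a + t * (b - a)) ` {0..1} \<subseteq> {0..1}"
      by (rule image_subsetI) (rule segment_param_in[OF assms(2,3)])
  qed (intro continuous_intros)
  then show ?thesis by (simp add: subpath_def o_def)
qed

text \<open>Both sides reparametrize \<open>p\<close> with the same end parameters, whatever the
  order of the three points. In particular a segment followed by its return, the case
  \<open>a = c\<close>, contracts.\<close>

lemma path_homotopic_subpath_join:
  assumes p: "pathin X p" and a: "a \<in> {0..1}" "b \<in> {0..1}" "c \<in> {0..1}"
  shows "path_homotopic X (path_join (subpath a b p) (subpath b c p)) (subpath a c p)"
proof -
  let ?r = "path_join (subpath a b id) (subpath b c id)"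
  have rid: "pathin euclideanreal (subpath a b id)" for a b
    by (auto simp: pathin_def subpath_def intro!: continuous_intros)
  have 1: "continuous_on {0..1} ?r"
    using pathin_join[OF rid[of a b] rid[of b c]] by (simp add: pathin_def)
  have 2: "?r ` {0..1} \<subseteq> {0..1}"
  proof
    fix y assume "y \<in> ?r ` {0..1}"
    then obtain t where t: "t \<in> {0..1}" "y = ?r t" by blast
    show "y \<in> {0..1}"
    proof (cases "t \<le> 1/2")
      case True
      with t have "y = a + (2 * t) * (b - a)" "2 * t \<in> {0..1}"
        by (simp_all add: path_join_def subpath_def)
      then show ?thesis
        using segment_param_in[OF a(1,2)] by (simp only:)
    next
      case False
      with t have "y = b + (2 * t - 1) * (c - b)" "2 * t - 1 \<in> {0..1}"
        by (simp_all add: path_join_def subpath_def)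
      then show ?thesis
        using segment_param_in[OF a(2,3)] by (simp only:)
    qed
  qed
  have 3: "(\<lambda>t. a + t * (c - a)) ` {0..1} \<subseteq> {0..1}"
    by (rule image_subsetI) (rule segment_param_in[OF a(1,3)])
  have "path_homotopic X (p \<circ> ?r) (p \<circ> (\<lambda>t. a + t * (c - a)))"
    by (rule path_homotopic_reparam[OF p 1 2 _ 3]) (auto intro!: continuous_intros)
  then show ?thesis
    unfolding comp_path_join comp_subpath by (simp add: subpath_def o_def)
qed

lemma path_from_to_join:
  "path_from_to X x y p \<Longrightarrow> path_from_to X y z q \<Longrightarrow> path_from_to X x z (path_join p q)"
  by (simp add: path_from_to_def pathin_join)

lemma path_from_to_reverse: "path_from_to X x y p \<Longrightarrow> path_from_to X y x (path_reverse p)"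
  by (simp add: path_from_to_def pathin_reverse)

lemma path_from_to_image:
  "path_from_to X x y p \<Longrightarrow> continuous_map X Y f \<Longrightarrow> path_from_to Y (f x) (f y) (f \<circ> p)"
  by (auto simp: path_from_to_def pathin_compose)

section \<open>Cancellation in the fundamental groupoid\<close>

lemma path_homotopic_cancel_left:
  assumes "pathin X q" "pathin X p" "q 1 = p 0"
  shows "path_homotopic X (path_join (path_reverse q) (path_join q p)) p"
proof -
  have "path_homotopic X (path_join (path_reverse q) (path_join q p))
      (path_join (path_join (path_reverse q) q) p)"
    using assms by (intro path_homotopic_sym[OF path_homotopic_assoc] pathin_reverse) auto
  also have "path_homotopic X \<dots> (path_join (\<lambda>_. q 1) p)"
    using assms by (intro path_homotopic_join path_homotopic_reverse_left path_homotopic_refl) auto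
  also have "path_homotopic X \<dots> p"
    using assms by (intro path_homotopic_const_left) auto
  finally show ?thesis .
qed

lemma path_homotopic_cancel_right:
  assumes "pathin X q" "pathin X p" "p 1 = q 0"
  shows "path_homotopic X (path_join (path_join p q) (path_reverse q)) p"
proof -
  have "path_homotopic X (path_join (path_join p q) (path_reverse q))
      (path_join p (path_join q (path_reverse q)))"
    using assms by (intro path_homotopic_assoc pathin_reverse) auto
  also have "path_homotopic X \<dots> (path_join p (\<lambda>_. q 0))"
    using assms by (intro path_homotopic_join path_homotopic_reverse_right path_homotopic_refl) auto
  also have "path_homotopic X \<dots> p"
    using assms by (intro path_homotopic_const_right) auto
  finally show ?thesis .
qed

lemma path_homotopic_join_cancel_left:
  assumes "path_homotopic X (path_join q p) (path_join q p')" "pathin X q" "pathin X p" "pathin X p'"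
    "q 1 = p 0" "q 1 = p' 0"
  shows "path_homotopic X p p'"
proof -
  have "path_homotopic X p (path_join (path_reverse q) (path_join q p))"
    using assms by (intro path_homotopic_sym[OF path_homotopic_cancel_left])
  also have "path_homotopic X \<dots> (path_join (path_reverse q) (path_join q p'))"
    using assms by (intro path_homotopic_join[OF path_homotopic_refl[OF pathin_reverse] assms(1)]) auto
  also have "path_homotopic X \<dots> p'"
    using assms by (intro path_homotopic_cancel_left)
  finally show ?thesis .
qed

lemma path_homotopic_join_cancel_right:
  assumes "path_homotopic X (path_join p q) (path_join p' q)" "pathin X q" "pathin X p" "pathin X p'"
    "p 1 = q 0" "p' 1 = q 0"
  shows "path_homotopic X p p'"
proof -
  have "path_homotopic X p (path_join (path_join p q) (path_reverse q))"
    using assms by (intro path_homotopic_sym[OF path_homotopic_cancel_right])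
  also have "path_homotopic X \<dots> (path_join (path_join p' q) (path_reverse q))"
    using assms by (intro path_homotopic_join[OF assms(1) path_homotopic_refl[OF pathin_reverse]]) auto
  also have "path_homotopic X \<dots> p'"
    using assms by (intro path_homotopic_cancel_right)
  finally show ?thesis .
qed

text \<open>A free homotopy \<open>h\<close> (first coordinate: time) moves the path along the tracks of its endpoints.\<close>

lemma path_homotopic_tracks:
  assumes h: "continuous_map (top_of_set ({0..1} \<times> {0..1})) X h"
  shows "path_homotopic X (path_join (\<lambda>t. h (0, t)) (\<lambda>s. h (s, 1))) (path_join (\<lambda>s. h (s, 0)) (\<lambda>t. h (1, t)))"
proof -
  define a b c d :: "real \<Rightarrow> real \<times> real"
    where "a = (\<lambda>t. (0, t))" "b = (\<lambda>s. (s, 1))" "c = (\<lambda>s. (s, 0))" "d = (\<lambda>t. (1, t))"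
  note abcd = a_b_c_d_def
  have 1: "pathin (top_of_set ({0..1} \<times> {0..1})) (path_join a b)"
    by (rule pathin_join) (auto simp: pathin_def abcd intro!: continuous_intros)
  have 2: "pathin (top_of_set ({0..1} \<times> {0..1})) (path_join c d)"
    by (rule pathin_join) (auto simp: pathin_def abcd intro!: continuous_intros)
  have "path_homotopic X (h \<circ> path_join a b) (h \<circ> path_join c d)"
  proof (rule path_homotopic_convex[OF h])
    show "path_join a b 0 = path_join c d 0" "path_join a b 1 = path_join c d 1"
      by (simp_all add: abcd)
  qed (use 1 2 in \<open>simp_all add: pathin_def image_subset_iff_funcset convex_Times\<close>)
  then show ?thesis
    unfolding comp_path_join by (simp add: abcd o_def)
qed

section \<open>Developing local cocycles along paths\<close>

text \<open>A local cocycle is a flat connection with values in a (not necessarily commutative) group,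
  written additively. Its holonomy is a homotopy invariant of paths.\<close>

definition local_cocycle :: "'s::topological_space set \<Rightarrow> ('s \<Rightarrow> 's \<Rightarrow> 'h::group_add) \<Rightarrow> bool" where
  "local_cocycle S \<theta> \<longleftrightarrow>
     (\<forall>z\<in>S. \<exists>N. open N \<and> z \<in> N \<and> (\<forall>a\<in>N \<inter> S. \<forall>b\<in>N \<inter> S. \<forall>c\<in>N \<inter> S. \<theta> a b + \<theta> b c = \<theta> a c))"

text \<open>A primitive of the cocycle. Increments are added on the right, so it stays a primitive
  after a translation on the left; the holonomy will be its total increment.\<close>

definition development :: "'s::topological_space set \<Rightarrow> ('s \<Rightarrow> 's \<Rightarrow> 'h::group_add) \<Rightarrow> ('s \<Rightarrow> 'h) \<Rightarrow> bool" where
  "development S \<theta> D \<longleftrightarrow>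
     (\<forall>z\<in>S. \<exists>N. open N \<and> z \<in> N \<and> (\<forall>a\<in>N \<inter> S. \<forall>b\<in>N \<inter> S. D b = D a + \<theta> a b))"

lemma local_cocycleE:
  assumes "local_cocycle S \<theta>" "z \<in> S"
  obtains N where "open N" "z \<in> N"
    "\<And>a b c. \<lbrakk>a \<in> N \<inter> S; b \<in> N \<inter> S; c \<in> N \<inter> S\<rbrakk> \<Longrightarrow> \<theta> a b + \<theta> b c = \<theta> a c"
  using bspec[OF assms(1)[unfolded local_cocycle_def] assms(2)] by auto

lemma developmentE:
  assumes "development S \<theta> D" "z \<in> S"
  obtains N where "open N" "z \<in> N" "\<And>a b. \<lbrakk>a \<in> N \<inter> S; b \<in> N \<inter> S\<rbrakk> \<Longrightarrow> D b = D a + \<theta> a b"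
  using bspec[OF assms(1)[unfolded development_def] assms(2)] by auto

lemma developmentI:
  assumes "\<And>z. z \<in> S \<Longrightarrow> \<exists>N. open N \<and> z \<in> N \<and> (\<forall>a\<in>N \<inter> S. \<forall>b\<in>N \<inter> S. D b = D a + \<theta> a b)"
  shows "development S \<theta> D"
  using assms by (simp add: development_def)

lemma local_cocycle_subset:
  assumes "local_cocycle S \<theta>" "T \<subseteq> S"
  shows "local_cocycle T \<theta>"
  unfolding local_cocycle_def
proof
  fix z assume "z \<in> T"
  then have "z \<in> S" using assms(2) by auto
  from local_cocycleE[OF assms(1) this] obtain N where N: "open N" "z \<in> N"
    "\<And>a b c. \<lbrakk>a \<in> N \<inter> S; b \<in> N \<inter> S; c \<in> N \<inter> S\<rbrakk> \<Longrightarrow> \<theta> a b + \<theta> b c = \<theta> a c" by blast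
  show "\<exists>N. open N \<and> z \<in> N \<and> (\<forall>a\<in>N \<inter> T. \<forall>b\<in>N \<inter> T. \<forall>c\<in>N \<inter> T. \<theta> a b + \<theta> b c = \<theta> a c)"
    using N assms(2) by (intro exI[of _ N] conjI ballI N) auto
qed

lemma development_cong:
  assumes D: "development S \<theta> D" and "\<And>a b. a \<in> S \<Longrightarrow> b \<in> S \<Longrightarrow> \<theta> a b = \<theta>' a b" "\<And>a. a \<in> S \<Longrightarrow> D a = D' a"
  shows "development S \<theta>' D'"
proof (rule developmentI)
  fix z assume "z \<in> S"
  from developmentE[OF D this] obtain N where N: "open N" "z \<in> N"
    "\<And>a b. \<lbrakk>a \<in> N \<inter> S; b \<in> N \<inter> S\<rbrakk> \<Longrightarrow> D b = D a + \<theta> a b" by blast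
  show "\<exists>N. open N \<and> z \<in> N \<and> (\<forall>a\<in>N \<inter> S. \<forall>b\<in>N \<inter> S. D' b = D' a + \<theta>' a b)"
  proof (intro exI[of _ N] conjI ballI)
    fix a b assume ab: "a \<in> N \<inter> S" "b \<in> N \<inter> S"
    then show "D' b = D' a + \<theta>' a b" using N(3)[OF ab] assms(2)[of a b] assms(3)[of a] assms(3)[of b] by simp
  qed (use N in auto)
qed

lemma development_pullback:
  assumes D: "development S \<theta> D" and r: "continuous_on T r" "r ` T \<subseteq> S"
  shows "development T (\<lambda>a b. \<theta> (r a) (r b)) (D \<circ> r)"
  unfolding development_def
proof
  fix z assume z: "z \<in> T"
  then have "r z \<in> S" using r by auto
  from developmentE[OF D this] obtain N where N: "open N" "r z \<in> N" "\<And>a b. a \<in> N \<inter> S \<Longrightarrow> b \<in> N \<inter> S \<Longrightarrow> D b = D a + \<theta> a b"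
    by blast
  obtain M where M: "open M" "M \<inter> T = r -` N \<inter> T"
    using r(1) N(1) unfolding continuous_on_open_invariant by blast
  show "\<exists>N. open N \<and> z \<in> N \<and> (\<forall>a\<in>N \<inter> T. \<forall>b\<in>N \<inter> T. (D \<circ> r) b = (D \<circ> r) a + \<theta> (r a) (r b))"
  proof (intro exI conjI ballI)
    have MT: "x \<in> M \<longleftrightarrow> r x \<in> N" if "x \<in> T" for x using M(2) that by blast
    show "open M" "z \<in> M" using M(1) MT[OF z] N(2) by simp_all
    fix a b assume "a \<in> M \<inter> T" "b \<in> M \<inter> T"
    then have "r a \<in> N \<inter> S" "r b \<in> N \<inter> S" using MT r(2) by auto
    from N(3)[OF this] show "(D \<circ> r) b = (D \<circ> r) a + \<theta> (r a) (r b)" by simp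
  qed
qed

text \<open>Both functions change by the same right summand, which cancels in
  \<open>D a - D' a\<close>; this difference is therefore locally constant.\<close>

lemma development_unique:
  assumes S: "connected S" and D: "development S \<theta> D" "development S \<theta> D'" and ab: "a \<in> S" "b \<in> S"
  shows "D a - D' a = D b - D' b"
proof (rule connected_local_const[OF S ab])
  show "\<forall>a\<in>S. \<forall>\<^sub>F b in at a within S. D a - D' a = D b - D' b"
  proof
    fix a assume a: "a \<in> S"
    obtain N where N: "open N" "a \<in> N" "\<And>x y. x \<in> N \<inter> S \<Longrightarrow> y \<in> N \<inter> S \<Longrightarrow> D y = D x + \<theta> x y"
      using developmentE[OF D(1) a] by blast
    obtain M where M: "open M" "a \<in> M" "\<And>x y. x \<in> M \<inter> S \<Longrightarrow> y \<in> M \<inter> S \<Longrightarrow> D' y = D' x + \<theta> x y"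
      using developmentE[OF D(2) a] by blast
    show "\<forall>\<^sub>F b in at a within S. D a - D' a = D b - D' b"
      unfolding eventually_at_topological
    proof (intro exI conjI ballI impI)
      show "open (N \<inter> M)" "a \<in> N \<inter> M" using N M by auto
      fix x assume "x \<in> N \<inter> M" "x \<noteq> a" "x \<in> S"
      then have x: "a \<in> N \<inter> S" "x \<in> N \<inter> S" "a \<in> M \<inter> S" "x \<in> M \<inter> S"
        using N(2) M(2) a by auto
      have "D x = D a + \<theta> a x" "D' x = D' a + \<theta> a x"
        using N(3)[OF x(1,2)] M(3)[OF x(3,4)] .
      then show "D a - D' a = D x - D' x"
        by (simp add: diff_conv_add_uminus minus_add add.assoc del: add_uminus_conv_diff)
    qed
  qed
qed

lemma development_small:
  assumes "\<And>a b c. a \<in> S \<Longrightarrow> b \<in> S \<Longrightarrow> c \<in> S \<Longrightarrow> \<theta> a b + \<theta> b c = \<theta> a c" "z \<in> S"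
  shows "development S \<theta> (\<theta> z)"
  by (rule developmentI, intro exI[of _ UNIV]) (use assms in auto)

text \<open>On the connected overlap the two primitives differ by a constant on the left, and
  translating the second one by it makes them agree.\<close>

lemma development_glue:
  assumes \<theta>: "local_cocycle (S \<union> T) \<theta>" and cl: "closed S" "closed T"
    and conn: "connected (S \<inter> T)" "S \<inter> T \<noteq> {}"
    and D1: "development S \<theta> D1" and D2: "development T \<theta> D2"
  shows "\<exists>D. development (S \<union> T) \<theta> D"
proof -
  obtain z0 where z0: "z0 \<in> S \<inter> T" using conn by blast
  define h where "h = D1 z0 - D2 z0"
  define D where "D x = (if x \<in> S then D1 x else h + D2 x)" for x
  have sub: "development (S \<inter> T) \<theta> D1" "development (S \<inter> T) \<theta> D2"
    using development_pullback[OF D1, of "S \<inter> T" id] development_pullback[OF D2, of "S \<inter> T" id]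
    by (auto simp: o_def)
  have DT: "D x = h + D2 x" if "x \<in> T" for x
    using development_unique[OF conn(1) sub, of z0 x] that z0
    by (auto simp: D_def h_def eq_diff_eq diff_eq_eq)
  have DS: "D x = D1 x" if "x \<in> S" for x
    using that by (simp add: D_def)
  have "development (S \<union> T) \<theta> D"
    unfolding development_def
  proof
    fix z assume z: "z \<in> S \<union> T"
    obtain N where N: "open N" "z \<in> N"
      "\<And>a b c. a \<in> N \<inter> (S \<union> T) \<Longrightarrow> b \<in> N \<inter> (S \<union> T) \<Longrightarrow> c \<in> N \<inter> (S \<union> T) \<Longrightarrow> \<theta> a b + \<theta> b c = \<theta> a c"
      using local_cocycleE[OF \<theta> z] by blast
    have 1: "\<exists>M. open M \<and> z \<in> M \<and> (\<forall>b\<in>M \<inter> S. D b = D z + \<theta> z b)" if "z \<in> S"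
    proof -
      obtain M where M: "open M" "z \<in> M" "\<And>x y. x \<in> M \<inter> S \<Longrightarrow> y \<in> M \<inter> S \<Longrightarrow> D1 y = D1 x + \<theta> x y"
        using developmentE[OF D1 \<open>z \<in> S\<close>] by blast
      show ?thesis
      proof (intro exI[of _ M] conjI ballI)
        fix b assume "b \<in> M \<inter> S"
        with M(3)[of z b] M(2) that show "D b = D z + \<theta> z b"
          by (simp add: DS add.assoc)
      qed (use M in auto)
    qed
    have 2: "\<exists>M. open M \<and> z \<in> M \<and> (\<forall>b\<in>M \<inter> T. D b = D z + \<theta> z b)" if "z \<in> T"
    proof -
      obtain M where M: "open M" "z \<in> M" "\<And>x y. x \<in> M \<inter> T \<Longrightarrow> y \<in> M \<inter> T \<Longrightarrow> D2 y = D2 x + \<theta> x y"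
        using developmentE[OF D2 \<open>z \<in> T\<close>] by blast
      show ?thesis
      proof (intro exI[of _ M] conjI ballI)
        fix b assume "b \<in> M \<inter> T"
        with M(3)[of z b] M(2) that show "D b = D z + \<theta> z b"
          by (simp add: DT add.assoc)
      qed (use M in auto)
    qed
    \<comment> \<open>If \<open>z\<close> misses the closed set \<open>S\<close>, the complement of
      \<open>S\<close> is a neighbourhood on which nothing has to be checked.\<close>
    have "\<exists>M. open M \<and> z \<in> M \<and> (\<forall>b\<in>M \<inter> S. D b = D z + \<theta> z b)"
      using 1 cl(1) by (cases "z \<in> S") (auto intro!: exI[of _ "- S"])
    then obtain M1 where M1: "open M1" "z \<in> M1" "\<And>b. b \<in> M1 \<inter> S \<Longrightarrow> D b = D z + \<theta> z b" by blast
    have "\<exists>M. open M \<and> z \<in> M \<and> (\<forall>b\<in>M \<inter> T. D b = D z + \<theta> z b)"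
      using 2 cl(2) by (cases "z \<in> T") (auto intro!: exI[of _ "- T"])
    then obtain M2 where M2: "open M2" "z \<in> M2" "\<And>b. b \<in> M2 \<inter> T \<Longrightarrow> D b = D z + \<theta> z b" by blast
    show "\<exists>N. open N \<and> z \<in> N \<and> (\<forall>a\<in>N \<inter> (S \<union> T). \<forall>b\<in>N \<inter> (S \<union> T). D b = D a + \<theta> a b)"
    proof (intro exI conjI ballI)
      show "open (N \<inter> M1 \<inter> M2)" "z \<in> N \<inter> M1 \<inter> M2" using N M1 M2 by auto
      have *: "D x = D z + \<theta> z x" if "x \<in> N \<inter> M1 \<inter> M2 \<inter> (S \<union> T)" for x
        using that M1(3) M2(3) by blast
      fix a b assume ab: "a \<in> N \<inter> M1 \<inter> M2 \<inter> (S \<union> T)" "b \<in> N \<inter> M1 \<inter> M2 \<inter> (S \<union> T)"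
      \<comment> \<open>Two points near \<open>z\<close> may lie in different pieces, so they are
        compared through \<open>z\<close>.\<close>
      have "\<theta> z a + \<theta> a b = \<theta> z b"
        by (rule N(3)) (use ab z N(2) in auto)
      then show "D b = D a + \<theta> a b"
        using *[OF ab(1)] *[OF ab(2)] by (simp add: add.assoc)
    qed
  qed
  then show ?thesis by blast
qed

text \<open>Primitives exist on small rectangles and can be glued along common sides. Bisection in
  the second coordinate yields a full strip around every \<open>s\<close>, and bisection in the
  first coordinate joins the strips.\<close>

lemma development_square:
  fixes \<theta> :: "real \<times> real \<Rightarrow> real \<times> real \<Rightarrow> 'h::group_add"
  assumes \<theta>: "local_cocycle ({0..1} \<times> {0..1}) \<theta>"
  shows "\<exists>D. development ({0..1} \<times> {0..1}) \<theta> D"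
proof -
  have glue1: "\<exists>D. development ({a..b} \<times> {c..d}) \<theta> D"
    if "\<exists>D. development ({a..b} \<times> {c..m}) \<theta> D" "\<exists>D. development ({a..b} \<times> {m..d}) \<theta> D"
      "0 \<le> a" "a \<le> b" "b \<le> 1" "0 \<le> c" "c \<le> m" "m \<le> d" "d \<le> 1" for a b c d m
  proof -
    have eq: "{a..b} \<times> {c..m} \<union> {a..b} \<times> {m..d} = {a..b} \<times> {c..d}"
      "{a..b} \<times> {c..m} \<inter> ({a..b} \<times> {m..d}) = {a..b} \<times> {m..m}"
      using that by auto
    have "local_cocycle ({a..b} \<times> {c..d}) \<theta>"
      by (rule local_cocycle_subset[OF \<theta>]) (use that in auto)
    then show ?thesis
      using that(1,2) development_glue[of "{a..b} \<times> {c..m}" "{a..b} \<times> {m..d}" \<theta>] that(4)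
      unfolding eq by (elim exE) (simp add: closed_Times connected_Times)
  qed
  have glue2: "\<exists>D. development ({a..c} \<times> {0..1}) \<theta> D"
    if "\<exists>D. development ({a..b} \<times> {0..1}) \<theta> D" "\<exists>D. development ({b..c} \<times> {0..1}) \<theta> D"
      "0 \<le> a" "a \<le> b" "b \<le> c" "c \<le> 1" for a b c
  proof -
    have eq: "{a..b} \<times> {0..1} \<union> {b..c} \<times> {0..1} = {a..c} \<times> {0..1::real}"
      "{a..b} \<times> {0..1} \<inter> ({b..c} \<times> {0..1}) = {b..b} \<times> {0..1::real}"
      using that by auto
    have "local_cocycle ({a..c} \<times> {0..1}) \<theta>"
      by (rule local_cocycle_subset[OF \<theta>]) (use that in auto)
    then show ?thesis
      using that(1,2) development_glue[of "{a..b} \<times> {0..1}" "{b..c} \<times> {0..1}" \<theta>]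
      unfolding eq by (elim exE) (simp add: closed_Times connected_Times)
  qed
  \<comment> \<open>Speaks of all narrow rectangles around the abscissa \<open>s\<close> at once, so
    that two heights can be stacked after passing to the smaller of their widths.\<close>
  define G where "G s \<delta> c d \<longleftrightarrow> (\<forall>a b. a \<le> s \<longrightarrow> s \<le> b \<longrightarrow> b - a < \<delta> \<longrightarrow> 0 \<le> a \<longrightarrow> b \<le> 1 \<longrightarrow>
      (\<exists>D. development ({a..b} \<times> {c..d}) \<theta> D))" for s \<delta> c d
  have GD: "\<exists>D. development ({a..b} \<times> {c..d}) \<theta> D"
    if "G s \<delta> c d" "a \<le> s" "s \<le> b" "b - a < \<delta>" "0 \<le> a" "b \<le> 1" for s \<delta> a b c d
    using that by (simp add: G_def)
  have strip: "\<exists>\<delta>>0. G s \<delta> 0 1" if s: "0 \<le> s" "s \<le> 1" for s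
  proof -
    define Q where "Q c d \<longleftrightarrow> (0 \<le> c \<longrightarrow> d \<le> 1 \<longrightarrow> (\<exists>\<delta>>0. G s \<delta> c d))" for c d
    have "Q 0 1"
    proof (rule Bolzano)
      fix c m d assume Q: "Q c m" "Q m d" and cm: "c \<le> m" "m \<le> d"
      show "Q c d"
        unfolding Q_def
      proof (intro impI)
        assume cd: "0 \<le> c" "d \<le> 1"
        with Q cm have "\<exists>\<delta>>0. G s \<delta> c m" "\<exists>\<delta>>0. G s \<delta> m d" by (simp_all add: Q_def)
        then obtain \<delta>1 \<delta>2 where \<delta>: "\<delta>1 > 0" "G s \<delta>1 c m" "\<delta>2 > 0" "G s \<delta>2 m d" by blast
        have "G s (min \<delta>1 \<delta>2) c d"
          unfolding G_def
        proof (intro allI impI)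
          fix a b assume *: "a \<le> s" "s \<le> b" "b - a < min \<delta>1 \<delta>2" "0 \<le> a" "b \<le> 1"
          show "\<exists>D. development ({a..b} \<times> {c..d}) \<theta> D"
            by (rule glue1[of a b c m d]; (rule GD[OF \<delta>(2)] GD[OF \<delta>(4)])?) (use * cm cd in linarith)+
        qed
        with \<delta> show "\<exists>\<delta>>0. G s \<delta> c d" by (intro exI[of _ "min \<delta>1 \<delta>2"]) simp
      qed
    next
      fix t :: real assume t: "0 \<le> t" "t \<le> 1"
      have st: "(s, t) \<in> {0..1} \<times> {0..1}" using s t by simp
      obtain N where N: "open N" "(s, t) \<in> N"
        "\<And>a b c. a \<in> N \<inter> ({0..1} \<times> {0..1}) \<Longrightarrow> b \<in> N \<inter> ({0..1} \<times> {0..1}) \<Longrightarrow> c \<in> N \<inter> ({0..1} \<times> {0..1}) \<Longrightarrow> \<theta> a b + \<theta> b c = \<theta> a c"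
        using local_cocycleE[OF \<theta> st] by blast
      from open_prod_elim[OF N(1,2)] obtain A B where AB: "open A" "open B" "(s, t) \<in> A \<times> B" "A \<times> B \<subseteq> N" .
      have AB': "s \<in> A" "t \<in> B" using AB(3) by simp_all
      obtain \<alpha> where \<alpha>: "\<alpha> > 0" "ball s \<alpha> \<subseteq> A" using openE[OF AB(1) AB'(1)] .
      obtain \<beta> where \<beta>: "\<beta> > 0" "ball t \<beta> \<subseteq> B" using openE[OF AB(2) AB'(2)] .
      show "\<exists>e>0. \<forall>c d. c \<le> t \<and> t \<le> d \<and> d - c < e \<longrightarrow> Q c d"
      proof (intro exI[of _ \<beta>] conjI allI impI \<beta>(1))
        fix c d assume cd: "c \<le> t \<and> t \<le> d \<and> d - c < \<beta>"
        show "Q c d"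
          unfolding Q_def
        proof (intro impI exI[of _ \<alpha>] conjI \<alpha>(1))
          assume cd': "0 \<le> c" "d \<le> 1"
          show "G s \<alpha> c d"
            unfolding G_def
          proof (intro allI impI)
            fix a b assume *: "a \<le> s" "s \<le> b" "b - a < \<alpha>" "0 \<le> a" "b \<le> 1"
            have "{a..b} \<subseteq> ball s \<alpha>" "{c..d} \<subseteq> ball t \<beta>"
              using * cd by (auto simp: dist_real_def)
            then have "{a..b} \<times> {c..d} \<subseteq> A \<times> B" using \<alpha>(2) \<beta>(2) by (intro Sigma_mono) auto
            moreover have "{a..b} \<times> {c..d} \<subseteq> {0..1} \<times> {0..1}" using * cd' by (intro Sigma_mono) auto
            ultimately have sub: "{a..b} \<times> {c..d} \<subseteq> N \<inter> ({0..1} \<times> {0..1})"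
              using AB(4) by blast
            have "development ({a..b} \<times> {c..d}) \<theta> (\<theta> (s, t))"
              by (rule development_small[OF N(3)]) (use sub in blast, use sub in blast, use sub in blast, use * cd in simp)
            then show "\<exists>D. development ({a..b} \<times> {c..d}) \<theta> D" by blast
          qed
        qed
      qed
    qed simp
    then show ?thesis by (simp add: Q_def)
  qed
  define P where "P a b \<longleftrightarrow> (0 \<le> a \<longrightarrow> b \<le> 1 \<longrightarrow> (\<exists>D. development ({a..b} \<times> {0..1}) \<theta> D))" for a b
  have "P 0 1"
  proof (rule Bolzano)
    fix a b c assume ab: "P a b" "P b c" "a \<le> b" "b \<le> c"
    show "P a c"
      unfolding P_def
    proof (intro impI)
      assume "0 \<le> a" "c \<le> 1"
      with ab show "\<exists>D. development ({a..c} \<times> {0..1}) \<theta> D"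
        by (intro glue2[of a b c]) (simp_all add: P_def)
    qed
  next
    fix s :: real assume "0 \<le> s" "s \<le> 1"
    from strip[OF this] obtain \<delta> where \<delta>: "\<delta> > 0" "G s \<delta> 0 1" by blast
    show "\<exists>d>0. \<forall>a b. a \<le> s \<and> s \<le> b \<and> b - a < d \<longrightarrow> P a b"
      by (intro exI[of _ \<delta>] conjI allI impI) (auto simp: P_def \<delta>(1) intro!: GD[OF \<delta>(2)])
  qed simp
  then show ?thesis by (simp add: P_def)
qed

section \<open>Cocycles on a space and holonomy along paths\<close>

definition cocycle_on :: "'a topology \<Rightarrow> ('a \<Rightarrow> 'a \<Rightarrow> 'h::group_add) \<Rightarrow> bool" where
  "cocycle_on X \<theta> \<longleftrightarrow> (\<forall>x\<in>topspace X. \<exists>U. openin X U \<and> x \<in> U \<and>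
     (\<forall>a\<in>U. \<forall>b\<in>U. \<forall>c\<in>U. \<theta> a b + \<theta> b c = \<theta> a c))"

lemma cocycle_onE:
  assumes "cocycle_on X \<theta>" "x \<in> topspace X"
  obtains U where "openin X U" "x \<in> U"
    "\<And>a b c. \<lbrakk>a \<in> U; b \<in> U; c \<in> U\<rbrakk> \<Longrightarrow> \<theta> a b + \<theta> b c = \<theta> a c"
  using bspec[OF assms(1)[unfolded cocycle_on_def] assms(2)] by auto

lemma cocycle_on_refl:
  assumes "cocycle_on X \<theta>" "x \<in> topspace X"
  shows "\<theta> x x = 0"
proof -
  have "\<theta> x x + \<theta> x x = \<theta> x x"
  proof (rule cocycle_onE[OF assms])
    fix U assume U: "x \<in> U" "\<And>a b c. \<lbrakk>a \<in> U; b \<in> U; c \<in> U\<rbrakk> \<Longrightarrow> \<theta> a b + \<theta> b c = \<theta> a c"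
    show ?thesis by (rule U(2)[OF U(1) U(1) U(1)])
  qed
  then show ?thesis using add_left_imp_eq[of "\<theta> x x" "\<theta> x x" 0] by simp
qed

lemma local_cocycle_map:
  assumes \<theta>: "cocycle_on X \<theta>" and c: "continuous_map (top_of_set S) X c"
  shows "local_cocycle S (\<lambda>a b. \<theta> (c a) (c b))"
  unfolding local_cocycle_def
proof
  fix z assume z: "z \<in> S"
  then have "c z \<in> topspace X" using c by (auto simp: continuous_map_def)
  from cocycle_onE[OF \<theta> this] obtain U where U: "openin X U" "c z \<in> U"
    "\<And>x y w. x \<in> U \<Longrightarrow> y \<in> U \<Longrightarrow> w \<in> U \<Longrightarrow> \<theta> x y + \<theta> y w = \<theta> x w"
    by metis
  have "openin (top_of_set S) {x \<in> S. c x \<in> U}"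
    using openin_continuous_map_preimage[OF c U(1)] by simp
  then obtain N where N: "open N" "{x \<in> S. c x \<in> U} = S \<inter> N" by (auto simp: openin_open)
  show "\<exists>N. open N \<and> z \<in> N \<and> (\<forall>x\<in>N \<inter> S. \<forall>y\<in>N \<inter> S. \<forall>w\<in>N \<inter> S. \<theta> (c x) (c y) + \<theta> (c y) (c w) = \<theta> (c x) (c w))"
  proof (intro exI conjI ballI)
    have NS: "x \<in> N \<longleftrightarrow> c x \<in> U" if "x \<in> S" for x using N(2) that by blast
    show "open N" "z \<in> N" using N(1) NS[OF z] U(2) by simp_all
    fix x y w assume "x \<in> N \<inter> S" "y \<in> N \<inter> S" "w \<in> N \<inter> S"
    then have "c x \<in> U" "c y \<in> U" "c w \<in> U" using NS by auto
    then show "\<theta> (c x) (c y) + \<theta> (c y) (c w) = \<theta> (c x) (c w)" by (rule U(3))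
  qed
qed

definition holonomy :: "('a \<Rightarrow> 'a \<Rightarrow> 'h::group_add) \<Rightarrow> (real \<Rightarrow> 'a) \<Rightarrow> 'h" where
  "holonomy \<theta> c = (let D = SOME D. development {0..1} (\<lambda>a b. \<theta> (c a) (c b)) D in - D 0 + D 1)"

text \<open>Another development differs by a translation on the left, which drops out of
  \<open>- D 0 + D 1\<close>; the choice made in \<open>holonomy\<close> is thus immaterial.\<close>

lemma holonomy_eq:
  assumes D: "development {0..1} (\<lambda>a b. \<theta> (c a) (c b)) D"
  shows "holonomy \<theta> c = - D 0 + D 1"
proof -
  define D' where "D' = (SOME D. development {0..1} (\<lambda>a b. \<theta> (c a) (c b)) D)"
  have D': "development {0..1} (\<lambda>a b. \<theta> (c a) (c b)) D'"
    unfolding D'_def by (rule someI[of "development {0..1} (\<lambda>a b. \<theta> (c a) (c b))", OF D])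
  have "D 0 - D' 0 = D 1 - D' 1"
    by (rule development_unique[OF _ D D']) auto
  then have "D 1 = D 0 - D' 0 + D' 1"
    by (simp add: eq_diff_eq)
  then have "- D 0 + D 1 = - D' 0 + D' 1"
    by (simp add: diff_conv_add_uminus add.assoc del: add_uminus_conv_diff)
  then show ?thesis
    by (simp add: holonomy_def D'_def Let_def)
qed

lemma development_homotopy:
  assumes "cocycle_on X \<theta>" "continuous_map (top_of_set ({0..1} \<times> {0..1})) X h"
  shows "\<exists>D. development ({0..1::real} \<times> {0..1::real}) (\<lambda>a b. \<theta> (h a) (h b)) D"
  by (rule development_square[OF local_cocycle_map[OF assms]])

text \<open>A path is a square that is constant in the first coordinate, so the existence result for
  squares covers it.\<close>

lemma development_path:
  assumes "cocycle_on X \<theta>" "pathin X c"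
  shows "\<exists>D. development {0..1} (\<lambda>a b. \<theta> (c a) (c b)) D"
proof -
  have "continuous_map (top_of_set ({0..1} \<times> {0..1})) X (c \<circ> (snd :: real \<times> real \<Rightarrow> real))"
    by (rule continuous_map_compose[OF _ assms(2)[unfolded pathin_def]])
      (auto intro!: continuous_intros)
  from development_homotopy[OF assms(1) this] obtain D where
    D: "development ({0..1::real} \<times> {0..1::real}) (\<lambda>a b. \<theta> ((c \<circ> snd) a) ((c \<circ> snd) b)) D" by blast
  have "development {0..1} (\<lambda>a b. \<theta> ((c \<circ> snd) (0::real, a)) ((c \<circ> snd) (0::real, b))) (D \<circ> (\<lambda>t. (0, t)))"
    by (rule development_pullback[OF D]) (auto intro!: continuous_intros)
  then show ?thesis by auto
qed

lemma holonomy_const: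
  assumes "cocycle_on X \<theta>" "x \<in> topspace X"
  shows "holonomy \<theta> (\<lambda>_. x) = 0"
proof -
  have "development {0..1::real} (\<lambda>a b. \<theta> x x) (\<lambda>_. 0)"
    using cocycle_on_refl[OF assms] unfolding development_def by auto
  from holonomy_eq[of \<theta> "\<lambda>_. x", OF this] show ?thesis by simp
qed

lemma holonomy_homotopic:
  fixes X :: "'a topology"
  assumes \<theta>: "cocycle_on X \<theta>" and pq: "path_homotopic X p q"
  shows "holonomy \<theta> p = holonomy \<theta> q"
proof -
  from pq obtain h :: "real \<times> real \<Rightarrow> 'a"
    where h: "continuous_map (top_of_set ({0..1} \<times> {0..1})) X h"
    "\<And>x. h (0, x) = p x" "\<And>x. h (1, x) = q x" "\<And>t. t \<in> {0..1} \<Longrightarrow> h (t, 0) = p 0 \<and> h (t, 1) = p 1"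
    unfolding path_homotopic_def homotopic_with_def by auto
  obtain D where D: "development ({0..1::real} \<times> {0..1::real}) (\<lambda>a b. \<theta> (h a) (h b)) D"
    using development_homotopy[OF \<theta> h(1)] by blast
  have row: "development {0..1} (\<lambda>a b. \<theta> (h (s, a)) (h (s, b))) (\<lambda>t. D (s, t))" if "s \<in> {0..1}" for s
  proof -
    have "development {0..1} (\<lambda>a b. \<theta> (h (s, a)) (h (s, b))) (D \<circ> (\<lambda>t. (s, t)))"
      by (rule development_pullback[OF D]) (use that in \<open>auto intro!: continuous_intros\<close>)
    then show ?thesis by (simp add: o_def)
  qed
  have col: "development {0..1} (\<lambda>a b. \<theta> (h (a, t)) (h (b, t))) (\<lambda>s. D (s, t))" if "t \<in> {0..1}" for t
  proof -
    have "development {0..1} (\<lambda>a b. \<theta> (h (a, t)) (h (b, t))) (D \<circ> (\<lambda>s. (s, t)))"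
      by (rule development_pullback[OF D]) (use that in \<open>auto intro!: continuous_intros\<close>)
    then show ?thesis by (simp add: o_def)
  qed
  have "p 0 \<in> topspace X" "p 1 \<in> topspace X"
    using path_homotopicD(1)[OF pq] path_start_in_topspace path_finish_in_topspace by blast+
  note z = cocycle_on_refl[OF \<theta> this(1)] cocycle_on_refl[OF \<theta> this(2)]
  \<comment> \<open>The endpoints stay fixed during the homotopy, and the cocycle vanishes on equal
    points, so the development is constant along these two sides of the square.\<close>
  have "D (0, t) = D (1, t)" if t: "t = 0 \<or> t = 1" for t
  proof -
    have "development {0..1} (\<lambda>a b. 0) (\<lambda>s. D (s, t))"
      by (rule development_cong[OF col[of t]]) (use t z h(4) in auto)
    moreover have "development {0..1::real} (\<lambda>a b. 0) (\<lambda>s. 0)"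
      unfolding development_def by auto
    ultimately have "D (0, t) - 0 = D (1, t) - 0"
      by (rule development_unique[of "{0..1::real}", rotated 1]) auto
    then show ?thesis by simp
  qed
  moreover have "holonomy \<theta> p = - D (0, 0) + D (0, 1)"
    using holonomy_eq[of \<theta> p "\<lambda>t. D (0, t)"] row[of 0] h by simp
  moreover have "holonomy \<theta> q = - D (1, 0) + D (1, 1)"
    using holonomy_eq[of \<theta> q "\<lambda>t. D (1, t)"] row[of 1] h by simp
  ultimately show ?thesis by simp
qed

lemma holonomy_join:
  assumes \<theta>: "cocycle_on X \<theta>" and pq: "pathin X p" "pathin X q" "p 1 = q 0"
  shows "holonomy \<theta> (path_join p q) = holonomy \<theta> p + holonomy \<theta> q"
proof -
  obtain D where D: "development {0..1} (\<lambda>a b. \<theta> (path_join p q a) (path_join p q b)) D"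
    using development_path[OF \<theta> pathin_join[OF pq]] by blast
  have e1: "path_join p q (t / 2) = p t" if "t \<in> {0..1}" for t
    using that by (simp add: path_join_def)
  have e2: "path_join p q ((t + 1) / 2) = q t" if "t \<in> {0..1}" for t
  proof (cases "t = 0")
    case True then show ?thesis using pq(3) by (simp add: path_join_def)
  next
    case False then show ?thesis using that by (simp add: path_join_def add_divide_distrib)
  qed
  have "development {0..1} (\<lambda>a b. \<theta> (path_join p q (a / 2)) (path_join p q (b / 2))) (D \<circ> (\<lambda>t. t / 2))"
    by (rule development_pullback[OF D]) (auto intro!: continuous_intros)
  then have "development {0..1} (\<lambda>a b. \<theta> (p a) (p b)) (D \<circ> (\<lambda>t. t / 2))"
    by (rule development_cong) (simp_all add: e1)
  from holonomy_eq[of \<theta>, OF this] have 1: "holonomy \<theta> p = - D 0 + D (1/2)" by simp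
  have "development {0..1} (\<lambda>a b. \<theta> (path_join p q ((a + 1) / 2)) (path_join p q ((b + 1) / 2))) (D \<circ> (\<lambda>t. (t + 1) / 2))"
    by (rule development_pullback[OF D]) (auto intro!: continuous_intros)
  then have "development {0..1} (\<lambda>a b. \<theta> (q a) (q b)) (D \<circ> (\<lambda>t. (t + 1) / 2))"
    by (rule development_cong) (simp_all add: e2)
  from holonomy_eq[of \<theta>, OF this] have 2: "holonomy \<theta> q = - D (1/2) + D 1" by simp
  show ?thesis
    using holonomy_eq[of \<theta> "path_join p q", OF D] by (simp add: 1 2 add.assoc)
qed

lemma holonomy_reverse:
  assumes \<theta>: "cocycle_on X \<theta>" and p: "pathin X p"
  shows "holonomy \<theta> (path_reverse p) = - holonomy \<theta> p"
proof -
  have "holonomy \<theta> p + holonomy \<theta> (path_reverse p) = holonomy \<theta> (path_join p (path_reverse p))"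
    using p by (intro holonomy_join[OF \<theta>, symmetric] pathin_reverse) auto
  also have "\<dots> = holonomy \<theta> (\<lambda>_. p 0)"
    by (rule holonomy_homotopic[OF \<theta> path_homotopic_reverse_right[OF p]])
  also have "\<dots> = 0"
    using p by (intro holonomy_const[OF \<theta>] path_start_in_topspace)
  finally show ?thesis
    by (rule minus_unique[symmetric])
qed

section \<open>Permutations of the natural numbers\<close>

text \<open>One group type for all degrees: holonomies take values in a fixed
  \<open>group_add\<close>, and the finite symmetric groups are cut out of it by
  \<open>small_perms\<close>.\<close>

typedef nat_perm = "{f :: nat \<Rightarrow> nat. bij f}"
  by (auto intro: bij_id)

setup_lifting type_definition_nat_perm

instantiation nat_perm :: group_add
begin

text \<open>The left summand acts first, so a sum of labels acts in the order in which a path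
  crosses the edges.\<close>

lift_definition plus_nat_perm :: "nat_perm \<Rightarrow> nat_perm \<Rightarrow> nat_perm" is "\<lambda>f g. g \<circ> f"
  by (rule bij_comp)

lift_definition zero_nat_perm :: nat_perm is id
  by (rule bij_id)

lift_definition uminus_nat_perm :: "nat_perm \<Rightarrow> nat_perm" is "inv_into UNIV"
  by (rule bij_imp_bij_inv)

definition minus_nat_perm :: "nat_perm \<Rightarrow> nat_perm \<Rightarrow> nat_perm" where
  "minus_nat_perm f g = f + - g"

instance
proof
  fix a b c :: nat_perm
  show "a + b + c = a + (b + c)" by transfer (simp add: o_assoc)
  show "0 + a = a" "a + 0 = a" by (transfer; simp)+
  show "- a + a = 0" by transfer (simp add: surj_iff[THEN iffD1, OF bij_is_surj])
  show "a + - b = a - b" by (simp add: minus_nat_perm_def)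
qed

end

text \<open>The symmetric group on the \<open>n + 1\<close> letters \<open>0, ..., n\<close>: a word
  of length \<open>n\<close> passes through \<open>n + 1\<close> positions.\<close>

definition small_perms :: "nat \<Rightarrow> nat_perm set" where
  "small_perms n = {f. \<forall>i>n. Rep_nat_perm f i = i}"

lemma small_perms_zero: "0 \<in> small_perms n"
  by (simp add: small_perms_def zero_nat_perm.rep_eq)

lemma small_perms_add: "f \<in> small_perms n \<Longrightarrow> g \<in> small_perms n \<Longrightarrow> f + g \<in> small_perms n"
  by (simp add: small_perms_def plus_nat_perm.rep_eq)

lemma bij_Rep_nat_perm: "bij (Rep_nat_perm f)"
  using Rep_nat_perm[of f] by simp

lemma small_perms_uminus: "f \<in> small_perms n \<Longrightarrow> - f \<in> small_perms n"
  by (auto simp: small_perms_def uminus_nat_perm.rep_eq intro!: inv_f_eq bij_is_inj[OF bij_Rep_nat_perm])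

lemma finite_small_perms: "finite (small_perms n)"
proof -
  have "(\<lambda>f. restrict (Rep_nat_perm f) {..n}) ` small_perms n \<subseteq> {..n} \<rightarrow>\<^sub>E {..n}"
  proof clarsimp
    fix f i assume f: "f \<in> small_perms n" and i: "i \<le> n"
    show "Rep_nat_perm f i \<le> n"
    proof (rule ccontr)
      assume "\<not> ?thesis"
      then have "Rep_nat_perm f (Rep_nat_perm f i) = Rep_nat_perm f i"
        using f by (simp add: small_perms_def)
      then have "Rep_nat_perm f i = i"
        using bij_Rep_nat_perm[of f] by (simp add: bij_def inj_eq)
      with i \<open>\<not> ?thesis\<close> show False by simp
    qed
  qed
  moreover have "inj_on (\<lambda>f. restrict (Rep_nat_perm f) {..n}) (small_perms n)"
  proof (rule inj_onI)
    fix f g assume fg: "f \<in> small_perms n" "g \<in> small_perms n"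
      and eq: "restrict (Rep_nat_perm f) {..n} = restrict (Rep_nat_perm g) {..n}"
    have "Rep_nat_perm f i = Rep_nat_perm g i" for i
      using fg fun_cong[OF eq, of i] by (cases "i \<le> n") (auto simp: small_perms_def)
    then show "f = g" by (simp add: Rep_nat_perm_inject[symmetric] fun_eq_iff)
  qed
  ultimately show ?thesis
    by (meson finite_PiE finite_atMost finite_imageD finite_subset)
qed

text \<open>A nontrivial group is wanted where exponents are compared through powers of its
  order.\<close>

lemma two_le_card_small_perms:
  assumes "n \<ge> 1"
  shows "card (small_perms n) \<ge> 2"
proof -
  define f where "f = Abs_nat_perm (Transposition.transpose 0 1)"
  have f: "Rep_nat_perm f = Transposition.transpose 0 1"
    by (simp add: f_def Abs_nat_perm_inverse)
  have "{0, f} \<subseteq> small_perms n"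
    using assms by (auto simp: small_perms_zero small_perms_def f Transposition.transpose_def zero_nat_perm.rep_eq)
  moreover have "f \<noteq> 0"
  proof
    assume "f = 0"
    then have "Rep_nat_perm f 0 = 0" by (simp add: zero_nat_perm.rep_eq)
    then show False unfolding f by simp
  qed
  ultimately show ?thesis
    using card_mono[OF finite_small_perms, of "{0, f}" n] by auto
qed

text \<open>The complements of domain and range in \<open>{..n}\<close> have equal size, so any
  bijection between them completes the partial map.\<close>

lemma extend_to_small_perm:
  assumes inj: "inj_on g A" and A: "A \<subseteq> {..n}" "g ` A \<subseteq> {..n}"
  shows "\<exists>f\<in>small_perms n. \<forall>i\<in>A. Rep_nat_perm f i = g i"
proof -
  have fin: "finite A" "finite (g ` A)" using finite_subset[OF A(1)] finite_subset[OF A(2)] by auto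
  have "card ({..n} - A) = card ({..n} - g ` A)"
    using A fin by (simp add: card_Diff_subset card_image[OF inj])
  then obtain h where h: "bij_betw h ({..n} - A) ({..n} - g ` A)"
    using finite_same_card_bij[of "{..n} - A" "{..n} - g ` A"] by auto
  define k where "k i = (if i \<in> A then g i else if i \<le> n then h i else i)" for i
  have 1: "bij_betw k A (g ` A)"
    using inj by (auto simp: bij_betw_def k_def inj_on_def)
  have 2: "bij_betw k ({..n} - A) ({..n} - g ` A)"
    using h by (rule bij_betw_cong[THEN iffD1, rotated]) (auto simp: k_def)
  have 3: "bij_betw k {n<..} {n<..}"
    using A by (intro bij_betw_cong[THEN iffD1, OF _ bij_betw_id]) (auto simp: k_def)
  have "bij_betw k (A \<union> ({..n} - A)) (g ` A \<union> ({..n} - g ` A))"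
    by (rule bij_betw_combine[OF 1 2]) auto
  moreover have "A \<union> ({..n} - A) = {..n}" "g ` A \<union> ({..n} - g ` A) = {..n}" using A by auto
  ultimately have "bij_betw k {..n} {..n}" by simp
  moreover have "{..n} \<inter> {n<..} = {}" by auto
  ultimately have "bij_betw k ({..n} \<union> {n<..}) ({..n} \<union> {n<..})" using 3 by (intro bij_betw_combine)
  moreover have "{..n} \<union> {n<..} = (UNIV :: nat set)" by auto
  ultimately have "bij k" by simp
  then have R: "Rep_nat_perm (Abs_nat_perm k) = k" by (simp add: Abs_nat_perm_inverse)
  show ?thesis
  proof (intro bexI ballI)
    show "Abs_nat_perm k \<in> small_perms n" using A by (auto simp: small_perms_def R k_def)
    show "Rep_nat_perm (Abs_nat_perm k) i = g i" if "i \<in> A" for i using that by (simp add: R k_def)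
  qed
qed

section \<open>Finite graphs\<close>

locale fgraph =
  fixes G :: "'a cw_graph"
  assumes finite_graph: "finite_graph G"
begin

abbreviation "X \<equiv> gtop G"
abbreviation "V \<equiv> verts G"
abbreviation "E \<equiv> edges G"
abbreviation "ch \<equiv> charmap G"

lemma Hausdorff: "Hausdorff_space X"
  and finite_verts: "finite V" and finite_edges: "finite E"
  and topspace_eq: "topspace X = V \<union> \<Union>E"
  using finite_graph unfolding finite_graph_def by simp_all

lemma edge_unique: "e \<in> E \<Longrightarrow> e' \<in> E \<Longrightarrow> x \<in> e \<Longrightarrow> x \<in> e' \<Longrightarrow> e = e'"
  using finite_graph unfolding finite_graph_def disjoint_def by blast

lemma vert_not_in_edge: "v \<in> V \<Longrightarrow> e \<in> E \<Longrightarrow> v \<notin> e"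
  using finite_graph unfolding finite_graph_def by blast

lemma ch_continuous: "e \<in> E \<Longrightarrow> continuous_map (top_of_set {0..1}) X (ch e)"
  and ch_0: "e \<in> E \<Longrightarrow> ch e 0 \<in> V" and ch_1: "e \<in> E \<Longrightarrow> ch e 1 \<in> V"
  and ch_homeo: "e \<in> E \<Longrightarrow> homeomorphic_map (top_of_set {0<..<1}) (subtopology X e) (ch e)"
  using finite_graph unfolding finite_graph_def by simp_all

lemma pathin_ch: "e \<in> E \<Longrightarrow> pathin X (ch e)"
  using ch_continuous by (simp add: pathin_def)

lemma edge_subset: "e \<in> E \<Longrightarrow> e \<subseteq> topspace X"
  using topspace_eq by blast

lemma vert_in: "v \<in> V \<Longrightarrow> v \<in> topspace X"
  using topspace_eq by blast

lemma ch_image: "e \<in> E \<Longrightarrow> ch e ` {0<..<1} = e"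
  using homeomorphic_imp_surjective_map[OF ch_homeo] edge_subset by (simp add: Int_absorb1)

lemma ch_mem: "e \<in> E \<Longrightarrow> 0 < t \<Longrightarrow> t < 1 \<Longrightarrow> ch e t \<in> e"
  using ch_image by (metis greaterThanLessThan_iff imageI)

lemma ch_inj: "e \<in> E \<Longrightarrow> inj_on (ch e) {0<..<1}"
  using homeomorphic_imp_injective_map[OF ch_homeo] by simp

lemma ch_eq_iff:
  assumes "e \<in> E" "e' \<in> E" "0 < s" "s < 1" "0 < t" "t < 1"
  shows "ch e s = ch e' t \<longleftrightarrow> e = e' \<and> s = t"
  using assms edge_unique[of e e' "ch e s"] ch_mem[of e s] ch_mem[of e' t] inj_onD[OF ch_inj, of e s t]
  by auto

lemma ch_in_edge_iff:
  assumes "e \<in> E" "e' \<in> E" "0 \<le> t" "t \<le> 1"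
  shows "ch e t \<in> e' \<longleftrightarrow> e = e' \<and> 0 < t \<and> t < 1"
proof (cases "t = 0 \<or> t = 1")
  case True
  then have "ch e t \<in> V" using assms ch_0 ch_1 by auto
  then show ?thesis using vert_not_in_edge assms True by auto
next
  case False
  then have "ch e t \<in> e" using assms by (auto intro: ch_mem)
  then show ?thesis using edge_unique[of e e'] assms False by auto
qed

lemma ch_in_verts_iff:
  assumes "e \<in> E" "0 \<le> t" "t \<le> 1"
  shows "ch e t \<in> V \<longleftrightarrow> t = 0 \<or> t = 1"
  using assms ch_0 ch_1 ch_mem[of e t] vert_not_in_edge by fastforce

lemma ch_in: "e \<in> E \<Longrightarrow> 0 \<le> t \<Longrightarrow> t \<le> 1 \<Longrightarrow> ch e t \<in> topspace X"
  using funcset_mem[OF path_image_subset_topspace[OF pathin_ch], of e t] by simp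

lemma point_cases:
  assumes "x \<in> topspace X"
  obtains "x \<in> V" | e t where "e \<in> E" "0 < t" "t < 1" "x = ch e t"
proof (cases "x \<in> V")
  case True then show ?thesis by (rule that(1))
next
  case False
  then obtain e where e: "e \<in> E" "x \<in> e" using assms topspace_eq by blast
  then have "x \<in> ch e ` {0<..<1}" using ch_image by simp
  then obtain t where "t \<in> {0<..<1}" "x = ch e t" by blast
  then show ?thesis using that(2)[OF e(1), of t] by simp
qed

section \<open>Coordinates on the open edges\<close>

definition cell_of :: "'a \<Rightarrow> 'a set" where
  "cell_of x = (THE e. e \<in> E \<and> x \<in> e)"

text \<open>Like \<open>cell_of\<close>, meaningful on open edges only; at a vertex the value is
  unspecified.\<close>

definition coord :: "'a \<Rightarrow> real" where
  "coord x = inv_into {0<..<1} (ch (cell_of x)) x"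

lemma cell_of_eq: "e \<in> E \<Longrightarrow> x \<in> e \<Longrightarrow> cell_of x = e"
  unfolding cell_of_def using edge_unique by (intro the_equality) auto

lemma cell_of_ch: "e \<in> E \<Longrightarrow> 0 < t \<Longrightarrow> t < 1 \<Longrightarrow> cell_of (ch e t) = e"
  by (rule cell_of_eq) (auto intro: ch_mem)

lemma coord_ch: "e \<in> E \<Longrightarrow> 0 < t \<Longrightarrow> t < 1 \<Longrightarrow> coord (ch e t) = t"
  unfolding coord_def by (simp add: cell_of_ch inv_into_f_f[OF ch_inj])

lemma coord_props:
  assumes "e \<in> E" "x \<in> e"
  shows "0 < coord x" "coord x < 1" "ch e (coord x) = x"
proof -
  have "x \<in> ch e ` {0<..<1}" using assms ch_image by simp
  then obtain t where "0 < t" "t < 1" "x = ch e t" by auto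
  then show "0 < coord x" "coord x < 1" "ch e (coord x) = x"
    using coord_ch[OF assms(1)] by auto
qed

lemma continuous_map_coord:
  assumes e: "e \<in> E"
  shows "continuous_map (subtopology X e) (top_of_set {0<..<1}) coord"
proof -
  obtain g where g: "homeomorphic_maps (top_of_set {0<..<1}) (subtopology X e) (ch e) g"
    using ch_homeo[OF e] homeomorphic_map_maps by blast
  have g': "continuous_map (subtopology X e) (top_of_set {0<..<1}) g"
    "\<And>x. x \<in> topspace (subtopology X e) \<Longrightarrow> ch e (g x) = x"
    using g unfolding homeomorphic_maps_def by auto
  show ?thesis
  proof (rule continuous_map_eq[OF g'(1)])
    fix x assume x: "x \<in> topspace (subtopology X e)"
    have "g x \<in> {0<..<1}" using continuous_map_image_subset_topspace[OF g'(1)] x by auto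
    then show "g x = coord x" using coord_ch[OF e, of "g x"] g'(2)[OF x] by simp
  qed
qed

section \<open>The weak topology\<close>

lemma closedin_verts_subset: "A \<subseteq> V \<Longrightarrow> closedin X A"
  using finite_subset[OF _ finite_verts] vert_in
  by (intro closedin_Hausdorff_finite[OF Hausdorff]) auto

lemma closed_map_ch: "e \<in> E \<Longrightarrow> closed_map (top_of_set {0..1}) X (ch e)"
  by (intro continuous_imp_closed_map ch_continuous Hausdorff) (simp_all add: compact_space_subtopology)

text \<open>\<open>C\<close> is a finite union of its vertices and of the images of its traces on
  the closed edges. These images are compact, hence closed in a Hausdorff space.\<close>

lemma closedin_coherent:
  assumes C: "C \<subseteq> topspace X"
    and cl: "\<And>e. e \<in> E \<Longrightarrow> closedin (top_of_set {0..1}) {t \<in> {0..1}. ch e t \<in> C}"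
  shows "closedin X C"
proof -
  have eq: "C = (C \<inter> V) \<union> (\<Union>e\<in>E. ch e ` {t \<in> {0..1}. ch e t \<in> C})"
  proof (intro equalityI subsetI)
    fix x assume x: "x \<in> C"
    then have "x \<in> topspace X" using C by blast
    then show "x \<in> (C \<inter> V) \<union> (\<Union>e\<in>E. ch e ` {t \<in> {0..1}. ch e t \<in> C})"
    proof (cases rule: point_cases)
      case 1 then show ?thesis using x by simp
    next
      case (2 e t)
      then have "t \<in> {t \<in> {0..1}. ch e t \<in> C}" using x by simp
      then show ?thesis using 2 by blast
    qed
  qed auto
  have "closedin X (ch e ` {t \<in> {0..1}. ch e t \<in> C})" if "e \<in> E" for e
    using closed_map_ch[OF that] cl[OF that] unfolding closed_map_def by blast
  then have "closedin X (\<Union>e\<in>E. ch e ` {t \<in> {0..1}. ch e t \<in> C})"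
    by (intro closedin_Union) (use finite_edges in auto)
  moreover have "closedin X (C \<inter> V)" by (rule closedin_verts_subset) simp
  ultimately show ?thesis by (subst eq) (rule closedin_Un)
qed

lemma openin_coherent:
  assumes U: "U \<subseteq> topspace X"
    and op: "\<And>e. e \<in> E \<Longrightarrow> openin (top_of_set {0..1}) {t \<in> {0..1}. ch e t \<in> U}"
  shows "openin X U"
proof -
  have "closedin X (topspace X - U)"
  proof (rule closedin_coherent)
    fix e assume e: "e \<in> E"
    have "{t \<in> {0..1}. ch e t \<in> topspace X - U} = {0..1} - {t \<in> {0..1}. ch e t \<in> U}"
      using ch_in[OF e] by auto
    then show "closedin (top_of_set {0..1}) {t \<in> {0..1}. ch e t \<in> topspace X - U}"
      using closedin_diff[OF closedin_topspace op[OF e]] by simp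
  qed simp
  then show ?thesis
    using U by (simp add: openin_closedin)
qed

lemma openin_edge_image:
  assumes e: "e \<in> E" and J: "open J" "J \<subseteq> {0<..<1}"
  shows "openin X (ch e ` J)"
proof (rule openin_coherent)
  show "ch e ` J \<subseteq> topspace X" using ch_in[OF e] J(2) by fastforce
  fix e' assume e': "e' \<in> E"
  have "{t \<in> {0..1}. ch e' t \<in> ch e ` J} = (if e' = e then J else {})"
  proof -
    have 1: "t \<in> J \<and> e' = e" if t: "t \<in> {0..1}" "ch e' t \<in> ch e ` J" for t
    proof -
      from t obtain s where s: "s \<in> J" "ch e' t = ch e s" by blast
      then have s01: "0 < s" "s < 1" using J(2) by auto
      have "ch e' t \<in> e" using s ch_mem[OF e s01] by simp
      then have "e' = e" "0 < t" "t < 1" using ch_in_edge_iff[OF e' e] t by auto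
      then show ?thesis using s s01 ch_eq_iff[of e e s t] e by simp
    qed
    have 2: "t \<in> {0..1}" if "t \<in> J" for t using subsetD[OF J(2) that] by simp
    have "(t \<in> {0..1} \<and> ch e' t \<in> ch e ` J) = (t \<in> J \<and> e' = e)" for t
      using 1 2 by blast
    then show ?thesis by simp
  qed
  then show "openin (top_of_set {0..1}) {t \<in> {0..1}. ch e' t \<in> ch e ` J}"
    using J by (auto intro!: open_subset)
qed

lemma openin_edge: "e \<in> E \<Longrightarrow> openin X e"
  using openin_edge_image[of e "{0<..<1}"] ch_image by simp

text \<open>For small \<open>r\<close> this is the ball of radius \<open>r\<close> about
  \<open>v\<close> when all edges have length 1; a loop at \<open>v\<close> enters with both of its
  ends.\<close>

definition star :: "'a \<Rightarrow> real \<Rightarrow> 'a set" where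
  "star v r = insert v {x. \<exists>e\<in>E. x \<in> e \<and> (ch e 0 = v \<and> coord x < r \<or> ch e 1 = v \<and> 1 - r < coord x)}"

lemma star_centre [simp]: "v \<in> star v r"
  by (simp add: star_def)

lemma ch_in_star_iff:
  assumes "e \<in> E" "0 < t" "t < 1" "v \<in> V"
  shows "ch e t \<in> star v r \<longleftrightarrow> ch e 0 = v \<and> t < r \<or> ch e 1 = v \<and> 1 - r < t"
proof -
  have m: "ch e t \<in> e" by (rule ch_mem[OF assms(1-3)])
  then have "ch e t \<noteq> v" using vert_not_in_edge assms by auto
  moreover have "e' = e" if "e' \<in> E" "ch e t \<in> e'" for e'
    using edge_unique[OF that(1) assms(1) that(2) m] .
  ultimately show ?thesis
    using m assms(1) coord_ch[OF assms(1-3)] by (auto simp: star_def)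
qed

lemma openin_star:
  assumes v: "v \<in> V" and r: "0 < r" "r \<le> 1/2"
  shows "openin X (star v r)"
proof (rule openin_coherent)
  show "star v r \<subseteq> topspace X" using edge_subset vert_in[OF v] by (auto simp: star_def)
  fix e assume e: "e \<in> E"
  let ?A = "(if ch e 0 = v then {..<r} else {}) \<union> (if ch e 1 = v then {1-r<..} else {})"
  have "ch e t \<in> star v r \<longleftrightarrow> t \<in> ?A" if t: "t \<in> {0..1}" for t
  proof -
    consider "t = 0" | "t = 1" | "0 < t" "t < 1" using t by fastforce
    then show ?thesis
    proof cases
      case 3 then show ?thesis using ch_in_star_iff[OF e 3 v] by auto
    next
      case 1
      have "ch e 0 \<in> star v r \<longleftrightarrow> ch e 0 = v"
        using vert_not_in_edge[OF ch_0[OF e]] by (auto simp: star_def)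
      then show ?thesis using 1 r by auto
    next
      case 2
      have "ch e 1 \<in> star v r \<longleftrightarrow> ch e 1 = v"
        using vert_not_in_edge[OF ch_1[OF e]] by (auto simp: star_def)
      then show ?thesis using 2 r by auto
    qed
  qed
  then have "{t \<in> {0..1}. ch e t \<in> star v r} = {0..1} \<inter> ?A" by blast
  moreover have "open ?A" by auto
  ultimately show "openin (top_of_set {0..1}) {t \<in> {0..1}. ch e t \<in> star v r}"
    by (auto simp: openin_open)
qed

text \<open>Allows homotopies of the graph to be checked edge by edge. Since \<open>Z\<close> is
  compact, its products with the closed edges are compact and map closedly, so preimages of closed
  sets are finite unions of closed images.\<close>

lemma continuous_map_coherent_prod:
  fixes F :: "'z \<times> 'a \<Rightarrow> 'b"
  assumes Z: "compact_space Z" "Hausdorff_space Z"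
    and Fv: "\<And>v. v \<in> V \<Longrightarrow> continuous_map Z Y (\<lambda>z. F (z, v))"
    and Fe: "\<And>e. e \<in> E \<Longrightarrow> continuous_map (prod_topology Z (top_of_set {0..1})) Y (\<lambda>(z, t). F (z, ch e t))"
  shows "continuous_map (prod_topology Z X) Y F"
  unfolding continuous_map_closedin
proof (intro conjI allI impI)
  have haus: "Hausdorff_space (prod_topology Z X)"
    using Z(2) Hausdorff by (simp add: Hausdorff_space_prod_topology)
  have Fe_mem: "F (z, ch e t) \<in> topspace Y" if "e \<in> E" "0 < t" "t < 1" "z \<in> topspace Z" for z e t
    using funcset_mem[OF continuous_map_funspace[OF Fe[OF that(1)]], of "(z, t)"] that by simp
  have Fv_mem: "F (z, v) \<in> topspace Y" if "v \<in> V" "z \<in> topspace Z" for z v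
    using funcset_mem[OF continuous_map_funspace[OF Fv[OF that(1)]] that(2)] .
  show "F \<in> topspace (prod_topology Z X) \<rightarrow> topspace Y"
  proof
    fix w assume w: "w \<in> topspace (prod_topology Z X)"
    obtain z x where zx: "w = (z, x)" by (cases w)
    then have z: "z \<in> topspace Z" and x: "x \<in> topspace X" using w by simp_all
    from x show "F w \<in> topspace Y"
      unfolding zx by (cases rule: point_cases) (simp_all add: Fe_mem Fv_mem z)
  qed
  fix C assume C: "closedin Y C"
  let ?P = "{w \<in> topspace (prod_topology Z X). F w \<in> C}"
  let ?A = "\<lambda>v. (\<lambda>z. (z, v)) ` {z \<in> topspace Z. F (z, v) \<in> C}"
  let ?B = "\<lambda>e. (\<lambda>(z, t). (z, ch e t)) ` {w \<in> topspace (prod_topology Z (top_of_set {0..1})). (\<lambda>(z, t). F (z, ch e t)) w \<in> C}"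
  have A: "closedin (prod_topology Z X) (?A v)" if v: "v \<in> V" for v
  proof -
    have "continuous_map Z (prod_topology Z X) (\<lambda>z. (z, v))"
      using vert_in[OF v] by (simp add: continuous_map_pairwise o_def)
    then have "closed_map Z (prod_topology Z X) (\<lambda>z. (z, v))"
      by (intro continuous_imp_closed_map Z haus)
    then show ?thesis
      using closedin_continuous_map_preimage[OF Fv[OF v] C] unfolding closed_map_def by blast
  qed
  have B: "closedin (prod_topology Z X) (?B e)" if e: "e \<in> E" for e
  proof -
    have "continuous_map (prod_topology Z (top_of_set {0..1})) (prod_topology Z X) (\<lambda>(z, t). (z, ch e t))"
      using ch_continuous[OF e] by (simp add: continuous_map_prod_top)
    moreover have "compact_space (prod_topology Z (top_of_set {0..1::real}))"
      using Z by (simp add: compact_space_prod_topology compact_space_subtopology)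
    ultimately have "closed_map (prod_topology Z (top_of_set {0..1})) (prod_topology Z X) (\<lambda>(z, t). (z, ch e t))"
      by (intro continuous_imp_closed_map haus)
    then show ?thesis
      using closedin_continuous_map_preimage[OF Fe[OF e] C] unfolding closed_map_def by blast
  qed
  have eq: "?P = (\<Union>v\<in>V. ?A v) \<union> (\<Union>e\<in>E. ?B e)"
  proof (intro equalityI subsetI)
    fix w assume w: "w \<in> ?P"
    obtain z x where zx: "w = (z, x)" by (cases w)
    then have z: "z \<in> topspace Z" "x \<in> topspace X" "F (z, x) \<in> C" using w by simp_all
    from z(2) show "w \<in> (\<Union>v\<in>V. ?A v) \<union> (\<Union>e\<in>E. ?B e)"
    proof (cases rule: point_cases)
      case 1
      have "z \<in> {z \<in> topspace Z. F (z, x) \<in> C}" using z by simp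
      then have "w \<in> ?A x" unfolding zx by (rule imageI)
      then show ?thesis using 1 by blast
    next
      case (2 e t)
      have "(z, t) \<in> {w \<in> topspace (prod_topology Z (top_of_set {0..1})). (\<lambda>(z, t). F (z, ch e t)) w \<in> C}"
        using z 2 by simp
      from imageI[OF this, of "\<lambda>(z, t). (z, ch e t)"] have "w \<in> ?B e" using 2(4) zx by simp
      then show ?thesis using 2(1) by blast
    qed
  next
    fix w assume "w \<in> (\<Union>v\<in>V. ?A v) \<union> (\<Union>e\<in>E. ?B e)"
    then show "w \<in> ?P"
    proof
      assume "w \<in> (\<Union>v\<in>V. ?A v)"
      then show ?thesis using vert_in by auto
    next
      assume "w \<in> (\<Union>e\<in>E. ?B e)"
      then show ?thesis using ch_in by auto
    qed
  qed
  have "closedin (prod_topology Z X) (\<Union>v\<in>V. ?A v)"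
    using A finite_verts by (intro closedin_Union) auto
  moreover have "closedin (prod_topology Z X) (\<Union>e\<in>E. ?B e)"
    using B finite_edges by (intro closedin_Union) auto
  ultimately show "closedin (prod_topology Z X) ?P" unfolding eq by (rule closedin_Un)
qed

lemma continuous_map_coherent:
  assumes fv: "f ` V \<subseteq> topspace Y"
    and fe: "\<And>e. e \<in> E \<Longrightarrow> continuous_map (top_of_set {0..1}) Y (f \<circ> ch e)"
  shows "continuous_map X Y f"
proof -
  \<comment> \<open>A one-point space reduces this to the version with parameters.\<close>
  let ?Z = "top_of_set {0::real}"
  have 1: "continuous_map (prod_topology ?Z X) Y (\<lambda>w. f (snd w))"
  proof (rule continuous_map_coherent_prod)
    fix e assume e: "e \<in> E"
    show "continuous_map (prod_topology ?Z (top_of_set {0..1})) Y (\<lambda>(z, t). f (snd (z, ch e t)))"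
      using continuous_map_snd_iff[OF fe[OF e], of ?Z] by (simp add: o_def)
  next
    fix v assume "v \<in> V"
    then show "continuous_map ?Z Y (\<lambda>z. f (snd (z, v)))" using fv by auto
  qed (simp_all add: compact_space_subtopology Hausdorff_space_subtopology)
  have 2: "continuous_map X (prod_topology ?Z X) (\<lambda>x. (0, x))"
    by (simp add: continuous_map_pairwise o_def)
  show ?thesis using continuous_map_compose[OF 2 1] by (simp add: o_def)
qed

subsection \<open>The cocycle of an edge labelling\<close>

text \<open>Crossing the midpoint of an edge picks up its label. The condition on the distance makes this
  trivial near the vertex of a loop.\<close>

definition jump :: "('a set \<Rightarrow> 'h::group_add) \<Rightarrow> 'a \<Rightarrow> 'a \<Rightarrow> 'h" where
  "jump L x y = (if \<exists>e\<in>E. x \<in> e \<and> y \<in> e \<and> \<bar>coord x - coord y\<bar> < 1/2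
     then - (if coord x < 1/2 then 0 else L (cell_of x)) + (if coord y < 1/2 then 0 else L (cell_of x)) else 0)"

lemma jump_edge:
  assumes "e \<in> E" "0 < s" "s < 1" "0 < t" "t < 1" "\<bar>s - t\<bar> < 1/2"
  shows "jump L (ch e s) (ch e t) = - (if s < 1/2 then 0 else L e) + (if t < 1/2 then 0 else L e)"
proof -
  have "\<exists>e'\<in>E. ch e s \<in> e' \<and> ch e t \<in> e' \<and> \<bar>coord (ch e s) - coord (ch e t)\<bar> < 1/2"
    using assms ch_mem[of e] by (intro bexI[of _ e]) (simp_all add: coord_ch)
  then show ?thesis
    using assms by (simp add: jump_def coord_ch cell_of_ch)
qed

lemma jump_vert: "x \<in> V \<or> y \<in> V \<Longrightarrow> jump L x y = 0"
  using vert_not_in_edge by (auto simp: jump_def)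

text \<open>In a star of radius 1/4 coordinates lie in the outer quarters. Two of them at distance
  less than 1/2 belong to the same end, hence to the same side of the midpoint.\<close>

lemma jump_star:
  assumes v: "v \<in> V" and xy: "x \<in> star v (1/4)" "y \<in> star v (1/4)"
  shows "jump L x y = 0"
proof (cases "\<exists>e\<in>E. x \<in> e \<and> y \<in> e \<and> \<bar>coord x - coord y\<bar> < 1/2")
  case False then show ?thesis by (simp only: jump_def if_False)
next
  case True
  then obtain e where e: "e \<in> E" "x \<in> e" "y \<in> e" and d: "\<bar>coord x - coord y\<bar> < 1/2" by blast
  note x = coord_props[OF e(1,2)] and y = coord_props[OF e(1,3)]
  have "coord x < 1/4 \<or> 1 - 1/4 < coord x"
    using xy(1) ch_in_star_iff[OF e(1) x(1,2) v, of "1/4"] x(3) by auto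
  moreover have "coord y < 1/4 \<or> 1 - 1/4 < coord y"
    using xy(2) ch_in_star_iff[OF e(1) y(1,2) v, of "1/4"] y(3) by auto
  ultimately have "coord x < 1/2 \<longleftrightarrow> coord y < 1/2" using d by linarith
  then show ?thesis by (simp add: jump_def)
qed

lemma cocycle_jump: "cocycle_on X (jump L)"
  unfolding cocycle_on_def
proof
  fix x assume "x \<in> topspace X"
  then show "\<exists>U. openin X U \<and> x \<in> U \<and> (\<forall>a\<in>U. \<forall>b\<in>U. \<forall>c\<in>U. jump L a b + jump L b c = jump L a c)"
  proof (cases rule: point_cases)
    case 1
    then show ?thesis
      using openin_star[OF 1, of "1/4"] by (intro exI[of _ "star x (1/4)"]) (simp add: jump_star)
  next
    case (2 e t)
    \<comment> \<open>Radius 1/4 keeps any two points of \<open>J\<close> at distance less than 1/2,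
      so that the first case of \<open>jump\<close> applies to them.\<close>
    define J where "J = {0<..<1} \<inter> ball t (1/4)"
    have J: "open J" "J \<subseteq> {0<..<1}" "t \<in> J" using 2 by (auto simp: J_def)
    have Jd: "\<bar>s - u\<bar> < 1/2" if "s \<in> J" "u \<in> J" for s u
    proof -
      have "\<bar>t - s\<bar> < 1/4" "\<bar>t - u\<bar> < 1/4" using that by (simp_all add: J_def dist_real_def)
      then show ?thesis by arith
    qed
    show ?thesis
    proof (intro exI conjI ballI)
      show "openin X (ch e ` J)" by (rule openin_edge_image[OF 2(1) J(1,2)])
      show "x \<in> ch e ` J" using 2 J by auto
      fix a b c assume "a \<in> ch e ` J" "b \<in> ch e ` J" "c \<in> ch e ` J"
      then obtain p q r where p: "p \<in> J" "q \<in> J" "r \<in> J" "a = ch e p" "b = ch e q" "c = ch e r" by blast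
      have "p \<in> {0<..<1}" "q \<in> {0<..<1}" "r \<in> {0<..<1}" using p J(2) by blast+
      then show "jump L a b + jump L b c = jump L a c"
        using Jd[OF p(1,2)] Jd[OF p(2,3)] Jd[OF p(1,3)] 2(1)
        by (simp only: p jump_edge greaterThanLessThan_iff) (simp add: add.assoc)
    qed
  qed
qed

abbreviation hol :: "('a set \<Rightarrow> 'h::group_add) \<Rightarrow> (real \<Rightarrow> 'a) \<Rightarrow> 'h" where
  "hol L \<equiv> holonomy (jump L)"

lemma hol_ch:
  assumes e: "e \<in> E"
  shows "hol L (ch e) = L e"
proof -
  \<comment> \<open>An explicit development, switching at the midpoint. Near an end of the edge it
    is constant, in accordance with the zero value of \<open>jump\<close> at vertices.\<close>
  define D where "D t = (if t < 1/2 then 0 else L e)" for t :: real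
  have *: "D b = D a + jump L (ch e a) (ch e b)"
    if ab: "a \<in> {0..1}" "b \<in> {0..1}" "\<bar>a - b\<bar> < 1/4" for a b
  proof (cases "a \<in> {0<..<1} \<and> b \<in> {0<..<1}")
    case True
    then show ?thesis using jump_edge[OF e, of a b L] ab by (simp add: D_def add.assoc[symmetric])
  next
    case False
    then have "a = 0 \<or> a = 1 \<or> b = 0 \<or> b = 1" using ab by fastforce
    then have "jump L (ch e a) (ch e b) = 0" using ch_0[OF e] ch_1[OF e] by (auto intro: jump_vert)
    moreover have "D a = D b" using False ab by (auto simp: D_def abs_if split: if_splits)
    ultimately show ?thesis by simp
  qed
  have "development {0..1} (\<lambda>a b. jump L (ch e a) (ch e b)) D"
  proof (rule developmentI)
    fix z :: real assume "z \<in> {0..1}"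
    have d: "\<bar>a - b\<bar> < 1/4" if "a \<in> ball z (1/8)" "b \<in> ball z (1/8)" for a b
    proof -
      have "\<bar>z - a\<bar> < 1/8" "\<bar>z - b\<bar> < 1/8" using that by (simp_all add: dist_real_def)
      then show ?thesis by arith
    qed
    show "\<exists>N. open N \<and> z \<in> N \<and> (\<forall>a\<in>N \<inter> {0..1}. \<forall>b\<in>N \<inter> {0..1}. D b = D a + jump L (ch e a) (ch e b))"
    proof (intro exI[of _ "ball z (1/8)"] conjI ballI)
      fix a b assume ab: "a \<in> ball z (1/8) \<inter> {0..1}" "b \<in> ball z (1/8) \<inter> {0..1}"
      show "D b = D a + jump L (ch e a) (ch e b)"
        by (rule *) (use ab d in blast)+
    qed auto
  qed
  from holonomy_eq[of "jump L" "ch e", OF this] show ?thesis by (simp add: D_def)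
qed

subsection \<open>Collapsing the ends of the edges\<close>

text \<open>The straight-line homotopy from the identity to the map that crushes the outer thirds to
  the ends and stretches the middle third over the interval.\<close>

definition squeeze :: "real \<Rightarrow> real \<Rightarrow> real" where
  "squeeze s t = (1 - s) * t + s * max 0 (min 1 (3 * t - 1))"

lemma squeeze_simps [simp]: "squeeze s 0 = 0" "squeeze s 1 = 1" "squeeze 0 t = t"
  by (simp_all add: squeeze_def)

lemma squeeze_1: "t \<le> 1/3 \<Longrightarrow> squeeze 1 t = 0" "2/3 \<le> t \<Longrightarrow> squeeze 1 t = 1"
  by (auto simp: squeeze_def max_def min_def)

lemma squeeze_in: 
  assumes "s \<in> {0..1}" "t \<in> {0..1}"
  shows "squeeze s t \<in> {0..1}"
proof -
  have "max 0 (min 1 (3 * t - 1)) \<in> {0..1::real}" by auto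
  then have "(1 - s) *\<^sub>R t + s *\<^sub>R max 0 (min 1 (3 * t - 1)) \<in> {0..1}"
    using convex_real_interval(5)[of 0 1, unfolded convex_alt] assms by fastforce
  then show ?thesis by (simp only: squeeze_def real_scaleR_def)
qed

lemma continuous_squeeze: "continuous_on S (\<lambda>w. squeeze (fst w) (snd w))"
  unfolding squeeze_def by (intro continuous_intros)

text \<open>Squeezes all edges at once: a homotopy of the graph that fixes the vertices and ends
  with every star of radius 1/3 at its centre.\<close>

definition collapse :: "real \<times> 'a \<Rightarrow> 'a" where
  "collapse = (\<lambda>(s, x). if x \<in> V then x else ch (cell_of x) (squeeze s (coord x)))"

lemma collapse_vert: "v \<in> V \<Longrightarrow> collapse (s, v) = v"
  by (simp add: collapse_def)

lemma collapse_ch: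
  assumes "e \<in> E" "0 \<le> t" "t \<le> 1"
  shows "collapse (s, ch e t) = ch e (squeeze s t)"
proof (cases "t = 0 \<or> t = 1")
  case True
  then show ?thesis using ch_0[OF assms(1)] ch_1[OF assms(1)] by (auto simp: collapse_def)
next
  case False
  then have t: "0 < t" "t < 1" using assms by auto
  then have "ch e t \<notin> V" using ch_in_verts_iff[OF assms] by simp
  then show ?thesis using coord_ch[OF assms(1) t] cell_of_ch[OF assms(1) t] by (simp add: collapse_def)
qed

lemma collapse_0: "x \<in> topspace X \<Longrightarrow> collapse (0, x) = x"
  by (erule point_cases) (simp_all add: collapse_vert collapse_ch)

lemma continuous_collapse: "continuous_map (prod_topology (top_of_set {0..1}) X) X collapse"
proof (rule continuous_map_coherent_prod)
  fix e assume e: "e \<in> E"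
  have "continuous_map (top_of_set ({0..1} \<times> {0..1})) (top_of_set {0..1}) (\<lambda>w. squeeze (fst w) (snd w))"
    using continuous_squeeze squeeze_in by (auto simp del: atLeastAtMost_iff)
  from continuous_map_compose[OF this ch_continuous[OF e]]
  have 1: "continuous_map (top_of_set ({0..1} \<times> {0..1})) X (\<lambda>w. ch e (squeeze (fst w) (snd w)))"
    by (simp add: o_def)
  show "continuous_map (prod_topology (top_of_set {0..1}) (top_of_set {0..1})) X (\<lambda>(z, t). collapse (z, ch e t))"
    by (simp, rule continuous_map_eq[OF 1]) (auto simp: collapse_ch[OF e])
next
  fix v assume v: "v \<in> V"
  show "continuous_map (top_of_set {0..1}) X (\<lambda>z. collapse (z, v))"
    using vert_in[OF v] by (simp add: collapse_vert[OF v])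
qed (simp_all add: compact_space_subtopology Hausdorff_space_subtopology)

lemma collapse_1_star:
  assumes v: "v \<in> V" and x: "x \<in> star v (1/3)"
  shows "collapse (1, x) = v"
proof -
  have "x \<in> topspace X" using x openin_subset[OF openin_star[OF v, of "1/3"]] by auto
  then show ?thesis
  proof (cases rule: point_cases)
    case 1
    then have "x = v" using x vert_not_in_edge by (auto simp: star_def)
    then show ?thesis using v by (simp add: collapse_vert)
  next
    case (2 e t)
    then have "ch e 0 = v \<and> t < 1/3 \<or> ch e 1 = v \<and> 1 - 1/3 < t"
      using x ch_in_star_iff[OF 2(1-3) v] by simp
    then show ?thesis using 2 collapse_ch[of e t 1] squeeze_1[of t] by auto
  qed
qed

end

lemma pathin_near:
  assumes c: "pathin X c" and U: "openin X U" and t: "t \<in> {0..1}" "c t \<in> U"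
  shows "\<exists>\<delta>>0. \<forall>s\<in>{0..1}. \<bar>s - t\<bar> < \<delta> \<longrightarrow> c s \<in> U"
proof -
  have "openin (top_of_set {0..1}) {s \<in> {0..1}. c s \<in> U}"
    using openin_continuous_map_preimage[OF c[unfolded pathin_def] U] by simp
  then have "\<forall>x\<in>{s \<in> {0..1}. c s \<in> U}. \<exists>e>0. ball x e \<inter> {0..1} \<subseteq> {s \<in> {0..1}. c s \<in> U}"
    unfolding openin_contains_ball by (rule conjunct2)
  from bspec[OF this, of t] t obtain e where e: "e > 0" "ball t e \<inter> {0..1} \<subseteq> {s \<in> {0..1}. c s \<in> U}" by auto
  have "c s \<in> U" if "s \<in> {0..1}" "\<bar>s - t\<bar> < e" for s
    using subsetD[OF e(2), of s] that by (simp add: dist_real_def abs_minus_commute)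
  with e(1) show ?thesis by blast
qed

section \<open>Edge words\<close>

text \<open>A letter is an edge with a direction, \<open>True\<close> being that of its
  characteristic map.\<close>

definition flip_letter :: "'a set \<times> bool \<Rightarrow> 'a set \<times> bool" where
  "flip_letter l = (fst l, \<not> snd l)"

definition inv_word :: "('a set \<times> bool) list \<Rightarrow> ('a set \<times> bool) list" where
  "inv_word w = rev (map flip_letter w)"

definition word_hol :: "('a set \<Rightarrow> 'h::group_add) \<Rightarrow> ('a set \<times> bool) list \<Rightarrow> 'h" where
  "word_hol L w = sum_list (map (\<lambda>l. if snd l then L (fst l) else - L (fst l)) w)"

lemma word_hol_simps [simp]:
  "word_hol L [] = 0"
  "word_hol L (l # w) = (if snd l then L (fst l) else - L (fst l)) + word_hol L w"
  "word_hol L (w @ w') = word_hol L w + word_hol L w'"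
  by (simp_all add: word_hol_def)

context fgraph
begin

definition src :: "'a set \<times> bool \<Rightarrow> 'a" where
  "src l = (if snd l then ch (fst l) 0 else ch (fst l) 1)"

definition tgt :: "'a set \<times> bool \<Rightarrow> 'a" where
  "tgt l = (if snd l then ch (fst l) 1 else ch (fst l) 0)"

definition letter_path :: "'a set \<times> bool \<Rightarrow> real \<Rightarrow> 'a" where
  "letter_path l = (if snd l then ch (fst l) else path_reverse (ch (fst l)))"

primrec walk :: "'a \<Rightarrow> ('a set \<times> bool) list \<Rightarrow> 'a \<Rightarrow> bool" where
  "walk u [] v \<longleftrightarrow> u = v \<and> u \<in> V"
| "walk u (l # w) v \<longleftrightarrow> fst l \<in> E \<and> src l = u \<and> walk (tgt l) w v"

primrec word_path :: "'a \<Rightarrow> ('a set \<times> bool) list \<Rightarrow> real \<Rightarrow> 'a" where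
  "word_path u [] = (\<lambda>_. u)"
| "word_path u (l # w) = path_join (letter_path l) (word_path (tgt l) w)"

lemma flip_letter_simps [simp]:
  "fst (flip_letter l) = fst l" "snd (flip_letter l) = (\<not> snd l)"
  "src (flip_letter l) = tgt l" "tgt (flip_letter l) = src l"
  "flip_letter (flip_letter l) = l"
  "letter_path (flip_letter l) = path_reverse (letter_path l)"
  by (auto simp: flip_letter_def src_def tgt_def letter_path_def)

lemma letter_path_props:
  assumes "fst l \<in> E"
  shows "pathin X (letter_path l)" "letter_path l 0 = src l" "letter_path l 1 = tgt l"
    "src l \<in> V" "tgt l \<in> V"
  using assms pathin_ch pathin_reverse[OF pathin_ch] ch_0 ch_1
  by (auto simp: letter_path_def src_def tgt_def)

lemma walk_verts: "walk u w v \<Longrightarrow> u \<in> V \<and> v \<in> V"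
  by (induction w arbitrary: u) (use letter_path_props in auto)

lemma word_path_props:
  assumes "walk u w v"
  shows "pathin X (word_path u w)" "word_path u w 0 = u" "word_path u w 1 = v"
proof -
  have "pathin X (word_path u w) \<and> word_path u w 0 = u \<and> word_path u w 1 = v"
    using assms
  proof (induction w arbitrary: u)
    case Nil
    then show ?case by (auto simp: vert_in)
  next
    case (Cons l w)
    then have l: "fst l \<in> E" "src l = u" "walk (tgt l) w v" by simp_all
    show ?case
      using Cons.IH[OF l(3)] letter_path_props[OF l(1)] l(2) by (simp add: pathin_join)
  qed
  then show "pathin X (word_path u w)" "word_path u w 0 = u" "word_path u w 1 = v" by simp_all
qed

lemma walk_append: "walk u w v \<Longrightarrow> walk v w' z \<Longrightarrow> walk u (w @ w') z"
  by (induction w arbitrary: u) auto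

lemma walk_appendD: "walk u (w @ w') z \<Longrightarrow> \<exists>v. walk u w v \<and> walk v w' z"
proof (induction w arbitrary: u)
  case Nil then show ?case using walk_verts by auto
qed auto

lemma word_path_append:
  assumes "walk u w v" "walk v w' z"
  shows "path_homotopic X (path_join (word_path u w) (word_path v w')) (word_path u (w @ w'))"
  using assms(1)
proof (induction w arbitrary: u)
  case Nil
  then show ?case using word_path_props[OF assms(2)] by (simp add: path_homotopic_const_left)
next
  case (Cons l w)
  then have l: "fst l \<in> E" "src l = u" "walk (tgt l) w v" by simp_all
  note lp = letter_path_props[OF l(1)] and wp = word_path_props[OF l(3)] and wp' = word_path_props[OF assms(2)]
  have "path_homotopic X (path_join (path_join (letter_path l) (word_path (tgt l) w)) (word_path v w'))
     (path_join (letter_path l) (path_join (word_path (tgt l) w) (word_path v w')))"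
    using lp wp wp' by (intro path_homotopic_assoc) auto
  also have "path_homotopic X \<dots> (path_join (letter_path l) (word_path (tgt l) (w @ w')))"
    using lp wp Cons.IH[OF l(3)] by (intro path_homotopic_join path_homotopic_refl) auto
  finally show ?case by simp
qed

lemma walk_inv_word: "walk u w v \<Longrightarrow> walk v (inv_word w) u"
proof (induction w arbitrary: u)
  case Nil then show ?case by (auto simp: inv_word_def)
next
  case (Cons l w)
  then have l: "fst l \<in> E" "src l = u" "walk (tgt l) w v" by simp_all
  have "walk (tgt l) [flip_letter l] u"
    using l letter_path_props[OF l(1)] by simp
  from walk_append[OF Cons.IH[OF l(3)] this] show ?case by (simp add: inv_word_def)
qed

lemma word_path_cancel_pair:
  assumes l: "fst l \<in> E" and w: "walk (src l) w v"
  shows "path_homotopic X (word_path (src l) (l # flip_letter l # w)) (word_path (src l) w)"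
  using path_homotopic_cancel_left[of X "path_reverse (letter_path l)" "word_path (src l) w"]
    letter_path_props[OF l] word_path_props[OF w]
  by (simp add: pathin_reverse)

lemma word_path_inv_word:
  assumes "walk u w v"
  shows "path_homotopic X (word_path v (inv_word w @ w)) (\<lambda>_. v)"
  using assms
proof (induction w arbitrary: u)
  case Nil
  then show ?case by (auto simp: inv_word_def path_homotopic_refl vert_in)
next
  case (Cons l w)
  then have l: "fst l \<in> E" "src l = u" "walk (tgt l) w v" by simp_all
  let ?k = "flip_letter l"
  have iw: "walk v (inv_word w) (tgt l)" by (rule walk_inv_word[OF l(3)])
  have k: "walk (tgt l) (?k # l # w) v" using l by simp
  have e: "inv_word (l # w) @ l # w = inv_word w @ (?k # l # w)" by (simp add: inv_word_def)
  have "path_homotopic X (word_path v (inv_word w @ (?k # l # w)))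
      (path_join (word_path v (inv_word w)) (word_path (tgt l) (?k # l # w)))"
    by (rule path_homotopic_sym[OF word_path_append[OF iw k]])
  also have "path_homotopic X \<dots> (path_join (word_path v (inv_word w)) (word_path (tgt l) w))"
    using word_path_cancel_pair[of ?k w v] l word_path_props[OF iw] word_path_props[OF k]
    by (intro path_homotopic_join path_homotopic_refl) simp_all
  also have "path_homotopic X \<dots> (word_path v (inv_word w @ w))"
    by (rule word_path_append[OF iw l(3)])
  also have "path_homotopic X \<dots> (\<lambda>_. v)" by (rule Cons.IH[OF l(3)])
  finally show ?case by (simp only: e)
qed

lemma hol_word_path:
  assumes "walk u w v"
  shows "hol L (word_path u w) = word_hol L w"
  using assms
proof (induction w arbitrary: u)
  case Nil
  then have "v \<in> topspace X" by (auto simp: vert_in)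
  then show ?case using holonomy_const[OF cocycle_jump] Nil by simp
next
  case (Cons l w)
  then have l: "fst l \<in> E" "src l = u" "walk (tgt l) w v" by simp_all
  note lp = letter_path_props[OF l(1)] and wp = word_path_props[OF l(3)]
  have "hol L (letter_path l) = (if snd l then L (fst l) else - L (fst l))"
    using hol_ch[OF l(1), of L] holonomy_reverse[OF cocycle_jump pathin_ch[OF l(1)], of L]
    by (simp add: letter_path_def)
  moreover have "hol L (word_path u (l # w)) = hol L (letter_path l) + hol L (word_path (tgt l) w)"
    unfolding word_path.simps using lp wp by (intro holonomy_join[OF cocycle_jump]) simp_all
  ultimately show ?case using Cons.IH[OF l(3)] by simp
qed

subsection \<open>Every path is homotopic to an edge word\<close>

text \<open>Anchors a point at a vertex, interior points at the initial end of their edge, so that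
  paths between arbitrary points can be compared with edge words.\<close>

definition base_path :: "'a \<Rightarrow> real \<Rightarrow> 'a" where
  "base_path x = (if x \<in> V then (\<lambda>_. x) else subpath 0 (coord x) (ch (cell_of x)))"

lemma base_path_vert: "v \<in> V \<Longrightarrow> base_path v = (\<lambda>_. v)"
  by (simp add: base_path_def)

lemma base_path_ch:
  assumes "e \<in> E" "0 < t" "t < 1"
  shows "base_path (ch e t) = subpath 0 t (ch e)"
  using ch_in_verts_iff[of e t] assms by (simp add: base_path_def coord_ch cell_of_ch)

lemma base_path_props:
  assumes "x \<in> topspace X"
  shows "pathin X (base_path x)" "base_path x 1 = x" "base_path x 0 \<in> V"
proof -
  have "pathin X (base_path x) \<and> base_path x 1 = x \<and> base_path x 0 \<in> V"
    using assms
  proof (cases rule: point_cases)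
    case 1 then show ?thesis using assms by (simp add: base_path_vert)
  next
    case (2 e t)
    then show ?thesis using pathin_subpath[OF pathin_ch[OF 2(1)], of 0 t] ch_0[OF 2(1)]
      by (simp add: base_path_ch)
  qed
  then show "pathin X (base_path x)" "base_path x 1 = x" "base_path x 0 \<in> V" by simp_all
qed

lemma path_homotopic_in_edge:
  assumes e: "e \<in> E" and r: "pathin (top_of_set {0..1}) r" and s: "pathin (top_of_set {0..1}) s"
    and "r 0 = s 0" "r 1 = s 1"
  shows "path_homotopic X (ch e \<circ> r) (ch e \<circ> s)"
  by (rule path_homotopic_convex[OF ch_continuous[OF e]])
    (use assms in \<open>simp_all add: pathin_def image_subset_iff_funcset\<close>)

lemma pathin_interval_subpath:
  assumes "a \<in> {0..1}" "b \<in> {0..1::real}"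
  shows "pathin (top_of_set {0..1}) (subpath a b id)"
  by (rule pathin_subpath[OF _ assms]) (simp add: pathin_def)

text \<open>Everything takes place in one interval, where paths with common ends are homotopic; the
  edge word is empty.\<close>

lemma word_of_path_in_edge:
  assumes e: "e \<in> E" and c: "pathin X c" and ce: "\<And>t. t \<in> {0..1} \<Longrightarrow> c t \<in> e"
  shows "path_homotopic X (path_join (base_path (c 0)) c) (base_path (c 1))"
    and "base_path (c 0) 0 = ch e 0" "base_path (c 1) 0 = ch e 0"
proof -
  have b: "base_path (c t) = subpath 0 (coord (c t)) (ch e)" if "t \<in> {0..1}" for t
    using base_path_ch[OF e coord_props(1,2)[OF e ce[OF that]]] coord_props(3)[OF e ce[OF that]] by simp
  then show "base_path (c 0) 0 = ch e 0" "base_path (c 1) 0 = ch e 0" by simp_all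
  have "continuous_map (top_of_set {0..1}) (subtopology X e) c"
    using c ce by (simp add: continuous_map_in_subtopology pathin_def)
  from continuous_map_compose[OF this continuous_map_coord[OF e]]
  have u: "pathin (top_of_set {0<..<1}) (coord \<circ> c)" by (simp add: pathin_def)
  then have u: "pathin (top_of_set {0..1}) (coord \<circ> c)"
    by (auto simp: pathin_def Pi_iff less_imp_le)
  have u01: "coord (c 0) \<in> {0..1}" "coord (c 1) \<in> {0..1}"
    using coord_props(1,2)[OF e ce[of 0]] coord_props(1,2)[OF e ce[of 1]] by simp_all
  have zero: "(0::real) \<in> {0..1}" by simp
  let ?r = "path_join (subpath 0 (coord (c 0)) id) (coord \<circ> c)"
  have r: "pathin (top_of_set {0..1}) ?r"
    by (rule pathin_join[OF pathin_interval_subpath[OF zero u01(1)] u]) simp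
  have "path_homotopic X (path_join (base_path (c 0)) c) (ch e \<circ> ?r)"
  proof (rule path_homotopic_eq)
    show "pathin X (path_join (base_path (c 0)) c)"
      using base_path_props[OF path_start_in_topspace[OF c]] c by (intro pathin_join) simp_all
    fix t :: real assume t: "t \<in> {0..1}"
    show "path_join (base_path (c 0)) c t = (ch e \<circ> ?r) t"
      using t coord_props(3)[OF e ce, of "2 * t - 1"] by (simp add: b path_join_def subpath_def)
  qed
  also have "path_homotopic X \<dots> (ch e \<circ> subpath 0 (coord (c 1)) id)"
    by (rule path_homotopic_in_edge[OF e r pathin_interval_subpath[OF zero u01(2)]]) simp_all
  finally show "path_homotopic X (path_join (base_path (c 0)) c) (base_path (c 1))"
    by (simp add: b comp_subpath)
qed

definition track :: "'a \<Rightarrow> real \<Rightarrow> 'a" where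
  "track x = (\<lambda>s. collapse (s, x))"

text \<open>For the last claim: anchor and track together contract if \<open>x\<close> lies near the
  initial end of its edge, and run over the whole edge if \<open>x\<close> lies near the terminal
  end. The word has at most one letter.\<close>

lemma track_props:
  assumes v: "v \<in> V" and x: "x \<in> star v (1/3)"
  shows "pathin X (track x)" "track x 0 = x" "track x 1 = v"
    "\<exists>w. walk (base_path x 0) w v \<and>
      path_homotopic X (path_join (base_path x) (track x)) (word_path (base_path x 0) w)"
proof -
  have xX: "x \<in> topspace X" using x openin_subset[OF openin_star[OF v, of "1/3"]] by auto
  have "continuous_map (top_of_set {0..1}) (prod_topology (top_of_set {0..1}) X) (\<lambda>s. (s, x))"
    using xX by (simp add: continuous_map_pairwise o_def)
  from continuous_map_compose[OF this continuous_collapse] show p: "pathin X (track x)"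
    by (simp add: pathin_def track_def o_def)
  show t0: "track x 0 = x" using collapse_0[OF xX] by (simp add: track_def)
  show t1: "track x 1 = v" using collapse_1_star[OF v x] by (simp add: track_def)
  from xX show "\<exists>w. walk (base_path x 0) w v \<and>
      path_homotopic X (path_join (base_path x) (track x)) (word_path (base_path x 0) w)"
  proof (cases rule: point_cases)
    case 1
    then have "x = v" using x vert_not_in_edge by (auto simp: star_def)
    then have "track x = (\<lambda>_. v)" using v by (simp add: track_def collapse_vert)
    then have "path_homotopic X (path_join (base_path x) (track x)) (\<lambda>_. v)"
      using v vert_in[OF v] \<open>x = v\<close> by (simp add: base_path_vert path_homotopic_const_left)
    then show ?thesis
      using v \<open>x = v\<close> by (intro exI[of _ "[]"]) (simp add: base_path_vert)
  next
    case (2 e t)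
    have st: "ch e 0 = v \<and> t < 1/3 \<or> ch e 1 = v \<and> 1 - 1/3 < t"
      using x ch_in_star_iff[OF 2(1-3) v] 2(4) by simp
    have b: "base_path x = ch e \<circ> subpath 0 t id"
      unfolding 2(4) comp_subpath using base_path_ch[OF 2(1-3)] by simp
    have tr: "track x = ch e \<circ> (\<lambda>s. squeeze s t)"
      using collapse_ch[OF 2(1)] 2 by (simp add: track_def o_def)
    have sq: "pathin (top_of_set {0..1}) (\<lambda>s. squeeze s t)"
      unfolding pathin_def
    proof (simp add: image_subset_iff_funcset[symmetric] del: atLeastAtMost_iff, intro conjI)
      show "continuous_on {0..1} (\<lambda>s. squeeze s t)"
        unfolding squeeze_def by (intro continuous_intros)
      show "(\<lambda>s. squeeze s t) ` {0..1} \<subseteq> {0..1}"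
        by (rule image_subsetI, rule squeeze_in) (use 2 in auto)
    qed
    have t01: "t \<in> {0..1}" and zero: "(0::real) \<in> {0..1}" using 2 by auto
    let ?r = "path_join (subpath 0 t id) (\<lambda>s. squeeze s t)"
    have r: "pathin (top_of_set {0..1}) ?r"
      by (rule pathin_join[OF pathin_interval_subpath[OF zero t01] sq]) simp
    have bt: "path_join (base_path x) (track x) = ch e \<circ> ?r"
      unfolding b tr comp_path_join ..
    have b0: "base_path x 0 = ch e 0" by (simp add: b)
    from st show ?thesis
    proof
      assume *: "ch e 0 = v \<and> t < 1/3"
      have "path_homotopic X (ch e \<circ> ?r) (ch e \<circ> (\<lambda>_. 0))"
        by (rule path_homotopic_in_edge[OF 2(1) r]) (use * in \<open>simp_all add: squeeze_1\<close>)
      then have "path_homotopic X (ch e \<circ> ?r) (\<lambda>_. v)" using * by (simp add: o_def)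
      then show ?thesis
        using v * by (intro exI[of _ "[]"]) (simp add: bt b0)
    next
      assume *: "ch e 1 = v \<and> 1 - 1/3 < t"
      have "path_homotopic X (ch e \<circ> ?r) (ch e \<circ> id)"
        by (rule path_homotopic_in_edge[OF 2(1) r]) (use * in \<open>simp_all add: squeeze_1 pathin_def\<close>)
      also have "path_homotopic X (ch e \<circ> id) (path_join (ch e) (\<lambda>_. v))"
        using * pathin_ch[OF 2(1)] by (simp add: path_homotopic_sym[OF path_homotopic_const_right])
      finally show ?thesis
        using v * 2(1) by (intro exI[of _ "[(e, True)]"]) (simp add: bt b0 src_def tgt_def letter_path_def)
    qed
  qed
qed

text \<open>The path may pass through the centre infinitely often, so it cannot be cut there.
  Instead the collapse moves it to the constant path at the centre, which leaves the tracks of its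
  endpoints, and with the anchors these are edge words.\<close>

lemma word_of_path_in_star:
  assumes v: "v \<in> V" and c: "pathin X c" and cs: "\<And>t. t \<in> {0..1} \<Longrightarrow> c t \<in> star v (1/3)"
  shows "\<exists>w. walk (base_path (c 0) 0) w (base_path (c 1) 0) \<and>
    path_homotopic X (path_join (base_path (c 0)) c) (path_join (word_path (base_path (c 0) 0) w) (base_path (c 1)))"
proof -
  have c01: "c 0 \<in> topspace X" "c 1 \<in> topspace X"
    using c path_start_in_topspace path_finish_in_topspace by blast+
  note b0 = base_path_props[OF c01(1)] and b1 = base_path_props[OF c01(2)]
  have s01: "c 0 \<in> star v (1/3)" "c 1 \<in> star v (1/3)" using cs by simp_all
  note t0 = track_props[OF v s01(1)] and t1 = track_props[OF v s01(2)]
  obtain w0 where w0: "walk (base_path (c 0) 0) w0 v"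
    "path_homotopic X (path_join (base_path (c 0)) (track (c 0))) (word_path (base_path (c 0) 0) w0)"
    using t0(4) by blast
  obtain w1 where w1: "walk (base_path (c 1) 0) w1 v"
    "path_homotopic X (path_join (base_path (c 1)) (track (c 1))) (word_path (base_path (c 1) 0) w1)"
    using t1(4) by blast
  note iw1 = walk_inv_word[OF w1(1)]
  let ?w = "w0 @ inv_word w1" and ?b0 = "base_path (c 0)" and ?b1 = "base_path (c 1)"
  have w: "walk (?b0 0) ?w (?b1 0)" by (rule walk_append[OF w0(1) iw1])
  note wp = word_path_props[OF w] and wp0 = word_path_props[OF w0(1)] and wp1 = word_path_props[OF w1(1)]
    and wpi = word_path_props[OF iw1]
  have "continuous_map (prod_topology (top_of_set {0..1}) (top_of_set {0..1})) (prod_topology (top_of_set {0..1}) X)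
      (\<lambda>(s, t). (s, c t))"
    using c by (simp add: continuous_map_prod_top pathin_def del: prod_topology_subtopology_eu)
  from continuous_map_compose[OF this continuous_collapse]
  have H: "continuous_map (top_of_set ({0..1} \<times> {0..1})) X (\<lambda>(s, t). collapse (s, c t))"
    by (simp add: o_def case_prod_unfold)
  have top: "path_homotopic X (path_join c (track (c 1))) (path_join (\<lambda>t. collapse (0, c t)) (track (c 1)))"
  proof (intro path_homotopic_join path_homotopic_refl t1(1))
    show "path_homotopic X c (\<lambda>t. collapse (0, c t))"
    proof (rule path_homotopic_eq[OF c])
      fix t :: real assume "t \<in> {0..1}"
      then have "c t \<in> topspace X" using funcset_mem[OF path_image_subset_topspace[OF c]] by blast
      then show "c t = collapse (0, c t)" by (simp add: collapse_0)
    qed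
  qed (simp add: t1)
  have bot: "path_homotopic X (path_join (track (c 0)) (\<lambda>t. collapse (1, c t))) (track (c 0))"
  proof -
    have "path_homotopic X (\<lambda>_. v) (\<lambda>t. collapse (1, c t))"
      using vert_in[OF v] cs collapse_1_star[OF v] by (intro path_homotopic_eq) simp_all
    from path_homotopic_join[OF path_homotopic_refl[OF t0(1)] this] t0(3)
    have "path_homotopic X (path_join (track (c 0)) (\<lambda>t. collapse (1, c t))) (path_join (track (c 0)) (\<lambda>_. v))"
      by (intro path_homotopic_sym[of X "path_join (track (c 0)) (\<lambda>_. v)"]) simp
    also have "path_homotopic X \<dots> (track (c 0))"
      using t0 by (intro path_homotopic_const_right) simp_all
    finally show ?thesis .
  qed
  have "path_homotopic X (path_join c (track (c 1))) (path_join (\<lambda>t. collapse (0, c t)) (track (c 1)))"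
    by (rule top)
  also have "path_homotopic X \<dots> (path_join (track (c 0)) (\<lambda>t. collapse (1, c t)))"
    using path_homotopic_tracks[OF H] by (simp add: track_def)
  also have "path_homotopic X \<dots> (track (c 0))" by (rule bot)
  finally have sq: "path_homotopic X (path_join c (track (c 1))) (track (c 0))" .
  have "path_homotopic X (path_join (path_join ?b0 c) (track (c 1))) (path_join ?b0 (path_join c (track (c 1))))"
    using b0 c t1 by (intro path_homotopic_assoc) simp_all
  also have "path_homotopic X \<dots> (path_join ?b0 (track (c 0)))"
    using b0 by (intro path_homotopic_join path_homotopic_refl sq) simp_all
  also have "path_homotopic X \<dots> (word_path (?b0 0) w0)" by (rule w0(2))
  finally have left: "path_homotopic X (path_join (path_join ?b0 c) (track (c 1))) (word_path (?b0 0) w0)" .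
  have "path_homotopic X (path_join (path_join (word_path (?b0 0) ?w) ?b1) (track (c 1)))
      (path_join (word_path (?b0 0) ?w) (path_join ?b1 (track (c 1))))"
    using wp b1 t1 by (intro path_homotopic_assoc) simp_all
  also have "path_homotopic X \<dots> (path_join (word_path (?b0 0) ?w) (word_path (?b1 0) w1))"
    using wp b1 by (intro path_homotopic_join path_homotopic_refl w1(2)) simp_all
  also have "path_homotopic X \<dots> (word_path (?b0 0) (?w @ w1))"
    by (rule word_path_append[OF w w1(1)])
  also have "path_homotopic X \<dots> (path_join (word_path (?b0 0) w0) (word_path v (inv_word w1 @ w1)))"
    using path_homotopic_sym[OF word_path_append[OF w0(1) walk_append[OF iw1 w1(1)]]] by simp
  also have "path_homotopic X \<dots> (path_join (word_path (?b0 0) w0) (\<lambda>_. v))"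
    using wp0 word_path_inv_word[OF w1(1)] word_path_props(2)[OF walk_append[OF iw1 w1(1)]]
    by (intro path_homotopic_join path_homotopic_refl) simp_all
  also have "path_homotopic X \<dots> (word_path (?b0 0) w0)"
    using wp0 by (intro path_homotopic_const_right) simp_all
  finally have right: "path_homotopic X (path_join (path_join (word_path (?b0 0) ?w) ?b1) (track (c 1))) (word_path (?b0 0) w0)" .
  have "path_homotopic X (path_join ?b0 c) (path_join (word_path (?b0 0) ?w) ?b1)"
    by (rule path_homotopic_join_cancel_right[OF path_homotopic_trans[OF left path_homotopic_sym[OF right]]])
      (use b0 b1 c t1 wp in \<open>simp_all add: pathin_join\<close>)
  with w show ?thesis by blast
qed

text \<open>Open stars and open edges cover the graph, so short subpaths are settled by the two
  local lemmas. Bisection concatenates their words, the anchor at the end of one piece being the one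
  with which the next begins.\<close>

theorem word_of_path:
  assumes c: "pathin X c"
  shows "\<exists>w. walk (base_path (c 0) 0) w (base_path (c 1) 0) \<and>
    path_homotopic X (path_join (base_path (c 0)) c) (path_join (word_path (base_path (c 0) 0) w) (base_path (c 1)))"
proof -
  define R where "R a b \<longleftrightarrow> (\<exists>w. walk (base_path (c a) 0) w (base_path (c b) 0) \<and>
    path_homotopic X (path_join (base_path (c a)) (subpath a b c)) (path_join (word_path (base_path (c a) 0) w) (base_path (c b))))" for a b
  define P where "P a b \<longleftrightarrow> (0 \<le> a \<longrightarrow> b \<le> 1 \<longrightarrow> R a b)" for a b
  have cX: "c t \<in> topspace X" if "t \<in> {0..1}" for t
    using funcset_mem[OF path_image_subset_topspace[OF c] that] .
  have "P 0 1"
  proof (rule Bolzano)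
    fix p q r assume pq: "P p q" "P q r" "p \<le> q" "q \<le> r"
    show "P p r"
      unfolding P_def
    proof (intro impI)
      assume pr: "0 \<le> p" "r \<le> 1"
      then have in01: "p \<in> {0..1}" "q \<in> {0..1}" "r \<in> {0..1}" using pq by simp_all
      note bp = base_path_props[OF cX[OF in01(1)]] and bq = base_path_props[OF cX[OF in01(2)]]
        and br = base_path_props[OF cX[OF in01(3)]]
      note sp = pathin_subpath[OF c in01(1,2)] pathin_subpath[OF c in01(2,3)] pathin_subpath[OF c in01(1,3)]
      have "R p q" "R q r" using pq pr by (simp_all add: P_def)
      then obtain w w' where w: "walk (base_path (c p) 0) w (base_path (c q) 0)"
          "path_homotopic X (path_join (base_path (c p)) (subpath p q c)) (path_join (word_path (base_path (c p) 0) w) (base_path (c q)))"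
        and w': "walk (base_path (c q) 0) w' (base_path (c r) 0)"
          "path_homotopic X (path_join (base_path (c q)) (subpath q r c)) (path_join (word_path (base_path (c q) 0) w') (base_path (c r)))"
        unfolding R_def by blast
      note wp = word_path_props[OF w(1)] and wp' = word_path_props[OF w'(1)]
      let ?bp = "base_path (c p)" and ?bq = "base_path (c q)" and ?br = "base_path (c r)"
      have "path_homotopic X (path_join ?bp (subpath p r c)) (path_join ?bp (path_join (subpath p q c) (subpath q r c)))"
        using bp path_homotopic_sym[OF path_homotopic_subpath_join[OF c in01]]
        by (intro path_homotopic_join path_homotopic_refl) simp_all
      also have "path_homotopic X \<dots> (path_join (path_join ?bp (subpath p q c)) (subpath q r c))"
        using bp sp by (intro path_homotopic_sym[OF path_homotopic_assoc]) simp_all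
      also have "path_homotopic X \<dots> (path_join (path_join (word_path (?bp 0) w) ?bq) (subpath q r c))"
        using sp by (intro path_homotopic_join path_homotopic_refl w(2)) simp_all
      also have "path_homotopic X \<dots> (path_join (word_path (?bp 0) w) (path_join ?bq (subpath q r c)))"
        using wp bq sp by (intro path_homotopic_assoc) simp_all
      also have "path_homotopic X \<dots> (path_join (word_path (?bp 0) w) (path_join (word_path (?bq 0) w') ?br))"
        using wp by (intro path_homotopic_join path_homotopic_refl w'(2)) simp_all
      also have "path_homotopic X \<dots> (path_join (path_join (word_path (?bp 0) w) (word_path (?bq 0) w')) ?br)"
        using wp wp' br by (intro path_homotopic_sym[OF path_homotopic_assoc]) simp_all
      also have "path_homotopic X \<dots> (path_join (word_path (?bp 0) (w @ w')) ?br)"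
        using br wp' by (intro path_homotopic_join path_homotopic_refl word_path_append[OF w(1) w'(1)]) simp_all
      finally show "R p r" unfolding R_def using walk_append[OF w(1) w'(1)] by blast
    qed
  next
    fix t :: real assume t: "0 \<le> t" "t \<le> 1"
    have "\<exists>U. openin X U \<and> c t \<in> U \<and> (\<forall>a b. a \<in> {0..1} \<longrightarrow> b \<in> {0..1} \<longrightarrow> (\<forall>s\<in>{0..1}. subpath a b c s \<in> U) \<longrightarrow> R a b)"
    proof -
      have "c t \<in> topspace X" using cX t by simp
      then show ?thesis
      proof (cases rule: point_cases)
        case 1
        show ?thesis
        proof (intro exI[of _ "star (c t) (1/3)"] conjI allI impI)
          fix a b :: real assume ab: "a \<in> {0..1}" "b \<in> {0..1}" "\<forall>s\<in>{0..1}. subpath a b c s \<in> star (c t) (1/3)"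
          show "R a b"
            using word_of_path_in_star[OF 1 pathin_subpath[OF c ab(1,2)]] ab(3) by (simp add: R_def)
        qed (use openin_star[OF 1] in simp_all)
      next
        case (2 e s)
        show ?thesis
        proof (intro exI[of _ e] conjI allI impI)
          show "openin X e" "c t \<in> e" using openin_edge[OF 2(1)] ch_mem[OF 2(1-3)] 2(4) by simp_all
          fix a b :: real assume ab: "a \<in> {0..1}" "b \<in> {0..1}" "\<forall>s\<in>{0..1}. subpath a b c s \<in> e"
          note we = word_of_path_in_edge[OF 2(1) pathin_subpath[OF c ab(1,2)] ab(3)[rule_format]]
          have "path_homotopic X (base_path (c b)) (path_join (\<lambda>_. ch e 0) (base_path (c b)))"
            using base_path_props[OF cX[OF ab(2)]] we(3)
            by (intro path_homotopic_sym[OF path_homotopic_const_left]) simp_all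
          with we(1) have "path_homotopic X (path_join (base_path (c a)) (subpath a b c)) (path_join (\<lambda>_. ch e 0) (base_path (c b)))"
            by (simp add: path_homotopic_trans)
          then show "R a b"
            using we(2,3) ch_0[OF 2(1)] unfolding R_def by (intro exI[of _ "[]"]) simp
        qed
      qed
    qed
    then obtain U where U: "openin X U" "c t \<in> U"
      "\<And>a b. a \<in> {0..1} \<Longrightarrow> b \<in> {0..1} \<Longrightarrow> \<forall>s\<in>{0..1}. subpath a b c s \<in> U \<Longrightarrow> R a b" by blast
    have t01: "t \<in> {0..1}" using t by simp
    obtain \<delta> where \<delta>: "\<delta> > 0" "\<forall>s\<in>{0..1}. \<bar>s - t\<bar> < \<delta> \<longrightarrow> c s \<in> U"
      using pathin_near[OF c U(1) t01 U(2)] by blast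
    show "\<exists>d>0. \<forall>a b. a \<le> t \<and> t \<le> b \<and> b - a < d \<longrightarrow> P a b"
    proof (intro exI[of _ \<delta>] conjI allI impI \<delta>(1))
      fix a b assume ab: "a \<le> t \<and> t \<le> b \<and> b - a < \<delta>"
      show "P a b"
        unfolding P_def
      proof (intro impI)
        assume ab': "0 \<le> a" "b \<le> 1"
        show "R a b"
        proof (rule U(3))
          show in01: "a \<in> {0..1}" "b \<in> {0..1}" using ab ab' by simp_all
          show "\<forall>s\<in>{0..1}. subpath a b c s \<in> U"
          proof
            fix s :: real assume s: "s \<in> {0..1}"
            have "a + s * (b - a) \<in> {a..b}" using segment_param_in[of a a b b s] s ab by simp
            moreover have "\<bar>r - t\<bar> < \<delta>" if "r \<in> {a..b}" for r using ab that by auto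
            ultimately have "\<bar>a + s * (b - a) - t\<bar> < \<delta>" by blast
            then have "c (a + s * (b - a)) \<in> U" using \<delta>(2) segment_param_in[OF in01 s] by blast
            then show "subpath a b c s \<in> U" by (simp only: subpath_def)
          qed
        qed
      qed
    qed
  qed simp
  then show ?thesis by (simp add: P_def R_def)
qed

end

section \<open>Detecting reduced words in finite permutation groups\<close>

abbreviation reduced_word :: "('a set \<times> bool) list \<Rightarrow> bool" where
  "reduced_word w \<equiv> (\<forall>i. Suc i < length w \<longrightarrow> w ! Suc i \<noteq> flip_letter (w ! i))"

text \<open>Let the letters of the word move the sheets \<open>0, 1, \<dots>, n\<close> one step up in turn. Reducedness is
  what makes the prescribed partial maps injective.\<close>

lemma reduced_word_detected:
  fixes w :: "('a set \<times> bool) list"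
  assumes red: "reduced_word w" and ne: "w \<noteq> []"
  shows "\<exists>n L. (\<forall>e. L e \<in> small_perms n) \<and> word_hol L w \<noteq> (0 :: nat_perm)"
proof -
  define n where "n = length w"
  \<comment> \<open>The label of \<open>e\<close> has to send \<open>i\<close> to
    \<open>i + 1\<close> for \<open>i\<close> in \<open>U e\<close>. A backward letter at position
    \<open>i - 1\<close> acts by the inverse of the label, hence the label has to send
    \<open>i\<close> to \<open>i - 1\<close> for \<open>i\<close> in \<open>D e\<close>.\<close>
  define U where "U e = {i. i < n \<and> w ! i = (e, True)}" for e
  define D where "D e = {i. 0 < i \<and> i \<le> n \<and> w ! (i - 1) = (e, False)}" for e
  define g where "g e i = (if i \<in> U e then Suc i else i - 1)" for e and i :: nat
  have no_flip: False if "Suc i < n" "w ! Suc i = (e, b)" "w ! i = (e, \<not> b)" for i e b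
    using red[rule_format, of i] that by (simp add: n_def flip_letter_def)
  have UD: "i \<notin> D e" if "i \<in> U e" for i e
  proof
    assume "i \<in> D e"
    then have "Suc (i - 1) < n" "w ! Suc (i - 1) = (e, True)" "w ! (i - 1) = (e, \<not> True)"
      using that by (simp_all add: U_def D_def)
    then show False by (rule no_flip)
  qed
  have inj: "inj_on (g e) (U e \<union> D e)" for e
  proof (rule inj_onI)
    have *: False if "i \<in> U e" "j \<in> D e" "Suc i = j - 1" for i j
    proof -
      have "Suc i < n" "w ! Suc i = (e, False)" "w ! i = (e, \<not> False)"
        using that by (auto simp: U_def D_def)
      then show False by (rule no_flip)
    qed
    fix i j assume i: "i \<in> U e \<union> D e" and j: "j \<in> U e \<union> D e" and eq: "g e i = g e j"
    consider "i \<in> U e" "j \<in> U e" | "i \<in> U e" "j \<in> D e" "j \<notin> U e" | "i \<in> D e" "i \<notin> U e" "j \<in> U e"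
      | "i \<in> D e" "i \<notin> U e" "j \<in> D e" "j \<notin> U e"
      using i j by blast
    then show "i = j"
    proof cases
      case 1 then show ?thesis using eq by (simp add: g_def)
    next
      case 2
      then have "Suc i = j - 1" using eq by (simp add: g_def)
      then show ?thesis using *[OF 2(1,2)] by blast
    next
      case 3
      then have "Suc j = i - 1" using eq by (simp add: g_def)
      then show ?thesis using *[OF 3(3,1)] by blast
    next
      case 4
      then have "0 < i" "0 < j" "i - 1 = j - 1" using eq by (simp_all add: g_def D_def)
      then show ?thesis by simp
    qed
  qed
  have "\<exists>f\<in>small_perms n. \<forall>i\<in>U e \<union> D e. Rep_nat_perm f i = g e i" for e
    by (rule extend_to_small_perm[OF inj]) (auto simp: U_def D_def g_def)
  then obtain L where L: "\<And>e. L e \<in> small_perms n"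
    "\<And>e i. i \<in> U e \<union> D e \<Longrightarrow> Rep_nat_perm (L e) i = g e i" by metis
  have step: "Rep_nat_perm (if snd (w ! i) then L (fst (w ! i)) else - L (fst (w ! i))) i = Suc i" if i: "i < n" for i
  proof (cases "snd (w ! i)")
    case True
    then have "i \<in> U (fst (w ! i))" using i by (simp add: U_def prod_eq_iff)
    then show ?thesis using L(2)[of i] True by (simp add: g_def)
  next
    case False
    then have d: "Suc i \<in> D (fst (w ! i))" using i by (simp add: D_def prod_eq_iff)
    then have "Rep_nat_perm (L (fst (w ! i))) (Suc i) = i"
      using L(2)[of "Suc i"] UD[of "Suc i" "fst (w ! i)"] by (auto simp: g_def)
    then show ?thesis
      using False by (simp add: uminus_nat_perm.rep_eq inv_f_eq[OF bij_is_inj[OF bij_Rep_nat_perm]])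
  qed
  have "Rep_nat_perm (word_hol L (take k w)) 0 = k" if "k \<le> n" for k
    using that
  proof (induction k)
    case 0 then show ?case by (simp add: word_hol_def zero_nat_perm.rep_eq)
  next
    case (Suc k)
    then have k: "k < length w" by (simp add: n_def)
    have "word_hol L (take (Suc k) w)
        = word_hol L (take k w) + (if snd (w ! k) then L (fst (w ! k)) else - L (fst (w ! k)))"
      by (simp add: take_Suc_conv_app_nth[OF k] word_hol_def)
    then show ?case using Suc step[of k] by (simp add: plus_nat_perm.rep_eq)
  qed
  from this[of n] have "Rep_nat_perm (word_hol L w) 0 = n" by (simp add: n_def)
  then have "word_hol L w \<noteq> 0"
    using ne by (auto simp: n_def zero_nat_perm.rep_eq)
  with L(1) show ?thesis by blast
qed

section \<open>Locally injective edge maps are injective on path classes\<close>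

text \<open>An immersion in the sense of Stallings. Since \<open>p\<close> respects the parameters
  of the edges, it can fold only two edges that are attached to a vertex by the same end and have
  the same image; two consecutive letters of opposite direction express this situation.\<close>

locale graph_immersion = H: fgraph H + G: fgraph G
  for H :: "'b cw_graph" and G :: "'a cw_graph" +
  fixes p :: "'b \<Rightarrow> 'a" and \<pi> :: "'b set \<Rightarrow> 'a set"
  assumes p_continuous: "continuous_map (gtop H) (gtop G) p"
    and p_verts: "v \<in> verts H \<Longrightarrow> p v \<in> verts G"
    and \<pi>_edges: "e \<in> edges H \<Longrightarrow> \<pi> e \<in> edges G"
    and p_ch: "e \<in> edges H \<Longrightarrow> t \<in> {0..1} \<Longrightarrow> p (charmap H e t) = charmap G (\<pi> e) t"
    and p_local_inj: "fst l \<in> edges H \<Longrightarrow> fst l' \<in> edges H \<Longrightarrow> H.tgt l = H.src l' \<Longrightarrow>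
      \<pi> (fst l) = \<pi> (fst l') \<Longrightarrow> snd l = (\<not> snd l') \<Longrightarrow> fst l = fst l'"
begin

abbreviation \<pi>_word :: "('b set \<times> bool) list \<Rightarrow> ('a set \<times> bool) list" where
  "\<pi>_word w \<equiv> map (\<lambda>l. (\<pi> (fst l), snd l)) w"

lemma p_src_tgt:
  assumes "fst l \<in> edges H"
  shows "G.src (\<pi> (fst l), snd l) = p (H.src l)" "G.tgt (\<pi> (fst l), snd l) = p (H.tgt l)"
  using assms p_ch[of "fst l" 0] p_ch[of "fst l" 1]
  by (auto simp: G.src_def H.src_def G.tgt_def H.tgt_def)

lemma walk_\<pi>_word: "H.walk u w v \<Longrightarrow> G.walk (p u) (\<pi>_word w) (p v)"
  by (induction w arbitrary: u) (auto simp: p_verts \<pi>_edges p_src_tgt)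

lemma p_word_path:
  assumes "H.walk u w v"
  shows "path_homotopic (gtop G) (p \<circ> H.word_path u w) (G.word_path (p u) (\<pi>_word w))"
  using assms
proof (induction w arbitrary: u)
  case Nil
  then show ?case by (auto simp: comp_path_const path_homotopic_refl G.vert_in p_verts)
next
  case (Cons l w)
  then have l: "fst l \<in> edges H" "H.src l = u" "H.walk (H.tgt l) w v" by simp_all
  have "path_homotopic (gtop G) (p \<circ> H.letter_path l) (G.letter_path (\<pi> (fst l), snd l))"
  proof (rule path_homotopic_eq)
    show "pathin (gtop G) (p \<circ> H.letter_path l)"
      by (rule pathin_compose[OF H.letter_path_props(1)[OF l(1)] p_continuous])
    fix t :: real assume "t \<in> {0..1}"
    then show "(p \<circ> H.letter_path l) t = G.letter_path (\<pi> (fst l), snd l) t"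
      using p_ch[OF l(1), of t] p_ch[OF l(1), of "1 - t"]
      by (simp add: H.letter_path_def G.letter_path_def path_reverse_def)
  qed
  moreover have "path_homotopic (gtop G) (p \<circ> H.word_path (H.tgt l) w) (G.word_path (p (H.tgt l)) (\<pi>_word w))"
    by (rule Cons.IH[OF l(3)])
  ultimately show ?case
    using H.letter_path_props[OF l(1)] H.word_path_props[OF l(3)] p_src_tgt[OF l(1)]
    by (simp add: comp_path_join path_homotopic_join)
qed

text \<open>A nonempty image word with trivial holonomies is not reduced. By local injectivity its
  cancelling pair comes from a cancelling pair of \<open>w\<close>, whose removal shortens
  \<open>w\<close> and changes neither the path class nor the holonomies.\<close>

lemma word_trivial:
  assumes "H.walk u w v"
    and "\<And>n L. (\<And>e. L e \<in> small_perms n) \<Longrightarrow> word_hol L (\<pi>_word w) = (0 :: nat_perm)"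
  shows "u = v \<and> path_homotopic (gtop H) (H.word_path u w) (\<lambda>_. u)"
  using assms
proof (induction "length w" arbitrary: w rule: less_induct)
  case less
  show ?case
  proof (cases "w = []")
    case True
    then show ?thesis using less.prems(1) by (auto simp: path_homotopic_refl H.vert_in)
  next
    case False
    have "\<not> reduced_word (\<pi>_word w)"
    proof
      assume "reduced_word (\<pi>_word w)"
      from reduced_word_detected[OF this] False less.prems(2) show False by fastforce
    qed
    then obtain i where i: "Suc i < length w" "\<pi>_word w ! Suc i = flip_letter (\<pi>_word w ! i)"
      by auto
    define w1 l l' w2 where "w1 = take i w" and "l = w ! i" and "l' = w ! Suc i" and "w2 = drop (Suc (Suc i)) w"
    have w: "w = w1 @ l # l' # w2"
      using i(1) by (simp add: w1_def l_def l'_def w2_def Cons_nth_drop_Suc)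
    obtain z where z: "H.walk u w1 z" "H.walk z (l # l' # w2) v"
      using H.walk_appendD[OF less.prems(1)[unfolded w]] by blast
    then have l: "fst l \<in> edges H" "fst l' \<in> edges H" "H.src l = z" "H.src l' = H.tgt l" "H.walk (H.tgt l') w2 v"
      by simp_all
    have "(\<pi> (fst l'), snd l') = flip_letter (\<pi> (fst l), snd l)"
      using i by (simp add: l_def l'_def)
    then have ll: "\<pi> (fst l) = \<pi> (fst l')" "snd l = (\<not> snd l')"
      by (auto simp: flip_letter_def prod_eq_iff)
    have "fst l = fst l'" by (rule p_local_inj[OF l(1,2) l(4)[symmetric] ll])
    then have l': "l' = flip_letter l" using ll(2) by (simp add: flip_letter_def prod_eq_iff)
    then have w2: "H.walk z w2 v" using l by simp
    have w12: "H.walk u (w1 @ w2) v" by (rule H.walk_append[OF z(1) w2])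
    have hol: "word_hol L (\<pi>_word (w1 @ w2)) = 0" if "\<And>e. L e \<in> small_perms n" for n L
    proof -
      have "word_hol L (\<pi>_word w) = word_hol L (\<pi>_word w1) + (word_hol L (\<pi>_word [l, l']) + word_hol L (\<pi>_word w2))"
        by (simp add: w add.assoc)
      also have "word_hol L (\<pi>_word [l, l']) = 0" by (simp add: l')
      finally have "word_hol L (\<pi>_word w) = word_hol L (\<pi>_word (w1 @ w2))" by simp
      moreover have "word_hol L (\<pi>_word w) = 0" by (rule less.prems(2)) (rule that)
      ultimately show ?thesis by simp
    qed
    have "length (w1 @ w2) < length w" by (simp add: w)
    then have IH: "u = v \<and> path_homotopic (gtop H) (H.word_path u (w1 @ w2)) (\<lambda>_. u)"
      using w12
    proof (rule less.hyps)
      fix n and L :: "'a set \<Rightarrow> nat_perm" assume "\<And>e. L e \<in> small_perms n"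
      then show "word_hol L (\<pi>_word (w1 @ w2)) = 0" by (rule hol)
    qed
    have "path_homotopic (gtop H) (H.word_path u w) (path_join (H.word_path u w1) (H.word_path z (l # l' # w2)))"
      unfolding w by (rule path_homotopic_sym[OF H.word_path_append[OF z]])
    also have "path_homotopic (gtop H) \<dots> (path_join (H.word_path u w1) (H.word_path z w2))"
      using H.word_path_cancel_pair[of l w2 v] l w2 H.word_path_props[OF z(1)] H.word_path_props[OF z(2)]
      by (intro path_homotopic_join path_homotopic_refl) (simp_all add: l')
    also have "path_homotopic (gtop H) \<dots> (H.word_path u (w1 @ w2))"
      by (rule H.word_path_append[OF z(1) w2])
    finally show ?thesis using IH path_homotopic_trans by blast
  qed
qed

text \<open>The loop is conjugate, by its anchor, to the path of an edge word, and trivial holonomy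
  survives conjugation.\<close>

theorem null_homotopic_if_hol_trivial:
  assumes c: "pathin (gtop H) c" "c 0 = c 1"
    and hol: "\<And>n L. (\<And>e. L e \<in> small_perms n) \<Longrightarrow> G.hol L (p \<circ> c) = (0 :: nat_perm)"
  shows "path_homotopic (gtop H) c (\<lambda>_. c 0)"
proof -
  have c0: "c 0 \<in> topspace (gtop H)" using path_start_in_topspace[OF c(1)] .
  let ?b = "H.base_path (c 0)"
  note b = H.base_path_props[OF c0]
  from H.word_of_path[OF c(1)] c(2) obtain w where w: "H.walk (?b 0) w (?b 0)"
    "path_homotopic (gtop H) (path_join ?b c) (path_join (H.word_path (?b 0) w) ?b)" by auto
  note wp = H.word_path_props[OF w(1)]
  have triv: "word_hol L (\<pi>_word w) = (0 :: nat_perm)" if L: "\<And>e. L e \<in> small_perms n" for n L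
  proof -
    have "G.hol L (path_join (p \<circ> ?b) (p \<circ> c)) = G.hol L (path_join (p \<circ> H.word_path (?b 0) w) (p \<circ> ?b))"
      using holonomy_homotopic[OF G.cocycle_jump path_homotopic_image[OF w(2) p_continuous]]
      by (simp add: comp_path_join)
    moreover have "G.hol L (path_join (p \<circ> ?b) (p \<circ> c)) = G.hol L (p \<circ> ?b) + G.hol L (p \<circ> c)"
      using b c by (intro holonomy_join[OF G.cocycle_jump] pathin_compose[OF _ p_continuous]) simp_all
    moreover have "G.hol L (path_join (p \<circ> H.word_path (?b 0) w) (p \<circ> ?b)) = G.hol L (p \<circ> H.word_path (?b 0) w) + G.hol L (p \<circ> ?b)"
      using b wp by (intro holonomy_join[OF G.cocycle_jump] pathin_compose[OF _ p_continuous]) simp_all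
    moreover have "G.hol L (p \<circ> H.word_path (?b 0) w) = word_hol L (\<pi>_word w)"
      by (rule trans[OF holonomy_homotopic[OF G.cocycle_jump p_word_path[OF w(1)]] G.hol_word_path[OF walk_\<pi>_word[OF w(1)]]])
    moreover have "G.hol L (p \<circ> c) = 0" by (rule hol) (rule L)
    ultimately have "word_hol L (\<pi>_word w) + G.hol L (p \<circ> ?b) = 0 + G.hol L (p \<circ> ?b)" by simp
    then show ?thesis by (simp only: add_right_cancel)
  qed
  have "?b 0 = ?b 0 \<and> path_homotopic (gtop H) (H.word_path (?b 0) w) (\<lambda>_. ?b 0)"
  proof (rule word_trivial[OF w(1)])
    fix n and L :: "'a set \<Rightarrow> nat_perm" assume "\<And>e. L e \<in> small_perms n"
    then show "word_hol L (\<pi>_word w) = 0" by (rule triv)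
  qed
  then have null: "path_homotopic (gtop H) (H.word_path (?b 0) w) (\<lambda>_. ?b 0)" by blast
  have "path_homotopic (gtop H) (path_join ?b c) (path_join (H.word_path (?b 0) w) ?b)" by (rule w(2))
  also have "path_homotopic (gtop H) \<dots> (path_join (\<lambda>_. ?b 0) ?b)"
    using wp b by (intro path_homotopic_join null path_homotopic_refl) simp_all
  also have "path_homotopic (gtop H) \<dots> ?b" using b by (intro path_homotopic_const_left) simp_all
  also have "path_homotopic (gtop H) ?b (path_join ?b (\<lambda>_. c 0))"
    using b by (intro path_homotopic_sym[OF path_homotopic_const_right]) simp_all
  finally show ?thesis
    by (rule path_homotopic_join_cancel_left) (use b c c0 in simp_all)
qed

corollary p_injective:
  assumes c: "pathin (gtop H) c" "c 0 = c 1" and null: "path_homotopic (gtop G) (p \<circ> c) (\<lambda>_. z)"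
  shows "path_homotopic (gtop H) c (\<lambda>_. c 0)"
proof (rule null_homotopic_if_hol_trivial[OF c])
  fix n and L :: "'a set \<Rightarrow> nat_perm"
  have "z \<in> topspace (gtop G)" using path_homotopicD(2)[OF null] by simp
  then show "G.hol L (p \<circ> c) = 0"
    using holonomy_homotopic[OF G.cocycle_jump null, of L] holonomy_const[OF G.cocycle_jump[of L], of z] by simp
qed

end

section \<open>Counting holonomy representations\<close>

context fgraph
begin

text \<open>The identity is an immersion, so the detection applies to loops of the graph
  itself.\<close>

lemma null_homotopic_if_hol_trivial:
  assumes "pathin X c" "c 0 = c 1"
    and "\<And>n L. (\<And>e. L e \<in> small_perms n) \<Longrightarrow> hol L c = (0 :: nat_perm)"
  shows "path_homotopic X c (\<lambda>_. c 0)"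
proof -
  interpret graph_immersion G G id id
  proof
    fix l l' :: "'a set \<times> bool"
    assume "id (fst l) = id (fst l')" then show "fst l = fst l'" by simp
  qed simp_all
  show ?thesis
  proof (rule null_homotopic_if_hol_trivial[OF assms(1,2)])
    fix n and L :: "'a set \<Rightarrow> nat_perm" assume "\<And>e. L e \<in> small_perms n"
    then have "hol L c = 0" by (rule assms(3))
    then show "hol L (id \<circ> c) = 0" by simp
  qed
qed

lemma word_of_vert_path:
  assumes c: "pathin X c" "c 0 \<in> V" "c 1 \<in> V"
  shows "\<exists>w. walk (c 0) w (c 1) \<and> path_homotopic X c (word_path (c 0) w)"
proof -
  from word_of_path[OF c(1)] obtain w where w: "walk (c 0) w (c 1)"
    "path_homotopic X (path_join (\<lambda>_. c 0) c) (path_join (word_path (c 0) w) (\<lambda>_. c 1))"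
    by (auto simp: base_path_vert c(2,3))
  have "path_homotopic X c (path_join (\<lambda>_. c 0) c)"
    by (rule path_homotopic_sym[OF path_homotopic_const_left[OF c(1)]]) simp
  also note w(2)
  also have "path_homotopic X (path_join (word_path (c 0) w) (\<lambda>_. c 1)) (word_path (c 0) w)"
    using word_path_props[OF w(1)] by (intro path_homotopic_const_right) simp_all
  finally show ?thesis using w(1) by blast
qed

lemma hol_in_subgroup:
  assumes c: "pathin X c" "c 0 \<in> V" "c 1 \<in> V"
    and S: "0 \<in> S" "\<And>a b. a \<in> S \<Longrightarrow> b \<in> S \<Longrightarrow> a + b \<in> S" "\<And>a. a \<in> S \<Longrightarrow> - a \<in> S"
    and L: "\<And>e. e \<in> E \<Longrightarrow> L e \<in> S"
  shows "hol L c \<in> S"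
proof -
  obtain w where w: "walk (c 0) w (c 1)" "path_homotopic X c (word_path (c 0) w)"
    using word_of_vert_path[OF c] by blast
  have "word_hol L w \<in> S" if "walk u w v" for u v
    using that by (induction w arbitrary: u) (auto intro: S L)
  then show ?thesis
    using w(1) unfolding holonomy_homotopic[OF cocycle_jump w(2)] hol_word_path[OF w(1)] by blast
qed

text \<open>A change of gauge at the vertices: along a walk the values of \<open>h\<close> cancel
  except at the two ends. With \<open>h = 0\<close> this says that only the labels on
  \<open>E\<close> matter.\<close>

lemma hol_cong:
  assumes c: "pathin X c" "c 0 \<in> V" "c 1 \<in> V" and L: "\<And>e. e \<in> E \<Longrightarrow> L e = - h (ch e 0) + L' e + h (ch e 1)"
  shows "hol L c = - h (c 0) + hol L' c + h (c 1)"
proof -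
  obtain w where w: "walk (c 0) w (c 1)" "path_homotopic X c (word_path (c 0) w)"
    using word_of_vert_path[OF c] by blast
  have "word_hol L w = - h u + word_hol L' w + h v" if "walk u w v" for u v
    using that
  proof (induction w arbitrary: u)
    case (Cons l w)
    then have l: "fst l \<in> E" "src l = u" "word_hol L w = - h (tgt l) + word_hol L' w + h v" by simp_all
    show ?case
      using l(2) L[OF l(1)] by (cases "snd l") (simp_all add: l(3) src_def tgt_def add.assoc minus_add minus_diff_eq diff_conv_add_uminus del: add_uminus_conv_diff)
  qed simp
  then show ?thesis
    using w(1) unfolding holonomy_homotopic[OF cocycle_jump w(2)] hol_word_path[OF w(1)] by blast
qed

text \<open>A labelling amounts to a representation together with holonomies along fixed paths from
  \<open>y\<close> to the other vertices: with these paths every edge closes up to a loop, and a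
  change of gauge prescribes their holonomies freely. Loops are indexed by \<open>A\<close> so that
  representations of different graphs become functions on one set.\<close>

theorem card_holonomies:
  fixes S :: "'h::group_add set" and \<iota> :: "'i \<Rightarrow> real \<Rightarrow> 'a"
  assumes y: "y \<in> V" and conn: "\<And>v. v \<in> V \<Longrightarrow> \<exists>c. path_from_to X y v c"
    and \<iota>: "\<And>a. a \<in> A \<Longrightarrow> path_from_to X y y (\<iota> a)"
    and all: "\<And>c. path_from_to X y y c \<Longrightarrow> \<exists>a\<in>A. path_homotopic X (\<iota> a) c"
    and fin: "finite S"
    and S: "0 \<in> S" "\<And>a b. a \<in> S \<Longrightarrow> b \<in> S \<Longrightarrow> a + b \<in> S" "\<And>a. a \<in> S \<Longrightarrow> - a \<in> S"
  defines "R \<equiv> (\<lambda>L. restrict (\<lambda>a. hol L (\<iota> a)) A)"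
  shows "card (R ` (E \<rightarrow>\<^sub>E S)) * card S ^ (card V - 1) = card S ^ card E"
proof -
  obtain \<gamma>' where \<gamma>': "\<And>v. v \<in> V \<Longrightarrow> path_from_to X y v (\<gamma>' v)" using conn by metis
  \<comment> \<open>Constant at \<open>y\<close>, so that \<open>y\<close> contributes no parameter
    of its own.\<close>
  define \<gamma> where "\<gamma> v = (if v = y then (\<lambda>_. y) else \<gamma>' v)" for v
  have \<gamma>: "pathin X (\<gamma> v)" "\<gamma> v 0 = y" "\<gamma> v 1 = v" if "v \<in> V" for v
    using \<gamma>'[OF that] vert_in[OF y] by (simp_all add: \<gamma>_def path_from_to_def)
  have \<gamma>y: "hol L (\<gamma> y) = 0" for L :: "'a set \<Rightarrow> 'h"
    using holonomy_const[OF cocycle_jump vert_in[OF y]] by (simp add: \<gamma>_def)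
  have \<iota>': "pathin X (\<iota> a)" "\<iota> a 0 = y" "\<iota> a 1 = y" if "a \<in> A" for a
    using \<iota>[OF that] by (simp_all add: path_from_to_def)
  define K where "K = V - {y}"
  define \<Psi> where "\<Psi> L = (R L, restrict (\<lambda>v. hol L (\<gamma> v)) K)" for L
  have KV: "v \<in> V" if "v \<in> K" for v using that by (simp add: K_def)
  have inj: "inj_on \<Psi> (E \<rightarrow>\<^sub>E S)"
  proof (rule inj_onI)
    fix L L' assume L: "L \<in> E \<rightarrow>\<^sub>E S" "L' \<in> E \<rightarrow>\<^sub>E S" and eq: "\<Psi> L = \<Psi> L'"
    have R: "hol L (\<iota> a) = hol L' (\<iota> a)" if "a \<in> A" for a
      using fun_cong[OF arg_cong[OF eq, of fst], of a] that by (simp add: \<Psi>_def R_def)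
    have g: "hol L (\<gamma> v) = hol L' (\<gamma> v)" if "v \<in> V" for v
      using fun_cong[OF arg_cong[OF eq, of snd], of v] that \<gamma>y[of L] \<gamma>y[of L']
      by (cases "v = y") (simp_all add: \<Psi>_def K_def)
    show "L = L'"
    proof (rule PiE_ext[OF L])
      fix e assume e: "e \<in> E"
      let ?u = "ch e 0" and ?v = "ch e 1"
      note u = \<gamma>[OF ch_0[OF e]] and v = \<gamma>[OF ch_1[OF e]]
      let ?c = "path_join (path_join (\<gamma> ?u) (ch e)) (path_reverse (\<gamma> ?v))"
      have "path_from_to X y y ?c"
        using u v pathin_ch[OF e] by (simp add: path_from_to_def pathin_join pathin_reverse)
      then obtain a where a: "a \<in> A" "path_homotopic X (\<iota> a) ?c" using all by blast
      have h: "hol M ?c = hol M (\<gamma> ?u) + M e + - hol M (\<gamma> ?v)" for M :: "'a set \<Rightarrow> 'h"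
        using u v pathin_ch[OF e] holonomy_join[OF cocycle_jump[of M], of "path_join (\<gamma> ?u) (ch e)" "path_reverse (\<gamma> ?v)"]
          holonomy_join[OF cocycle_jump[of M], of "\<gamma> ?u" "ch e"] holonomy_reverse[OF cocycle_jump[of M], of "\<gamma> ?v"]
        by (simp only: hol_ch[OF e] pathin_join pathin_reverse path_join_simps path_reverse_simps)
      have "hol L ?c = hol L' ?c"
        using R[OF a(1)] unfolding holonomy_homotopic[OF cocycle_jump a(2)] .
      then have "hol L' (\<gamma> ?u) + L e + - hol L' (\<gamma> ?v) = hol L' (\<gamma> ?u) + L' e + - hol L' (\<gamma> ?v)"
        unfolding h by (simp only: g[OF ch_0[OF e]] g[OF ch_1[OF e]])
      then show "L e = L' e" by (simp only: add_right_cancel add_left_cancel)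
    qed
  qed
  have "\<Psi> ` (E \<rightarrow>\<^sub>E S) = R ` (E \<rightarrow>\<^sub>E S) \<times> (K \<rightarrow>\<^sub>E S)"
  proof (intro equalityI subsetI)
    fix z assume "z \<in> \<Psi> ` (E \<rightarrow>\<^sub>E S)"
    then obtain L where L: "L \<in> E \<rightarrow>\<^sub>E S" "z = \<Psi> L" by blast
    have "hol L (\<gamma> v) \<in> S" if "v \<in> K" for v
      using \<gamma>[OF KV[OF that]] KV[OF that] y L(1) by (intro hol_in_subgroup S) auto
    then show "z \<in> R ` (E \<rightarrow>\<^sub>E S) \<times> (K \<rightarrow>\<^sub>E S)" using L by (simp add: \<Psi>_def)
  next
    fix z assume "z \<in> R ` (E \<rightarrow>\<^sub>E S) \<times> (K \<rightarrow>\<^sub>E S)"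
    then obtain L k where L: "L \<in> E \<rightarrow>\<^sub>E S" and k: "k \<in> K \<rightarrow>\<^sub>E S" and z: "z = (R L, k)" by blast
    \<comment> \<open>The gauge that turns the holonomy of \<open>\<gamma> v\<close> into
      \<open>k v\<close>. It vanishes at \<open>y\<close>, so loops at \<open>y\<close> keep their
      holonomy.\<close>
    define h where "h v = (if v = y then 0 else - hol L (\<gamma> v) + k v)" for v
    define L' where "L' = restrict (\<lambda>e. - h (ch e 0) + L e + h (ch e 1)) E"
    have hS: "h v \<in> S" if "v \<in> V" for v
    proof (cases "v = y")
      case False
      then have "hol L (\<gamma> v) \<in> S"
        using \<gamma>[OF that] that y L by (intro hol_in_subgroup S) auto
      moreover have "k v \<in> S" using k that False by (auto simp: K_def)
      ultimately show ?thesis using S by (simp add: h_def)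
    qed (simp add: h_def S)
    have L'S: "L' \<in> E \<rightarrow>\<^sub>E S"
    proof
      fix e assume e: "e \<in> E"
      have "L e \<in> S" using L e by blast
      then show "L' e \<in> S"
        using hS[OF ch_0[OF e]] hS[OF ch_1[OF e]] e S(2,3) by (simp add: L'_def del: add_uminus_conv_diff)
    qed (simp add: L'_def)
    have hol: "hol L' c = - h (c 0) + hol L c + h (c 1)" if "pathin X c" "c 0 \<in> V" "c 1 \<in> V" for c
      by (rule hol_cong[OF that]) (simp add: L'_def)
    have "R L' = R L"
      using hol[OF \<iota>'(1)] \<iota>'(2,3) y by (auto simp: R_def h_def intro!: restrict_ext)
    moreover have "restrict (\<lambda>v. hol L' (\<gamma> v)) K = k"
    proof (rule extensionalityI)
      fix v assume v: "v \<in> K"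
      have "v \<noteq> y" using v by (simp add: K_def)
      moreover have "hol L' (\<gamma> v) = - h y + hol L (\<gamma> v) + h v"
        using hol[OF \<gamma>(1)[OF KV[OF v]]] \<gamma>(2,3)[OF KV[OF v]] KV[OF v] y by simp
      ultimately show "restrict (\<lambda>v. hol L' (\<gamma> v)) K v = k v"
        using v by (simp add: h_def add.assoc[symmetric])
    qed (use k in \<open>simp_all add: PiE_def\<close>)
    ultimately have "\<Psi> L' = z" by (simp add: \<Psi>_def z)
    then show "z \<in> \<Psi> ` (E \<rightarrow>\<^sub>E S)" using L'S by blast
  qed
  then have "card (R ` (E \<rightarrow>\<^sub>E S)) * card (K \<rightarrow>\<^sub>E S) = card (E \<rightarrow>\<^sub>E S)"
    using card_image[OF inj] by (simp add: card_cartesian_product)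
  moreover have "card K = card V - 1" "finite K"
    using finite_verts y by (simp_all add: K_def)
  ultimately show ?thesis
    using finite_edges by (simp add: card_PiE)
qed

end

text \<open>Labels pull back: each edge of \<open>H\<close> receives the holonomy of its image, and
  then both sides agree letter by letter.\<close>

lemma hol_compose:
  assumes "fgraph H" "fgraph G" and q: "continuous_map (gtop H) (gtop G) q"
    and c: "pathin (gtop H) c" "c 0 \<in> verts H" "c 1 \<in> verts H"
  shows "fgraph.hol G L (q \<circ> c) = fgraph.hol H (\<lambda>e. fgraph.hol G L (q \<circ> charmap H e)) c"
proof -
  interpret H: fgraph H by fact
  interpret G: fgraph G by fact
  let ?L = "\<lambda>e. G.hol L (q \<circ> charmap H e)"
  obtain w where w: "H.walk (c 0) w (c 1)" "path_homotopic (gtop H) c (H.word_path (c 0) w)"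
    using H.word_of_vert_path[OF c] by blast
  have *: "G.hol L (q \<circ> H.word_path u w) = word_hol ?L w" if "H.walk u w v" for u v
    using that
  proof (induction w arbitrary: u)
    case Nil
    then have "q v \<in> topspace (gtop G)"
      using funcset_mem[OF continuous_map_funspace[OF q] H.vert_in] by auto
    then show ?case using Nil holonomy_const[OF G.cocycle_jump] by (simp add: comp_path_const)
  next
    case (Cons l w)
    then have l: "fst l \<in> edges H" "H.src l = u" "H.walk (H.tgt l) w v" by simp_all
    note lp = H.letter_path_props[OF l(1)] and wp = H.word_path_props[OF l(3)]
    have "G.hol L (q \<circ> H.letter_path l) = (if snd l then ?L (fst l) else - ?L (fst l))"
      using holonomy_reverse[OF G.cocycle_jump pathin_compose[OF H.pathin_ch[OF l(1)] q], of L]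
      by (simp add: H.letter_path_def comp_path_reverse)
    moreover have "G.hol L (q \<circ> H.word_path u (l # w)) = G.hol L (q \<circ> H.letter_path l) + G.hol L (q \<circ> H.word_path (H.tgt l) w)"
      unfolding H.word_path.simps comp_path_join using lp wp
      by (intro holonomy_join[OF G.cocycle_jump] pathin_compose[OF _ q]) simp_all
    moreover have "G.hol L (q \<circ> H.word_path (H.tgt l) w) = word_hol ?L w" by (rule Cons.IH[OF l(3)])
    ultimately show ?case by (simp only: word_hol_simps)
  qed
  show ?thesis
    unfolding holonomy_homotopic[OF H.cocycle_jump w(2)] H.hol_word_path[OF w(1)]
      holonomy_homotopic[OF G.cocycle_jump path_homotopic_image[OF w(2) q]] by (rule *[OF w(1)])
qed

section \<open>Subdivisions of paths\<close>

context fgraph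
begin

text \<open>The condition of \<open>edge_subdivision\<close> on an arbitrary path, so that it can be
  carried along maps between graphs.\<close>

definition path_subdivision :: "(real \<Rightarrow> 'a) \<Rightarrow> real list \<Rightarrow> bool" where
  "path_subdivision c ts \<longleftrightarrow>
     ts \<noteq> [] \<and> sorted_wrt (<) ts \<and> hd ts = 0 \<and> last ts = 1 \<and>
     (\<forall>i. Suc i < length ts \<longrightarrow>
        (\<exists>d\<in>E. homeomorphic_map (top_of_set {ts ! i<..<ts ! Suc i}) (subtopology X d) c))"

lemma path_subdivisionD:
  assumes "path_subdivision c ts" "Suc i < length ts"
  shows "\<exists>d\<in>E. homeomorphic_map (top_of_set {ts ! i<..<ts ! Suc i}) (subtopology X d) c"
  using assms unfolding path_subdivision_def by simp

definition vert_times :: "(real \<Rightarrow> 'a) \<Rightarrow> real set" where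
  "vert_times c = {t \<in> {0..1}. c t \<in> V}"

text \<open>Edges are open, so away from vertices the edge containing \<open>c t\<close> is locally
  constant in \<open>t\<close>.\<close>

lemma connected_in_edge:
  assumes c: "pathin X c" and J: "connected J" "J \<subseteq> {0..1}" "J \<noteq> {}" and no: "J \<inter> vert_times c = {}"
  shows "\<exists>d\<in>E. c ` J \<subseteq> d"
proof -
  have cX: "c t \<in> \<Union>E" if "t \<in> J" for t
  proof -
    have "t \<in> {0..1}" using that J by blast
    then have "c t \<in> topspace X" "c t \<notin> V"
      using funcset_mem[OF path_image_subset_topspace[OF c]] no that by (auto simp: vert_times_def)
    then show ?thesis using topspace_eq by blast
  qed
  obtain t0 where t0: "t0 \<in> J" using J(3) by blast
  obtain d where d: "d \<in> E" "c t0 \<in> d" using cX[OF t0] by blast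
  have same: "cell_of (c t0) = cell_of (c t)" if "t \<in> J" for t
  proof (rule connected_local_const[OF J(1) t0 that])
    show "\<forall>a\<in>J. \<forall>\<^sub>F b in at a within J. cell_of (c a) = cell_of (c b)"
    proof
      fix a assume a: "a \<in> J"
      obtain e where e: "e \<in> E" "c a \<in> e" using cX[OF a] by blast
      have "openin (top_of_set {0..1}) {s \<in> {0..1}. c s \<in> e}"
        using openin_continuous_map_preimage[OF c[unfolded pathin_def] openin_edge[OF e(1)]] by simp
      then obtain N where N: "open N" "{s \<in> {0..1}. c s \<in> e} = {0..1} \<inter> N" by (auto simp: openin_open)
      have N': "s \<in> N \<longleftrightarrow> c s \<in> e" if "s \<in> J" for s using N(2) that J(2) by blast
      show "\<forall>\<^sub>F b in at a within J. cell_of (c a) = cell_of (c b)"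
        unfolding eventually_at_topological
      proof (intro exI[of _ N] conjI ballI impI)
        show "open N" "a \<in> N" using N(1) N'[OF a] e by simp_all
        fix s assume "s \<in> N" "s \<noteq> a" "s \<in> J"
        then have "c s \<in> e" using N' by simp
        then show "cell_of (c a) = cell_of (c s)" using cell_of_eq[OF e(1)] e(2) by simp
      qed
    qed
  qed
  have "c t \<in> d" if t: "t \<in> J" for t
  proof -
    obtain e where e: "e \<in> E" "c t \<in> e" using cX[OF t] by blast
    have "e = d" using same[OF t] cell_of_eq[OF e] cell_of_eq[OF d] by simp
    then show ?thesis using e(2) by simp
  qed
  then show ?thesis using d(1) by blast
qed

lemma continuous_coord_path:
  assumes c: "pathin X c" and J: "J \<subseteq> {0..1}" and d: "d \<in> E" "c ` J \<subseteq> d"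
  shows "continuous_on J (coord \<circ> c)"
proof -
  have "continuous_map (top_of_set J) X c"
    using continuous_map_from_subtopology_mono[OF c[unfolded pathin_def] J] .
  then have "continuous_map (top_of_set J) (subtopology X d) c"
    using d(2) by (simp add: continuous_map_in_subtopology image_subset_iff_funcset)
  from continuous_map_compose[OF this continuous_map_coord[OF d(1)]] show ?thesis by simp
qed

lemma inj_on_coord_path:
  assumes d: "d \<in> E" "c ` J \<subseteq> d"
  shows "inj_on (coord \<circ> c) J \<longleftrightarrow> inj_on c J"
proof
  assume "inj_on c J"
  moreover have "inj_on coord (c ` J)"
    by (rule inj_onI) (metis coord_props(3)[OF d(1)] d(2) subsetD)
  ultimately show "inj_on (coord \<circ> c) J" by (rule comp_inj_on)
qed (rule inj_on_imageI2)

text \<open>In the coordinate of the edge, a continuous injection of an interval is a homeomorphism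
  onto its image by invariance of domain, so only bijectivity has to be checked.\<close>

lemma homeomorphic_map_onto_edge_iff:
  assumes c: "pathin X c" and ab: "0 \<le> a" "a < b" "b \<le> 1" and d: "d \<in> E"
  shows "homeomorphic_map (top_of_set {a<..<b}) (subtopology X d) c \<longleftrightarrow>
    c ` {a<..<b} = d \<and> inj_on c {a<..<b}"
proof
  assume h: "homeomorphic_map (top_of_set {a<..<b}) (subtopology X d) c"
  show "c ` {a<..<b} = d \<and> inj_on c {a<..<b}"
    using homeomorphic_imp_surjective_map[OF h] homeomorphic_imp_injective_map[OF h] edge_subset[OF d]
    by (simp add: Int_absorb1)
next
  assume h: "c ` {a<..<b} = d \<and> inj_on c {a<..<b}"
  let ?J = "{a<..<b}" and ?u = "coord \<circ> c"
  have J: "?J \<subseteq> {0..1}" using ab by auto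
  have sub: "c ` ?J \<subseteq> d" using h by simp
  have cu: "continuous_on ?J ?u" by (rule continuous_coord_path[OF c J d sub])
  have iu: "inj_on ?u ?J" using inj_on_coord_path[OF d sub] h by simp
  obtain g where g: "homeomorphism ?J (?u ` ?J) ?u g"
    by (rule invariance_of_domain_homeomorphism[OF _ cu _ iu]) auto
  have im: "?u ` ?J = {0<..<1}"
  proof -
    have "?u ` ?J = coord ` (c ` ?J)" by (simp only: image_comp)
    also have "\<dots> = coord ` d" using h by simp
    also have "\<dots> = {0<..<1}"
    proof (intro equalityI subsetI)
      fix s assume "s \<in> coord ` d" then show "s \<in> {0<..<1}" using coord_props(1,2)[OF d] by auto
    next
      fix s :: real assume s: "s \<in> {0<..<1}"
      then have "coord (ch d s) = s" "ch d s \<in> d" using coord_ch[OF d] ch_mem[OF d] by simp_all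
      then show "s \<in> coord ` d" by (metis imageI)
    qed
    finally show ?thesis .
  qed
  have "homeomorphic_map (top_of_set ?J) (top_of_set {0<..<1}) ?u"
    unfolding homeomorphic_map_maps homeomorphic_maps_def
  proof (intro exI[of _ g] conjI)
    have "?u \<in> ?J \<rightarrow> {0<..<1}" using im by blast
    then show "continuous_map (top_of_set ?J) (top_of_set {0<..<1}) ?u" using cu by simp
    have "g \<in> {0<..<1} \<rightarrow> ?J" "continuous_on {0<..<1} g"
      using homeomorphism_image2[OF g] homeomorphism_cont2[OF g] unfolding im by blast+
    then show "continuous_map (top_of_set {0<..<1}) (top_of_set ?J) g" by simp
    show "\<forall>x\<in>topspace (top_of_set ?J). g (?u x) = x" using homeomorphism_apply1[OF g] by simp
    show "\<forall>y\<in>topspace (top_of_set {0<..<1}). ?u (g y) = y" using homeomorphism_apply2[OF g] unfolding im by simp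
  qed
  from homeomorphic_map_compose[OF this ch_homeo[OF d]]
  have "homeomorphic_map (top_of_set ?J) (subtopology X d) (ch d \<circ> ?u)" .
  then show "homeomorphic_map (top_of_set ?J) (subtopology X d) c"
  proof (rule homeomorphic_map_eq)
    fix t assume "t \<in> topspace (top_of_set ?J)"
    then have "c t \<in> d" using sub by auto
    then show "(ch d \<circ> ?u) t = c t" using coord_props(3)[OF d] by simp
  qed
qed

lemma path_subdivision_image:
  assumes c: "pathin X c" and ts: "path_subdivision c ts" and i: "Suc i < length ts"
  shows "0 \<le> ts ! i" "ts ! i < ts ! Suc i" "ts ! Suc i \<le> 1"
    "c ` {ts ! i<..<ts ! Suc i} \<in> E" "inj_on c {ts ! i<..<ts ! Suc i}"
proof -
  have srt: "sorted_wrt (<) ts" and ne: "ts \<noteq> []" and hl: "hd ts = 0" "last ts = 1"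
    using ts by (simp_all add: path_subdivision_def)
  have srt': "sorted ts" using srt strict_sorted_iff by blast
  show ab: "ts ! i < ts ! Suc i" using sorted_wrt_nth_less[OF srt, of i "Suc i"] i by simp
  show a: "0 \<le> ts ! i" using sorted_nth_mono[OF srt', of 0 i] i hl ne by (simp add: hd_conv_nth)
  show b: "ts ! Suc i \<le> 1"
    using sorted_nth_mono[OF srt', of "Suc i" "length ts - 1"] i hl ne by (simp add: last_conv_nth)
  obtain d where d: "d \<in> E" "homeomorphic_map (top_of_set {ts ! i<..<ts ! Suc i}) (subtopology X d) c"
    using bexE[OF path_subdivisionD[OF ts i]] .
  show "c ` {ts ! i<..<ts ! Suc i} \<in> E" "inj_on c {ts ! i<..<ts ! Suc i}"
    using d(2) d(1) unfolding homeomorphic_map_onto_edge_iff[OF c a ab b d(1)] by simp_all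
qed

lemma gap_exists:
  fixes ts :: "real list"
  assumes "ts \<noteq> []" "hd ts \<le> t" "t \<le> last ts" "t \<notin> set ts"
  shows "\<exists>i. Suc i < length ts \<and> ts ! i < t \<and> t < ts ! Suc i"
  using assms
proof (induction ts)
  case (Cons a ts)
  show ?case
  proof (cases "ts = []")
    case True then show ?thesis using Cons.prems by simp
  next
    case False
    show ?thesis
    proof (cases "t < hd ts")
      case True
      then show ?thesis using False Cons.prems by (intro exI[of _ 0]) (simp add: hd_conv_nth)
    next
      case f: False
      then obtain i where "Suc i < length ts" "ts ! i < t" "t < ts ! Suc i"
        using Cons.IH[OF False] Cons.prems False by auto
      then show ?thesis by (intro exI[of _ "Suc i"]) simp
    qed
  qed
qed simp

text \<open>Otherwise \<open>c t\<close> lies in \<open>d\<close> and equals \<open>c s0\<close> for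
  some \<open>s0\<close> inside the interval. Times near \<open>t\<close> then have images close to
  \<open>c s0\<close>, but those are already taken by times near \<open>s0\<close>.\<close>

lemma endpoint_is_vert:
  assumes c: "pathin X c" and ab: "0 \<le> a" "a < b" "b \<le> 1" and d: "d \<in> E"
    and h: "homeomorphic_map (top_of_set {a<..<b}) (subtopology X d) c" and t: "t = a \<or> t = b"
  shows "c t \<in> V"
proof (rule ccontr)
  assume nv: "c t \<notin> V"
  note im = h[unfolded homeomorphic_map_onto_edge_iff[OF c ab d]]
  have t01: "t \<in> {0..1}" using t ab by auto
  have "c t \<in> topspace X" using funcset_mem[OF path_image_subset_topspace[OF c] t01] .
  then obtain e where e: "e \<in> E" "c t \<in> e" using nv topspace_eq by blast
  have near: "\<exists>s\<in>{a<..<b}. c s \<in> W \<and> \<bar>s - t\<bar> < \<epsilon>" if W: "openin X W" "c t \<in> W" and \<epsilon>: "\<epsilon> > 0" for W \<epsilon>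
  proof -
    obtain \<delta> where \<delta>: "\<delta> > 0" "\<forall>s\<in>{0..1}. \<bar>s - t\<bar> < \<delta> \<longrightarrow> c s \<in> W"
      using pathin_near[OF c W(1) t01 W(2)] by blast
    define s where "s = (if t = a then t + min (min \<delta> \<epsilon>) (b - a) / 2 else t - min (min \<delta> \<epsilon>) (b - a) / 2)"
    define m where "m = min (min \<delta> \<epsilon>) (b - a) / 2"
    have m: "0 < m" "m < \<delta>" "m < \<epsilon>" "m < b - a" using \<delta>(1) \<epsilon> ab by (auto simp: m_def min_def)
    have s: "s = t + m \<and> t = a \<or> s = t - m \<and> t = b"
      using t by (auto simp: s_def m_def)
    then have "s \<in> {a<..<b}" "\<bar>s - t\<bar> < \<epsilon>" "\<bar>s - t\<bar> < \<delta>" using m by auto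
    moreover have "s \<in> {0..1}" using \<open>s \<in> {a<..<b}\<close> ab by simp
    ultimately show ?thesis using \<delta>(2) by (intro bexI[of _ s]) auto
  qed
  have "e = d"
  proof -
    obtain s where "s \<in> {a<..<b}" "c s \<in> e" using near[OF openin_edge[OF e(1)] e(2), of 1] by auto
    then have "c s \<in> d" using im by blast
    then show ?thesis using edge_unique[OF e(1) d \<open>c s \<in> e\<close>] by simp
  qed
  then obtain s0 where s0: "s0 \<in> {a<..<b}" "c t = c s0" using e(2) im by blast
  \<comment> \<open>Half the distance keeps the times near \<open>s0\<close> apart from those near
    \<open>t\<close>.\<close>
  define \<epsilon> where "\<epsilon> = \<bar>s0 - t\<bar> / 2"
  have \<epsilon>: "\<epsilon> > 0" using s0 t by (auto simp: \<epsilon>_def)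
  let ?N = "{a<..<b} \<inter> ball s0 \<epsilon>"
  have "openin (top_of_set {a<..<b}) ?N" by (auto simp: openin_open)
  then have "openin (subtopology X d) (c ` ?N)"
    using homeomorphic_imp_open_map[OF h] by (simp add: open_map_def)
  then have W: "openin X (c ` ?N)" using openin_trans_full openin_edge[OF d] by blast
  have "c t \<in> c ` ?N" using s0 \<epsilon> by auto
  from near[OF W this \<epsilon>] obtain s where s: "s \<in> {a<..<b}" "c s \<in> c ` ?N" "\<bar>s - t\<bar> < \<epsilon>" by blast
  then obtain s' where s': "s' \<in> {a<..<b}" "s' \<in> ball s0 \<epsilon>" "c s = c s'" by blast
  have "s = s'" using inj_onD[OF conjunct2[OF im] s'(3) s(1) s'(1)] .
  then have "\<bar>s0 - s\<bar> < \<epsilon>" using s'(2) by (simp add: dist_real_def)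
  then show False using s(3) abs_triangle_ineq[of "s0 - s" "s - t"] by (simp add: \<epsilon>_def)
qed

text \<open>This is the uniqueness on which the definite description in \<open>edge_path\<close>
  rests.\<close>

lemma path_subdivision_verts:
  assumes c: "pathin X c" and ts: "path_subdivision c ts"
  shows "set ts = vert_times c" "ts = sorted_list_of_set (vert_times c)"
proof -
  have ne: "ts \<noteq> []" and srt: "sorted_wrt (<) ts" and hl: "hd ts = 0" "last ts = 1"
    using ts by (simp_all add: path_subdivision_def)
  note im = path_subdivision_image[OF c ts]
  have len: "Suc 0 < length ts"
  proof (rule ccontr)
    assume "\<not> ?thesis"
    then obtain a where "ts = [a]" using ne by (cases ts) auto
    then show False using hl by simp
  qed
  have "t \<in> vert_times c" if t: "t \<in> set ts" for t
  proof -
    obtain j where j: "j < length ts" "t = ts ! j" using t unfolding in_set_conv_nth by blast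
    have "\<exists>i. Suc i < length ts \<and> (t = ts ! i \<or> t = ts ! Suc i)"
    proof (cases j)
      case 0
      then show ?thesis using len j(2) by (intro exI[of _ 0] conjI disjI1) simp_all
    next
      case (Suc i)
      then show ?thesis using j by (intro exI[of _ i] conjI disjI2) simp_all
    qed
    then obtain i where i: "Suc i < length ts" "t = ts ! i \<or> t = ts ! Suc i" by blast
    obtain d where d: "d \<in> E" "homeomorphic_map (top_of_set {ts ! i<..<ts ! Suc i}) (subtopology X d) c"
      using bexE[OF path_subdivisionD[OF ts i(1)]] .
    have "c t \<in> V" by (rule endpoint_is_vert[OF c im(1-3)[OF i(1)] d i(2)])
    moreover have "t \<in> {0..1}" using i(2) im(1-3)[OF i(1)] by auto
    ultimately show ?thesis by (simp add: vert_times_def)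
  qed
  moreover have "t \<in> set ts" if t: "t \<in> vert_times c" for t
  proof (rule ccontr)
    assume "t \<notin> set ts"
    with gap_exists[OF ne _ _ this] t hl obtain i where i: "Suc i < length ts" "t \<in> {ts ! i<..<ts ! Suc i}"
      by (auto simp: vert_times_def)
    then have "c t \<in> c ` {ts ! i<..<ts ! Suc i}" by blast
    then have "c t \<notin> V" using im(4)[OF i(1)] vert_not_in_edge by blast
    then show False using that by (simp add: vert_times_def)
  qed
  ultimately show s: "set ts = vert_times c" by blast
  have "sorted ts" "distinct ts" using srt strict_sorted_iff by blast+
  then show "ts = sorted_list_of_set (vert_times c)"
    unfolding s[symmetric] by (simp add: sorted_list_of_set.idem_if_sorted_distinct)
qed

text \<open>The graph map condition without a list and without reference to the edges of the target;
  in this form it passes to compositions. That each gap is mapped onto a whole edge will be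
  automatic.\<close>

definition regular_path :: "(real \<Rightarrow> 'a) \<Rightarrow> bool" where
  "regular_path c \<longleftrightarrow> pathin X c \<and> c 0 \<in> V \<and> c 1 \<in> V \<and> finite (vert_times c) \<and>
     (\<forall>J. connected J \<longrightarrow> J \<subseteq> {0..1} \<longrightarrow> J \<inter> vert_times c = {} \<longrightarrow> inj_on c J)"

lemma connected_in_gap:
  fixes ts :: "real list"
  assumes ts: "ts \<noteq> []" "hd ts = 0" "last ts = 1"
    and J: "connected J" "J \<subseteq> {0..1}" "J \<inter> set ts = {}" "J \<noteq> {}"
  shows "\<exists>i. Suc i < length ts \<and> J \<subseteq> {ts ! i<..<ts ! Suc i}"
proof -
  obtain t where t: "t \<in> J" using J(4) by blast
  then have "t \<in> {0..1}" "t \<notin> set ts" using J(2,3) by blast+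
  then obtain i where i: "Suc i < length ts" "ts ! i < t" "t < ts ! Suc i"
    using gap_exists[OF ts(1), of t] ts by auto
  have out: "ts ! i \<notin> J" "ts ! Suc i \<notin> J" using J(3) i(1) nth_mem[of i ts] nth_mem[of "Suc i" ts] by auto
  have "s \<in> {ts ! i<..<ts ! Suc i}" if s: "s \<in> J" for s
  proof (rule ccontr)
    assume "\<not> ?thesis"
    then have "s \<le> ts ! i \<or> ts ! Suc i \<le> s" by auto
    then show False
    proof
      assume "s \<le> ts ! i"
      then have "ts ! i \<in> J" using J(1)[THEN connectedD_interval, OF s t] i by simp
      then show False using out by simp
    next
      assume "ts ! Suc i \<le> s"
      then have "ts ! Suc i \<in> J" using J(1)[THEN connectedD_interval, OF t s] i by simp
      then show False using out by simp
    qed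
  qed
  then show ?thesis using i(1) by blast
qed

text \<open>For the converse, the image of a gap between consecutive vertex times is both open and
  closed in an edge, hence all of it; openness is invariance of domain.\<close>

lemma regular_path_iff:
  assumes c: "pathin X c"
  shows "(\<exists>ts. path_subdivision c ts) \<longleftrightarrow> regular_path c"
proof
  assume "\<exists>ts. path_subdivision c ts"
  then obtain ts where ts: "path_subdivision c ts" ..
  have hl: "ts \<noteq> []" "hd ts = 0" "last ts = 1" using ts by (simp_all add: path_subdivision_def)
  note s = path_subdivision_verts(1)[OF c ts]
  have "0 \<in> set ts" "1 \<in> set ts" using hl hd_in_set[OF hl(1)] last_in_set[OF hl(1)] by simp_all
  then have "c 0 \<in> V" "c 1 \<in> V" using s by (auto simp: vert_times_def)
  moreover have "finite (vert_times c)" unfolding s[symmetric] by simp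
  moreover have "inj_on c J" if J: "connected J" "J \<subseteq> {0..1}" "J \<inter> vert_times c = {}" for J
  proof (cases "J = {}")
    case False
    obtain i where i: "Suc i < length ts" "J \<subseteq> {ts ! i<..<ts ! Suc i}"
      using connected_in_gap[OF hl J(1,2) _ False] J(3) s by blast
    show ?thesis by (rule inj_on_subset[OF path_subdivision_image(5)[OF c ts i(1)] i(2)])
  qed simp
  ultimately show "regular_path c" using c unfolding regular_path_def by blast
next
  assume r: "regular_path c"
  have T: "finite (vert_times c)" "0 \<in> vert_times c" "1 \<in> vert_times c" "vert_times c \<subseteq> {0..1}"
    using r by (auto simp: regular_path_def vert_times_def)
  define ts where "ts = sorted_list_of_set (vert_times c)"
  have set: "set ts = vert_times c" and srt: "sorted_wrt (<) ts" and srt': "sorted ts"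
    using T(1) by (simp_all add: ts_def)
  have ne: "ts \<noteq> []" using set T(2) by auto
  have hd: "hd ts = 0"
  proof -
    have "ts ! 0 \<in> {0..1}" using nth_mem[of 0 ts] ne set T(4) by auto
    moreover obtain j where "j < length ts" "ts ! j = 0" using T(2) unfolding set[symmetric] in_set_conv_nth by blast
    ultimately show ?thesis using sorted_nth_mono[OF srt', of 0 j] ne by (simp add: hd_conv_nth)
  qed
  have last: "last ts = 1"
  proof -
    have "last ts \<in> {0..1}" using last_in_set[OF ne] set T(4) by auto
    moreover obtain j where "j < length ts" "ts ! j = 1" using T(3) unfolding set[symmetric] in_set_conv_nth by blast
    ultimately show ?thesis
      using sorted_nth_mono[OF srt', of j "length ts - 1"] ne by (simp add: last_conv_nth order_antisym)
  qed
  have "\<exists>d\<in>E. homeomorphic_map (top_of_set {ts ! i<..<ts ! Suc i}) (subtopology X d) c" if i: "Suc i < length ts" for i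
  proof -
    let ?a = "ts ! i" and ?b = "ts ! Suc i"
    have ab: "?a < ?b" using sorted_wrt_nth_less[OF srt, of i "Suc i"] i by simp
    have mem: "?a \<in> vert_times c" "?b \<in> vert_times c" using i set nth_mem[of i ts] nth_mem[of "Suc i" ts] by auto
    then have ab01: "0 \<le> ?a" "?b \<le> 1" and vab: "c ?a \<in> V" "c ?b \<in> V" by (auto simp: vert_times_def)
    let ?J = "{?a<..<?b}"
    have J: "connected ?J" "?J \<subseteq> {0..1}" "?J \<noteq> {}" using ab ab01 by auto
    have no: "?J \<inter> vert_times c = {}"
    proof (rule ccontr)
      assume "?J \<inter> vert_times c \<noteq> {}"
      then obtain t where t: "t \<in> ?J" "t \<in> set ts" using set by blast
      then obtain j where j: "j < length ts" "ts ! j = t" unfolding in_set_conv_nth by blast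
      show False
      proof (cases "j \<le> i")
        case True then show False using sorted_nth_mono[OF srt', of j i] i j t(1) by simp
      next
        case False then show False using sorted_nth_mono[OF srt', of "Suc i" j] i j t(1) by simp
      qed
    qed
    obtain d where d: "d \<in> E" "c ` ?J \<subseteq> d" using connected_in_edge[OF c J no] by blast
    have inj: "inj_on c ?J" using r J(1,2) no unfolding regular_path_def by blast
    let ?u = "coord \<circ> c"
    have cu: "continuous_on ?J ?u" by (rule continuous_coord_path[OF c J(2) d])
    have op: "open (?u ` ?J)"
      by (rule invariance_of_domain[OF cu]) (use inj inj_on_coord_path[OF d] in auto)
    have uJ: "?u ` ?J \<subseteq> {0<..<1}" using d coord_props(1,2)[OF d(1)] by fastforce
    text \<open>The image is closed in the edge as well, because the closed interval adds only vertices.\<close>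
    have "closedin (top_of_set {0<..<1}) (?u ` ?J)"
    proof -
      have "pathin X (subpath ?a ?b c)" using c ab ab01 by (intro pathin_subpath) auto
      from compactin_path_image[OF this] have "closedin X (subpath ?a ?b c ` {0..1})"
        using compactin_imp_closedin Hausdorff by blast
      moreover have "subpath ?a ?b c ` {0..1} = c ` {?a..?b}"
      proof -
        have "(\<lambda>t. ?a + t * (?b - ?a)) ` {0..1} = {?a..?b}"
          using image_affinity_atLeastAtMost[of "?b - ?a" ?a 0 1] ab by (simp add: mult.commute add.commute)
        moreover have "subpath ?a ?b c ` {0..1} = c ` ((\<lambda>t. ?a + t * (?b - ?a)) ` {0..1})"
          by (simp only: image_image subpath_def)
        ultimately show ?thesis by (simp only:)
      qed
      ultimately have "closedin X (c ` {?a..?b})" by simp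
      from closedin_continuous_map_preimage[OF continuous_map_into_fulltopology[OF homeomorphic_imp_continuous_map[OF ch_homeo[OF d(1)]]] this]
      have "closedin (top_of_set {0<..<1}) {s \<in> {0<..<1}. ch d s \<in> c ` {?a..?b}}" by simp
      moreover have "{s \<in> {0<..<1}. ch d s \<in> c ` {?a..?b}} = ?u ` ?J"
      proof (intro equalityI subsetI)
        fix s assume "s \<in> {s \<in> {0<..<1}. ch d s \<in> c ` {?a..?b}}"
        then obtain t where s: "0 < s" "s < 1" and t: "t \<in> {?a..?b}" "ch d s = c t" by auto
        have "c t \<in> d" using ch_mem[OF d(1) s] t(2) by simp
        then have "t \<noteq> ?a" "t \<noteq> ?b" using vab vert_not_in_edge[OF _ d(1)] by auto
        then have "t \<in> ?J" using t(1) by simp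
        moreover have "s = ?u t" using coord_ch[OF d(1) s] t(2) by simp
        ultimately show "s \<in> ?u ` ?J" by blast
      next
        fix s assume "s \<in> ?u ` ?J"
        then obtain t where t: "t \<in> ?J" "s = coord (c t)" by auto
        have "c t \<in> d" using d(2) t(1) by blast
        then show "s \<in> {s \<in> {0<..<1}. ch d s \<in> c ` {?a..?b}}"
          using coord_props[OF d(1)] t by auto
      qed
      ultimately show ?thesis by simp
    qed
    moreover have "openin (top_of_set {0<..<1}) (?u ` ?J)" using op uJ by (simp add: open_subset)
    moreover have "connected {0<..<1::real}" by simp
    ultimately have full: "?u ` ?J = {0<..<1}" using J(3) unfolding connected_clopen by blast
    have "c ` ?J = d"
    proof (intro equalityI d(2) subsetI)
      fix z assume z: "z \<in> d"
      have "coord z \<in> ?u ` ?J" using full coord_props(1,2)[OF d(1) z] by simp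
      then obtain t where t: "t \<in> ?J" "coord z = coord (c t)" by auto
      have "c t \<in> d" using d(2) t(1) by blast
      then have "z = c t" using coord_props(3)[OF d(1)] z t(2) by metis
      then show "z \<in> c ` ?J" using t(1) by blast
    qed
    then show ?thesis
      using d(1) inj homeomorphic_map_onto_edge_iff[OF c ab01(1) ab ab01(2) d(1)] by blast
  qed
  then have "path_subdivision c ts" unfolding path_subdivision_def using ne srt hd last by blast
  then show "\<exists>ts. path_subdivision c ts" ..
qed

text \<open>Each gap contributes at most one time. This lies behind the finiteness of composed
  subdivisions and of the folded graph.\<close>

lemma regular_path_finite_fibre:
  assumes r: "regular_path c"
  shows "finite {t \<in> {0..1}. c t = z}"
proof -
  have c: "pathin X c" using r by (simp add: regular_path_def)
  obtain ts where ts: "path_subdivision c ts" using regular_path_iff[OF c] r by blast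
  have hl: "ts \<noteq> []" "hd ts = 0" "last ts = 1" using ts by (simp_all add: path_subdivision_def)
  let ?g = "\<lambda>i. {t \<in> {ts ! i<..<ts ! Suc i}. c t = z}"
  have "finite (?g i)" if i: "Suc i < length ts" for i
  proof (cases "?g i = {}")
    case True then show ?thesis by (simp only: finite.emptyI)
  next
    case False
    then obtain s where s: "s \<in> ?g i" by blast
    have "?g i \<subseteq> {s}"
      using inj_onD[OF path_subdivision_image(5)[OF c ts i]] s by blast
    then show ?thesis by (rule finite_subset) simp
  qed
  then have "finite (set ts \<union> (\<Union>i\<in>{i. Suc i < length ts}. ?g i))"
    by (intro finite_UnI finite_UN_I) (auto intro: finite_subset[of _ "{..<length ts}"])
  moreover have "{t \<in> {0..1}. c t = z} \<subseteq> set ts \<union> (\<Union>i\<in>{i. Suc i < length ts}. ?g i)"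
  proof
    fix t assume t: "t \<in> {t \<in> {0..1}. c t = z}"
    show "t \<in> set ts \<union> (\<Union>i\<in>{i. Suc i < length ts}. ?g i)"
    proof (cases "t \<in> set ts")
      case False
      then obtain i where "Suc i < length ts" "ts ! i < t" "t < ts ! Suc i"
        using gap_exists[OF hl(1), of t] hl t by auto
      then show ?thesis using t by auto
    qed simp
  qed
  ultimately show ?thesis by (rule finite_subset[rotated])
qed

end

section \<open>Graph maps, their powers and their edge paths\<close>

lemma edge_subdivision_eq:
  assumes "fgraph H"
  shows "edge_subdivision G H f e = fgraph.path_subdivision H (f \<circ> charmap G e)"
  by (rule ext) (unfold edge_subdivision_def fgraph.path_subdivision_def[OF assms], rule refl)

lemma graph_map_iff_regular:
  assumes G: "fgraph G" and H: "fgraph H"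
  shows "graph_map G H f \<longleftrightarrow> continuous_map (gtop G) (gtop H) f \<and> f ` verts G \<subseteq> verts H \<and>
    (\<forall>e\<in>edges G. fgraph.regular_path H (f \<circ> charmap G e))"
proof -
  have "(\<exists>ts. edge_subdivision G H f e ts) = fgraph.regular_path H (f \<circ> charmap G e)"
    if "e \<in> edges G" "continuous_map (gtop G) (gtop H) f" for e
    unfolding edge_subdivision_eq[OF H]
    by (rule fgraph.regular_path_iff[OF H pathin_compose[OF fgraph.pathin_ch[OF G that(1)] that(2)]])
  then show ?thesis unfolding graph_map_def by (simp cong: conj_cong)
qed

lemma graph_map_id:
  assumes "fgraph G"
  shows "graph_map G G id"
proof -
  interpret fgraph G by fact
  have vt: "vert_times (id \<circ> charmap G e) = {0, 1}" if "e \<in> edges G" for e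
    using ch_in_verts_iff[OF that] by (auto simp: vert_times_def)
  show ?thesis
    unfolding graph_map_iff_regular[OF assms assms]
  proof (intro conjI ballI)
    fix e assume e: "e \<in> edges G"
    show "regular_path (id \<circ> charmap G e)"
      unfolding regular_path_def vt[OF e]
    proof (intro conjI allI impI)
      fix J :: "real set" assume J: "J \<subseteq> {0..1}" "J \<inter> {0, 1} = {}"
      have "J \<subseteq> {0<..<1}"
      proof
        fix t assume "t \<in> J"
        then have "t \<in> {0..1}" "t \<noteq> 0" "t \<noteq> 1" using J by blast+
        then show "t \<in> {0<..<1}" by simp
      qed
      then show "inj_on (id \<circ> charmap G e) J" using inj_on_subset[OF ch_inj[OF e]] by simp
    qed (use pathin_ch[OF e] ch_0[OF e] ch_1[OF e] in simp_all)
  qed simp_all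
qed

text \<open>The vertex times of the composite are those of \<open>f\<close> and the times at which
  \<open>f\<close> meets one of the finitely many interior points that \<open>g\<close> sends to
  vertices. Between them \<open>f\<close> stays in one edge, whose coordinate reduces injectivity to
  that of \<open>g\<close>.\<close>

lemma graph_map_compose:
  assumes G: "fgraph G" and H: "fgraph H" and K: "fgraph K"
    and f: "graph_map G H f" and g: "graph_map H K g"
  shows "graph_map G K (g \<circ> f)"
proof -
  interpret G: fgraph G by fact
  interpret H: fgraph H by fact
  interpret K: fgraph K by fact
  have fc: "continuous_map (gtop G) (gtop H) f" and fv: "\<And>v. v \<in> verts G \<Longrightarrow> f v \<in> verts H"
    and fr: "\<And>e. e \<in> edges G \<Longrightarrow> H.regular_path (f \<circ> charmap G e)"
    using f unfolding graph_map_iff_regular[OF G H] by auto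
  have gc: "continuous_map (gtop H) (gtop K) g" and gv: "\<And>v. v \<in> verts H \<Longrightarrow> g v \<in> verts K"
    and rg: "\<And>d. d \<in> edges H \<Longrightarrow> K.regular_path (g \<circ> charmap H d)"
    using g unfolding graph_map_iff_regular[OF H K] by auto
  show ?thesis
    unfolding graph_map_iff_regular[OF G K]
  proof (intro conjI ballI)
    show "continuous_map (gtop G) (gtop K) (g \<circ> f)" by (rule continuous_map_compose[OF fc gc])
    show "(g \<circ> f) ` verts G \<subseteq> verts K" by (rule image_subsetI) (simp add: fv gv)
    fix e assume e: "e \<in> edges G"
    define b where "b = f \<circ> charmap G e"
    define c where "c = g \<circ> b"
    have rb: "H.regular_path b" unfolding b_def by (rule fr[OF e])
    then have b: "pathin (gtop H) b" "b 0 \<in> verts H" "b 1 \<in> verts H" "finite (H.vert_times b)"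
      unfolding H.regular_path_def by blast+
    have c: "pathin (gtop K) c" unfolding c_def by (rule pathin_compose[OF b(1) gc])
    have sub: "H.vert_times b \<subseteq> K.vert_times c"
      using gv by (auto simp: H.vert_times_def K.vert_times_def c_def)
    have rgf: "finite (K.vert_times (g \<circ> charmap H d))" if "d \<in> edges H" for d
      using rg[OF that] unfolding K.regular_path_def by blast
    let ?F = "\<Union>d\<in>edges H. charmap H d ` K.vert_times (g \<circ> charmap H d)"
    have fF: "finite ?F"
      using H.finite_edges rgf by (intro finite_UN_I finite_imageI)
    have "finite (\<Union>z\<in>?F. {t \<in> {0..1}. b t = z})"
      by (rule finite_UN_I[OF fF]) (rule H.regular_path_finite_fibre[OF rb])
    moreover have "K.vert_times c \<subseteq> H.vert_times b \<union> (\<Union>z\<in>?F. {t \<in> {0..1}. b t = z})"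
    proof
      fix t assume t: "t \<in> K.vert_times c"
      then have t01: "t \<in> {0..1}" and gt: "g (b t) \<in> verts K" by (simp_all add: K.vert_times_def c_def)
      show "t \<in> H.vert_times b \<union> (\<Union>z\<in>?F. {t \<in> {0..1}. b t = z})"
      proof (cases "b t \<in> verts H")
        case True then show ?thesis using t01 by (simp add: H.vert_times_def)
      next
        case False
        have "b t \<in> topspace (gtop H)" using funcset_mem[OF path_image_subset_topspace[OF b(1)] t01] .
        then have "\<exists>d s. d \<in> edges H \<and> 0 < s \<and> s < 1 \<and> b t = charmap H d s"
        proof (cases rule: H.point_cases)
          case 1 then show ?thesis using False by blast
        next
          case (2 d s) then show ?thesis by blast
        qed
        then obtain d s where d: "d \<in> edges H" "0 < s" "s < 1" "b t = charmap H d s" by blast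
        then have "s \<in> K.vert_times (g \<circ> charmap H d)" using gt by (simp add: K.vert_times_def)
        then have "b t \<in> ?F" using d by blast
        then show ?thesis using t01 by blast
      qed
    qed
    ultimately have fin: "finite (K.vert_times c)"
      using finite_subset[OF _ finite_UnI[OF b(4)]] by blast
    have "inj_on c J" if J: "connected J" "J \<subseteq> {0..1}" "J \<inter> K.vert_times c = {}" for J
    proof (cases "J = {}")
      case False
      have noT: "J \<inter> H.vert_times b = {}" using J(3) sub by blast
      have injb: "inj_on b J" using rb J(1,2) noT unfolding H.regular_path_def by blast
      obtain d where d: "d \<in> edges H" "b ` J \<subseteq> d" using H.connected_in_edge[OF b(1) J(1,2) False noT] by blast
      let ?u = "H.coord \<circ> b"
      have "connected (?u ` J)"
        by (rule connected_continuous_image[OF H.continuous_coord_path[OF b(1) J(2) d] J(1)])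
      moreover have bu: "b t = charmap H d (?u t)" "0 < ?u t" "?u t < 1" if "t \<in> J" for t
        using H.coord_props[OF d(1), of "b t"] d(2) that by auto
      then have "?u ` J \<subseteq> {0..1}" by (auto simp: less_imp_le)
      moreover have "?u ` J \<inter> K.vert_times (g \<circ> charmap H d) = {}"
      proof (rule ccontr)
        assume "?u ` J \<inter> K.vert_times (g \<circ> charmap H d) \<noteq> {}"
        then obtain t where t: "t \<in> J" "?u t \<in> K.vert_times (g \<circ> charmap H d)" by blast
        have "(g \<circ> charmap H d) (?u t) \<in> verts K" using t(2) unfolding K.vert_times_def by blast
        then have "g (b t) \<in> verts K"
          unfolding comp_apply[of g "charmap H d"] bu(1)[OF t(1), symmetric] .
        then have "c t \<in> verts K" by (simp add: c_def)
        then have "t \<in> K.vert_times c" using t(1) J(2) unfolding K.vert_times_def by blast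
        then show False using t(1) J(3) by blast
      qed
      ultimately have "inj_on (g \<circ> charmap H d) (?u ` J)"
        using rg[OF d(1)] unfolding K.regular_path_def by blast
      moreover have "inj_on ?u J" using H.inj_on_coord_path[OF d] injb by simp
      ultimately have "inj_on (g \<circ> charmap H d \<circ> ?u) J" by (rule comp_inj_on[rotated])
      then show ?thesis
        by (rule inj_on_cong[THEN iffD1, rotated]) (use bu(1) in \<open>simp add: c_def\<close>)
    qed simp
    moreover have "c 0 \<in> verts K" "c 1 \<in> verts K" using b(2,3) gv by (simp_all add: c_def)
    ultimately have "K.regular_path c"
      using c fin unfolding K.regular_path_def by blast
    then show "K.regular_path (g \<circ> f \<circ> charmap G e)" by (simp add: c_def b_def o_assoc)
  qed
qed

lemma graph_map_funpow:
  assumes "fgraph G" "graph_map G G f"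
  shows "graph_map G G (f ^^ n)"
proof (induction n)
  case 0
  then show ?case using graph_map_id[OF assms(1)] by (simp add: id_def)
next
  case (Suc n)
  then show ?case using graph_map_compose[OF assms(1,1,1) Suc assms(2)] by (simp add: o_def)
qed

lemma graph_map_edge_path:
  assumes G: "fgraph G" and H: "fgraph H" and f: "graph_map G H f" and e: "e \<in> edges G"
  obtains ts where "edge_subdivision G H f e ts"
    "edge_path G H f e = map (\<lambda>i. (f \<circ> charmap G e) ` {ts ! i<..<ts ! Suc i}) [0..<length ts - 1]"
    "set ts = fgraph.vert_times H (f \<circ> charmap G e)"
proof -
  interpret H: fgraph H by fact
  obtain ts where ts: "edge_subdivision G H f e ts" using f e by (auto simp: graph_map_def)
  have fc: "continuous_map (gtop G) (gtop H) f" using f unfolding graph_map_def by blast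
  have c: "pathin (gtop H) (f \<circ> charmap G e)" by (rule pathin_compose[OF fgraph.pathin_ch[OF G e] fc])
  note ts' = ts[unfolded edge_subdivision_eq[OF H]]
  have "(THE ts. edge_subdivision G H f e ts) = ts"
    using H.path_subdivision_verts(2)[OF c] ts' unfolding edge_subdivision_eq[OF H]
    by (intro the_equality) metis+
  then show thesis
    using that[OF ts] H.path_subdivision_verts(1)[OF c ts'] by (simp add: edge_path_def Let_def)
qed

text \<open>An edge is covered as soon as it is met, which turns occurrences in edge paths into
  statements about images of sets.\<close>

lemma in_edge_path_iff:
  assumes G: "fgraph G" and H: "fgraph H" and f: "graph_map G H f" and e: "e \<in> edges G" and d: "d \<in> edges H"
  shows "d \<in> set (edge_path G H f e) \<longleftrightarrow> f ` e \<inter> d \<noteq> {}" "d \<in> set (edge_path G H f e) \<Longrightarrow> d \<subseteq> f ` e"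
proof -
  interpret G: fgraph G by fact
  interpret H: fgraph H by fact
  obtain ts where ts: "edge_subdivision G H f e ts"
    "edge_path G H f e = map (\<lambda>i. (f \<circ> charmap G e) ` {ts ! i<..<ts ! Suc i}) [0..<length ts - 1]"
    "set ts = H.vert_times (f \<circ> charmap G e)"
    by (rule graph_map_edge_path[OF G H f e])
  note ts' = ts(1)[unfolded edge_subdivision_eq[OF H]]
  have fc: "continuous_map (gtop G) (gtop H) f" using f unfolding graph_map_def by blast
  have c: "pathin (gtop H) (f \<circ> charmap G e)" by (rule pathin_compose[OF G.pathin_ch[OF e] fc])
  note im = H.path_subdivision_image[OF c ts']
  have hl: "ts \<noteq> []" "hd ts = 0" "last ts = 1" using ts' by (simp_all add: H.path_subdivision_def)
  have mem: "d \<in> set (edge_path G H f e) \<longleftrightarrow> (\<exists>i. Suc i < length ts \<and> d = (f \<circ> charmap G e) ` {ts ! i<..<ts ! Suc i})"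
    unfolding ts(2) by (auto simp: less_diff_conv)
  show 1: "d \<subseteq> f ` e" if de: "d \<in> set (edge_path G H f e)"
  proof -
    obtain i where i: "Suc i < length ts" "d = (f \<circ> charmap G e) ` {ts ! i<..<ts ! Suc i}"
      using de mem by blast
    have "{ts ! i<..<ts ! Suc i} \<subseteq> {0<..<1}" using im(1,3)[OF i(1)] by auto
    then have "charmap G e ` {ts ! i<..<ts ! Suc i} \<subseteq> e" using G.ch_image[OF e] by blast
    then show ?thesis unfolding i(2) image_comp[symmetric] by blast
  qed
  show "d \<in> set (edge_path G H f e) \<longleftrightarrow> f ` e \<inter> d \<noteq> {}"
  proof
    assume "d \<in> set (edge_path G H f e)"
    moreover have "d \<noteq> {}" using H.ch_image[OF d] by auto
    ultimately show "f ` e \<inter> d \<noteq> {}" using 1 by blast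
  next
    assume "f ` e \<inter> d \<noteq> {}"
    then obtain z where z: "z \<in> e" "f z \<in> d" by blast
    then have "z \<in> charmap G e ` {0<..<1}" using G.ch_image[OF e] by simp
    then obtain t where t: "0 < t" "t < 1" "f (charmap G e t) \<in> d" using z(2) by auto
    then have "t \<notin> set ts" using H.vert_not_in_edge[OF _ d] by (auto simp: ts(3) H.vert_times_def)
    then obtain i where i: "Suc i < length ts" "t \<in> {ts ! i<..<ts ! Suc i}"
      using H.gap_exists[OF hl(1), of t] hl t by auto
    let ?d = "(f \<circ> charmap G e) ` {ts ! i<..<ts ! Suc i}"
    have "f (charmap G e t) \<in> ?d" using i(2) by force
    then have "d = ?d" by (rule H.edge_unique[OF d im(4)[OF i(1)] t(3)])
    then show "d \<in> set (edge_path G H f e)" using mem i(1) by blast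
  qed
qed

text \<open>Positivity forgets multiplicities, so irreducibility becomes a statement about images of
  edges. In the induction an intermediate edge that is met is covered, hence available in full for
  the next application of \<open>f\<close>.\<close>

lemma matrix_power_pos_iff:
  assumes G: "fgraph G" and f: "graph_map G G f" and e: "e \<in> edges G" "e' \<in> edges G"
  shows "matrix_power (edges G) (transition_matrix G f) n e e' > 0 \<longleftrightarrow> (f ^^ n) ` e \<inter> e' \<noteq> {}"
  using e(2)
proof (induction n arbitrary: e')
  interpret fgraph G by fact
  case 0
  have "e \<noteq> {}" using ch_image[OF e(1)] by auto
  then show ?case using edge_unique[OF e(1) 0] by auto
next
  interpret fgraph G by fact
  case (Suc n)
  have fn: "graph_map G G (f ^^ n)" by (rule graph_map_funpow[OF G f])
  have gen: "(\<Sum>k\<in>A. F k) > 0 \<longleftrightarrow> (\<exists>k\<in>A. F k > 0)" if "finite A" for A and F :: "'a set \<Rightarrow> nat"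
    using sum_eq_0_iff[OF that, of F] by auto
  have "matrix_power (edges G) (transition_matrix G f) (Suc n) e e' > 0 \<longleftrightarrow>
      (\<exists>k\<in>edges G. matrix_power (edges G) (transition_matrix G f) n e k * transition_matrix G f k e' > 0)"
    unfolding matrix_power.simps by (rule gen[OF finite_edges])
  also have "\<dots> \<longleftrightarrow> (\<exists>k\<in>edges G. (f ^^ n) ` e \<inter> k \<noteq> {} \<and> f ` k \<inter> e' \<noteq> {})"
  proof (rule bex_cong[OF refl])
    fix k assume k: "k \<in> edges G"
    have "transition_matrix G f k e' > 0 \<longleftrightarrow> f ` k \<inter> e' \<noteq> {}"
      using in_edge_path_iff(1)[OF G G f k Suc.prems] by (simp add: transition_matrix_def count_list_0_iff flip: neq0_conv)
    then show "matrix_power (edges G) (transition_matrix G f) n e k * transition_matrix G f k e' > 0 \<longleftrightarrow>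
        (f ^^ n) ` e \<inter> k \<noteq> {} \<and> f ` k \<inter> e' \<noteq> {}"
      using Suc.IH[OF k] by (simp only: nat_0_less_mult_iff)
  qed
  also have "\<dots> \<longleftrightarrow> (f ^^ Suc n) ` e \<inter> e' \<noteq> {}"
  proof
    assume "\<exists>k\<in>edges G. (f ^^ n) ` e \<inter> k \<noteq> {} \<and> f ` k \<inter> e' \<noteq> {}"
    then obtain k where k: "k \<in> edges G" "(f ^^ n) ` e \<inter> k \<noteq> {}" "f ` k \<inter> e' \<noteq> {}" by blast
    have "k \<subseteq> (f ^^ n) ` e"
      using in_edge_path_iff[OF G G fn e(1) k(1)] k(2) by blast
    then have "f ` k \<subseteq> (f ^^ Suc n) ` e" by auto
    then show "(f ^^ Suc n) ` e \<inter> e' \<noteq> {}" using k(3) by blast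
  next
    assume "(f ^^ Suc n) ` e \<inter> e' \<noteq> {}"
    then obtain z where z: "z \<in> e" "f ((f ^^ n) z) \<in> e'" by auto
    let ?y = "(f ^^ n) z"
    have "?y \<in> topspace (gtop G)"
      using funcset_mem[OF continuous_map_funspace, of "gtop G" "gtop G" "f ^^ n" z] fn edge_subset[OF e(1)] z(1)
      by (auto simp: graph_map_def)
    moreover have "?y \<notin> verts G"
    proof
      assume "?y \<in> verts G"
      then have "f ?y \<in> verts G" using f by (auto simp: graph_map_def)
      then show False using vert_not_in_edge[OF _ Suc.prems] z(2) by blast
    qed
    ultimately obtain k where k: "k \<in> edges G" "?y \<in> k" using topspace_eq by blast
    then show "\<exists>k\<in>edges G. (f ^^ n) ` e \<inter> k \<noteq> {} \<and> f ` k \<inter> e' \<noteq> {}" using z by blast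
  qed
  finally show ?case .
qed

lemma irreducible_map_iff:
  assumes "fgraph G" "graph_map G G f"
  shows "irreducible_map G f \<longleftrightarrow> (\<forall>e\<in>edges G. \<forall>e'\<in>edges G. \<exists>n\<ge>1. (f ^^ n) ` e \<inter> e' \<noteq> {})"
proof -
  have *: "(\<exists>t\<ge>1. matrix_power (edges G) (transition_matrix G f) t e e' > 0) \<longleftrightarrow> (\<exists>n\<ge>1. (f ^^ n) ` e \<inter> e' \<noteq> {})"
    if "e \<in> edges G" "e' \<in> edges G" for e e'
    unfolding matrix_power_pos_iff[OF assms that] ..
  show ?thesis unfolding irreducible_map_def by (rule ball_cong[OF refl], rule ball_cong[OF refl]) (rule *)
qed

text \<open>\<open>p\<close> maps each edge bijectively onto an edge, so an interval runs
  bijectively over an edge before composing with \<open>p\<close> exactly if it does so afterwards.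
  Both conditions therefore hold for the same lists.\<close>

lemma (in graph_immersion) path_subdivision_lift:
  assumes c: "pathin (gtop H) c"
    and refl: "\<And>x. x \<in> topspace (gtop H) \<Longrightarrow> p x \<in> verts G \<Longrightarrow> x \<in> verts H"
  shows "H.path_subdivision c = G.path_subdivision (p \<circ> c)"
proof -
  have pc: "pathin (gtop G) (p \<circ> c)" by (rule pathin_compose[OF c p_continuous])
  have p_image: "p ` e = \<pi> e" if "e \<in> edges H" for e
  proof -
    have "p ` e = (\<lambda>t. p (charmap H e t)) ` {0<..<1}" unfolding image_image[symmetric] H.ch_image[OF that] ..
    also have "\<dots> = charmap G (\<pi> e) ` {0<..<1}" using p_ch[OF that] by (intro image_cong) auto
    finally show ?thesis using G.ch_image[OF \<pi>_edges[OF that]] by simp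
  qed
  have p_inj: "inj_on p e" if e: "e \<in> edges H" for e
  proof (rule inj_onI)
    fix x y assume xy: "x \<in> e" "y \<in> e" "p x = p y"
    note x = H.coord_props[OF e xy(1)] and y = H.coord_props[OF e xy(2)]
    have "charmap G (\<pi> e) (H.coord x) = charmap G (\<pi> e) (H.coord y)"
      using p_ch[OF e, of "H.coord x"] p_ch[OF e, of "H.coord y"] x y xy(3) by simp
    then have "H.coord x = H.coord y"
      using G.ch_eq_iff[of "\<pi> e" "\<pi> e" "H.coord x" "H.coord y"] x(1,2) y(1,2) \<pi>_edges[OF e] by blast
    then show "x = y" using x(3) y(3) by metis
  qed
  have key: "(\<exists>d\<in>edges H. homeomorphic_map (top_of_set {a<..<b}) (subtopology (gtop H) d) c) \<longleftrightarrow>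
      (\<exists>d\<in>edges G. homeomorphic_map (top_of_set {a<..<b}) (subtopology (gtop G) d) (p \<circ> c))"
    if ab: "0 \<le> a" "a < b" "b \<le> 1" for a b
  proof
    assume "\<exists>d\<in>edges H. homeomorphic_map (top_of_set {a<..<b}) (subtopology (gtop H) d) c"
    then obtain d where d: "d \<in> edges H" "c ` {a<..<b} = d" "inj_on c {a<..<b}"
      using H.homeomorphic_map_onto_edge_iff[OF c ab] by blast
    have "(p \<circ> c) ` {a<..<b} = p ` (c ` {a<..<b})" by (simp only: image_comp)
    then have "(p \<circ> c) ` {a<..<b} = \<pi> d" unfolding d(2) p_image[OF d(1)] .
    moreover have "inj_on (p \<circ> c) {a<..<b}" using d p_inj[OF d(1)] by (intro comp_inj_on) simp_all
    ultimately show "\<exists>d\<in>edges G. homeomorphic_map (top_of_set {a<..<b}) (subtopology (gtop G) d) (p \<circ> c)"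
      using \<pi>_edges[OF d(1)] G.homeomorphic_map_onto_edge_iff[OF pc ab] by blast
  next
    assume "\<exists>d\<in>edges G. homeomorphic_map (top_of_set {a<..<b}) (subtopology (gtop G) d) (p \<circ> c)"
    then obtain d where d: "d \<in> edges G" "(p \<circ> c) ` {a<..<b} = d" "inj_on (p \<circ> c) {a<..<b}"
      using G.homeomorphic_map_onto_edge_iff[OF pc ab] by blast
    let ?J = "{a<..<b}"
    have no: "?J \<inter> H.vert_times c = {}"
    proof (rule ccontr)
      assume "?J \<inter> H.vert_times c \<noteq> {}"
      then obtain t where t: "t \<in> ?J" "c t \<in> verts H" unfolding H.vert_times_def by blast
      then have "p (c t) \<in> verts G" "p (c t) \<in> d" using p_verts d(2) by auto
      then show False using G.vert_not_in_edge d(1) by blast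
    qed
    have J: "connected ?J" "?J \<subseteq> {0..1}" "?J \<noteq> {}" using ab by auto
    obtain e where e: "e \<in> edges H" "c ` ?J \<subseteq> e" using H.connected_in_edge[OF c J no] by blast
    have sub: "(p \<circ> c) ` ?J \<subseteq> \<pi> e"
      unfolding p_image[OF e(1), symmetric] image_comp[symmetric] by (rule image_mono[OF e(2)])
    have "\<pi> e = d"
    proof -
      obtain t where "t \<in> ?J" using J(3) by blast
      then have "(p \<circ> c) t \<in> \<pi> e" "(p \<circ> c) t \<in> d" using sub d(2) by blast+
      then show ?thesis using G.edge_unique[OF \<pi>_edges[OF e(1)] d(1)] by blast
    qed
    have "c ` ?J = e"
    proof (intro equalityI e(2) subsetI)
      fix z assume z: "z \<in> e"
      then have "p z \<in> (p \<circ> c) ` ?J" using p_image[OF e(1)] \<open>\<pi> e = d\<close> d(2) by blast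
      then obtain t where t: "t \<in> ?J" "p z = p (c t)" by auto
      have "z = c t" by (rule inj_onD[OF p_inj[OF e(1)] t(2) z]) (use e(2) t(1) in blast)
      then show "z \<in> c ` ?J" using t(1) by blast
    qed
    moreover have "inj_on c ?J" by (rule inj_on_imageI2[OF d(3)])
    ultimately show "\<exists>d\<in>edges H. homeomorphic_map (top_of_set {a<..<b}) (subtopology (gtop H) d) c"
      using e(1) H.homeomorphic_map_onto_edge_iff[OF c ab e(1)] by blast
  qed
  show ?thesis
  proof
    fix ts :: "real list"
    have "0 \<le> ts ! i \<and> ts ! i < ts ! Suc i \<and> ts ! Suc i \<le> 1"
      if ts: "ts \<noteq> []" "sorted_wrt (<) ts" "hd ts = 0" "last ts = 1" and i: "Suc i < length ts" for i and ts :: "real list"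
    proof -
      have srt: "sorted ts" using ts(2) strict_sorted_iff by blast
      show ?thesis
        using sorted_wrt_nth_less[OF ts(2), of i "Suc i"] sorted_nth_mono[OF srt, of 0 i]
          sorted_nth_mono[OF srt, of "Suc i" "length ts - 1"] i ts
        by (simp add: hd_conv_nth last_conv_nth)
    qed
    then show "H.path_subdivision c ts = G.path_subdivision (p \<circ> c) ts"
      unfolding H.path_subdivision_def G.path_subdivision_def using key by blast
  qed
qed

section \<open>Graphs from characteristic maps\<close>

text \<open>The topology is not part of the data; it will be the weak one for the characteristic
  maps.\<close>

locale graph_data =
  fixes V :: "'a set" and E :: "'a set set" and c :: "'a set \<Rightarrow> real \<Rightarrow> 'a"
  assumes finite_V: "finite V" and finite_E: "finite E"
    and c_inj: "e \<in> E \<Longrightarrow> inj_on (c e) {0<..<1}"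
    and c_image: "e \<in> E \<Longrightarrow> c e ` {0<..<1} = e"
    and c_0: "e \<in> E \<Longrightarrow> c e 0 \<in> V" and c_1: "e \<in> E \<Longrightarrow> c e 1 \<in> V"
    and E_disj: "e \<in> E \<Longrightarrow> e' \<in> E \<Longrightarrow> x \<in> e \<Longrightarrow> x \<in> e' \<Longrightarrow> e = e'"
    and V_E: "v \<in> V \<Longrightarrow> e \<in> E \<Longrightarrow> v \<notin> e"
begin

definition coherent_open :: "'a set \<Rightarrow> bool" where
  "coherent_open U \<longleftrightarrow> U \<subseteq> V \<union> \<Union>E \<and> (\<forall>e\<in>E. openin (top_of_set {0..1}) {t \<in> {0..1}. c e t \<in> U})"

definition graph :: "'a cw_graph" where
  "graph = \<lparr>gtop = topology coherent_open, verts = V, edges = E, charmap = c\<rparr>"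

lemma graph_simps [simp]:
  "verts graph = V" "edges graph = E" "charmap graph = c"
  by (simp_all add: graph_def)

lemma istopology_coherent_open: "istopology coherent_open"
  unfolding istopology_def
proof (intro conjI allI impI)
  fix S T assume S: "coherent_open S" and T: "coherent_open T"
  have "{t \<in> {0..1}. c e t \<in> S \<inter> T} = {t \<in> {0..1}. c e t \<in> S} \<inter> {t \<in> {0..1}. c e t \<in> T}" for e
    by blast
  with S T show "coherent_open (S \<inter> T)" by (auto simp: coherent_open_def intro!: openin_Int)
next
  fix K assume K: "\<forall>S\<in>K. coherent_open S"
  have "{t \<in> {0..1}. c e t \<in> \<Union>K} = \<Union>((\<lambda>S. {t \<in> {0..1}. c e t \<in> S}) ` K)" for e
    by blast
  with K show "coherent_open (\<Union>K)" by (auto simp: coherent_open_def intro!: openin_Union)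
qed

lemma openin_graph: "openin (gtop graph) = coherent_open"
  by (simp add: graph_def istopology_coherent_open)

lemma c_in:
  assumes "e \<in> E" "t \<in> {0..1}"
  shows "c e t \<in> V \<union> \<Union>E"
proof -
  consider "t = 0" | "t = 1" | "t \<in> {0<..<1}" using assms(2) by fastforce
  then show ?thesis using c_0[OF assms(1)] c_1[OF assms(1)] c_image[OF assms(1)] assms(1) by cases auto
qed

lemma topspace_graph: "topspace (gtop graph) = V \<union> \<Union>E"
proof -
  have eq: "{t \<in> {0..1}. c e t \<in> V \<union> \<Union>E} = {0..1}" if "e \<in> E" for e using c_in[OF that] by blast
  have "coherent_open (V \<union> \<Union>E)" unfolding coherent_open_def using eq by simp
  then have "V \<union> \<Union>E \<subseteq> topspace (gtop graph)" unfolding openin_graph[symmetric] by (rule openin_subset)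
  moreover have "topspace (gtop graph) \<subseteq> V \<union> \<Union>E"
    using openin_topspace[of "gtop graph"] by (simp add: openin_graph coherent_open_def)
  ultimately show ?thesis by blast
qed

lemma continuous_c: "e \<in> E \<Longrightarrow> continuous_map (top_of_set {0..1}) (gtop graph) (c e)"
  unfolding continuous_map_def using c_in by (auto simp: openin_graph topspace_graph coherent_open_def)

lemma c_mem: "e \<in> E \<Longrightarrow> t \<in> {0<..<1} \<Longrightarrow> c e t \<in> e"
  using c_image by blast

lemma openin_c_image:
  assumes e: "e \<in> E" and J: "open J" "J \<subseteq> {0<..<1}"
  shows "openin (gtop graph) (c e ` J)"
  unfolding openin_graph coherent_open_def
proof (intro conjI ballI)
  show "c e ` J \<subseteq> V \<union> \<Union>E" using c_mem[OF e] J(2) e by blast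
  fix e' assume e': "e' \<in> E"
  have 1: "t \<in> J \<and> e' = e" if t: "t \<in> {0..1}" "c e' t \<in> c e ` J" for t
  proof -
    from t obtain s where s: "s \<in> J" "c e' t = c e s" by blast
    then have ce: "c e' t \<in> e" using c_mem[OF e subsetD[OF J(2) s(1)]] by (simp only:)
    then have "c e' t \<notin> V" using V_E e by blast
    then have "t \<noteq> 0" "t \<noteq> 1" using c_0[OF e'] c_1[OF e'] by auto
    then have t': "t \<in> {0<..<1}" using t(1) by simp
    have "e' = e" using E_disj[OF e' e c_mem[OF e' t'] ce] .
    then show ?thesis using inj_onD[OF c_inj[OF e], of t s] s t' subsetD[OF J(2) s(1)] by simp
  qed
  have 2: "t \<in> {0..1}" if "t \<in> J" for t using subsetD[OF J(2) that] by simp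
  have "(t \<in> {0..1} \<and> c e' t \<in> c e ` J) = (t \<in> J \<and> e' = e)" for t
    using 1 2 by blast
  then have "{t \<in> {0..1}. c e' t \<in> c e ` J} = (if e' = e then J else {})" by simp
  moreover have "J \<subseteq> {0..1}" using 2 by blast
  ultimately show "openin (top_of_set {0..1}) {t \<in> {0..1}. c e' t \<in> c e ` J}"
    using J(1) by (simp add: open_subset)
qed

lemma homeomorphic_c:
  assumes e: "e \<in> E"
  shows "homeomorphic_map (top_of_set {0<..<1}) (subtopology (gtop graph) e) (c e)"
proof (rule bijective_open_imp_homeomorphic_map)
  have sub: "{0<..<1} \<subseteq> {0..1::real}" by auto
  show "continuous_map (top_of_set {0<..<1}) (subtopology (gtop graph) e) (c e)"
    using continuous_map_from_subtopology_mono[OF continuous_c[OF e] sub] c_mem[OF e]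
    by (simp add: continuous_map_in_subtopology Pi_iff)
  show "open_map (top_of_set {0<..<1}) (subtopology (gtop graph) e) (c e)"
    unfolding open_map_def
  proof (intro allI impI)
    fix J :: "real set" assume "openin (top_of_set {0<..<1}) J"
    then have J: "open J" "J \<subseteq> {0<..<1}" by (simp_all add: openin_open_eq)
    have "c e ` J = c e ` J \<inter> e" using J(2) c_mem[OF e] by blast
    then show "openin (subtopology (gtop graph) e) (c e ` J)"
      using openin_c_image[OF e J] unfolding openin_subtopology by blast
  qed
  show "c e ` topspace (top_of_set {0<..<1}) = topspace (subtopology (gtop graph) e)"
    using e by (simp add: c_image topspace_graph Int_absorb1 Union_upper le_supI2)
  show "inj_on (c e) (topspace (top_of_set {0<..<1}))" using c_inj[OF e] by simp
qed

section \<open>Separation of points in the weak topology\<close>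

definition cell :: "'a \<Rightarrow> 'a set" where "cell x = (THE e. e \<in> E \<and> x \<in> e)"
definition height :: "'a \<Rightarrow> real" where "height x = inv_into {0<..<1} (c (cell x)) x"

lemma cell_height:
  assumes "e \<in> E" "t \<in> {0<..<1}"
  shows "cell (c e t) = e" "height (c e t) = t"
proof -
  show "cell (c e t) = e"
    unfolding cell_def using E_disj c_mem[OF assms] assms(1) by (intro the_equality) auto
  then show "height (c e t) = t"
    using inv_into_f_f[OF c_inj[OF assms(1)] assms(2)] by (simp add: height_def)
qed

text \<open>Functions that are continuous along all edges have open preimages in the weak topology,
  so the Hausdorff property follows once they separate points.\<close>

lemma separating_function:
  assumes x: "x \<in> V \<union> \<Union>E" and y: "y \<in> V \<union> \<Union>E" and ne: "x \<noteq> y"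
  shows "\<exists>h::'a \<Rightarrow> real. (\<forall>e\<in>E. continuous_on {0..1} (h \<circ> c e)) \<and> h x \<noteq> h y"
proof -
  have bump: "continuous_on {0..1} ((\<lambda>z. if z \<in> e then \<phi> (height z) else 0) \<circ> c e')"
    if e: "e \<in> E" "e' \<in> E" and \<phi>: "continuous_on {0..1} \<phi>" "\<phi> 0 = 0" "\<phi> 1 = 0" for e e' and \<phi> :: "real \<Rightarrow> real"
  proof -
    have "((\<lambda>z. if z \<in> e then \<phi> (height z) else 0) \<circ> c e') t = (if e' = e then \<phi> t else 0)" if t: "t \<in> {0..1}" for t
    proof (cases "t = 0 \<or> t = 1")
      case True
      then have "c e' t \<notin> e" using c_0[OF e(2)] c_1[OF e(2)] V_E e(1) by auto
      then show ?thesis using True \<phi> by auto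
    next
      case False
      then have t': "t \<in> {0<..<1}" using t by simp
      have "c e' t \<in> e \<longleftrightarrow> e' = e" using E_disj[OF e(2,1) c_mem[OF e(2) t']] c_mem[OF e(2) t'] by blast
      then show ?thesis using cell_height[OF e(2) t'] by auto
    qed
    note eq = this
    have "continuous_on {0..1} (\<lambda>t. if e' = e then \<phi> t else 0)" using \<phi>(1) by (cases "e' = e") simp_all
    then show ?thesis by (rule continuous_on_eq) (rule eq[symmetric])
  qed
  have edge: "\<exists>h::'a \<Rightarrow> real. (\<forall>e\<in>E. continuous_on {0..1} (h \<circ> c e)) \<and> h x \<noteq> h y"
    if e: "e \<in> E" "x \<in> e" and ne: "x \<noteq> y" for x y e
  proof -
    \<comment> \<open>\<open>h1\<close> separates \<open>x\<close> from all points off the edge. If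
      \<open>h1\<close> takes the same value at two points of the edge, that value is nonzero, and
      \<open>h2\<close>, which is the height times \<open>h1\<close>, tells them apart.\<close>
    define h1 h2 :: "'a \<Rightarrow> real" where
      "h1 = (\<lambda>z. if z \<in> e then (\<lambda>t. t * (1 - t)) (height z) else 0)" and
      "h2 = (\<lambda>z. if z \<in> e then (\<lambda>t. t * (t * (1 - t))) (height z) else 0)"
    have c1: "\<forall>e'\<in>E. continuous_on {0..1} (h1 \<circ> c e')"
      unfolding h1_def by (intro ballI bump[OF e(1)]) (auto intro!: continuous_intros)
    have c2: "\<forall>e'\<in>E. continuous_on {0..1} (h2 \<circ> c e')"
      unfolding h2_def by (intro ballI bump[OF e(1)]) (auto intro!: continuous_intros)
    have "x \<in> c e ` {0<..<1}" using e c_image by simp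
    then obtain s where s: "s \<in> {0<..<1}" "x = c e s" by blast
    then have hs: "height x = s" using cell_height[OF e(1)] by simp
    have nz: "h1 x \<noteq> 0" using s(1) e(2) by (simp add: h1_def hs)
    show ?thesis
    proof (cases "y \<in> e")
      case False
      then have "h1 y = 0" by (simp add: h1_def)
      then show ?thesis using c1 nz by (intro exI[of _ h1]) simp
    next
      case True
      then have "y \<in> c e ` {0<..<1}" using e c_image by simp
      then obtain t where t: "t \<in> {0<..<1}" "y = c e t" by blast
      then have ht: "height y = t" using cell_height[OF e(1)] by simp
      have st: "s \<noteq> t" using ne s t by auto
      show ?thesis
      proof (cases "h1 x = h1 y")
        case f: False then show ?thesis using c1 by blast
      next
        case eq: True
        have h2: "h2 x = s * h1 x" "h2 y = t * h1 y"
          using e(2) True by (simp_all add: h1_def h2_def hs ht)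
        have "h2 x \<noteq> h2 y" unfolding h2 eq using st nz[unfolded eq] by simp
        then show ?thesis using c2 by blast
      qed
    qed
  qed
  show ?thesis
  proof (cases "\<exists>e\<in>E. x \<in> e \<or> y \<in> e")
    case True
    then obtain e where e: "e \<in> E" "x \<in> e \<or> y \<in> e" by blast
    from e(2) show ?thesis
    proof
      assume "y \<in> e"
      from edge[OF e(1) this ne[symmetric]] obtain h :: "'a \<Rightarrow> real"
        where "\<forall>e\<in>E. continuous_on {0..1} (h \<circ> c e)" "h y \<noteq> h x" by blast
      then show ?thesis by (intro exI[of _ h]) simp
    qed (rule edge[OF e(1) _ ne])
  next
    case False
    then have xy: "x \<in> V" "y \<in> V" using x y by blast+
    \<comment> \<open>The indicator of \<open>x\<close> on the vertices, interpolated linearly along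
      the edges.\<close>
    define h :: "'a \<Rightarrow> real" where "h z = (if z \<in> V then of_bool (z = x)
      else (1 - height z) * of_bool (c (cell z) 0 = x) + height z * of_bool (c (cell z) 1 = x))" for z
    have "continuous_on {0..1} (h \<circ> c e)" if e: "e \<in> E" for e
    proof -
      have eq: "(h \<circ> c e) t = (1 - t) * of_bool (c e 0 = x) + t * of_bool (c e 1 = x)" if t: "t \<in> {0..1}" for t
      proof (cases "t = 0 \<or> t = 1")
        case True
        then show ?thesis using c_0[OF e] c_1[OF e] by (auto simp: h_def)
      next
        case False
        then have t': "t \<in> {0<..<1}" using t by simp
        then have "c e t \<notin> V" using c_mem[OF e t'] V_E e by blast
        then show ?thesis using cell_height[OF e t'] by (simp add: h_def)
      qed
      have "continuous_on {0..1} (\<lambda>t. (1 - t) * of_bool (c e 0 = x) + t * of_bool (c e 1 = x) :: real)"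
        by (intro continuous_intros)
      then show ?thesis by (subst continuous_on_cong[OF refl eq])
    qed
    moreover have "h x \<noteq> h y" using xy ne by (simp add: h_def)
    ultimately show ?thesis by blast
  qed
qed

lemma openin_preimage:
  assumes "\<And>e. e \<in> E \<Longrightarrow> continuous_on {0..1} (h \<circ> c e)" "open W"
  shows "openin (gtop graph) {x \<in> V \<union> \<Union>E. h x \<in> W}"
  unfolding openin_graph coherent_open_def
proof (intro conjI ballI)
  fix e assume e: "e \<in> E"
  have "{t \<in> {0..1}. c e t \<in> {x \<in> V \<union> \<Union>E. h x \<in> W}} = {0..1} \<inter> (h \<circ> c e) -` W"
  proof (rule Set.set_eqI)
    fix t
    show "t \<in> {t \<in> {0..1}. c e t \<in> {x \<in> V \<union> \<Union>E. h x \<in> W}} \<longleftrightarrow> t \<in> {0..1} \<inter> (h \<circ> c e) -` W"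
      unfolding mem_Collect_eq Int_iff vimage_eq comp_apply using c_in[OF e, of t] by blast
  qed
  then show "openin (top_of_set {0..1}) {t \<in> {0..1}. c e t \<in> {x \<in> V \<union> \<Union>E. h x \<in> W}}"
    using continuous_openin_preimage_gen[OF assms(1)[OF e] assms(2)] by simp
qed blast

lemma Hausdorff_graph: "Hausdorff_space (gtop graph)"
  unfolding Hausdorff_space_def topspace_graph
proof (intro allI impI)
  fix x y assume xy: "x \<in> V \<union> \<Union>E \<and> y \<in> V \<union> \<Union>E \<and> x \<noteq> y"
  then obtain h :: "'a \<Rightarrow> real" where h: "\<forall>e\<in>E. continuous_on {0..1} (h \<circ> c e)" "h x \<noteq> h y"
    using separating_function by blast
  obtain A B where AB: "open A" "open B" "h x \<in> A" "h y \<in> B" "A \<inter> B = {}"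
    using hausdorff[OF h(2)] by blast
  show "\<exists>U W. openin (gtop graph) U \<and> openin (gtop graph) W \<and> x \<in> U \<and> y \<in> W \<and> disjnt U W"
  proof (intro exI conjI)
    show "openin (gtop graph) {x \<in> V \<union> \<Union>E. h x \<in> A}" by (rule openin_preimage[OF bspec[OF h(1)] AB(1)])
    show "openin (gtop graph) {x \<in> V \<union> \<Union>E. h x \<in> B}" by (rule openin_preimage[OF bspec[OF h(1)] AB(2)])
  qed (use xy AB in \<open>auto simp: disjnt_def\<close>)
qed

lemma fgraph_graph: "fgraph graph"
proof
  have "disjoint E" by (rule disjointI) (use E_disj in blast)
  moreover have "V \<inter> \<Union>E = {}" using V_E by blast
  ultimately show "finite_graph graph"
    unfolding finite_graph_def
    using Hausdorff_graph finite_V finite_E topspace_graph continuous_c homeomorphic_c c_0 c_1 by simp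
qed

end

section \<open>Folding a graph map\<close>

text \<open>Extended by the identity, \<open>v\<close> becomes a monotone surjection of the line,
  and such a map is continuous.\<close>

lemma mono_bijection_extends:
  fixes v :: "real \<Rightarrow> real"
  assumes mono: "strict_mono_on {0<..<1} v" and im: "v ` {0<..<1} = {0<..<1}"
  shows "\<exists>r. continuous_on {0..1} r \<and> r ` {0..1} = {0..1} \<and> (\<forall>s\<in>{0<..<1}. r s = v s)"
proof -
  define r where "r s = (if s \<in> {0<..<1} then v s else s)" for s
  have v01: "0 < v s" "v s < 1" if "0 < s" "s < 1" for s
  proof -
    have "v s \<in> v ` {0<..<1}" using that by (intro imageI) simp
    then show "0 < v s" "v s < 1" unfolding im by simp_all
  qed
  have rm: "r x \<le> r y" if "x \<le> y" for x y
  proof (cases "x = y")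
    case False
    then have "x < y" using that by simp
    then show ?thesis
      using v01[of x] v01[of y] strict_mono_onD[OF mono, of x y] by (auto simp: r_def)
  qed simp
  have "y \<in> range r" for y
  proof (cases "y \<in> {0<..<1}")
    case True
    then have "y \<in> v ` {0<..<1}" using im by simp
    then obtain s where "s \<in> {0<..<1}" "y = v s" by blast
    then have "y = r s" by (simp add: r_def)
    then show ?thesis by blast
  next
    case False
    then have "y = r y" by (simp only: r_def if_False)
    then show ?thesis by blast
  qed
  then have "range r = UNIV" by blast
  then have "continuous_on UNIV r" using rm by (intro continuous_onI_mono) auto
  then have "continuous_on {0..1} r" using continuous_on_subset by blast
  moreover have "r ` {0..1} = {0..1}"
  proof -
    have eq: "{0..1::real} = insert 0 (insert 1 {0<..<1})" by auto
    have ri: "r ` {0<..<1} = {0<..<1}" using im by (simp add: r_def)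
    have "r 0 = 0" "r 1 = 1" by (simp_all add: r_def)
    then show ?thesis by (simp only: eq image_insert ri)
  qed
  moreover have "\<forall>s\<in>{0<..<1}. r s = v s" by (simp add: r_def)
  ultimately show ?thesis by blast
qed

text \<open>Meant for inverses of homeomorphisms onto open edges, which have to be extended to the
  closed interval. A continuous injection on an interval is monotone; the decreasing case is
  reflected to the increasing one.\<close>

lemma bijection_extends:
  fixes v :: "real \<Rightarrow> real"
  assumes cont: "continuous_on {0<..<1} v" and inj: "inj_on v {0<..<1}" and im: "v ` {0<..<1} = {0<..<1}"
  shows "\<exists>r. continuous_on {0..1} r \<and> r ` {0..1} = {0..1} \<and> (\<forall>s\<in>{0<..<1}. r s = v s)"
proof -
  have "strict_mono_on {0<..<1} v \<or> strict_antimono_on {0<..<1} v"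
    using injective_eq_monotone_map[of "{0<..<1}" v] cont inj by (simp add: is_interval_connected_1)
  then show ?thesis
  proof
    assume "strict_mono_on {0<..<1} v" then show ?thesis using mono_bijection_extends im by blast
  next
    assume anti: "strict_antimono_on {0<..<1} v"
    have sm: "strict_mono_on {0<..<1} (\<lambda>s. 1 - v s)"
      using anti by (auto simp: monotone_on_def)
    have fl: "(\<lambda>y. 1 - y) ` S = S" if S: "\<And>y::real. y \<in> S \<Longrightarrow> 1 - y \<in> S" for S
    proof (intro equalityI subsetI)
      fix y assume "y \<in> S"
      then have "1 - (1 - y) \<in> (\<lambda>y. 1 - y) ` S" using S by blast
      then show "y \<in> (\<lambda>y. 1 - y) ` S" by simp
    next
      fix y assume "y \<in> (\<lambda>y. 1 - y) ` S" then show "y \<in> S" using S by blast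
    qed
    have flip: "(\<lambda>y. 1 - y) ` {0<..<1} = {0<..<1::real}" "(\<lambda>y. 1 - y) ` {0..1} = {0..1::real}"
      by (rule fl, simp)+
    have im2: "(\<lambda>s. 1 - v s) ` {0<..<1} = {0<..<1}"
    proof -
      have "(\<lambda>s. 1 - v s) ` {0<..<1} = (\<lambda>y. 1 - y) ` (v ` {0<..<1})" by (simp only: image_image)
      then show ?thesis unfolding im flip(1) .
    qed
    obtain r where r: "continuous_on {0..1} r" "r ` {0..1} = {0..1}" "\<forall>s\<in>{0<..<1}. r s = 1 - v s"
      using mono_bijection_extends[OF sm im2] by blast
    show ?thesis
    proof (intro exI conjI ballI)
      show "continuous_on {0..1} (\<lambda>s. 1 - r s)" using r(1) by (intro continuous_intros)
      show "(\<lambda>s. 1 - r s) ` {0..1} = {0..1}" proof -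
        have "(\<lambda>s. 1 - r s) ` {0..1} = (\<lambda>y. 1 - y) ` (r ` {0..1})" by (simp only: image_image)
        then show ?thesis unfolding r(2) flip(2) .
      qed
      show "1 - r s = v s" if "s \<in> {0<..<1}" for s using r(3) that by simp
    qed
  qed
qed

section \<open>Points identified under a graph map\<close>

locale folding = G: fgraph G + H: fgraph H
  for G :: "'a cw_graph" and H :: "'b cw_graph" +
  fixes g :: "'a \<Rightarrow> 'b"
  assumes g_map: "graph_map G H g"
begin

lemma g_continuous: "continuous_map (gtop G) (gtop H) g"
  and g_verts: "v \<in> verts G \<Longrightarrow> g v \<in> verts H"
  and g_regular: "e \<in> edges G \<Longrightarrow> H.regular_path (g \<circ> charmap G e)"
  using g_map unfolding graph_map_iff_regular[OF G.fgraph_axioms H.fgraph_axioms] by auto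

text \<open>Points are identified when a path between them becomes null-homotopic under \<open>g\<close>. This is the
  folded graph through which \<open>g\<close> factors with the second factor injective on fundamental groups.\<close>

definition rel :: "'a \<Rightarrow> 'a \<Rightarrow> bool" where
  "rel z w \<longleftrightarrow> (\<exists>a. path_from_to (gtop G) z w a \<and> path_homotopic (gtop H) (g \<circ> a) (\<lambda>_. g z))"

lemma rel_in: "rel z w \<Longrightarrow> z \<in> topspace (gtop G) \<and> w \<in> topspace (gtop G)"
  unfolding rel_def path_from_to_def using path_start_in_topspace path_finish_in_topspace by blast

lemma rel_refl:
  assumes "z \<in> topspace (gtop G)"
  shows "rel z z"
  unfolding rel_def
proof (intro exI conjI)
  show "path_from_to (gtop G) z z (\<lambda>_. z)" using assms by (simp add: path_from_to_def)
  show "path_homotopic (gtop H) (g \<circ> (\<lambda>_. z)) (\<lambda>_. g z)"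
    using funcset_mem[OF continuous_map_funspace[OF g_continuous] assms]
    by (simp add: comp_path_const path_homotopic_refl)
qed

lemma rel_g:
  assumes "rel z w"
  shows "g z = g w"
proof -
  obtain a where "path_from_to (gtop G) z w a" "path_homotopic (gtop H) (g \<circ> a) (\<lambda>_. g z)"
    using assms unfolding rel_def by blast
  then show ?thesis using path_homotopicD(4)[of "gtop H" "g \<circ> a" "\<lambda>_. g z"] by (simp add: path_from_to_def)
qed

lemma rel_sym:
  assumes "rel z w"
  shows "rel w z"
proof -
  obtain a where a: "path_from_to (gtop G) z w a" "path_homotopic (gtop H) (g \<circ> a) (\<lambda>_. g z)"
    using assms unfolding rel_def by blast
  have "path_homotopic (gtop H) (path_reverse (g \<circ> a)) (path_reverse (\<lambda>_. g z))"
    by (rule path_homotopic_reverse[OF a(2)])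
  then have "path_homotopic (gtop H) (g \<circ> path_reverse a) (\<lambda>_. g w)"
    unfolding comp_path_reverse by (simp add: path_reverse_def rel_g[OF assms])
  then show ?thesis using path_from_to_reverse[OF a(1)] unfolding rel_def by blast
qed

lemma rel_trans:
  assumes "rel z w" "rel w y"
  shows "rel z y"
proof -
  obtain a where a: "path_from_to (gtop G) z w a" "path_homotopic (gtop H) (g \<circ> a) (\<lambda>_. g z)"
    using assms(1) unfolding rel_def by blast
  obtain b where b: "path_from_to (gtop G) w y b" "path_homotopic (gtop H) (g \<circ> b) (\<lambda>_. g w)"
    using assms(2) unfolding rel_def by blast
  have "path_homotopic (gtop H) (path_join (g \<circ> a) (g \<circ> b)) (path_join (\<lambda>_. g z) (\<lambda>_. g z))"
    using a b rel_g[OF assms(1)] by (intro path_homotopic_join) (simp_all add: path_from_to_def)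
  then have "path_homotopic (gtop H) (g \<circ> path_join a b) (\<lambda>_. g z)"
    unfolding comp_path_join by (simp add: path_join_def)
  then show ?thesis using path_from_to_join[OF a(1) b(1)] unfolding rel_def by blast
qed

definition cls :: "'a \<Rightarrow> 'a set" where "cls z = {w. rel z w}"

definition proj :: "'a set \<Rightarrow> 'b" where "proj C = g (SOME z. z \<in> C)"

lemma cls_eq_iff:
  assumes "z \<in> topspace (gtop G)" "w \<in> topspace (gtop G)"
  shows "cls z = cls w \<longleftrightarrow> rel z w"
proof
  assume "cls z = cls w"
  moreover have "w \<in> cls w" using rel_refl[OF assms(2)] by (simp add: cls_def)
  ultimately have "w \<in> cls z" by simp
  then show "rel z w" by (simp add: cls_def)
next
  assume r: "rel z w"
  show "cls z = cls w" unfolding cls_def using r rel_sym rel_trans by blast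
qed

lemma proj_cls:
  assumes "z \<in> topspace (gtop G)"
  shows "proj (cls z) = g z"
proof -
  have "z \<in> cls z" using rel_refl[OF assms] by (simp add: cls_def)
  then have "(SOME z'. z' \<in> cls z) \<in> cls z" by (rule someI)
  then have "rel z (SOME z'. z' \<in> cls z)" unfolding cls_def by simp
  then show ?thesis using rel_g unfolding proj_def by simp
qed

text \<open>An arc over the edge \<open>d\<close> that keeps the time of the characteristic map, so
  that two such arcs can be compared at equal times, endpoints included.\<close>

definition is_lift :: "'b set \<Rightarrow> (real \<Rightarrow> 'a) \<Rightarrow> bool" where
  "is_lift d \<kappa> \<longleftrightarrow> d \<in> edges H \<and> pathin (gtop G) \<kappa> \<and> (\<forall>t\<in>{0..1}. g (\<kappa> t) = charmap H d t)"

lemma is_liftD: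
  assumes "is_lift d \<kappa>"
  shows "d \<in> edges H" "pathin (gtop G) \<kappa>" "t \<in> {0..1} \<Longrightarrow> g (\<kappa> t) = charmap H d t"
    "t \<in> {0..1} \<Longrightarrow> \<kappa> t \<in> topspace (gtop G)"
  using assms funcset_mem[OF path_image_subset_topspace] unfolding is_lift_def by blast+

text \<open>Travelling along \<open>\<kappa>\<close> from \<open>s'\<close> to \<open>s\<close>,
  across, and along \<open>\<kappa>'\<close> from \<open>s\<close> to \<open>s'\<close> has as image
  a segment of \<open>d\<close> run there and back. So two arcs over an edge are identified at all
  times as soon as they are at one time, even at an end.\<close>

lemma is_lift_rel:
  assumes \<kappa>: "is_lift d \<kappa>" and \<kappa>': "is_lift d \<kappa>'" and s: "s \<in> {0..1}" "s' \<in> {0..1}" and r: "rel (\<kappa> s) (\<kappa>' s)"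
  shows "rel (\<kappa> s') (\<kappa>' s')"
proof -
  obtain a where a: "path_from_to (gtop G) (\<kappa> s) (\<kappa>' s) a" "path_homotopic (gtop H) (g \<circ> a) (\<lambda>_. g (\<kappa> s))"
    using r unfolding rel_def by blast
  let ?c = "charmap H d"
  have d: "d \<in> edges H" using is_liftD(1)[OF \<kappa>] .
  have sub: "path_homotopic (gtop H) (g \<circ> subpath x y k) (subpath x y ?c)"
    if k: "is_lift d k" and xy: "x \<in> {0..1}" "y \<in> {0..1}" for k x y
  proof (rule path_homotopic_eq)
    show "pathin (gtop H) (g \<circ> subpath x y k)"
      using is_liftD(2)[OF k] xy by (intro pathin_compose[OF _ g_continuous] pathin_subpath)
    fix t :: real assume "t \<in> {0..1}"
    then show "(g \<circ> subpath x y k) t = subpath x y ?c t"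
      using is_liftD(3)[OF k segment_param_in[OF xy]] by (simp add: subpath_def)
  qed
  have p: "path_from_to (gtop G) (\<kappa> s') (\<kappa> s) (subpath s' s \<kappa>)" "path_from_to (gtop G) (\<kappa>' s) (\<kappa>' s') (subpath s s' \<kappa>')"
    using s pathin_subpath[OF is_liftD(2)[OF \<kappa>]] pathin_subpath[OF is_liftD(2)[OF \<kappa>']] by (simp_all add: path_from_to_def)
  let ?b = "path_join (subpath s' s \<kappa>) (path_join a (subpath s s' \<kappa>'))"
  have pc: "pathin (gtop H) (subpath s s' ?c)" "pathin (gtop H) (subpath s' s ?c)"
    using pathin_subpath[OF H.pathin_ch[OF d]] s by blast+
  have gs: "g (\<kappa> s) = ?c s" "g (\<kappa>' s) = ?c s" "g (\<kappa> s') = ?c s'"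
    using is_liftD(3)[OF \<kappa> s(1)] is_liftD(3)[OF \<kappa>' s(1)] is_liftD(3)[OF \<kappa> s(2)] .
  have "path_homotopic (gtop H) (g \<circ> ?b) (path_join (subpath s' s ?c) (path_join (\<lambda>_. ?c s) (subpath s s' ?c)))"
    unfolding comp_path_join using a p gs
    by (intro path_homotopic_join sub \<kappa> \<kappa>' s) (simp_all add: path_from_to_def)
  also have "path_homotopic (gtop H) \<dots> (path_join (subpath s' s ?c) (subpath s s' ?c))"
    using pc by (intro path_homotopic_join path_homotopic_refl path_homotopic_const_left) simp_all
  also have "path_homotopic (gtop H) \<dots> (subpath s' s' ?c)"
    by (rule path_homotopic_subpath_join[OF H.pathin_ch[OF d] s(2,1,2)])
  also have "subpath s' s' ?c = (\<lambda>_. g (\<kappa> s'))" by (simp add: subpath_def gs)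
  finally show ?thesis
    unfolding rel_def using path_from_to_join[OF p(1) path_from_to_join[OF a(1) p(2)]] by blast
qed

text \<open>The inverse of the homeomorphism on the open gap extends continuously to the closed
  interval, and the lifting equation extends by density because \<open>H\<close> is
  Hausdorff.\<close>

lemma gap_lift:
  assumes e: "e \<in> edges G" and ab: "0 \<le> a" "a < b" "b \<le> 1" and d: "d \<in> edges H"
    and im: "(g \<circ> charmap G e) ` {a<..<b} = d" and inj: "inj_on (g \<circ> charmap G e) {a<..<b}"
  shows "\<exists>\<tau>. continuous_on {0..1} \<tau> \<and> \<tau> ` {0..1} = {a..b} \<and> is_lift d (charmap G e \<circ> \<tau>)"
proof -
  let ?c = "g \<circ> charmap G e" and ?J = "{a<..<b}"
  have pc: "pathin (gtop H) ?c" by (rule pathin_compose[OF G.pathin_ch[OF e] g_continuous])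
  have "homeomorphic_map (top_of_set ?J) (subtopology (gtop H) d) ?c"
    using H.homeomorphic_map_onto_edge_iff[OF pc ab d] im inj by blast
  then obtain u where u: "homeomorphic_maps (top_of_set ?J) (subtopology (gtop H) d) ?c u"
    using homeomorphic_map_maps by blast
  have topd: "topspace (subtopology (gtop H) d) = d" using H.edge_subset[OF d] by (simp add: Int_absorb1)
  have uc: "continuous_map (subtopology (gtop H) d) (top_of_set ?J) u"
    and uinv: "\<And>y. y \<in> d \<Longrightarrow> ?c (u y) = y" "\<And>t. t \<in> ?J \<Longrightarrow> u (?c t) = t"
    using u unfolding homeomorphic_maps_def topd by auto
  \<comment> \<open>The inverse, rescaled from the gap to the unit interval, so that
    \<open>bijection_extends\<close> applies.\<close>
  define w where "w s = (u (charmap H d s) - a) / (b - a)" for s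
  have uJ: "u (charmap H d s) \<in> ?J" if "s \<in> {0<..<1}" for s
  proof -
    have "charmap H d s \<in> topspace (subtopology (gtop H) d)" unfolding topd using H.ch_mem[OF d, of s] that by simp
    then show ?thesis using funcset_mem[OF continuous_map_funspace[OF uc]] by fastforce
  qed
  have "continuous_map (top_of_set {0<..<1}) (top_of_set ?J) (u \<circ> charmap H d)"
    by (rule continuous_map_compose[OF homeomorphic_imp_continuous_map[OF H.ch_homeo[OF d]] uc])
  then have wc: "continuous_on {0<..<1} w"
    unfolding w_def using ab by (auto simp: o_def intro!: continuous_intros)
  have wu: "a + w s * (b - a) = u (charmap H d s)" for s using ab by (simp add: w_def)
  have winj: "inj_on w {0<..<1}"
  proof (rule inj_onI)
    fix x y :: real assume xy: "x \<in> {0<..<1}" "y \<in> {0<..<1}" "w x = w y"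
    then have "u (charmap H d x) = u (charmap H d y)" using wu[of x] wu[of y] by simp
    moreover have "charmap H d x \<in> d" "charmap H d y \<in> d"
      using xy H.ch_mem[OF d] by simp_all
    ultimately have "charmap H d x = charmap H d y"
      using uinv(1)[of "charmap H d x"] uinv(1)[of "charmap H d y"] by simp
    then show "x = y" using inj_onD[OF H.ch_inj[OF d]] xy by blast
  qed
  have wim: "w ` {0<..<1} = {0<..<1}"
  proof (intro equalityI subsetI)
    fix y assume "y \<in> w ` {0<..<1}"
    then obtain s where "s \<in> {0<..<1}" "y = w s" by blast
    then show "y \<in> {0<..<1}" using uJ[of s] ab by (simp add: w_def)
  next
    fix y :: real assume y: "y \<in> {0<..<1}"
    define t where "t = a + y * (b - a)"
    have "0 < y * (b - a)" using y ab by simp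
    moreover have "y * (b - a) < 1 * (b - a)" using y ab by (intro mult_strict_right_mono) simp_all
    ultimately have t: "t \<in> ?J" by (simp add: t_def)
    then have "?c t \<in> d" using im by blast
    then have "?c t \<in> charmap H d ` {0<..<1}" using H.ch_image[OF d] by simp
    then obtain s where s: "s \<in> {0<..<1}" "?c t = charmap H d s" by blast
    have "w s = y" using uinv(2)[OF t] s(2) ab by (simp add: w_def t_def)
    then show "y \<in> w ` {0<..<1}" using s(1) by blast
  qed
  obtain r where r: "continuous_on {0..1} r" "r ` {0..1} = {0..1}" "\<forall>s\<in>{0<..<1}. r s = w s"
    using bijection_extends[OF wc winj wim] by blast
  define \<tau> where "\<tau> s = a + r s * (b - a)" for s
  have \<tau>c: "continuous_on {0..1} \<tau>" unfolding \<tau>_def using r(1) by (intro continuous_intros)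
  have \<tau>im: "\<tau> ` {0..1} = {a..b}"
  proof -
    have "(\<lambda>t. (b - a) * t + a) ` {0..1} = {a..b}"
      using image_affinity_atLeastAtMost[of "b - a" a 0 1] ab by simp
    moreover have "\<tau> ` {0..1} = (\<lambda>t. (b - a) * t + a) ` (r ` {0..1})"
      unfolding image_image \<tau>_def by (simp add: algebra_simps)
    ultimately show ?thesis using r(2) by simp
  qed
  have \<kappa>: "pathin (gtop G) (charmap G e \<circ> \<tau>)"
    by (rule pathin_compose_real[OF G.ch_continuous[OF e] \<tau>c]) (use \<tau>im ab in auto)
  have "g ((charmap G e \<circ> \<tau>) t) = charmap H d t" if t: "t \<in> {0..1}" for t
  proof -
    have "(g \<circ> (charmap G e \<circ> \<tau>)) t = charmap H d t"
    proof (rule forall_in_closure_of_eq[where X="top_of_set {0..1}" and S="{0<..<1}"])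
      have int: "{0..1} \<inter> {0<..<1} = {0<..<1::real}" by auto
      show "t \<in> top_of_set {0..1} closure_of {0<..<1}"
        unfolding closure_of_subtopology int using t by simp
      show "continuous_map (top_of_set {0..1}) (gtop H) (g \<circ> (charmap G e \<circ> \<tau>))"
        using pathin_compose[OF \<kappa> g_continuous] by (simp add: pathin_def)
      fix s :: real assume s: "s \<in> {0<..<1}"
      then have "\<tau> s = u (charmap H d s)" using r(3) wu by (simp add: \<tau>_def)
      then show "(g \<circ> (charmap G e \<circ> \<tau>)) s = charmap H d s"
        using uinv(1)[OF H.ch_mem[OF d, of s]] s by simp
    qed (use H.Hausdorff H.ch_continuous[OF d] in auto)
    then show ?thesis by simp
  qed
  then have "is_lift d (charmap G e \<circ> \<tau>)" using d \<kappa> by (simp add: is_lift_def)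
  with \<tau>c \<tau>im show ?thesis by blast
qed

section \<open>The folded graph\<close>

definition lift_image :: "(real \<Rightarrow> 'a) \<Rightarrow> 'a set set" where
  "lift_image \<kappa> = (\<lambda>t. cls (\<kappa> t)) ` {0<..<1}"

definition fold_edges :: "'a set set set" where
  "fold_edges = {e. \<exists>d \<kappa>. is_lift d \<kappa> \<and> e = lift_image \<kappa>}"

definition fold_verts :: "'a set set" where
  "fold_verts = cls ` {z \<in> topspace (gtop G). g z \<in> verts H}"

text \<open>One arc per edge is chosen to provide the characteristic map. By
  \<open>lift_match\<close> the choice affects neither the edge below nor the class at a given
  time.\<close>

definition lift_of :: "'a set set \<Rightarrow> 'b set \<times> (real \<Rightarrow> 'a)" where
  "lift_of e = (SOME (d, \<kappa>). is_lift d \<kappa> \<and> e = lift_image \<kappa>)"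

definition proj_edge :: "'a set set \<Rightarrow> 'b set" where "proj_edge e = fst (lift_of e)"

definition fold_ch :: "'a set set \<Rightarrow> real \<Rightarrow> 'a set" where "fold_ch e t = cls (snd (lift_of e) t)"

lemma lift_of:
  assumes "e \<in> fold_edges"
  shows "is_lift (proj_edge e) (snd (lift_of e))" "e = lift_image (snd (lift_of e))"
proof -
  have "\<exists>x. (\<lambda>(d, \<kappa>). is_lift d \<kappa> \<and> e = lift_image \<kappa>) x" using assms unfolding fold_edges_def by auto
  from someI_ex[OF this] show "is_lift (proj_edge e) (snd (lift_of e))" "e = lift_image (snd (lift_of e))"
    unfolding proj_edge_def lift_of_def[symmetric] by (auto simp: case_prod_unfold)
qed

text \<open>Applying \<open>g\<close> to the common class gives one interior point of an edge of
  \<open>H\<close>, which determines the edge and the time; \<open>is_lift_rel\<close> then spreads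
  the agreement to all times.\<close>

lemma lift_match:
  assumes \<kappa>: "is_lift d \<kappa>" and \<kappa>': "is_lift d' \<kappa>'" and s: "s \<in> {0<..<1}" "s' \<in> {0<..<1}"
    and eq: "cls (\<kappa> s) = cls (\<kappa>' s')"
  shows "d = d'" "s = s'" "t \<in> {0..1} \<Longrightarrow> cls (\<kappa> t) = cls (\<kappa>' t)"
proof -
  have s01: "s \<in> {0..1}" "s' \<in> {0..1}" using s by simp_all
  have r: "rel (\<kappa> s) (\<kappa>' s')" using eq cls_eq_iff is_liftD(4)[OF \<kappa> s01(1)] is_liftD(4)[OF \<kappa>' s01(2)] by blast
  have "charmap H d s = charmap H d' s'"
    using rel_g[OF r] is_liftD(3)[OF \<kappa> s01(1)] is_liftD(3)[OF \<kappa>' s01(2)] by simp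
  then show ds: "d = d'" "s = s'"
    using H.ch_eq_iff[OF is_liftD(1)[OF \<kappa>] is_liftD(1)[OF \<kappa>'], of s s'] s by auto
  show "cls (\<kappa> t) = cls (\<kappa>' t)" if t: "t \<in> {0..1}"
    using is_lift_rel[of d \<kappa> \<kappa>' s t] \<kappa> \<kappa>' s01 t r ds cls_eq_iff is_liftD(4)[OF \<kappa> t] is_liftD(4)[OF \<kappa>' t] by simp
qed

lemma lift_image_eq:
  assumes \<kappa>: "is_lift d \<kappa>"
  shows "lift_image \<kappa> \<in> fold_edges" "proj_edge (lift_image \<kappa>) = d"
    "t \<in> {0..1} \<Longrightarrow> fold_ch (lift_image \<kappa>) t = cls (\<kappa> t)"
proof -
  show e: "lift_image \<kappa> \<in> fold_edges" using \<kappa> by (auto simp: fold_edges_def)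
  let ?e = "lift_image \<kappa>" and ?k = "snd (lift_of (lift_image \<kappa>))"
  note k = lift_of[OF e]
  have "cls (\<kappa> (1/2)) \<in> lift_image ?k" using k(2) unfolding lift_image_def[of \<kappa>] by force
  then obtain s where s: "s \<in> {0<..<1}" "cls (\<kappa> (1/2)) = cls (?k s)" unfolding lift_image_def[of ?k] by blast
  have half: "1/2 \<in> {0<..<1::real}" by simp
  note m = lift_match[OF \<kappa> k(1) half s]
  show "proj_edge ?e = d" using m(1) by simp
  show "fold_ch ?e t = cls (\<kappa> t)" if "t \<in> {0..1}" using m(3)[OF that] by (simp add: fold_ch_def)
qed

lemma finite_preimage:
  assumes "finite M"
  shows "finite {z \<in> topspace (gtop G). g z \<in> M}"
proof -
  have "finite (\<Union>e\<in>edges G. charmap G e ` (\<Union>m\<in>M. {t \<in> {0..1}. (g \<circ> charmap G e) t = m}))"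
    using assms G.finite_edges H.regular_path_finite_fibre[OF g_regular] by (intro finite_UN_I finite_imageI) simp_all
  moreover have "{z \<in> topspace (gtop G). g z \<in> M} \<subseteq>
      verts G \<union> (\<Union>e\<in>edges G. charmap G e ` (\<Union>m\<in>M. {t \<in> {0..1}. (g \<circ> charmap G e) t = m}))"
  proof
    fix z assume z: "z \<in> {z \<in> topspace (gtop G). g z \<in> M}"
    then have "z \<in> topspace (gtop G)" by simp
    then show "z \<in> verts G \<union> (\<Union>e\<in>edges G. charmap G e ` (\<Union>m\<in>M. {t \<in> {0..1}. (g \<circ> charmap G e) t = m}))"
    proof (cases rule: G.point_cases)
      case (2 e t)
      then have "t \<in> (\<Union>m\<in>M. {t \<in> {0..1}. (g \<circ> charmap G e) t = m})" using z by simp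
      then show ?thesis using 2(1,4) by blast
    qed simp
  qed
  ultimately show ?thesis by (rule rev_finite_subset[OF finite_UnI[OF G.finite_verts]])
qed

lemma fold_ch_props:
  assumes e: "e \<in> fold_edges"
  shows "fold_ch e ` {0<..<1} = e" "inj_on (fold_ch e) {0<..<1}" "fold_ch e 0 \<in> fold_verts" "fold_ch e 1 \<in> fold_verts"
proof -
  let ?k = "snd (lift_of e)"
  note k = lift_of[OF e]
  have "fold_ch e = (\<lambda>t. cls (?k t))" by (rule ext) (rule fold_ch_def)
  then show "fold_ch e ` {0<..<1} = e" by (simp only: k(2)[unfolded lift_image_def, symmetric])
  show "inj_on (fold_ch e) {0<..<1}"
  proof (rule inj_onI)
    fix x y :: real assume "x \<in> {0<..<1}" "y \<in> {0<..<1}" "fold_ch e x = fold_ch e y"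
    then show "x = y" using lift_match(2)[OF k(1) k(1)] by (simp add: fold_ch_def)
  qed
  show "fold_ch e 0 \<in> fold_verts" "fold_ch e 1 \<in> fold_verts"
    using is_liftD(3,4)[OF k(1), of 0] is_liftD(3,4)[OF k(1), of 1] H.ch_0 H.ch_1 is_liftD(1)[OF k(1)]
    by (auto simp: fold_verts_def fold_ch_def)
qed

lemma fold_edge_cases:
  assumes e: "e \<in> fold_edges" and x: "x \<in> e"
  obtains s where "s \<in> {0<..<1}" "x = cls (snd (lift_of e) s)"
proof -
  have "x \<in> (\<lambda>t. cls (snd (lift_of e) t)) ` {0<..<1}"
    by (rule subst[where P="\<lambda>S. x \<in> S", OF lift_of(2)[OF e, unfolded lift_image_def] x])
  then show ?thesis by (rule imageE) (rule that)
qed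

lemma fold_edges_disjoint:
  assumes e: "e \<in> fold_edges" "e' \<in> fold_edges" and x: "x \<in> e" "x \<in> e'"
  shows "e = e'"
proof -
  note k = lift_of[OF e(1)] and k' = lift_of[OF e(2)]
  obtain s where s: "s \<in> {0<..<1}" "x = cls (snd (lift_of e) s)" by (rule fold_edge_cases[OF e(1) x(1)])
  obtain s' where s': "s' \<in> {0<..<1}" "x = cls (snd (lift_of e') s')" by (rule fold_edge_cases[OF e(2) x(2)])
  have "cls (snd (lift_of e) s) = cls (snd (lift_of e') s')" using s(2) s'(2) by simp
  note m = lift_match(3)[OF k(1) k'(1) s(1) s'(1) this]
  have "lift_image (snd (lift_of e)) = lift_image (snd (lift_of e'))"
    unfolding lift_image_def using m by (intro image_cong) simp_all
  then show ?thesis using k(2) k'(2) by simp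
qed

sublocale D: graph_data fold_verts fold_edges fold_ch
proof
  show "finite fold_verts"
    unfolding fold_verts_def using finite_preimage[OF H.finite_verts] by (rule finite_imageI)
  have half: "1/2 \<in> {0<..<1::real}" "1/2 \<in> {0..1::real}" by simp_all
  \<comment> \<open>Disjoint edges have distinct midpoints, and these are classes of the finitely
    many points over midpoints of edges of \<open>H\<close>.\<close>
  let ?M = "(\<lambda>d. charmap H d (1/2)) ` edges H"
  have "(\<lambda>e. fold_ch e (1/2)) ` fold_edges \<subseteq> cls ` {z \<in> topspace (gtop G). g z \<in> ?M}"
  proof (rule image_subsetI)
    fix e assume e: "e \<in> fold_edges"
    note k = lift_of(1)[OF e]
    show "fold_ch e (1/2) \<in> cls ` {z \<in> topspace (gtop G). g z \<in> ?M}"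
      unfolding fold_ch_def using is_liftD(1)[OF k] is_liftD(3,4)[OF k half(2)] by (intro imageI) simp
  qed
  then have "finite ((\<lambda>e. fold_ch e (1/2)) ` fold_edges)"
    by (rule finite_subset) (intro finite_imageI finite_preimage H.finite_edges)
  moreover have "inj_on (\<lambda>e. fold_ch e (1/2)) fold_edges"
  proof (rule inj_onI)
    fix e e' assume e: "e \<in> fold_edges" "e' \<in> fold_edges" "fold_ch e (1/2) = fold_ch e' (1/2)"
    have "fold_ch e (1/2) \<in> e" "fold_ch e' (1/2) \<in> e'" using fold_ch_props(1) e(1,2) half(1) by blast+
    then show "e = e'" using fold_edges_disjoint[OF e(1,2)] e(3) by simp
  qed
  ultimately show "finite fold_edges" by (rule finite_imageD)
  fix e assume e: "e \<in> fold_edges"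
  show "inj_on (fold_ch e) {0<..<1}" "fold_ch e ` {0<..<1} = e" "fold_ch e 0 \<in> fold_verts" "fold_ch e 1 \<in> fold_verts"
    using fold_ch_props[OF e] by blast+
  show "e = e'" if "e' \<in> fold_edges" "x \<in> e" "x \<in> e'" for e' x
    using fold_edges_disjoint[OF e] that by blast
  show "v \<notin> e" if v: "v \<in> fold_verts" for v
  proof
    assume ve: "v \<in> e"
    obtain s where s: "s \<in> {0<..<1}" "v = cls (snd (lift_of e) s)" by (rule fold_edge_cases[OF e ve])
    obtain z where z: "z \<in> topspace (gtop G)" "g z \<in> verts H" "v = cls z" using v unfolding fold_verts_def by blast
    note k = lift_of(1)[OF e]
    have s01: "s \<in> {0..1}" using s(1) by simp
    have "rel z (snd (lift_of e) s)" using s z cls_eq_iff is_liftD(4)[OF k s01] by simp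
    then have "charmap H (proj_edge e) s \<in> verts H" using rel_g is_liftD(3)[OF k s01] z(2) by simp
    then show False using H.vert_not_in_edge H.ch_mem[of "proj_edge e" s] is_liftD(1)[OF k] s(1) by simp
  qed
qed

abbreviation "Q \<equiv> D.graph"

sublocale Q: fgraph Q by (rule D.fgraph_graph)

lemma lift_through:
  assumes z: "z \<in> topspace (gtop G)" and d: "d \<in> edges H" "g z \<in> d"
  shows "\<exists>\<kappa> s. is_lift d \<kappa> \<and> 0 < s \<and> s < 1 \<and> \<kappa> s = z"
proof -
  have "g z \<notin> verts H" using H.vert_not_in_edge d by blast
  then have "z \<notin> verts G" using g_verts by blast
  with z obtain e t where e: "e \<in> edges G" "0 < t" "t < 1" "z = charmap G e t" by (cases rule: G.point_cases) auto
  let ?c = "g \<circ> charmap G e"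
  have pc: "pathin (gtop H) ?c" by (rule pathin_compose[OF G.pathin_ch[OF e(1)] g_continuous])
  obtain ts where ts: "H.path_subdivision ?c ts" using H.regular_path_iff[OF pc] g_regular[OF e(1)] by blast
  have hl: "ts \<noteq> []" "hd ts = 0" "last ts = 1" using ts by (simp_all add: H.path_subdivision_def)
  have "t \<notin> set ts"
    using H.path_subdivision_verts(1)[OF pc ts] e(4) \<open>g z \<notin> verts H\<close> by (auto simp: H.vert_times_def)
  then obtain i where i: "Suc i < length ts" "ts ! i < t" "t < ts ! Suc i"
    using H.gap_exists[OF hl(1), of t] hl e by auto
  note im = H.path_subdivision_image[OF pc ts i(1)]
  have "?c t \<in> ?c ` {ts ! i<..<ts ! Suc i}" using i by (intro imageI) simp
  then have "?c ` {ts ! i<..<ts ! Suc i} = d" using H.edge_unique[OF im(4) d(1)] d(2) e(4) by simp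
  from gap_lift[OF e(1) im(1-3) d(1) this im(5)]
  obtain \<tau> where \<tau>: "\<tau> ` {0..1} = {ts ! i..ts ! Suc i}" "is_lift d (charmap G e \<circ> \<tau>)" by blast
  have "t \<in> \<tau> ` {0..1}" using \<tau>(1) i by simp
  then obtain s where s: "s \<in> {0..1}" "t = \<tau> s" by blast
  have "charmap H d s \<in> d" using is_liftD(3)[OF \<tau>(2) s(1)] d(2) e(4) s(2) by simp
  then have "0 < s" "s < 1" using H.ch_in_edge_iff[OF d(1) d(1), of s] s(1) by simp_all
  then show ?thesis using \<tau>(2) s(2) e(4) by (intro exI[of _ "charmap G e \<circ> \<tau>"] exI[of _ s]) simp
qed

lemma cls_cases:
  assumes z: "z \<in> topspace (gtop G)"
  shows "g z \<in> verts H \<and> cls z \<in> fold_verts \<or> (\<exists>\<kappa> s d. is_lift d \<kappa> \<and> 0 < s \<and> s < 1 \<and> \<kappa> s = z \<and> cls z \<in> lift_image \<kappa>)"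
proof (cases "g z \<in> verts H")
  case True then show ?thesis using z by (auto simp: fold_verts_def)
next
  case False
  have "g z \<in> topspace (gtop H)" using funcset_mem[OF continuous_map_funspace[OF g_continuous] z] .
  then obtain d where d: "d \<in> edges H" "g z \<in> d" using False H.topspace_eq by blast
  obtain \<kappa> s where \<kappa>: "is_lift d \<kappa>" "0 < s" "s < 1" "\<kappa> s = z" using lift_through[OF z d] by blast
  then have "cls z \<in> lift_image \<kappa>" unfolding lift_image_def by (intro image_eqI[of _ _ s]) auto
  then show ?thesis using \<kappa> by blast
qed

lemma topspace_fold: "topspace (gtop Q) = cls ` topspace (gtop G)"
proof (intro equalityI subsetI)
  fix x assume "x \<in> topspace (gtop Q)"
  then consider "x \<in> fold_verts" | e where "e \<in> fold_edges" "x \<in> e" using D.topspace_graph by auto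
  then show "x \<in> cls ` topspace (gtop G)"
  proof cases
    case 1 then show ?thesis by (auto simp: fold_verts_def)
  next
    case 2
    obtain s where s: "s \<in> {0<..<1}" "x = cls (snd (lift_of e) s)" by (rule fold_edge_cases[OF 2])
    then show ?thesis using is_liftD(4)[OF lift_of(1)[OF 2(1)], of s] by simp
  qed
next
  fix x assume "x \<in> cls ` topspace (gtop G)"
  then obtain z where z: "z \<in> topspace (gtop G)" "x = cls z" by blast
  show "x \<in> topspace (gtop Q)"
    unfolding D.topspace_graph using cls_cases[OF z(1)] z(2) lift_image_eq(1) by blast
qed

text \<open>Tested on the closed edges of \<open>G\<close>, whose gaps are reparametrized by lifts.
  Along a lift \<open>cls\<close> is a characteristic map of the folded graph, and the
  reparametrization carries compact preimages to compact sets.\<close>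

lemma continuous_cls: "continuous_map (gtop G) (gtop Q) cls"
  unfolding continuous_map_closedin
proof (intro conjI allI impI)
  show "cls \<in> topspace (gtop G) \<rightarrow> topspace (gtop Q)" using topspace_fold by blast
  fix C assume C: "closedin (gtop Q) C"
  show "closedin (gtop G) {z \<in> topspace (gtop G). cls z \<in> C}"
  proof (rule G.closedin_coherent)
    fix e assume e: "e \<in> edges G"
    let ?c = "g \<circ> charmap G e"
    have pc: "pathin (gtop H) ?c" by (rule pathin_compose[OF G.pathin_ch[OF e] g_continuous])
    obtain ts where ts: "H.path_subdivision ?c ts" using H.regular_path_iff[OF pc] g_regular[OF e] by blast
    have hl: "ts \<noteq> []" "hd ts = 0" "last ts = 1" using ts by (simp_all add: H.path_subdivision_def)
    let ?S = "{t \<in> {0..1}. charmap G e t \<in> {z \<in> topspace (gtop G). cls z \<in> C}}"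
    have gap: "closed {t \<in> {ts ! i..ts ! Suc i}. cls (charmap G e t) \<in> C}" if i: "Suc i < length ts" for i
    proof -
      note im = H.path_subdivision_image[OF pc ts i]
      from gap_lift[OF e im(1-4) refl im(5)] obtain \<tau> where
        \<tau>: "continuous_on {0..1} \<tau>" "\<tau> ` {0..1} = {ts ! i..ts ! Suc i}" "is_lift (?c ` {ts ! i<..<ts ! Suc i}) (charmap G e \<circ> \<tau>)"
        by blast
      note l = lift_image_eq[OF \<tau>(3)]
      have "closedin (top_of_set {0..1}) {s \<in> topspace (top_of_set {0..1}). fold_ch (lift_image (charmap G e \<circ> \<tau>)) s \<in> C}"
        by (rule closedin_continuous_map_preimage[OF D.continuous_c[OF l(1)] C])
      then have "compact {s \<in> {0..1}. fold_ch (lift_image (charmap G e \<circ> \<tau>)) s \<in> C}"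
        using closedin_compact[of "{0..1::real}"] by simp
      moreover have "{s \<in> {0..1}. fold_ch (lift_image (charmap G e \<circ> \<tau>)) s \<in> C} = {s \<in> {0..1}. cls (charmap G e (\<tau> s)) \<in> C}"
        using l(3) by auto
      ultimately have "compact {s \<in> {0..1}. cls (charmap G e (\<tau> s)) \<in> C}" by simp
      then have "compact (\<tau> ` {s \<in> {0..1}. cls (charmap G e (\<tau> s)) \<in> C})"
        by (intro compact_continuous_image continuous_on_subset[OF \<tau>(1)]) auto
      moreover have "\<tau> ` {s \<in> {0..1}. cls (charmap G e (\<tau> s)) \<in> C} = {t \<in> {ts ! i..ts ! Suc i}. cls (charmap G e t) \<in> C}"
        unfolding \<tau>(2)[symmetric] by blast
      ultimately show ?thesis using compact_imp_closed by simp
    qed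
    have "?S = (\<Union>i\<in>{i. Suc i < length ts}. {t \<in> {ts ! i..ts ! Suc i}. cls (charmap G e t) \<in> C})"
    proof (intro equalityI subsetI)
      fix t assume t: "t \<in> ?S"
      have "\<exists>i. Suc i < length ts \<and> t \<in> {ts ! i..ts ! Suc i}"
      proof (cases "t \<in> set ts")
        case False
        then show ?thesis using H.gap_exists[OF hl(1), of t] hl t by force
      next
        case True
        then obtain j where j: "j < length ts" "t = ts ! j" unfolding in_set_conv_nth by blast
        have len: "Suc 0 < length ts"
        proof (rule ccontr)
          assume "\<not> ?thesis"
          then obtain x where "ts = [x]" using hl(1) by (cases ts) auto
          then show False using hl by simp
        qed
        show ?thesis
        proof (cases j)
          case 0
          then show ?thesis using j len H.path_subdivision_image(2)[OF pc ts len] by (intro exI[of _ 0]) simp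
        next
          case (Suc i)
          then show ?thesis using j H.path_subdivision_image(2)[OF pc ts, of i] by (intro exI[of _ i]) simp
        qed
      qed
      then show "t \<in> (\<Union>i\<in>{i. Suc i < length ts}. {t \<in> {ts ! i..ts ! Suc i}. cls (charmap G e t) \<in> C})" using t by blast
    next
      fix t assume "t \<in> (\<Union>i\<in>{i. Suc i < length ts}. {t \<in> {ts ! i..ts ! Suc i}. cls (charmap G e t) \<in> C})"
      then obtain i where i: "Suc i < length ts" "t \<in> {ts ! i..ts ! Suc i}" "cls (charmap G e t) \<in> C" by blast
      have t01: "0 \<le> t" "t \<le> 1" using H.path_subdivision_image(1,3)[OF pc ts i(1)] i(2) by auto
      then show "t \<in> ?S" using i(3) G.ch_in[OF e t01] by simp
    qed
    moreover have "closed (\<Union>i\<in>{i. Suc i < length ts}. {t \<in> {ts ! i..ts ! Suc i}. cls (charmap G e t) \<in> C})"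
    proof (rule closed_UN)
      show "finite {i. Suc i < length ts}" by (rule finite_subset[of _ "{..<length ts}"]) auto
    qed (use gap in auto)
    ultimately have "closed ?S" by simp
    then show "closedin (top_of_set {0..1}) ?S" by (intro closed_subset) auto
  qed blast
qed

lemma proj_fold_ch:
  assumes "e \<in> fold_edges" "t \<in> {0..1}"
  shows "proj (fold_ch e t) = charmap H (proj_edge e) t"
  using proj_cls is_liftD(3,4)[OF lift_of(1)[OF assms(1)] assms(2)] by (simp add: fold_ch_def)

lemma proj_fold_verts: "v \<in> fold_verts \<Longrightarrow> proj v \<in> verts H"
  unfolding fold_verts_def using proj_cls by auto

sublocale I: graph_immersion Q H proj proj_edge
proof
  show "continuous_map (gtop Q) (gtop H) proj"
  proof (rule Q.continuous_map_coherent)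
    show "proj ` verts Q \<subseteq> topspace (gtop H)"
      using H.vert_in proj_fold_verts by auto
    fix e assume "e \<in> edges Q"
    then have e: "e \<in> fold_edges" by simp
    show "continuous_map (top_of_set {0..1}) (gtop H) (proj \<circ> charmap Q e)"
      by (rule continuous_map_eq[OF H.ch_continuous[OF is_liftD(1)[OF lift_of(1)[OF e]]]])
        (simp add: proj_fold_ch[OF e])
  qed
  show "proj v \<in> verts H" if "v \<in> verts Q" for v using that proj_fold_verts by simp
  show "proj_edge e \<in> edges H" if "e \<in> edges Q" for e using that is_liftD(1)[OF lift_of(1)] by simp
  show "proj (charmap Q e t) = charmap H (proj_edge e) t" if "e \<in> edges Q" "t \<in> {0..1}" for e t
    using that proj_fold_ch by simp
  fix l l' :: "'a set set \<times> bool"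
  assume l: "fst l \<in> edges Q" "fst l' \<in> edges Q" "Q.tgt l = Q.src l'" "proj_edge (fst l) = proj_edge (fst l')" "snd l = (\<not> snd l')"
  then have e: "fst l \<in> fold_edges" "fst l' \<in> fold_edges" by simp_all
  \<comment> \<open>The end by which both edges are attached to the common vertex: since the
    directions are opposite, it is the same end for both. From there \<open>is_lift_rel\<close>
    passes to the midpoints.\<close>
  define s :: real where "s = (if snd l then 1 else 0)"
  have s: "s \<in> {0..1}" by (simp add: s_def)
  have "fold_ch (fst l) s = fold_ch (fst l') s"
    using l(3,5) by (cases "snd l") (simp_all add: Q.tgt_def Q.src_def s_def)
  then have "cls (snd (lift_of (fst l)) s) = cls (snd (lift_of (fst l')) s)" by (simp add: fold_ch_def)
  note k = lift_of(1)[OF e(1)] and k' = lift_of(1)[OF e(2)]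
  have r: "rel (snd (lift_of (fst l)) s) (snd (lift_of (fst l')) s)"
    using \<open>cls _ = cls _\<close> cls_eq_iff is_liftD(4)[OF k s] is_liftD(4)[OF k' s] by blast
  have half: "1/2 \<in> {0..1::real}" "1/2 \<in> {0<..<1::real}" by simp_all
  have "rel (snd (lift_of (fst l)) (1/2)) (snd (lift_of (fst l')) (1/2))"
    using is_lift_rel[OF k k'[folded l(4)] s half(1) r] .
  then have "fold_ch (fst l) (1/2) = fold_ch (fst l') (1/2)"
    using cls_eq_iff is_liftD(4)[OF k half(1)] is_liftD(4)[OF k' half(1)] by (simp add: fold_ch_def)
  moreover have "fold_ch (fst l) (1/2) \<in> fst l" "fold_ch (fst l') (1/2) \<in> fst l'"
    using fold_ch_props(1) e half(2) by blast+
  ultimately show "fst l = fst l'" using fold_edges_disjoint[OF e] by simp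
qed

lemma proj_reflects_verts:
  assumes "x \<in> topspace (gtop Q)" "proj x \<in> verts H"
  shows "x \<in> verts Q"
proof -
  obtain z where z: "z \<in> topspace (gtop G)" "x = cls z" using assms(1) topspace_fold by blast
  then have "x \<in> fold_verts" using assms(2) proj_cls[OF z(1)] unfolding fold_verts_def by auto
  then show ?thesis by simp
qed

lemma path_subdivision_fold:
  assumes "pathin (gtop Q) c"
  shows "Q.path_subdivision c = H.path_subdivision (proj \<circ> c)"
  by (rule I.path_subdivision_lift[OF assms proj_reflects_verts])

text \<open>The image under \<open>cls\<close> is a loop whose projection contracts, and
  \<open>proj\<close> is injective on path classes.\<close>

lemma rel_null:
  assumes r: "path_from_to (gtop G) z w a" "path_homotopic (gtop H) (g \<circ> a) (\<lambda>_. y)"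
    and eq: "cls z = cls w"
  shows "path_homotopic (gtop Q) (cls \<circ> a) (\<lambda>_. cls z)"
proof -
  have a: "pathin (gtop G) a" "a 0 = z" "a 1 = w" using r(1) by (simp_all add: path_from_to_def)
  have "pathin (gtop Q) (cls \<circ> a)" by (rule pathin_compose[OF a(1) continuous_cls])
  moreover have "path_homotopic (gtop H) (proj \<circ> (cls \<circ> a)) (\<lambda>_. y)"
  proof (rule path_homotopic_trans[OF path_homotopic_sym[OF path_homotopic_eq] r(2)])
    show "pathin (gtop H) (g \<circ> a)" by (rule pathin_compose[OF a(1) g_continuous])
    fix t :: real assume "t \<in> {0..1}"
    then show "(g \<circ> a) t = (proj \<circ> (cls \<circ> a)) t"
      using funcset_mem[OF path_image_subset_topspace[OF a(1)]] by (simp add: proj_cls)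
  qed
  ultimately show ?thesis using I.p_injective[of "cls \<circ> a" y] a eq by simp
qed

text \<open>Surjectivity of \<open>cls\<close> on path classes. The endpoints may be prescribed
  anywhere in their classes, which is what makes lifts of consecutive paths fit together.\<close>

definition liftable :: "(real \<Rightarrow> 'a set) \<Rightarrow> bool" where
  "liftable b \<longleftrightarrow> pathin (gtop Q) b \<and> (\<forall>z\<in>topspace (gtop G). \<forall>w\<in>topspace (gtop G). cls z = b 0 \<longrightarrow> cls w = b 1 \<longrightarrow>
     (\<exists>a. path_from_to (gtop G) z w a \<and> path_homotopic (gtop Q) (cls \<circ> a) b))"

lemma liftableD:
  assumes "liftable b" "z \<in> topspace (gtop G)" "w \<in> topspace (gtop G)" "cls z = b 0" "cls w = b 1"
  shows "\<exists>a. path_from_to (gtop G) z w a \<and> path_homotopic (gtop Q) (cls \<circ> a) b"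
  using assms by (simp add: liftable_def)

text \<open>Prescribed endpoints are joined to those of \<open>a\<close> by paths witnessing
  \<open>rel\<close>, and these become null-homotopic in the folded graph by
  \<open>rel_null\<close>.\<close>

lemma liftable_cls:
  assumes a: "pathin (gtop G) a"
  shows "liftable (cls \<circ> a)"
  unfolding liftable_def
proof (intro conjI ballI impI)
  show pa: "pathin (gtop Q) (cls \<circ> a)" by (rule pathin_compose[OF a continuous_cls])
  fix z w assume z: "z \<in> topspace (gtop G)" "w \<in> topspace (gtop G)" "cls z = (cls \<circ> a) 0" "cls w = (cls \<circ> a) 1"
  have a01: "a 0 \<in> topspace (gtop G)" "a 1 \<in> topspace (gtop G)"
    using path_start_in_topspace[OF a] path_finish_in_topspace[OF a] .
  have r: "rel z (a 0)" "rel w (a 1)" using z a01 cls_eq_iff by auto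
  note r(1) rel_sym[OF r(2)]
  then obtain \<alpha> \<beta> where \<alpha>: "path_from_to (gtop G) z (a 0) \<alpha>" "path_homotopic (gtop H) (g \<circ> \<alpha>) (\<lambda>_. g z)"
    and \<beta>: "path_from_to (gtop G) (a 1) w \<beta>" "path_homotopic (gtop H) (g \<circ> \<beta>) (\<lambda>_. g (a 1))"
    unfolding rel_def by blast
  have n\<alpha>: "path_homotopic (gtop Q) (cls \<circ> \<alpha>) (\<lambda>_. cls z)" by (rule rel_null[OF \<alpha>]) (use z in simp)
  have n\<beta>: "path_homotopic (gtop Q) (cls \<circ> \<beta>) (\<lambda>_. cls (a 1))" by (rule rel_null[OF \<beta>]) (use z in simp)
  have e: "\<alpha> 1 = a 0" "\<beta> 0 = a 1" "\<alpha> 0 = z" "\<beta> 1 = w" using \<alpha>(1) \<beta>(1) by (simp_all add: path_from_to_def)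
  have "path_homotopic (gtop Q) (cls \<circ> path_join \<alpha> (path_join a \<beta>)) (path_join (\<lambda>_. cls z) (path_join (cls \<circ> a) (\<lambda>_. cls (a 1))))"
    unfolding comp_path_join using e by (intro path_homotopic_join n\<alpha> n\<beta> path_homotopic_refl[OF pa]) simp_all
  also have "path_homotopic (gtop Q) \<dots> (path_join (cls \<circ> a) (\<lambda>_. cls (a 1)))"
    using pa z(3) a01(2) topspace_fold by (intro path_homotopic_const_left pathin_join) simp_all
  also have "path_homotopic (gtop Q) \<dots> (cls \<circ> a)" using pa by (intro path_homotopic_const_right) simp_all
  finally have "path_homotopic (gtop Q) (cls \<circ> path_join \<alpha> (path_join a \<beta>)) (cls \<circ> a)" .
  moreover have "path_from_to (gtop G) z w (path_join \<alpha> (path_join a \<beta>))"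
    using \<alpha>(1) \<beta>(1) a by (intro path_from_to_join[of _ z "a 0"] path_from_to_join[of _ "a 0" "a 1"]) (simp_all add: path_from_to_def)
  ultimately show "\<exists>a'. path_from_to (gtop G) z w a' \<and> path_homotopic (gtop Q) (cls \<circ> a') (cls \<circ> a)" by blast
qed

lemma liftable_homotopic:
  assumes "liftable b" "path_homotopic (gtop Q) b b'"
  shows "liftable b'"
  unfolding liftable_def
proof (intro conjI ballI impI)
  note e = path_homotopicD[OF assms(2)]
  show "pathin (gtop Q) b'" by (rule e(2))
  fix z w assume z: "z \<in> topspace (gtop G)" "w \<in> topspace (gtop G)" "cls z = b' 0" "cls w = b' 1"
  then have "cls z = b 0" "cls w = b 1" using e(3,4) by simp_all
  then obtain a where a: "path_from_to (gtop G) z w a" "path_homotopic (gtop Q) (cls \<circ> a) b"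
    using assms(1) z(1,2) unfolding liftable_def by blast
  show "\<exists>a. path_from_to (gtop G) z w a \<and> path_homotopic (gtop Q) (cls \<circ> a) b'"
    using a(1) path_homotopic_trans[OF a(2) assms(2)] by blast
qed

lemma liftable_join:
  assumes b: "liftable b" and b': "liftable b'" and e: "b 1 = b' 0"
  shows "liftable (path_join b b')"
  unfolding liftable_def
proof (intro conjI ballI impI)
  show "pathin (gtop Q) (path_join b b')" using assms by (simp add: liftable_def pathin_join)
  fix z w assume z: "z \<in> topspace (gtop G)" "w \<in> topspace (gtop G)" "cls z = path_join b b' 0" "cls w = path_join b b' 1"
  have "b 1 \<in> topspace (gtop Q)" using b path_finish_in_topspace by (auto simp: liftable_def)
  then obtain y where y: "y \<in> topspace (gtop G)" "cls y = b 1" using topspace_fold by auto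
  obtain a where a: "path_from_to (gtop G) z y a" "path_homotopic (gtop Q) (cls \<circ> a) b"
    using liftableD[OF b z(1) y(1) _ y(2)] z(3) unfolding path_join_simps by blast
  obtain a' where a': "path_from_to (gtop G) y w a'" "path_homotopic (gtop Q) (cls \<circ> a') b'"
    using liftableD[OF b' y(1) z(2) y(2)[unfolded e]] z(4) unfolding path_join_simps by blast
  have "path_homotopic (gtop Q) (cls \<circ> path_join a a') (path_join b b')"
    unfolding comp_path_join using a a' by (intro path_homotopic_join) (simp_all add: path_from_to_def)
  with path_from_to_join[OF a(1) a'(1)]
  show "\<exists>a. path_from_to (gtop G) z w a \<and> path_homotopic (gtop Q) (cls \<circ> a) (path_join b b')" by blast
qed

lemma liftable_reverse:
  assumes b: "liftable b"
  shows "liftable (path_reverse b)"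
  unfolding liftable_def
proof (intro conjI ballI impI)
  show "pathin (gtop Q) (path_reverse b)" using b by (simp add: liftable_def pathin_reverse)
  fix z w assume z: "z \<in> topspace (gtop G)" "w \<in> topspace (gtop G)" "cls z = path_reverse b 0" "cls w = path_reverse b 1"
  then have "cls z = b 1" "cls w = b 0" by simp_all
  then obtain a where a: "path_from_to (gtop G) w z a" "path_homotopic (gtop Q) (cls \<circ> a) b"
    using liftableD[OF b z(2,1)] by blast
  have "path_homotopic (gtop Q) (cls \<circ> path_reverse a) (path_reverse b)"
    unfolding comp_path_reverse by (rule path_homotopic_reverse[OF a(2)])
  with path_from_to_reverse[OF a(1)]
  show "\<exists>a. path_from_to (gtop G) z w a \<and> path_homotopic (gtop Q) (cls \<circ> a) (path_reverse b)" by blast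
qed

lemma liftable_edge:
  assumes e: "e \<in> edges Q" and s: "s \<in> {0..1}" "t \<in> {0..1}"
  shows "liftable (subpath s t (charmap Q e))"
proof -
  have e': "e \<in> fold_edges" using e by simp
  have "subpath s t (charmap Q e) = cls \<circ> subpath s t (snd (lift_of e))"
    by (simp add: subpath_def fold_ch_def o_def)
  then show ?thesis using liftable_cls[OF pathin_subpath[OF is_liftD(2)[OF lift_of(1)[OF e']] s]] by simp
qed

lemma liftable_const:
  assumes "x \<in> topspace (gtop Q)"
  shows "liftable (\<lambda>_. x)"
proof -
  obtain z where z: "z \<in> topspace (gtop G)" "x = cls z" using assms topspace_fold by blast
  have "liftable (cls \<circ> (\<lambda>_. z))" by (rule liftable_cls) (use z in simp)
  then show ?thesis by (simp add: comp_path_const z(2))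
qed

lemma liftable_word: "Q.walk u w v \<Longrightarrow> liftable (Q.word_path u w)"
proof (induction w arbitrary: u)
  case Nil
  then show ?case using liftable_const Q.vert_in by auto
next
  case (Cons l w)
  then have l: "fst l \<in> edges Q" "Q.src l = u" "Q.walk (Q.tgt l) w v" by simp_all
  have "liftable (charmap Q (fst l))" using liftable_edge[OF l(1), of 0 1] by simp
  then have "liftable (Q.letter_path l)" using liftable_reverse by (simp add: Q.letter_path_def)
  then show ?case
    using liftable_join[OF _ Cons.IH[OF l(3)]] Q.letter_path_props[OF l(1)] Q.word_path_props[OF l(3)] by simp
qed

lemma liftable_base_path:
  assumes x: "x \<in> topspace (gtop Q)"
  shows "liftable (Q.base_path x)"
  using x
proof (cases rule: Q.point_cases)
  case 1 then show ?thesis using liftable_const[OF x] by (simp add: Q.base_path_vert)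
next
  case (2 e t) then show ?thesis
    unfolding 2(4) Q.base_path_ch[OF 2(1-3)] using liftable_edge[OF 2(1), of 0 t] by simp
qed

text \<open>An edge of the folded graph is by construction the image of an arc of \<open>G\<close>,
  so edge words and anchors lift, and with them every path.\<close>

theorem all_liftable:
  assumes b: "pathin (gtop Q) b"
  shows "liftable b"
proof -
  note b01 = path_start_in_topspace[OF b] path_finish_in_topspace[OF b]
  let ?p = "Q.base_path (b 0)" and ?q = "Q.base_path (b 1)"
  note p = Q.base_path_props[OF b01(1)] and q = Q.base_path_props[OF b01(2)]
  obtain w where w: "Q.walk (?p 0) w (?q 0)" "path_homotopic (gtop Q) (path_join ?p b) (path_join (Q.word_path (?p 0) w) ?q)"
    using Q.word_of_path[OF b] by blast
  note wp = Q.word_path_props[OF w(1)]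
  have "path_homotopic (gtop Q) (path_join (path_reverse ?p) (path_join (Q.word_path (?p 0) w) ?q)) (path_join (path_reverse ?p) (path_join ?p b))"
    using p wp by (intro path_homotopic_join path_homotopic_refl path_homotopic_sym[OF w(2)] pathin_reverse) simp_all
  also have "path_homotopic (gtop Q) \<dots> b" using p b by (intro path_homotopic_cancel_left) simp_all
  finally show ?thesis
    by (rule liftable_homotopic[rotated])
      (use p q wp in \<open>simp add: liftable_join liftable_reverse liftable_word[OF w(1)] liftable_base_path[OF b01(1)] liftable_base_path[OF b01(2)]\<close>)
qed

end

section \<open>Folding a power of a self-map\<close>

lemma (in fgraph) path_subdivision_cong:
  assumes c: "pathin X c" and eq: "\<And>t. t \<in> {0..1} \<Longrightarrow> c t = c' t"
  shows "path_subdivision c = path_subdivision c'"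
proof
  fix ts
  have "homeomorphic_map (top_of_set {ts ! i<..<ts ! Suc i}) (subtopology X d) c \<longleftrightarrow>
        homeomorphic_map (top_of_set {ts ! i<..<ts ! Suc i}) (subtopology X d) c'"
    if ts: "ts \<noteq> []" "sorted_wrt (<) ts" "hd ts = 0" "last ts = 1" and i: "Suc i < length ts" for i d
  proof -
    have srt: "sorted ts" using ts(2) strict_sorted_iff by blast
    have "0 \<le> ts ! i" "ts ! Suc i \<le> 1"
      using sorted_nth_mono[OF srt, of 0 i] sorted_nth_mono[OF srt, of "Suc i" "length ts - 1"] i ts
      by (simp_all add: hd_conv_nth last_conv_nth)
    then have eq': "c t = c' t" if "t \<in> {ts ! i<..<ts ! Suc i}" for t using that by (intro eq) auto
    show ?thesis
    proof
      assume "homeomorphic_map (top_of_set {ts ! i<..<ts ! Suc i}) (subtopology X d) c"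
      then show "homeomorphic_map (top_of_set {ts ! i<..<ts ! Suc i}) (subtopology X d) c'"
        by (rule homeomorphic_map_eq) (use eq' in simp)
    next
      assume "homeomorphic_map (top_of_set {ts ! i<..<ts ! Suc i}) (subtopology X d) c'"
      then show "homeomorphic_map (top_of_set {ts ! i<..<ts ! Suc i}) (subtopology X d) c"
        by (rule homeomorphic_map_eq) (use eq' in simp)
    qed
  qed
  then show "path_subdivision c ts = path_subdivision c' ts"
    unfolding path_subdivision_def by blast
qed

context folding
begin

lemma edge_subdivision_proj:
  assumes e: "e \<in> edges Q"
  shows "\<exists>ts. edge_subdivision Q H proj e ts"
proof -
  have "\<exists>ts. edge_subdivision Q Q id e ts"
    using graph_map_id[OF Q.fgraph_axioms] e unfolding graph_map_def by blast
  then show ?thesis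
    unfolding edge_subdivision_eq[OF H.fgraph_axioms] edge_subdivision_eq[OF Q.fgraph_axioms] id_comp
      path_subdivision_fold[OF Q.pathin_ch[OF e]] .
qed

lemma graph_map_proj: "graph_map Q H proj"
  unfolding graph_map_def using I.p_continuous I.p_verts edge_subdivision_proj by blast

lemma proj_cls_path:
  assumes c: "pathin (gtop G) c" and t: "t \<in> {0..1}"
  shows "proj (cls (c t)) = g (c t)"
  using funcset_mem[OF path_image_subset_topspace[OF c] t] by (rule proj_cls)

lemma graph_map_cls: "graph_map G Q cls"
  unfolding graph_map_def
proof (intro conjI ballI)
  show "continuous_map (gtop G) (gtop Q) cls" by (rule continuous_cls)
  show "cls ` verts G \<subseteq> verts Q"
  proof (rule image_subsetI)
    fix v assume v: "v \<in> verts G"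
    have "cls v \<in> fold_verts" unfolding fold_verts_def using g_verts[OF v] G.vert_in[OF v] by blast
    then show "cls v \<in> verts Q" by simp
  qed
  fix e assume e: "e \<in> edges G"
  have pc: "pathin (gtop Q) (cls \<circ> charmap G e)" by (rule pathin_compose[OF G.pathin_ch[OF e] continuous_cls])
  have "H.path_subdivision (proj \<circ> (cls \<circ> charmap G e)) = H.path_subdivision (g \<circ> charmap G e)"
    by (rule H.path_subdivision_cong[OF pathin_compose[OF pc I.p_continuous]])
      (simp add: proj_cls_path[OF G.pathin_ch[OF e]])
  then have eq: "edge_subdivision G Q cls e = edge_subdivision G H g e"
    unfolding edge_subdivision_eq[OF H.fgraph_axioms] edge_subdivision_eq[OF Q.fgraph_axioms]
      path_subdivision_fold[OF pc] .
  have "\<exists>ts. edge_subdivision G H g e ts" using g_map e unfolding graph_map_def by blast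
  then show "\<exists>ts. edge_subdivision G Q cls e ts" unfolding eq .
qed

end

locale self_folding = G: fgraph G for G :: "'a cw_graph" +
  fixes f :: "'a \<Rightarrow> 'a" and k :: nat
  assumes f_map: "graph_map G G f"
begin

sublocale F: folding G G "f ^^ k"
  by unfold_locales (rule graph_map_funpow[OF G.fgraph_axioms f_map])

abbreviation "X \<equiv> topspace (gtop G)"
abbreviation "Q \<equiv> F.Q"
abbreviation "cls \<equiv> F.cls"
abbreviation "proj \<equiv> F.proj"

lemma f_continuous: "continuous_map (gtop G) (gtop G) f"
  and f_verts: "v \<in> verts G \<Longrightarrow> f v \<in> verts G"
  using f_map unfolding graph_map_def by auto

lemma fn_continuous: "continuous_map (gtop G) (gtop G) (f ^^ n)"
  using graph_map_funpow[OF G.fgraph_axioms f_map] unfolding graph_map_def by blast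

lemma fn_in: "z \<in> X \<Longrightarrow> (f ^^ n) z \<in> X"
  using funcset_mem[OF continuous_map_funspace[OF fn_continuous]] .

lemma f_in: "z \<in> X \<Longrightarrow> f z \<in> X"
  using fn_in[of z 1] by simp

text \<open>Because \<open>f\<close> commutes with \<open>f ^^ k\<close>, the image of a witness is
  again a witness.\<close>

lemma rel_f:
  assumes "F.rel z w"
  shows "F.rel (f z) (f w)"
proof -
  obtain a where a: "path_from_to (gtop G) z w a" "path_homotopic (gtop G) ((f ^^ k) \<circ> a) (\<lambda>_. (f ^^ k) z)"
    using assms unfolding F.rel_def by blast
  have eq: "(f ^^ k) \<circ> (f \<circ> a) = f \<circ> ((f ^^ k) \<circ> a)" by (simp add: fun_eq_iff funpow_swap1)
  have "path_homotopic (gtop G) ((f ^^ k) \<circ> (f \<circ> a)) (\<lambda>_. (f ^^ k) (f z))"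
    unfolding eq using path_homotopic_image[OF a(2) f_continuous] by (simp add: comp_path_const funpow_swap1)
  then show ?thesis
    unfolding F.rel_def using path_from_to_image[OF a(1) f_continuous] by blast
qed

definition fold_map :: "'a set \<Rightarrow> 'a set" where "fold_map C = cls (f (SOME z. z \<in> C))"

lemma fold_map_cls:
  assumes "z \<in> X"
  shows "fold_map (cls z) = cls (f z)"
proof -
  have "z \<in> cls z" using F.rel_refl[OF assms] by (simp add: F.cls_def)
  then have "(SOME z'. z' \<in> cls z) \<in> cls z" by (rule someI)
  then have "F.rel z (SOME z'. z' \<in> cls z)" by (simp add: F.cls_def)
  then have "F.rel (f z) (f (SOME z'. z' \<in> cls z))" by (rule rel_f)
  then show ?thesis unfolding fold_map_def using F.cls_eq_iff F.rel_in by blast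
qed

lemma fold_map_pow_cls: "z \<in> X \<Longrightarrow> (fold_map ^^ n) (cls z) = cls ((f ^^ n) z)"
  by (induction n) (simp_all add: fold_map_cls fn_in)

lemma point_of_fold:
  assumes "x \<in> topspace (gtop Q)"
  obtains z where "z \<in> X" "x = cls z"
  using assms F.topspace_fold by blast

lemma proj_fold_map_pow:
  assumes "x \<in> topspace (gtop Q)"
  shows "proj ((fold_map ^^ n) x) = (f ^^ n) (proj x)"
proof -
  obtain z where z: "z \<in> X" "x = cls z" using point_of_fold[OF assms] .
  have "f ^^ k \<circ> f ^^ n = f ^^ n \<circ> f ^^ k" by (simp add: add.commute flip: funpow_add)
  then have "(f ^^ k) ((f ^^ n) z) = (f ^^ n) ((f ^^ k) z)" by (simp add: fun_eq_iff)
  then show ?thesis using z by (simp add: fold_map_pow_cls F.proj_cls fn_in)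
qed

lemma proj_fold_map: "x \<in> topspace (gtop Q) \<Longrightarrow> proj (fold_map x) = f (proj x)"
  using proj_fold_map_pow[of x 1] by simp

lemma cls_proj:
  assumes "x \<in> topspace (gtop Q)"
  shows "cls (proj x) = (fold_map ^^ k) x"
proof -
  obtain z where z: "z \<in> X" "x = cls z" using point_of_fold[OF assms] .
  then show ?thesis by (simp add: F.proj_cls fold_map_pow_cls)
qed

text \<open>Along an edge the map is \<open>cls\<close> after \<open>f ^^ n\<close> on the chosen
  arc, and the weak topology asks for no more.\<close>

lemma continuous_fold_map_pow: "continuous_map (gtop Q) (gtop Q) (fold_map ^^ n)"
proof (rule F.Q.continuous_map_coherent)
  show "(fold_map ^^ n) ` verts Q \<subseteq> topspace (gtop Q)"
  proof (rule image_subsetI)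
    fix v assume "v \<in> verts Q"
    then obtain z where "z \<in> X" "v = cls z" using point_of_fold F.Q.vert_in by blast
    then show "(fold_map ^^ n) v \<in> topspace (gtop Q)"
      using fn_in by (auto simp: fold_map_pow_cls F.topspace_fold)
  qed
  fix e assume "e \<in> edges Q"
  then have e: "e \<in> F.fold_edges" by simp
  note l = F.is_liftD[OF F.lift_of(1)[OF e]]
  have "continuous_map (top_of_set {0..1}) (gtop Q) (cls \<circ> ((f ^^ n) \<circ> snd (F.lift_of e)))"
    using l(2) unfolding pathin_def by (intro continuous_map_compose[OF _ F.continuous_cls] continuous_map_compose[OF _ fn_continuous])
  then show "continuous_map (top_of_set {0..1}) (gtop Q) ((fold_map ^^ n) \<circ> charmap Q e)"
    by (rule continuous_map_eq) (simp add: F.fold_ch_def fold_map_pow_cls l(4))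
qed

lemma pathin_fold_map_pow: "e \<in> edges Q \<Longrightarrow> pathin (gtop Q) ((fold_map ^^ n) \<circ> charmap Q e)"
  by (rule pathin_compose[OF F.Q.pathin_ch continuous_fold_map_pow])

lemma proj_fold_map_pow_ch:
  assumes "e \<in> edges Q" "t \<in> {0..1}"
  shows "proj ((fold_map ^^ n) (charmap Q e t)) = (f ^^ n) (charmap G (F.proj_edge e) t)"
  using proj_fold_map_pow[OF F.Q.ch_in[OF assms(1)]] F.I.p_ch[OF assms] assms(2) by simp

text \<open>Stated for all powers, since expansion compares the edge paths of \<open>f ^^ n\<close>
  for growing \<open>n\<close>.\<close>

lemma edge_subdivision_fold_map_pow:
  assumes e: "e \<in> edges Q"
  shows "edge_subdivision Q Q (fold_map ^^ n) e = edge_subdivision G G (f ^^ n) (F.proj_edge e)"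
proof -
  have "edge_subdivision Q Q (fold_map ^^ n) e = G.path_subdivision (proj \<circ> ((fold_map ^^ n) \<circ> charmap Q e))"
    unfolding edge_subdivision_eq[OF F.Q.fgraph_axioms] by (rule F.path_subdivision_fold[OF pathin_fold_map_pow[OF e]])
  also have "\<dots> = G.path_subdivision ((f ^^ n) \<circ> charmap G (F.proj_edge e))"
    by (rule G.path_subdivision_cong[OF pathin_compose[OF pathin_fold_map_pow[OF e] F.I.p_continuous]])
      (simp only: o_apply proj_fold_map_pow_ch[OF e])
  finally show ?thesis by (simp only: edge_subdivision_eq[OF G.fgraph_axioms])
qed

lemma graph_map_fold_map: "graph_map Q Q fold_map"
  unfolding graph_map_def
proof (intro conjI ballI)
  show "continuous_map (gtop Q) (gtop Q) fold_map" using continuous_fold_map_pow[of 1] by simp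
  show "fold_map ` verts Q \<subseteq> verts Q"
  proof (rule image_subsetI)
    fix v assume "v \<in> verts Q"
    then have "v \<in> F.fold_verts" by simp
    then obtain z where z: "z \<in> X" "(f ^^ k) z \<in> verts G" "v = cls z" unfolding F.fold_verts_def by blast
    have "(f ^^ k) (f z) \<in> verts G" using f_verts[OF z(2)] by (simp add: funpow_swap1)
    then have "cls (f z) \<in> F.fold_verts" unfolding F.fold_verts_def using f_in[OF z(1)] by blast
    then show "fold_map v \<in> verts Q" unfolding z(3) fold_map_cls[OF z(1)] by simp
  qed
  fix e assume e: "e \<in> edges Q"
  have "\<exists>ts. edge_subdivision G G (f ^^ 1) (F.proj_edge e) ts"
    using f_map F.I.\<pi>_edges[OF e] by (simp add: graph_map_def)
  then show "\<exists>ts. edge_subdivision Q Q fold_map e ts"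
    using edge_subdivision_fold_map_pow[OF e, of 1] by simp
qed

lemma expanding_fold_map:
  assumes "expanding_map G f"
  shows "expanding_map Q fold_map"
  unfolding expanding_map_def
proof
  fix e assume e: "e \<in> edges Q"
  have "length (edge_path Q Q (fold_map ^^ n) e) = length (edge_path G G (f ^^ n) (F.proj_edge e))" for n
    unfolding edge_path_def edge_subdivision_fold_map_pow[OF e] by (simp add: Let_def)
  then show "filterlim (\<lambda>n. length (edge_path Q Q (fold_map ^^ n) e)) at_top sequentially"
    using assms F.I.\<pi>_edges[OF e] unfolding expanding_map_def by simp
qed

text \<open>After composing with \<open>proj\<close> one sees a power of \<open>f\<close> on the
  edge below, and injectivity of a composite passes to the map applied first.\<close>

lemma train_track_fold_map:
  assumes "train_track_map G f"
  shows "train_track_map Q fold_map"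
  unfolding train_track_map_def
proof (intro conjI ballI allI impI)
  show "graph_map Q Q fold_map" by (rule graph_map_fold_map)
  have "fold_map ` topspace (gtop Q) = cls ` f ` X"
    unfolding F.topspace_fold image_image using fold_map_cls by (intro image_cong) simp_all
  also have "f ` X = X" using assms by (simp add: train_track_map_def)
  finally show "fold_map ` topspace (gtop Q) = topspace (gtop Q)" by (simp only: F.topspace_fold)
  fix e and n :: nat and t :: real assume e: "e \<in> edges Q" and n: "1 \<le> n" and t: "t \<in> {0..1}"
  obtain r where r: "r > 0" "inj_on ((f ^^ n) \<circ> charmap G (F.proj_edge e)) ({0..1} \<inter> ball t r)"
    using assms F.I.\<pi>_edges[OF e] n t unfolding train_track_map_def by blast
  have "inj_on (proj \<circ> ((fold_map ^^ n) \<circ> charmap Q e)) ({0..1} \<inter> ball t r)"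
    by (rule inj_on_cong[THEN iffD1, OF _ r(2)]) (simp only: o_apply proj_fold_map_pow_ch[OF e] Int_iff)
  then show "\<exists>r>0. inj_on ((fold_map ^^ n) \<circ> charmap Q e) ({0..1} \<inter> ball t r)"
    using r(1) inj_on_imageI2 by blast
qed

text \<open>The midpoint of \<open>e'\<close> is the class of a point \<open>z\<close> in some edge
  \<open>d\<close> of \<open>G\<close>. A power of \<open>f\<close> carries the edge below
  \<open>e\<close> over \<open>d\<close>, hence over \<open>z\<close>; the additional exponent
  \<open>k\<close> arises because \<open>cls\<close> after \<open>proj\<close> is
  \<open>fold_map ^^ k\<close>.\<close>

lemma irreducible_fold_map:
  assumes "irreducible_map G f"
  shows "irreducible_map Q fold_map"
  unfolding irreducible_map_iff[OF F.Q.fgraph_axioms graph_map_fold_map]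
proof (intro ballI)
  fix e e' assume e: "e \<in> edges Q" and e': "e' \<in> edges Q"
  then have e'': "e' \<in> F.fold_edges" by simp
  define z where "z = snd (F.lift_of e') (1/2)"
  note l = F.is_liftD[OF F.lift_of(1)[OF e'']]
  have half: "1/2 \<in> {0..1::real}" "1/2 \<in> {0<..<1::real}" by simp_all
  have z: "z \<in> X" "(f ^^ k) z = charmap G (F.proj_edge e') (1/2)" using l(3,4)[OF half(1)] by (simp_all add: z_def)
  have "cls z = charmap Q e' (1/2)" by (simp add: z_def F.fold_ch_def)
  then have cz: "cls z \<in> e'" using imageI[OF half(2), of "F.fold_ch e'"] unfolding F.fold_ch_props(1)[OF e''] by simp
  have "(f ^^ k) z \<notin> verts G"
    using G.ch_in_verts_iff[OF l(1), of "1/2"] by (simp add: z(2))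
  then have "z \<notin> verts G" using F.g_verts by blast
  then obtain d where d: "d \<in> edges G" "z \<in> d" using z(1) G.topspace_eq by blast
  obtain n where n: "n \<ge> 1" "(f ^^ n) ` F.proj_edge e \<inter> d \<noteq> {}"
    using bspec[OF bspec[OF assms[unfolded irreducible_map_iff[OF G.fgraph_axioms f_map]] F.I.\<pi>_edges[OF e]] d(1)]
    by blast
  have "d \<subseteq> (f ^^ n) ` F.proj_edge e"
    using in_edge_path_iff[OF G.fgraph_axioms G.fgraph_axioms graph_map_funpow[OF G.fgraph_axioms f_map] F.I.\<pi>_edges[OF e] d(1)] n(2)
    by blast
  then obtain y where y: "y \<in> F.proj_edge e" "z = (f ^^ n) y" using d(2) by blast
  then obtain s where s: "s \<in> {0<..<1}" "y = charmap G (F.proj_edge e) s"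
    using G.ch_image[OF F.I.\<pi>_edges[OF e]] by blast
  have s01: "s \<in> {0..1}" using s(1) by simp
  let ?x = "charmap Q e s"
  have x: "?x \<in> e" "?x \<in> topspace (gtop Q)" using F.Q.ch_mem[OF e, of s] F.Q.edge_subset[OF e] s(1) by auto
  have yx: "y = proj ?x" using F.I.p_ch[OF e s01] s(2) by simp
  have "y \<in> X" using y(1) G.edge_subset[OF F.I.\<pi>_edges[OF e]] by blast
  have "(fold_map ^^ (n + k)) ?x = cls z"
  proof -
    have "(fold_map ^^ (n + k)) ?x = (fold_map ^^ n) (cls y)"
      using cls_proj[OF x(2)] yx by (simp add: funpow_add)
    also have "\<dots> = cls z" using fold_map_pow_cls[OF \<open>y \<in> X\<close>] y(2) by simp
    finally show ?thesis .
  qed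
  then have "cls z \<in> (fold_map ^^ (n + k)) ` e" using imageI[OF x(1), of "fold_map ^^ (n + k)"] by simp
  then show "\<exists>n\<ge>1. (fold_map ^^ n) ` e \<inter> e' \<noteq> {}" using cz n(1) by (intro exI[of _ "n + k"]) auto
qed

end

section \<open>Vertices of valence one\<close>

context fgraph
begin

lemma closedin_image_interval:
  assumes c: "pathin X c" and ab: "0 \<le> a" "a \<le> b" "b \<le> 1"
  shows "closedin X (c ` {a..b})"
proof -
  have "continuous_map (top_of_set {a..b}) X c"
    using continuous_map_from_subtopology_mono[OF c[unfolded pathin_def], of "{a..b}"] ab by auto
  then have "compactin X (c ` {a..b})"
    by (rule image_compactin[rotated]) (simp add: compactin_subtopology)
  then show ?thesis using compactin_imp_closedin Hausdorff by blast
qed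

text \<open>\<open>h\<close> is the distance from \<open>v\<close> along its only edge, cut off at
  1. It is a chart near \<open>v\<close> in which \<open>v\<close> is the end of an interval and
  \<open>h\<close> has its minimum there.\<close>

lemma valence_one_function:
  assumes v: "v \<in> V" and val: "valence G v = 1"
  obtains h e where "e \<in> E" "ch e 0 = v \<or> ch e 1 = v" "continuous_map X euclideanreal h"
    "h v = 0" "\<And>x. x \<in> topspace X \<Longrightarrow> h x \<ge> 0" "inj_on h {x \<in> topspace X. h x < 1}"
proof -
  let ?A = "{e \<in> E. ch e 0 = v}" and ?B = "{e \<in> E. ch e 1 = v}"
  have fin: "finite ?A" "finite ?B" using finite_edges by simp_all
  have "card ?A + card ?B = 1" using val by (simp add: valence_def)
  then have "card ?A = 1 \<and> card ?B = 0 \<or> card ?A = 0 \<and> card ?B = 1" by linarith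
  \<comment> \<open>\<open>b\<close> records whether the edge starts or ends at
    \<open>v\<close>.\<close>
  then obtain e b where e: "?A = (if b then {e} else {})" "?B = (if b then {} else {e})"
  proof
    assume "card ?A = 1 \<and> card ?B = 0"
    then obtain e where "?A = {e}" "?B = {}" using fin by (auto simp: card_1_singleton_iff)
    then show thesis by (intro that[of True e]) simp_all
  next
    assume "card ?A = 0 \<and> card ?B = 1"
    then obtain e where "?B = {e}" "?A = {}" using fin by (auto simp: card_1_singleton_iff)
    then show thesis by (intro that[of False e]) simp_all
  qed
  have eE: "e \<in> E" and ev: "ch e 0 = v \<longleftrightarrow> b" "ch e 1 = v \<longleftrightarrow> \<not> b"
    using e by (cases b; auto)+
  have other: "ch e' 0 \<noteq> v" "ch e' 1 \<noteq> v" if "e' \<in> E" "e' \<noteq> e" for e'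
    using e that by (cases b; auto)+
  define \<rho> where "\<rho> t = (if b then t else 1 - t)" for t :: real
  define h where "h x = (if x \<in> V then of_bool (x \<noteq> v) else if cell_of x = e then \<rho> (coord x) else 1)" for x
  have he: "h (ch e t) = \<rho> t" if t: "t \<in> {0..1}" for t
  proof (cases "t = 0 \<or> t = 1")
    case True
    then show ?thesis using ch_0[OF eE] ch_1[OF eE] ev by (auto simp: h_def \<rho>_def)
  next
    case False
    then have "0 < t" "t < 1" using t by simp_all
    then show ?thesis using ch_in_verts_iff[OF eE, of t] by (simp add: h_def cell_of_ch[OF eE] coord_ch[OF eE])
  qed
  have he': "h (ch e' t) = 1" if e': "e' \<in> E" "e' \<noteq> e" and t: "t \<in> {0..1}" for e' t
  proof (cases "t = 0 \<or> t = 1")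
    case True
    then show ?thesis using ch_0[OF e'(1)] ch_1[OF e'(1)] other[OF e'] by (auto simp: h_def)
  next
    case False
    then have "0 < t" "t < 1" using t by simp_all
    then show ?thesis using ch_in_verts_iff[OF e'(1), of t] e'(2) by (simp add: h_def cell_of_ch[OF e'(1)])
  qed
  have cases: "h x = of_bool (x \<noteq> v) \<and> x \<in> V \<or> (\<exists>t. 0 < t \<and> t < 1 \<and> x = ch e t \<and> h x = \<rho> t) \<or> h x = 1"
    if x: "x \<in> topspace X" for x
    using x
  proof (cases rule: point_cases)
    case 1 then show ?thesis by (simp add: h_def)
  next
    case (2 e' t)
    show ?thesis
    proof (cases "e' = e")
      case True
      have "x = ch e t" "h x = \<rho> t" using 2 he[of t] True by simp_all
      then show ?thesis using 2(2,3) by blast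
    next
      case False
      have "h x = 1" using 2 he'[OF 2(1) False, of t] by simp
      then show ?thesis by simp
    qed
  qed
  show thesis
  proof (rule that[OF eE, of h])
    show "ch e 0 = v \<or> ch e 1 = v" using ev by auto
    show "continuous_map X euclideanreal h"
    proof (rule continuous_map_coherent)
      fix e' assume e': "e' \<in> E"
      have "continuous_on {0..1} (\<lambda>t. if e' = e then \<rho> t else 1)"
        unfolding \<rho>_def by (cases "e' = e"; cases b) (simp_all add: continuous_intros)
      then have "continuous_map (top_of_set {0..1}) euclideanreal (\<lambda>t. if e' = e then \<rho> t else 1)"
        unfolding continuous_map_iff_continuous .
      then show "continuous_map (top_of_set {0..1}) euclideanreal (h \<circ> ch e')"
        by (rule continuous_map_eq) (use he he'[OF e'] in auto)
    qed simp
    show "h v = 0" using v by (simp add: h_def)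
    show "h x \<ge> 0" if "x \<in> topspace X" for x using cases[OF that] by (auto simp: \<rho>_def)
    show "inj_on h {x \<in> topspace X. h x < 1}"
    proof (rule inj_onI)
      have c2: "x = v \<and> h x = 0 \<or> (\<exists>t. 0 < t \<and> t < 1 \<and> x = ch e t \<and> h x = \<rho> t)"
        if "x \<in> {x \<in> topspace X. h x < 1}" for x
        using cases[of x] that by (cases "x = v") auto
      have pos: "\<rho> t > 0" if "0 < t" "t < 1" for t using that by (simp add: \<rho>_def)
      fix x y assume x: "x \<in> {x \<in> topspace X. h x < 1}" and y: "y \<in> {x \<in> topspace X. h x < 1}" and eq: "h x = h y"
      from c2[OF x] show "x = y"
      proof
        assume xv: "x = v \<and> h x = 0"
        from c2[OF y] show ?thesis
        proof
          assume "\<exists>t. 0 < t \<and> t < 1 \<and> y = ch e t \<and> h y = \<rho> t"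
          then obtain t where "0 < t" "t < 1" "h y = \<rho> t" by blast
          then show ?thesis using pos[of t] eq xv by simp
        qed (use xv in simp)
      next
        assume "\<exists>t. 0 < t \<and> t < 1 \<and> x = ch e t \<and> h x = \<rho> t"
        then obtain t where t: "0 < t" "t < 1" "x = ch e t" "h x = \<rho> t" by blast
        from c2[OF y] show ?thesis
        proof
          assume "y = v \<and> h y = 0"
          then show ?thesis using pos[OF t(1,2)] eq t(4) by simp
        next
          assume "\<exists>t. 0 < t \<and> t < 1 \<and> y = ch e t \<and> h y = \<rho> t"
          then obtain s where s: "y = ch e s" "h y = \<rho> s" by blast
          have "\<rho> t = \<rho> s" using eq t(4) s(2) by simp
          then have "t = s" by (simp add: \<rho>_def split: if_splits)
          then show ?thesis using t(3) s(1) by simp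
        qed
      qed
    qed
  qed
qed

text \<open>An expanding irreducible train track map folds at no interior point of an edge, but the interior of
  some edge is eventually mapped over every vertex.\<close>

theorem no_valence_one_train_track:
  assumes tt: "train_track_map G f" and ex: "expanding_map G f" and irr: "irreducible_map G f"
  shows "no_valence_one G"
  unfolding no_valence_one_def
proof (intro ballI notI)
  fix v assume v: "v \<in> V" and val: "valence G v = 1"
  obtain h e where e: "e \<in> E" "ch e 0 = v \<or> ch e 1 = v" and h: "continuous_map X euclideanreal h"
    "h v = 0" "\<And>x. x \<in> topspace X \<Longrightarrow> h x \<ge> 0" "inj_on h {x \<in> topspace X. h x < 1}"
    by (rule valence_one_function[OF v val]) blast
  have gm: "graph_map G G f" using tt by (simp add: train_track_map_def)
  note fn = graph_map_funpow[OF fgraph_axioms gm]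
  have fnc: "continuous_map X X (f ^^ n)" for n using fn by (simp add: graph_map_def)
  \<comment> \<open>Among three letters there is a middle one, whose closed parameter interval stays
    away from both ends of \<open>e\<close>.\<close>
  have "eventually (\<lambda>n. 3 \<le> length (edge_path G G (f ^^ n) e)) sequentially"
    using ex e(1) unfolding expanding_map_def filterlim_at_top by blast
  then obtain n where n: "3 \<le> length (edge_path G G (f ^^ n) e)" by (auto simp: eventually_sequentially)
  obtain ts where ts: "edge_subdivision G G (f ^^ n) e ts"
    "edge_path G G (f ^^ n) e = map (\<lambda>i. ((f ^^ n) \<circ> ch e) ` {ts ! i<..<ts ! Suc i}) [0..<length ts - 1]"
    by (rule graph_map_edge_path[OF fgraph_axioms fgraph_axioms fn e(1)])
  have len: "Suc 0 < length ts" "Suc 1 < length ts" "Suc 2 < length ts" using n ts(2) by simp_all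
  let ?c = "(f ^^ n) \<circ> ch e"
  have pc: "pathin X ?c" by (rule pathin_compose[OF pathin_ch[OF e(1)] fnc])
  note im = path_subdivision_image[OF pc ts(1)[unfolded edge_subdivision_eq[OF fgraph_axioms]]]
  let ?a = "ts ! 1" and ?b = "ts ! 2"
  have ab: "0 < ?a" "?a < ?b" "?b < 1"
    using im(1,2)[OF len(1)] im(2)[OF len(2)] im(2,3)[OF len(3)] by (simp_all add: numeral_2_eq_2)
  let ?d = "?c ` {?a<..<?b}"
  have d: "?d \<in> E" using im(4)[OF len(2)] by (simp add: numeral_2_eq_2)
  obtain m where m: "m \<ge> 1" "(f ^^ m) ` ?d \<inter> e \<noteq> {}"
    using bspec[OF bspec[OF irr[unfolded irreducible_map_iff[OF fgraph_axioms gm]] d] e(1)] by blast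
  have sub: "e \<subseteq> (f ^^ m) ` ?d"
    using in_edge_path_iff[OF fgraph_axioms fgraph_axioms fn d e(1)] m(2) by blast
  let ?k = "(f ^^ (m + n)) \<circ> ch e"
  have pk: "pathin X ?k" by (rule pathin_compose[OF pathin_ch[OF e(1)] fnc])
  let ?C = "?k ` {?a..?b}"
  have clC: "closedin X ?C" by (rule closedin_image_interval[OF pk]) (use ab in simp_all)
  have eC: "e \<subseteq> ?C"
  proof
    fix x assume "x \<in> e"
    then obtain t where "t \<in> {?a<..<?b}" "x = (f ^^ m) (?c t)" using sub by auto
    then show "x \<in> ?C" by (intro image_eqI[of _ _ t]) (simp_all add: funpow_add)
  qed
  \<comment> \<open>The image of the closed middle interval is closed and contains \<open>e\<close>,
    hence it contains the end vertices of \<open>e\<close> as well.\<close>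
  have vC: "v \<in> ?C"
  proof -
    have "closedin (top_of_set {0..1}) {t \<in> {0..1}. ch e t \<in> ?C}"
      using closedin_continuous_map_preimage[OF ch_continuous[OF e(1)] clC] by simp
    then have "closed {t \<in> {0..1}. ch e t \<in> ?C}" using closedin_closed_trans by blast
    moreover have "{0<..<1} \<subseteq> {t \<in> {0..1}. ch e t \<in> ?C}" using eC ch_mem[OF e(1)] by auto
    ultimately have "closure {0<..<1} \<subseteq> {t \<in> {0..1}. ch e t \<in> ?C}" by (rule closure_minimal[rotated])
    then have *: "{0..1} \<subseteq> {t \<in> {0..1}. ch e t \<in> ?C}" by simp
    have "ch e 0 \<in> ?C" "ch e 1 \<in> ?C" using subsetD[OF *, of 0] subsetD[OF *, of 1] by simp_all
    then show ?thesis using e(2) by auto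
  qed
  then obtain s where s: "s \<in> {?a..?b}" "v = ?k s" by blast
  have s01: "0 < s" "s < 1" "s \<in> {0..1}" using s(1) ab by simp_all
  have "m + n \<ge> 1" using m(1) by simp
  then obtain r where r: "r > 0" "inj_on ?k ({0..1} \<inter> ball s r)"
    using tt e(1) s01(3) unfolding train_track_map_def by blast
  \<comment> \<open>Nonnegative, and zero at the interior time \<open>s\<close>. Near
    \<open>s\<close> it is injective by the train track property, hence strictly monotone, so it
    would take negative values.\<close>
  let ?u = "h \<circ> ?k"
  have pu: "continuous_on {0..1} ?u"
    using continuous_map_compose[OF pk[unfolded pathin_def] h(1)] by simp
  have "openin X {x \<in> topspace X. h x \<in> {..<1}}"
    by (rule openin_continuous_map_preimage[OF h(1)]) simp
  moreover have "?k s \<in> {x \<in> topspace X. h x \<in> {..<1}}"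
    using s(2) h(2) vert_in[OF v] by simp
  ultimately obtain \<delta> where \<delta>: "\<delta> > 0" "\<forall>t\<in>{0..1}. \<bar>t - s\<bar> < \<delta> \<longrightarrow> ?k t \<in> {x \<in> topspace X. h x \<in> {..<1}}"
    using pathin_near[OF pk _ s01(3)] by blast
  define \<epsilon> where "\<epsilon> = min (min r \<delta>) (min s (1 - s)) / 2"
  have \<epsilon>: "0 < \<epsilon>" "\<epsilon> < r" "\<epsilon> < \<delta>" "\<epsilon> < s" "\<epsilon> < 1 - s" using r(1) \<delta>(1) s01(1,2) by (auto simp: \<epsilon>_def min_def)
  let ?J = "{s - \<epsilon>..s + \<epsilon>}"
  have J: "?J \<subseteq> {0..1}" "?J \<subseteq> {0..1} \<inter> ball s r" using \<epsilon> by (auto simp: dist_real_def)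
  have "inj_on h (?k ` ?J)"
  proof (rule inj_on_subset[OF h(4)])
    have "?k t \<in> {x \<in> topspace X. h x < 1}" if "t \<in> ?J" for t
    proof -
      have "\<bar>t - s\<bar> < \<delta>" using that \<epsilon> by (simp add: abs_le_iff abs_less_iff)
      then show ?thesis using \<delta>(2) J(1) that by auto
    qed
    then show "?k ` ?J \<subseteq> {x \<in> topspace X. h x < 1}" by blast
  qed
  then have "inj_on ?u ?J" using inj_on_subset[OF r(2) J(2)] by (rule comp_inj_on[rotated])
  then have "strict_mono_on ?J ?u \<or> strict_antimono_on ?J ?u"
    using injective_eq_monotone_map[of ?J ?u] continuous_on_subset[OF pu J(1)] by (simp add: is_interval_cc)
  moreover have us: "?u s = 0" using s(2) h(2) by simp
  moreover have upos: "?u t \<ge> 0" if "t \<in> {0..1}" for t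
    using h(3) funcset_mem[OF path_image_subset_topspace[OF pk] that] by simp
  moreover have mem: "s - \<epsilon> \<in> ?J" "s \<in> ?J" "s + \<epsilon> \<in> ?J" using \<epsilon> by simp_all
  ultimately show False
  proof (elim disjE)
    assume "strict_mono_on ?J ?u"
    then have "?u (s - \<epsilon>) < ?u s" using mem \<epsilon>(1) by (intro strict_mono_onD[of ?J ?u]) simp_all
    moreover have "s - \<epsilon> \<in> {0..1}" using J(1) mem(1) by blast
    ultimately show False using us upos[of "s - \<epsilon>"] by linarith
  next
    assume "strict_antimono_on ?J ?u"
    then have "?u (s + \<epsilon>) < ?u s" using mem \<epsilon>(1) unfolding monotone_on_def by auto
    moreover have "s + \<epsilon> \<in> {0..1}" using J(1) mem(3) by blast
    ultimately show False using us upos[of "s + \<epsilon>"] by linarith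
  qed
qed

text \<open>The set of points reachable from \<open>x\<close> contains each closed edge or misses
  it, so it and its complement are both closed in the weak topology.\<close>

lemma path_connected:
  assumes conn: "connected_space X" and x: "x \<in> topspace X" and y: "y \<in> topspace X"
  shows "\<exists>c. path_from_to X x y c"
proof -
  define R where "R = {z \<in> topspace X. \<exists>c. path_from_to X x z c}"
  have step: "w \<in> R" if z: "z \<in> R" and c: "path_from_to X z w c" for z w c
    using z path_from_to_join[OF _ c] path_finish_in_topspace[of X c] c unfolding R_def path_from_to_def by blast
  have edge: "ch e s \<in> R \<longleftrightarrow> ch e t \<in> R" if e: "e \<in> E" and st: "s \<in> {0..1}" "t \<in> {0..1}" for e s t
  proof -
    have "path_from_to X (ch e s) (ch e t) (subpath s t (ch e))" "path_from_to X (ch e t) (ch e s) (subpath t s (ch e))"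
      using pathin_subpath[OF pathin_ch[OF e]] st by (simp_all add: path_from_to_def)
    then show ?thesis using step by blast
  qed
  have cl: "{t \<in> {0..1}. ch e t \<in> R} = (if ch e 0 \<in> R then {0..1} else {})" if "e \<in> E" for e
    using edge[OF that, of 0] by auto
  have cl': "{t \<in> {0..1}. ch e t \<in> topspace X - R} = (if ch e 0 \<in> R then {} else {0..1})" if "e \<in> E" for e
    using edge[OF that, of 0] ch_in[OF that] by auto
  have "closedin X R"
  proof (rule closedin_coherent)
    show "R \<subseteq> topspace X" unfolding R_def by blast
    show "closedin (top_of_set {0..1}) {t \<in> {0..1}. ch e t \<in> R}" if "e \<in> E" for e
      unfolding cl[OF that] by simp
  qed
  moreover have "closedin X (topspace X - R)"
  proof (rule closedin_coherent)
    show "topspace X - R \<subseteq> topspace X" by blast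
    show "closedin (top_of_set {0..1}) {t \<in> {0..1}. ch e t \<in> topspace X - R}" if "e \<in> E" for e
      unfolding cl'[OF that] by simp
  qed
  then have "openin X R" by (simp add: openin_closedin_eq R_def)
  ultimately have "R = {} \<or> R = topspace X" using conn unfolding connected_space_clopen_in by blast
  moreover have "x \<in> R" using x unfolding R_def path_from_to_def by (auto intro: exI[of _ "\<lambda>_. x"])
  ultimately show ?thesis using y unfolding R_def by blast
qed

end

section \<open>The kernels of the powers stabilize\<close>

lemma card_small_perms_pos: "card (small_perms n) > 0"
  using finite_small_perms[of n] small_perms_zero[of n] by (auto simp: card_gt_0_iff)

context self_folding
begin

lemma cls_path_from_to: "path_from_to (gtop G) z w a \<Longrightarrow> path_from_to (gtop Q) (cls z) (cls w) (cls \<circ> a)"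
  by (rule path_from_to_image[OF _ F.continuous_cls])

text \<open>On loops, \<open>cls\<close> and \<open>f ^^ k\<close> have the same kernel: one
  direction composes with \<open>proj\<close>, the other is \<open>rel_null\<close>.\<close>

lemma cls_null_iff:
  assumes a: "path_from_to (gtop G) x x a"
  shows "path_homotopic (gtop Q) (cls \<circ> a) (\<lambda>_. cls x) \<longleftrightarrow>
    path_homotopic (gtop G) ((f ^^ k) \<circ> a) (\<lambda>_. (f ^^ k) x)"
proof
  have pa: "pathin (gtop G) a" and x: "x \<in> X"
    using a path_start_in_topspace by (auto simp: path_from_to_def)
  assume "path_homotopic (gtop Q) (cls \<circ> a) (\<lambda>_. cls x)"
  from path_homotopic_image[OF this F.I.p_continuous]
  have 1: "path_homotopic (gtop G) (proj \<circ> (cls \<circ> a)) (\<lambda>_. (f ^^ k) x)"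
    by (simp add: comp_path_const F.proj_cls[OF x])
  have "path_homotopic (gtop G) ((f ^^ k) \<circ> a) (proj \<circ> (cls \<circ> a))"
    by (rule path_homotopic_eq[OF pathin_compose[OF pa fn_continuous]]) (simp add: F.proj_cls_path[OF pa])
  then show "path_homotopic (gtop G) ((f ^^ k) \<circ> a) (\<lambda>_. (f ^^ k) x)"
    using 1 by (rule path_homotopic_trans)
next
  assume "path_homotopic (gtop G) ((f ^^ k) \<circ> a) (\<lambda>_. (f ^^ k) x)"
  then show "path_homotopic (gtop Q) (cls \<circ> a) (\<lambda>_. cls x)" by (rule F.rel_null[OF a]) simp
qed

text \<open>Functions on the loops of \<open>G\<close>, not of the folded graph, so that the sets
  for different \<open>k\<close> can be compared by inclusion.\<close>

definition holonomies :: "'a \<Rightarrow> nat \<Rightarrow> ((real \<Rightarrow> 'a) \<Rightarrow> nat_perm) set" where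
  "holonomies x n = (\<lambda>L. restrict (\<lambda>a. F.Q.hol L (cls \<circ> a)) {a. path_from_to (gtop G) x x a}) `
     (edges Q \<rightarrow>\<^sub>E small_perms n)"

lemma cls_vert:
  assumes "x \<in> verts G"
  shows "cls x \<in> verts Q"
proof -
  have "cls x \<in> F.fold_verts" unfolding F.fold_verts_def using F.g_verts[OF assms] G.vert_in[OF assms] by blast
  then show ?thesis by simp
qed

lemma card_holonomies_power:
  assumes conn: "connected_space (gtop G)" and x: "x \<in> verts G"
  shows "card (holonomies x n) * card (small_perms n) ^ (card (verts Q) - 1) = card (small_perms n) ^ card (edges Q)"
  unfolding holonomies_def
proof (rule F.Q.card_holonomies)
  have xX: "x \<in> X" by (rule G.vert_in[OF x])
  show "cls x \<in> verts Q" by (rule cls_vert[OF x])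
  fix v assume "v \<in> verts Q"
  then obtain z where z: "z \<in> X" "v = cls z" using point_of_fold F.Q.vert_in by blast
  obtain c where "path_from_to (gtop G) x z c" using G.path_connected[OF conn xX z(1)] by blast
  then show "\<exists>c. path_from_to (gtop Q) (cls x) v c" using cls_path_from_to z(2) by blast
next
  fix c assume c: "path_from_to (gtop Q) (cls x) (cls x) c"
  then have "F.liftable c" by (intro F.all_liftable) (simp add: path_from_to_def)
  moreover have "cls x = c 0" "cls x = c 1" using c by (simp_all add: path_from_to_def)
  ultimately obtain a where "path_from_to (gtop G) x x a" "path_homotopic (gtop Q) (cls \<circ> a) c"
    using G.vert_in[OF x] unfolding F.liftable_def by blast
  then show "\<exists>a\<in>{a. path_from_to (gtop G) x x a}. path_homotopic (gtop Q) (cls \<circ> a) c" by blast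
qed (auto simp: cls_path_from_to finite_small_perms small_perms_zero small_perms_add small_perms_uminus)

text \<open>Otherwise the counting formula would equate a positive multiple of a larger power with a
  smaller one; the group of order 2 already shows this.\<close>

lemma verts_le_edges:
  assumes conn: "connected_space (gtop G)" and x: "x \<in> verts G"
  shows "card (verts Q) - 1 \<le> card (edges Q)"
proof (rule ccontr)
  assume "\<not> ?thesis"
  then have less: "card (edges Q) < card (verts Q) - 1" by simp
  let ?s = "card (small_perms 1)"
  have s: "?s > 1" using two_le_card_small_perms[of 1] by simp
  have eq: "card (holonomies x 1) * ?s ^ (card (verts Q) - 1) = ?s ^ card (edges Q)"
    by (rule card_holonomies_power[OF conn x])
  then have "card (holonomies x 1) \<noteq> 0" using s by (intro notI) simp
  then have "1 * ?s ^ (card (verts Q) - 1) \<le> card (holonomies x 1) * ?s ^ (card (verts Q) - 1)"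
    by (intro mult_right_mono) simp_all
  then have "?s ^ (card (verts Q) - 1) \<le> ?s ^ card (edges Q)" unfolding eq by simp
  moreover have "?s ^ card (edges Q) < ?s ^ (card (verts Q) - 1)" by (rule power_strict_increasing[OF less s])
  ultimately show False by simp
qed

text \<open>The first Betti number of the folded graph. If \<open>G\<close> is connected and has a
  vertex, \<open>verts_le_edges\<close> ensures that the subtraction cuts nothing off.\<close>

definition betti :: nat where "betti = card (edges Q) - (card (verts Q) - 1)"

lemma card_holonomies_betti:
  assumes conn: "connected_space (gtop G)" and x: "x \<in> verts G"
  shows "card (holonomies x n) = card (small_perms n) ^ betti"
proof -
  let ?s = "card (small_perms n)"
  have "card (edges Q) = betti + (card (verts Q) - 1)"
    using verts_le_edges[OF conn x] by (simp add: betti_def)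
  then have "card (holonomies x n) * ?s ^ (card (verts Q) - 1) = ?s ^ betti * ?s ^ (card (verts Q) - 1)"
    using card_holonomies_power[OF conn x, of n] by (simp only: power_add)
  then show ?thesis using card_small_perms_pos[of n] by simp
qed

end

text \<open>A later folding is a quotient of an earlier one, so it has fewer holonomy representations.\<close>

lemma holonomies_mono:
  assumes sf: "self_folding G f" and km: "k \<le> m" and x: "x \<in> verts G"
  shows "self_folding.holonomies G f m x n \<subseteq> self_folding.holonomies G f k x n"
proof
  interpret A: self_folding G f k by (rule sf)
  interpret B: self_folding G f m by (rule sf)
  have rel: "B.F.rel z w" if "A.F.rel z w" for z w
  proof -
    obtain a where a: "path_from_to (gtop G) z w a" "path_homotopic (gtop G) ((f ^^ k) \<circ> a) (\<lambda>_. (f ^^ k) z)"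
      using \<open>A.F.rel z w\<close> unfolding A.F.rel_def by blast
    have fm: "f ^^ m = f ^^ (m - k) \<circ> f ^^ k" using km by (simp flip: funpow_add)
    have "path_homotopic (gtop G) ((f ^^ m) \<circ> a) (\<lambda>_. (f ^^ m) z)"
      using path_homotopic_image[OF a(2) A.fn_continuous[of "m - k"]] unfolding fm by (simp add: comp_path_const o_assoc)
    then show ?thesis unfolding B.F.rel_def using a(1) by blast
  qed
  \<comment> \<open>The class map of the later folding factors through that of the earlier
    one.\<close>
  define q where "q C = B.cls (SOME z. z \<in> C)" for C
  have q: "q (A.cls z) = B.cls z" if z: "z \<in> A.X" for z
  proof -
    have "z \<in> A.cls z" using A.F.rel_refl[OF z] by (simp add: A.F.cls_def)
    then have "(SOME z'. z' \<in> A.cls z) \<in> A.cls z" by (rule someI)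
    then have "A.F.rel z (SOME z'. z' \<in> A.cls z)" by (simp add: A.F.cls_def)
    then have "B.F.rel z (SOME z'. z' \<in> A.cls z)" by (rule rel)
    then show ?thesis unfolding q_def using B.F.cls_eq_iff B.F.rel_in by blast
  qed
  have qch: "continuous_map (top_of_set {0..1}) (gtop B.Q) (q \<circ> charmap A.Q e)" if e: "e \<in> edges A.Q" for e
  proof -
    have e': "e \<in> A.F.fold_edges" using e by simp
    note l = A.F.is_liftD[OF A.F.lift_of(1)[OF e']]
    have "continuous_map (top_of_set {0..1}) (gtop B.Q) (B.cls \<circ> snd (A.F.lift_of e))"
      using continuous_map_compose[OF l(2)[unfolded pathin_def] B.F.continuous_cls] .
    then show ?thesis by (rule continuous_map_eq) (simp add: A.F.fold_ch_def q l(4))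
  qed
  have qv: "q v \<in> verts B.Q" if v: "v \<in> verts A.Q" for v
  proof -
    have "v \<in> A.F.fold_verts" using v by simp
    then obtain z where z: "z \<in> A.X" "(f ^^ k) z \<in> verts G" "v = A.cls z" unfolding A.F.fold_verts_def by blast
    have "(f ^^ (m - k)) ((f ^^ k) z) \<in> verts G"
      using graph_map_funpow[OF A.G.fgraph_axioms A.f_map, of "m - k"] z(2) unfolding graph_map_def by blast
    then have "(f ^^ m) z \<in> verts G" using km by (simp flip: funpow_add[THEN fun_cong, unfolded o_apply])
    then have "B.cls z \<in> B.F.fold_verts" unfolding B.F.fold_verts_def using z(1) by blast
    then show ?thesis unfolding z(3) q[OF z(1)] by simp
  qed
  have qc: "continuous_map (gtop A.Q) (gtop B.Q) q"
    by (rule A.F.Q.continuous_map_coherent[OF _ qch]) (use qv B.F.Q.vert_in in auto)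
  let ?A = "{a. path_from_to (gtop G) x x a}"
  fix \<rho> assume "\<rho> \<in> B.holonomies x n"
  then obtain L where L: "L \<in> edges B.Q \<rightarrow>\<^sub>E small_perms n" "\<rho> = restrict (\<lambda>a. B.F.Q.hol L (B.cls \<circ> a)) ?A"
    unfolding B.holonomies_def by blast
  \<comment> \<open>The labelling pulled back along \<open>q\<close>; \<open>L2\<close> makes it
    extensional, as \<open>holonomies\<close> requires.\<close>
  define L1 where "L1 e = B.F.Q.hol L (q \<circ> charmap A.Q e)" for e
  define L2 where "L2 = restrict L1 (edges A.Q)"
  have "L1 e \<in> small_perms n" if e: "e \<in> edges A.Q" for e
    unfolding L1_def
  proof (rule B.F.Q.hol_in_subgroup)
    show "pathin (gtop B.Q) (q \<circ> charmap A.Q e)" using qch[OF e] by (simp add: pathin_def)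
    show "(q \<circ> charmap A.Q e) 0 \<in> verts B.Q" "(q \<circ> charmap A.Q e) 1 \<in> verts B.Q"
      using qv[OF A.F.Q.ch_0[OF e]] qv[OF A.F.Q.ch_1[OF e]] by simp_all
    show "L e' \<in> small_perms n" if "e' \<in> edges B.Q" for e' using L(1) that by blast
  qed (auto simp: small_perms_zero small_perms_add small_perms_uminus)
  then have L2: "L2 \<in> edges A.Q \<rightarrow>\<^sub>E small_perms n" by (simp add: L2_def)
  have "B.F.Q.hol L (B.cls \<circ> a) = A.F.Q.hol L2 (A.cls \<circ> a)" if a: "path_from_to (gtop G) x x a" for a
  proof -
    have pa: "pathin (gtop G) a" using a by (simp add: path_from_to_def)
    have pA: "pathin (gtop A.Q) (A.cls \<circ> a)" "(A.cls \<circ> a) 0 \<in> verts A.Q" "(A.cls \<circ> a) 1 \<in> verts A.Q"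
      using A.cls_path_from_to[OF a] A.cls_vert[OF x] by (simp_all add: path_from_to_def)
    have "path_homotopic (gtop B.Q) (B.cls \<circ> a) (q \<circ> (A.cls \<circ> a))"
    proof (rule path_homotopic_eq[OF pathin_compose[OF pa B.F.continuous_cls]])
      fix t :: real assume "t \<in> {0..1}"
      then have "a t \<in> A.X" using funcset_mem[OF path_image_subset_topspace[OF pa]] by blast
      then show "(B.cls \<circ> a) t = (q \<circ> (A.cls \<circ> a)) t" by (simp add: q)
    qed
    then have "B.F.Q.hol L (B.cls \<circ> a) = B.F.Q.hol L (q \<circ> (A.cls \<circ> a))"
      by (rule holonomy_homotopic[OF B.F.Q.cocycle_jump])
    also have "\<dots> = A.F.Q.hol L1 (A.cls \<circ> a)"
      unfolding L1_def by (rule hol_compose[OF A.F.Q.fgraph_axioms B.F.Q.fgraph_axioms qc pA])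
    also have "\<dots> = A.F.Q.hol L2 (A.cls \<circ> a)"
    proof -
      have "L1 e = - 0 + L2 e + 0" if "e \<in> edges A.Q" for e using that by (simp add: L2_def)
      from A.F.Q.hol_cong[OF pA, of L1 "\<lambda>_. 0" L2, OF this] show ?thesis
        by (simp only: minus_zero add_0_left add_0_right)
    qed
    finally show ?thesis .
  qed
  then have "\<rho> = restrict (\<lambda>a. A.F.Q.hol L2 (A.cls \<circ> a)) ?A"
    unfolding L(2) by (intro restrict_ext) simp
  then show "\<rho> \<in> A.holonomies x n" unfolding A.holonomies_def using L2 by blast
qed

lemma conjugate_null_iff:
  assumes d: "path_from_to X y x d" and a: "path_from_to X x x a"
  shows "path_homotopic X (path_join (path_join d a) (path_reverse d)) (\<lambda>_. y) \<longleftrightarrow> path_homotopic X a (\<lambda>_. x)"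
proof
  have pd: "pathin X d" "d 0 = y" "d 1 = x" and pa: "pathin X a" "a 0 = x" "a 1 = x"
    using d a by (simp_all add: path_from_to_def)
  have y: "y \<in> topspace X" and x: "x \<in> topspace X"
    using path_start_in_topspace[OF pd(1)] path_finish_in_topspace[OF pd(1)] pd by simp_all
  have rd: "pathin X (path_reverse d)" by (rule pathin_reverse[OF pd(1)])
  {
    assume "path_homotopic X a (\<lambda>_. x)"
    then have "path_homotopic X (path_join (path_join d a) (path_reverse d)) (path_join (path_join d (\<lambda>_. x)) (path_reverse d))"
      using pd pa rd by (intro path_homotopic_join path_homotopic_refl) simp_all
    also have "path_homotopic X \<dots> (path_join d (path_reverse d))"
      using pd rd by (intro path_homotopic_join path_homotopic_const_right path_homotopic_refl) simp_all
    also have "path_homotopic X \<dots> (\<lambda>_. y)" using path_homotopic_reverse_right[OF pd(1)] pd(2) by simp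
    finally show "path_homotopic X (path_join (path_join d a) (path_reverse d)) (\<lambda>_. y)" .
  next
    assume null: "path_homotopic X (path_join (path_join d a) (path_reverse d)) (\<lambda>_. y)"
    have "path_homotopic X (\<lambda>_. y) (path_join d (path_reverse d))"
      using path_homotopic_sym[OF path_homotopic_reverse_right[OF pd(1)]] pd(2) by simp
    with null have "path_homotopic X (path_join (path_join d a) (path_reverse d)) (path_join d (path_reverse d))"
      by (rule path_homotopic_trans)
    then have "path_homotopic X (path_join d a) d"
      by (rule path_homotopic_join_cancel_right) (use pd pa rd in \<open>simp_all add: pathin_join\<close>)
    also have "path_homotopic X d (path_join d (\<lambda>_. x))"
      using pd by (intro path_homotopic_sym[OF path_homotopic_const_right]) simp_all
    finally show "path_homotopic X a (\<lambda>_. x)"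
      by (rule path_homotopic_join_cancel_left) (use pd pa x in simp_all)
  }
qed

text \<open>One \<open>k\<close> serves all basepoints. It is found at a vertex, where the count of
  representations applies, and carried to other points by conjugation.\<close>

theorem kernels_stabilize:
  fixes G :: "'a cw_graph"
  assumes G: "fgraph G" and conn: "connected_space (gtop G)" and f: "graph_map G G f" and v: "verts G \<noteq> {}"
  shows "\<exists>k\<ge>1. \<forall>m\<ge>k. \<forall>x a. path_from_to (gtop G) x x a \<longrightarrow>
    path_homotopic (gtop G) ((f ^^ m) \<circ> a) (\<lambda>_. (f ^^ m) x) \<longrightarrow>
    path_homotopic (gtop G) ((f ^^ k) \<circ> a) (\<lambda>_. (f ^^ k) x)"
proof -
  interpret G: fgraph G by fact
  have sf: "self_folding G f" using G f by (simp add: self_folding_def self_folding_axioms_def)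
  obtain x0 where x0: "x0 \<in> verts G" using v by blast
  have x0X: "x0 \<in> topspace (gtop G)" by (rule G.vert_in[OF x0])
  let ?b = "self_folding.betti G f"
  \<comment> \<open>Minimality turns the inclusion of holonomy sets for a later \<open>m\<close>
    into an equality: both are finite, and the one for \<open>k\<close> has no more elements than
    the one for \<open>m\<close>.\<close>
  obtain k where k: "k \<ge> 1" "\<And>m. m \<ge> 1 \<Longrightarrow> ?b k \<le> ?b m"
    using ex_has_least_nat[of "\<lambda>k. k \<ge> 1" 1 ?b] by auto
  interpret A: self_folding G f k by (rule sf)
  have base: "path_homotopic (gtop G) ((f ^^ k) \<circ> a) (\<lambda>_. (f ^^ k) x0)"
    if m: "m \<ge> k" and a: "path_from_to (gtop G) x0 x0 a"
      and null: "path_homotopic (gtop G) ((f ^^ m) \<circ> a) (\<lambda>_. (f ^^ m) x0)" for m a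
  proof -
    interpret B: self_folding G f m by (rule sf)
    have eq: "A.holonomies x0 n = B.holonomies x0 n" for n
    proof (rule card_seteq[symmetric])
      show "B.holonomies x0 n \<subseteq> A.holonomies x0 n" by (rule holonomies_mono[OF sf m x0])
      show "finite (A.holonomies x0 n)"
        unfolding A.holonomies_def using A.F.Q.finite_edges finite_small_perms by (intro finite_imageI finite_PiE) auto
      have "m \<ge> 1" using m k(1) by simp
      then show "card (A.holonomies x0 n) \<le> card (B.holonomies x0 n)"
        unfolding A.card_holonomies_betti[OF conn x0] B.card_holonomies_betti[OF conn x0]
        using card_small_perms_pos[of n] k(2) by (intro power_increasing) simp_all
    qed
    have nullB: "path_homotopic (gtop B.Q) (B.cls \<circ> a) (\<lambda>_. B.cls x0)"
      using B.cls_null_iff[OF a] null by simp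
    have pA: "pathin (gtop A.Q) (A.cls \<circ> a)" "(A.cls \<circ> a) 0 = A.cls x0" "(A.cls \<circ> a) 1 = A.cls x0"
      using A.cls_path_from_to[OF a] by (simp_all add: path_from_to_def)
    have "path_homotopic (gtop A.Q) (A.cls \<circ> a) (\<lambda>_. (A.cls \<circ> a) 0)"
    proof (rule A.F.Q.null_homotopic_if_hol_trivial)
      show "pathin (gtop A.Q) (A.cls \<circ> a)" "(A.cls \<circ> a) 0 = (A.cls \<circ> a) 1" using pA by simp_all
      fix n and L :: "'a set set \<Rightarrow> nat_perm" assume L: "\<And>e. L e \<in> small_perms n"
      define L0 where "L0 = restrict L (edges A.Q)"
      have "L0 \<in> edges A.Q \<rightarrow>\<^sub>E small_perms n" using L by (simp add: L0_def)
      then have "restrict (\<lambda>a. A.F.Q.hol L0 (A.cls \<circ> a)) {a. path_from_to (gtop G) x0 x0 a} \<in> A.holonomies x0 n"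
        unfolding A.holonomies_def by blast
      \<comment> \<open>Every representation for \<open>k\<close> is one for \<open>m\<close>, where
        the loop is trivial.\<close>
      then obtain L' where L': "restrict (\<lambda>a. A.F.Q.hol L0 (A.cls \<circ> a)) {a. path_from_to (gtop G) x0 x0 a} =
          restrict (\<lambda>a. B.F.Q.hol L' (B.cls \<circ> a)) {a. path_from_to (gtop G) x0 x0 a}"
        unfolding eq B.holonomies_def by blast
      have "A.F.Q.hol L (A.cls \<circ> a) = A.F.Q.hol L0 (A.cls \<circ> a)"
        using A.F.Q.hol_cong[OF pA(1), of L "\<lambda>_. 0" L0] pA A.cls_vert[OF x0] by (simp add: L0_def)
      also have "\<dots> = B.F.Q.hol L' (B.cls \<circ> a)" using fun_cong[OF L', of a] a by simp
      also have "\<dots> = B.F.Q.hol L' (\<lambda>_. B.cls x0)" by (rule holonomy_homotopic[OF B.F.Q.cocycle_jump nullB])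
      also have "\<dots> = 0"
        using B.F.topspace_fold x0X by (intro holonomy_const[OF B.F.Q.cocycle_jump]) blast
      finally show "A.F.Q.hol L (A.cls \<circ> a) = 0" .
    qed
    then show ?thesis using A.cls_null_iff[OF a] unfolding pA(2) by blast
  qed
  show ?thesis
  proof (intro exI[of _ k] conjI k(1) allI impI)
    fix m x a assume m: "k \<le> m" and a: "path_from_to (gtop G) x x a"
      and null: "path_homotopic (gtop G) ((f ^^ m) \<circ> a) (\<lambda>_. (f ^^ m) x)"
    have xX: "x \<in> topspace (gtop G)" using a path_start_in_topspace by (auto simp: path_from_to_def)
    obtain d where d: "path_from_to (gtop G) x0 x d" using G.path_connected[OF conn x0X xX] by blast
    let ?a = "path_join (path_join d a) (path_reverse d)"
    have a': "path_from_to (gtop G) x0 x0 ?a"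
      by (intro path_from_to_join[OF path_from_to_join[OF d a]] path_from_to_reverse d)
    have iff: "path_homotopic (gtop G) ((f ^^ j) \<circ> ?a) (\<lambda>_. (f ^^ j) x0) \<longleftrightarrow>
        path_homotopic (gtop G) ((f ^^ j) \<circ> a) (\<lambda>_. (f ^^ j) x)" for j
      unfolding comp_path_join comp_path_reverse
      by (rule conjugate_null_iff[OF path_from_to_image[OF d A.fn_continuous] path_from_to_image[OF a A.fn_continuous]])
    show "path_homotopic (gtop G) ((f ^^ k) \<circ> a) (\<lambda>_. (f ^^ k) x)"
      using base[OF m a'] null unfolding iff by blast
  qed
qed

section \<open>The fundamental group\<close>

lemma path_class_self: "pathin X p \<Longrightarrow> p \<in> path_class X p"
  by (simp add: path_class_def path_homotopic_refl)

lemma path_class_eqI: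
  assumes "path_homotopic X p q"
  shows "path_class X p = path_class X q"
  unfolding path_class_def
  using path_homotopic_trans[OF assms] path_homotopic_trans[OF path_homotopic_sym[OF assms]] by blast

lemma path_class_eq_iff: "pathin X q \<Longrightarrow> path_class X p = path_class X q \<longleftrightarrow> path_homotopic X p q"
  using path_class_eqI path_class_self unfolding path_class_def by blast

lemma carrier_pi1: "carrier (pi1 X x) = path_class X ` {p. path_from_to X x x p}"
  and one_pi1: "\<one>\<^bsub>pi1 X x\<^esub> = path_class X (\<lambda>_. x)"
  by (simp_all add: pi1_def)

lemma path_class_in_carrier: "path_from_to X x x p \<Longrightarrow> path_class X p \<in> carrier (pi1 X x)"
  by (simp add: carrier_pi1)

lemma UN_constant_eq': "a \<in> A \<Longrightarrow> (\<And>b. b \<in> A \<Longrightarrow> f b = c) \<Longrightarrow> (\<Union>b\<in>A. f b) = c"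
  by blast

lemma mult_pi1:
  assumes "path_from_to X x x p" "path_from_to X x x q"
  shows "path_class X p \<otimes>\<^bsub>pi1 X x\<^esub> path_class X q = path_class X (path_join p q)"
proof -
  have p: "pathin X p" "p 1 = x" and q: "pathin X q" "q 0 = x"
    using assms by (simp_all add: path_from_to_def)
  have "path_class X (path_join p' q') = path_class X (path_join p q)"
    if "p' \<in> path_class X p" "q' \<in> path_class X q" for p' q'
  proof (rule path_class_eqI[OF path_homotopic_sym])
    show "path_homotopic X (path_join p q) (path_join p' q')"
      using that p q by (intro path_homotopic_join) (simp_all add: path_class_def)
  qed
  then have "(\<Union>p'\<in>path_class X p. \<Union>q'\<in>path_class X q. path_class X (path_join p' q')) = path_class X (path_join p q)"
    by (intro UN_constant_eq'[OF path_class_self[OF p(1)]] UN_constant_eq'[OF path_class_self[OF q(1)]])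
  then show ?thesis unfolding pi1_def by simp
qed

lemma pi1_cases:
  assumes "A \<in> carrier (pi1 X x)"
  obtains p where "path_from_to X x x p" "A = path_class X p"
  using assms by (auto simp: carrier_pi1)

lemma group_pi1:
  assumes x: "x \<in> topspace X"
  shows "group (pi1 X x)"
proof (rule groupI)
  have c: "path_from_to X x x (\<lambda>_. x)" using x by (simp add: path_from_to_def)
  show "\<one>\<^bsub>pi1 X x\<^esub> \<in> carrier (pi1 X x)" unfolding one_pi1 by (rule path_class_in_carrier[OF c])
  fix A assume "A \<in> carrier (pi1 X x)"
  then obtain p where p: "path_from_to X x x p" "A = path_class X p" by (rule pi1_cases)
  have pp: "pathin X p" "p 0 = x" "p 1 = x" using p(1) by (simp_all add: path_from_to_def)
  show "\<one>\<^bsub>pi1 X x\<^esub> \<otimes>\<^bsub>pi1 X x\<^esub> A = A"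
    unfolding one_pi1 p(2) mult_pi1[OF c p(1)]
    by (rule path_class_eqI[OF path_homotopic_const_left[OF pp(1,2)]])
  show "\<exists>B\<in>carrier (pi1 X x). B \<otimes>\<^bsub>pi1 X x\<^esub> A = \<one>\<^bsub>pi1 X x\<^esub>"
  proof (intro bexI)
    show "path_class X (path_reverse p) \<in> carrier (pi1 X x)"
      by (rule path_class_in_carrier[OF path_from_to_reverse[OF p(1)]])
    show "path_class X (path_reverse p) \<otimes>\<^bsub>pi1 X x\<^esub> A = \<one>\<^bsub>pi1 X x\<^esub>"
      unfolding one_pi1 p(2) mult_pi1[OF path_from_to_reverse[OF p(1)] p(1)]
      using path_class_eqI[OF path_homotopic_reverse_left[OF pp(1)]] pp(3) by simp
  qed
  fix B assume "B \<in> carrier (pi1 X x)"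
  then obtain q where q: "path_from_to X x x q" "B = path_class X q" by (rule pi1_cases)
  show "A \<otimes>\<^bsub>pi1 X x\<^esub> B \<in> carrier (pi1 X x)"
    unfolding p(2) q(2) mult_pi1[OF p(1) q(1)] by (rule path_class_in_carrier[OF path_from_to_join[OF p(1) q(1)]])
  fix C assume "C \<in> carrier (pi1 X x)"
  then obtain r where r: "path_from_to X x x r" "C = path_class X r" by (rule pi1_cases)
  show "A \<otimes>\<^bsub>pi1 X x\<^esub> B \<otimes>\<^bsub>pi1 X x\<^esub> C = A \<otimes>\<^bsub>pi1 X x\<^esub> (B \<otimes>\<^bsub>pi1 X x\<^esub> C)"
    unfolding p(2) q(2) r(2) mult_pi1[OF p(1) q(1)] mult_pi1[OF q(1) r(1)]
      mult_pi1[OF path_from_to_join[OF p(1) q(1)] r(1)] mult_pi1[OF p(1) path_from_to_join[OF q(1) r(1)]]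
    using p(1) q(1) r(1) by (intro path_class_eqI path_homotopic_assoc) (simp_all add: path_from_to_def)
qed

section \<open>Induced homomorphisms and their kernels\<close>

definition pi1_map :: "'b topology \<Rightarrow> ('a \<Rightarrow> 'b) \<Rightarrow> (real \<Rightarrow> 'a) set \<Rightarrow> (real \<Rightarrow> 'b) set" where
  "pi1_map Y \<phi> A = (\<Union>p\<in>A. path_class Y (\<phi> \<circ> p))"

lemma pi1_map_class:
  assumes "pathin X p" "continuous_map X Y \<phi>"
  shows "pi1_map Y \<phi> (path_class X p) = path_class Y (\<phi> \<circ> p)"
  unfolding pi1_map_def
proof (rule UN_constant_eq'[OF path_class_self[OF assms(1)]])
  fix q assume "q \<in> path_class X p"
  then have "path_homotopic X p q" by (simp add: path_class_def)
  from path_homotopic_image[OF this assms(2)] show "path_class Y (\<phi> \<circ> q) = path_class Y (\<phi> \<circ> p)"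
    by (rule path_class_eqI[OF path_homotopic_sym])
qed

lemma pi1_map_hom:
  assumes \<phi>: "continuous_map X Y \<phi>"
  shows "pi1_map Y \<phi> \<in> hom (pi1 X x) (pi1 Y (\<phi> x))"
proof (rule homI)
  fix A assume "A \<in> carrier (pi1 X x)"
  then obtain p where p: "path_from_to X x x p" "A = path_class X p" by (rule pi1_cases)
  then have pp: "pathin X p" by (simp add: path_from_to_def)
  note p' = path_from_to_image[OF p(1) \<phi>]
  show "pi1_map Y \<phi> A \<in> carrier (pi1 Y (\<phi> x))"
    unfolding p(2) pi1_map_class[OF pp \<phi>] by (rule path_class_in_carrier[OF p'])
  fix B assume "B \<in> carrier (pi1 X x)"
  then obtain q where q: "path_from_to X x x q" "B = path_class X q" by (rule pi1_cases)
  then have qq: "pathin X q" by (simp add: path_from_to_def)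
  have pq: "pathin X (path_join p q)" using path_from_to_join[OF p(1) q(1)] by (simp add: path_from_to_def)
  show "pi1_map Y \<phi> (A \<otimes>\<^bsub>pi1 X x\<^esub> B) = pi1_map Y \<phi> A \<otimes>\<^bsub>pi1 Y (\<phi> x)\<^esub> pi1_map Y \<phi> B"
    unfolding p(2) q(2) mult_pi1[OF p(1) q(1)] pi1_map_class[OF pq \<phi>] pi1_map_class[OF pp \<phi>] pi1_map_class[OF qq \<phi>]
      mult_pi1[OF p' path_from_to_image[OF q(1) \<phi>]] comp_path_join ..
qed

lemma pi1_endo_class:
  assumes \<sigma>: "path_from_to X x (f x) \<sigma>" and f: "continuous_map X X f" and p: "path_from_to X x x p"
  shows "pi1_endo X \<sigma> f (path_class X p) = path_class X (path_join (path_join \<sigma> (f \<circ> p)) (path_reverse \<sigma>))"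
  unfolding pi1_endo_def
proof (rule UN_constant_eq')
  have pp: "pathin X p" "p 0 = x" "p 1 = x" using p by (simp_all add: path_from_to_def)
  show "p \<in> path_class X p" by (rule path_class_self[OF pp(1)])
  fix q assume "q \<in> path_class X p"
  then have pq: "path_homotopic X p q" by (simp add: path_class_def)
  have "path_homotopic X (path_join (path_join \<sigma> (f \<circ> p)) (path_reverse \<sigma>)) (path_join (path_join \<sigma> (f \<circ> q)) (path_reverse \<sigma>))"
    using \<sigma> pp by (intro path_homotopic_join path_homotopic_image[OF pq f] path_homotopic_refl pathin_reverse)
      (simp_all add: path_from_to_def)
  then show "path_class X (path_join (path_join \<sigma> (f \<circ> q)) (path_reverse \<sigma>)) = path_class X (path_join (path_join \<sigma> (f \<circ> p)) (path_reverse \<sigma>))"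
    by (rule path_class_eqI[OF path_homotopic_sym])
qed

lemma conjugate_loop:
  assumes "path_from_to X x (f x) \<sigma>" "continuous_map X X f" "path_from_to X x x p"
  shows "path_from_to X x x (path_join (path_join \<sigma> (f \<circ> p)) (path_reverse \<sigma>))"
  by (rule path_from_to_join[OF path_from_to_join[OF assms(1) path_from_to_image[OF assms(3,2)]] path_from_to_reverse[OF assms(1)]])

lemma pi1_endo_hom:
  assumes \<sigma>: "path_from_to X x (f x) \<sigma>" and f: "continuous_map X X f"
  shows "pi1_endo X \<sigma> f \<in> hom (pi1 X x) (pi1 X x)"
proof (rule homI)
  fix A assume "A \<in> carrier (pi1 X x)"
  then obtain p where p: "path_from_to X x x p" "A = path_class X p" by (rule pi1_cases)
  note lp = conjugate_loop[OF \<sigma> f p(1)]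
  show "pi1_endo X \<sigma> f A \<in> carrier (pi1 X x)"
    unfolding p(2) pi1_endo_class[OF \<sigma> f p(1)] by (rule path_class_in_carrier[OF lp])
  fix B assume "B \<in> carrier (pi1 X x)"
  then obtain q where q: "path_from_to X x x q" "B = path_class X q" by (rule pi1_cases)
  note lq = conjugate_loop[OF \<sigma> f q(1)]
  have s: "pathin X \<sigma>" "\<sigma> 0 = x" "\<sigma> 1 = f x" using \<sigma> by (simp_all add: path_from_to_def)
  have fp: "pathin X (f \<circ> p)" "p 0 = x" "p 1 = x" and fq: "pathin X (f \<circ> q)" "q 0 = x" "q 1 = x"
    using path_from_to_image[OF p(1) f] path_from_to_image[OF q(1) f] p(1) q(1) by (simp_all add: path_from_to_def)
  let ?r = "path_reverse \<sigma>"
  have r: "pathin X ?r" by (rule pathin_reverse[OF s(1)])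
  let ?L = "path_join (path_join \<sigma> (f \<circ> p)) ?r" and ?M = "path_join (path_join \<sigma> (f \<circ> q)) ?r"
  \<comment> \<open>After rebracketing, the reversed \<open>\<sigma>\<close> of the first factor
    cancels against the \<open>\<sigma>\<close> of the second.\<close>
  have "path_homotopic X (path_join ?L ?M) (path_join (path_join \<sigma> (f \<circ> p)) (path_join ?r ?M))"
    using s fp fq r by (intro path_homotopic_assoc) (simp_all add: pathin_join)
  also have "path_homotopic X (path_join (path_join \<sigma> (f \<circ> p)) (path_join ?r ?M)) (path_join (path_join \<sigma> (f \<circ> p)) (path_join ?r (path_join \<sigma> (path_join (f \<circ> q) ?r))))"
    using s fp fq r by (intro path_homotopic_join path_homotopic_assoc path_homotopic_refl) (simp_all add: pathin_join)
  also have "path_homotopic X \<dots> (path_join (path_join \<sigma> (f \<circ> p)) (path_join (f \<circ> q) ?r))"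
    using s fp fq r by (intro path_homotopic_join path_homotopic_cancel_left path_homotopic_refl) (simp_all add: pathin_join)
  also have "path_homotopic X \<dots> (path_join (path_join (path_join \<sigma> (f \<circ> p)) (f \<circ> q)) ?r)"
    using s fp fq r by (intro path_homotopic_sym[OF path_homotopic_assoc]) (simp_all add: pathin_join)
  also have "path_homotopic X \<dots> (path_join (path_join \<sigma> (path_join (f \<circ> p) (f \<circ> q))) ?r)"
    using s fp fq r by (intro path_homotopic_join path_homotopic_assoc path_homotopic_refl) (simp_all add: pathin_join)
  finally have main: "path_homotopic X (path_join ?L ?M) (path_join (path_join \<sigma> (f \<circ> path_join p q)) ?r)"
    by (simp only: comp_path_join)
  show "pi1_endo X \<sigma> f (A \<otimes>\<^bsub>pi1 X x\<^esub> B) = pi1_endo X \<sigma> f A \<otimes>\<^bsub>pi1 X x\<^esub> pi1_endo X \<sigma> f B"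
    unfolding p(2) q(2) mult_pi1[OF p(1) q(1)] pi1_endo_class[OF \<sigma> f p(1)] pi1_endo_class[OF \<sigma> f q(1)]
      pi1_endo_class[OF \<sigma> f path_from_to_join[OF p(1) q(1)]] mult_pi1[OF lp lq]
    by (rule path_class_eqI[OF main, symmetric])
qed

lemma continuous_map_funpow:
  assumes "continuous_map X X f"
  shows "continuous_map X X (f ^^ m)"
proof (induction m)
  case 0 show ?case by simp
next
  case (Suc m) show ?case unfolding funpow.simps by (rule continuous_map_compose[OF Suc.IH assms])
qed

text \<open>Each application of the endomorphism conjugates by a path, which does not affect
  null-homotopy. So the auxiliary path \<open>\<sigma>\<close> disappears from the kernels of the
  powers.\<close>

lemma pi1_endo_funpow_one_iff:
  assumes \<sigma>: "path_from_to X x (f x) \<sigma>" and f: "continuous_map X X f" and p: "path_from_to X x x p"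
  shows "(pi1_endo X \<sigma> f ^^ m) (path_class X p) = \<one>\<^bsub>pi1 X x\<^esub> \<longleftrightarrow> path_homotopic X ((f ^^ m) \<circ> p) (\<lambda>_. (f ^^ m) x)"
  using p
proof (induction m arbitrary: p)
  case 0
  have "x \<in> topspace X" using \<sigma> path_start_in_topspace by (auto simp: path_from_to_def)
  then show ?case by (simp add: one_pi1 path_class_eq_iff o_def)
next
  case (Suc m)
  have fm: "continuous_map X X (f ^^ m)" by (rule continuous_map_funpow[OF f])
  let ?q = "path_join (path_join \<sigma> (f \<circ> p)) (path_reverse \<sigma>)"
  have "(pi1_endo X \<sigma> f ^^ Suc m) (path_class X p) = (pi1_endo X \<sigma> f ^^ m) (path_class X ?q)"
    unfolding funpow_Suc_right o_apply pi1_endo_class[OF \<sigma> f Suc.prems] ..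
  then have "(pi1_endo X \<sigma> f ^^ Suc m) (path_class X p) = \<one>\<^bsub>pi1 X x\<^esub> \<longleftrightarrow> path_homotopic X ((f ^^ m) \<circ> ?q) (\<lambda>_. (f ^^ m) x)"
    using Suc.IH[OF conjugate_loop[OF \<sigma> f Suc.prems]] by (simp only:)
  also have "\<dots> \<longleftrightarrow> path_homotopic X ((f ^^ m) \<circ> (f \<circ> p)) (\<lambda>_. (f ^^ m) (f x))"
    unfolding comp_path_join comp_path_reverse
    by (rule conjugate_null_iff[OF path_from_to_image[OF \<sigma> fm] path_from_to_image[OF path_from_to_image[OF Suc.prems f] fm]])
  also have "(f ^^ m) \<circ> (f \<circ> p) = (f ^^ Suc m) \<circ> p" by (simp add: fun_eq_iff funpow_swap1)
  finally show ?case by (simp add: funpow_swap1)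
qed

lemma stable_kernel_pi1:
  assumes \<sigma>: "path_from_to X x (f x) \<sigma>" and f: "continuous_map X X f"
  shows "stable_kernel (pi1 X x) (pi1_endo X \<sigma> f) =
    {path_class X p |p. path_from_to X x x p \<and> (\<exists>m\<ge>1. path_homotopic X ((f ^^ m) \<circ> p) (\<lambda>_. (f ^^ m) x))}"
proof (intro equalityI subsetI)
  fix A assume "A \<in> stable_kernel (pi1 X x) (pi1_endo X \<sigma> f)"
  then obtain m where m: "m \<ge> 1" "A \<in> carrier (pi1 X x)" "(pi1_endo X \<sigma> f ^^ m) A = \<one>\<^bsub>pi1 X x\<^esub>"
    by (auto simp: stable_kernel_def kernel_def)
  obtain p where p: "path_from_to X x x p" "A = path_class X p" using m(2) by (rule pi1_cases)
  then show "A \<in> {path_class X p |p. path_from_to X x x p \<and> (\<exists>m\<ge>1. path_homotopic X ((f ^^ m) \<circ> p) (\<lambda>_. (f ^^ m) x))}"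
    using m pi1_endo_funpow_one_iff[OF \<sigma> f p(1)] by blast
next
  fix A assume "A \<in> {path_class X p |p. path_from_to X x x p \<and> (\<exists>m\<ge>1. path_homotopic X ((f ^^ m) \<circ> p) (\<lambda>_. (f ^^ m) x))}"
  then obtain p m where p: "A = path_class X p" "path_from_to X x x p" "m \<ge> 1"
    "path_homotopic X ((f ^^ m) \<circ> p) (\<lambda>_. (f ^^ m) x)" by blast
  then have "A \<in> kernel (pi1 X x) (pi1 X x) (pi1_endo X \<sigma> f ^^ m)"
    using pi1_endo_funpow_one_iff[OF \<sigma> f p(2)] path_class_in_carrier[OF p(2)] by (simp add: kernel_def)
  then show "A \<in> stable_kernel (pi1 X x) (pi1_endo X \<sigma> f)"
    using p(3) by (auto simp: stable_kernel_def)
qed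

section \<open>The folded graph realizes the stable quotient\<close>

theorem theorem1p1:
  fixes \<Theta> :: "'a cw_graph" and f :: "'a \<Rightarrow> 'a" and x :: 'a and \<sigma> :: "real \<Rightarrow> 'a"
  assumes "finite_graph \<Theta>" and "connected_space (gtop \<Theta>)" and "no_valence_one \<Theta>"
    and "train_track_map \<Theta> f" and "expanding_map \<Theta> f" and "irreducible_map \<Theta> f"
    and "x \<in> topspace (gtop \<Theta>)" and "path_from_to (gtop \<Theta>) x (f x) \<sigma>"
  shows
    "let f_star = pi1_endo (gtop \<Theta>) \<sigma> f;
         Q = stable_quotient (pi1 (gtop \<Theta>) x) f_star;
         \<phi> = stable_endo (pi1 (gtop \<Theta>) x) f_star
     in
     \<exists>(\<Theta>' :: 'a set cw_graph) (f' :: 'a set \<Rightarrow> 'a set).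
       finite_graph \<Theta>' \<and> connected_space (gtop \<Theta>') \<and> no_valence_one \<Theta>' \<and>
       train_track_map \<Theta>' f' \<and> expanding_map \<Theta>' f' \<and> irreducible_map \<Theta>' f' \<and>
       (\<exists>y \<tau> \<psi>. y \<in> topspace (gtop \<Theta>') \<and> path_from_to (gtop \<Theta>') y (f' y) \<tau> \<and>
          \<psi> \<in> iso (pi1 (gtop \<Theta>') y) Q \<and>
          (\<exists>c\<in>carrier Q. \<forall>a\<in>carrier (pi1 (gtop \<Theta>') y).
             \<psi> (pi1_endo (gtop \<Theta>') \<tau> f' a) = c \<otimes>\<^bsub>Q\<^esub> \<phi> (\<psi> a) \<otimes>\<^bsub>Q\<^esub> inv\<^bsub>Q\<^esub> c)) \<and>
       (\<exists>(p :: 'a set \<Rightarrow> 'a) (\<Phi> :: 'a \<Rightarrow> 'a set).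
          graph_map \<Theta>' \<Theta> p \<and> graph_map \<Theta> \<Theta>' \<Phi> \<and>
          (\<forall>z\<in>topspace (gtop \<Theta>). f' (\<Phi> z) = \<Phi> (f z)) \<and>
          (\<forall>w\<in>topspace (gtop \<Theta>'). p (f' w) = f (p w)) \<and>
          (\<exists>K\<ge>1.
             (\<forall>z\<in>topspace (gtop \<Theta>). p (\<Phi> z) = (f ^^ K) z) \<and>
             (\<forall>w\<in>topspace (gtop \<Theta>'). \<Phi> (p w) = (f' ^^ K) w)))"
proof -
  let ?X = "gtop \<Theta>" and ?\<pi> = "pi1 (gtop \<Theta>) x"
  have G: "fgraph \<Theta>" using assms(1) by (rule fgraph.intro)
  interpret G: fgraph \<Theta> by (rule G)
  have gm: "graph_map \<Theta> \<Theta> f" using assms(4) by (simp add: train_track_map_def)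
  have verts: "verts \<Theta> \<noteq> {}"
  proof
    assume e: "verts \<Theta> = {}"
    then have "edges \<Theta> = {}" using G.ch_0 by blast
    with e show False using assms(7) G.topspace_eq by simp
  qed
  obtain k where k: "k \<ge> 1" and stab: "\<And>m x a. m \<ge> k \<Longrightarrow> path_from_to ?X x x a \<Longrightarrow>
      path_homotopic ?X ((f ^^ m) \<circ> a) (\<lambda>_. (f ^^ m) x) \<Longrightarrow> path_homotopic ?X ((f ^^ k) \<circ> a) (\<lambda>_. (f ^^ k) x)"
    using kernels_stabilize[OF G assms(2) gm verts] by blast
  interpret S: self_folding \<Theta> f k using G gm by (simp add: self_folding_def self_folding_axioms_def)
  let ?Q = "S.F.Q" and ?h = "S.fold_map" and ?\<Phi> = "S.F.cls" and ?p = "S.F.proj"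
  define F where "F = pi1_endo ?X \<sigma> f"
  define N where "N = stable_kernel ?\<pi> F"
  define y where "y = ?\<Phi> x"
  let ?\<rho> = "pi1 (gtop ?Q) y"
  \<comment> \<open>Transporting \<open>\<sigma>\<close> makes \<open>push\<close> intertwine the
    two endomorphisms exactly, so that the inner automorphism in the conclusion can be taken to be
    trivial.\<close>
  define \<tau> where "\<tau> = ?\<Phi> \<circ> \<sigma>"
  define F' where "F' = pi1_endo (gtop ?Q) \<tau> ?h"
  define push where "push = pi1_map (gtop ?Q) ?\<Phi>"
  have y: "y \<in> topspace (gtop ?Q)" unfolding y_def S.F.topspace_fold using assms(7) by (rule imageI)
  have hy: "?h y = ?\<Phi> (f x)" unfolding y_def by (rule S.fold_map_cls[OF assms(7)])
  have \<tau>: "path_from_to (gtop ?Q) y (?h y) \<tau>"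
    unfolding hy unfolding y_def \<tau>_def by (rule S.cls_path_from_to[OF assms(8)])
  have hc: "continuous_map (gtop ?Q) (gtop ?Q) ?h" using S.continuous_fold_map_pow[of 1] by simp
  have tt: "train_track_map ?Q ?h" and ex: "expanding_map ?Q ?h" and irr: "irreducible_map ?Q ?h"
    using S.train_track_fold_map assms(4) S.expanding_fold_map assms(5) S.irreducible_fold_map assms(6) by blast+
  have conn: "connected_space (gtop ?Q)"
    using connectedin_continuous_map_image[OF S.F.continuous_cls, of "topspace ?X"] assms(2)
    unfolding S.F.topspace_fold[symmetric] by (simp add: connectedin_topspace)
  interpret P: group ?\<pi> by (rule group_pi1[OF assms(7)])
  interpret R: group ?\<rho> by (rule group_pi1[OF y])
  have Fhom: "F \<in> hom ?\<pi> ?\<pi>" unfolding F_def by (rule pi1_endo_hom[OF assms(8) S.f_continuous])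
  have phom: "push \<in> hom ?\<pi> ?\<rho>" unfolding push_def y_def by (rule pi1_map_hom[OF S.F.continuous_cls])
  interpret push: group_hom ?\<pi> ?\<rho> push using phom by unfold_locales
  have push: "push (path_class ?X p) = path_class (gtop ?Q) (?\<Phi> \<circ> p)" if "path_from_to ?X x x p" for p
    unfolding push_def using that by (intro pi1_map_class[OF _ S.F.continuous_cls]) (simp add: path_from_to_def)
  have surj: "push ` carrier ?\<pi> = carrier ?\<rho>"
  proof (intro equalityI subsetI)
    fix B assume "B \<in> push ` carrier ?\<pi>" then show "B \<in> carrier ?\<rho>" using push.hom_closed by blast
  next
    fix B assume "B \<in> carrier ?\<rho>"
    then obtain b where b: "path_from_to (gtop ?Q) y y b" "B = path_class (gtop ?Q) b" by (rule pi1_cases)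
    have "S.F.liftable b" using b(1) by (intro S.F.all_liftable) (simp add: path_from_to_def)
    moreover have "?\<Phi> x = b 0" "?\<Phi> x = b 1" using b(1) by (simp_all add: path_from_to_def y_def)
    ultimately obtain a where a: "path_from_to ?X x x a" "path_homotopic (gtop ?Q) (?\<Phi> \<circ> a) b"
      using assms(7) unfolding S.F.liftable_def by blast
    have "B = push (path_class ?X a)"
      unfolding push[OF a(1)] b(2) by (rule path_class_eqI[OF path_homotopic_sym[OF a(2)]])
    then show "B \<in> push ` carrier ?\<pi>" using path_class_in_carrier[OF a(1)] by (rule image_eqI)
  qed
  have push_one: "push (path_class ?X p) = \<one>\<^bsub>?\<rho>\<^esub> \<longleftrightarrow> path_homotopic ?X ((f ^^ k) \<circ> p) (\<lambda>_. (f ^^ k) x)"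
    if p: "path_from_to ?X x x p" for p
    unfolding push[OF p] one_pi1 using y S.cls_null_iff[OF p] by (simp add: path_class_eq_iff y_def)
  \<comment> \<open>The stable kernel is a union over all powers, while the kernel of
    \<open>push\<close> belongs to the power \<open>k\<close> alone; stabilization identifies
    them.\<close>
  have ker: "N = kernel ?\<pi> ?\<rho> push"
  proof (intro equalityI subsetI)
    fix A assume "A \<in> N"
    then obtain p m where p: "A = path_class ?X p" "path_from_to ?X x x p" "path_homotopic ?X ((f ^^ m) \<circ> p) (\<lambda>_. (f ^^ m) x)"
      unfolding N_def F_def stable_kernel_pi1[OF assms(8) S.f_continuous] by blast
    \<comment> \<open>\<open>m\<close> may be smaller than \<open>k\<close>, so it is raised to
      \<open>m + k\<close> before \<open>stab\<close> is applied.\<close>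
    have "f ^^ (m + k) = f ^^ k \<circ> f ^^ m" by (simp add: add.commute flip: funpow_add)
    then have "path_homotopic ?X ((f ^^ (m + k)) \<circ> p) (\<lambda>_. (f ^^ (m + k)) x)"
      using path_homotopic_image[OF p(3) S.fn_continuous[of k]] by (simp add: comp_path_const o_assoc)
    from stab[OF _ p(2) this] have "path_homotopic ?X ((f ^^ k) \<circ> p) (\<lambda>_. (f ^^ k) x)" by simp
    then show "A \<in> kernel ?\<pi> ?\<rho> push"
      using push_one[OF p(2)] path_class_in_carrier[OF p(2)] by (simp add: kernel_def p(1))
  next
    fix A assume A: "A \<in> kernel ?\<pi> ?\<rho> push"
    then have "A \<in> carrier ?\<pi>" by (simp add: kernel_def)
    then obtain p where p: "path_from_to ?X x x p" "A = path_class ?X p" by (rule pi1_cases)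
    have "path_homotopic ?X ((f ^^ k) \<circ> p) (\<lambda>_. (f ^^ k) x)"
      using A push_one[OF p(1)] by (simp add: kernel_def p(2))
    then show "A \<in> N"
      unfolding N_def F_def stable_kernel_pi1[OF assms(8) S.f_continuous] using p k by blast
  qed
  interpret N: normal N ?\<pi> unfolding ker by (rule push.normal_kernel)
  let ?M = "?\<pi> Mod N"
  interpret M: group ?M by (rule N.factorgroup_is_group)
  \<comment> \<open>The isomorphism of the first isomorphism theorem for \<open>push\<close>;
    \<open>\<psi>\<close> will be its inverse.\<close>
  define \<theta> where "\<theta> = (\<lambda>C. the_elem (push ` C))"
  have \<theta>: "\<theta> \<in> iso ?M ?\<rho>" unfolding \<theta>_def ker by (rule push.FactGroup_iso_set[OF surj])
  define \<psi> where "\<psi> = inv_into (carrier ?M) \<theta>"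
  have \<psi>: "\<psi> \<in> iso ?\<rho> ?M" unfolding \<psi>_def by (rule M.iso_set_sym[OF \<theta>])
  have coset: "N #>\<^bsub>?\<pi>\<^esub> a \<in> carrier ?M" if "a \<in> carrier ?\<pi>" for a
    using that by (auto simp: FactGroup_def RCOSETS_def)
  have \<theta>_coset: "\<theta> (N #>\<^bsub>?\<pi>\<^esub> a) = push a" if a: "a \<in> carrier ?\<pi>" for a
  proof -
    have "push ` (N #>\<^bsub>?\<pi>\<^esub> a) = {push a}"
    proof (intro equalityI subsetI)
      fix b assume "b \<in> push ` (N #>\<^bsub>?\<pi>\<^esub> a)"
      then obtain n where n: "n \<in> N" "b = push (n \<otimes>\<^bsub>?\<pi>\<^esub> a)" unfolding r_coset_def by blast
      have "n \<in> carrier ?\<pi>" "push n = \<one>\<^bsub>?\<rho>\<^esub>" using n(1) unfolding ker kernel_def by simp_all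
      then show "b \<in> {push a}" using n(2) a push.hom_mult[of n a] push.hom_closed[OF a] by simp
    next
      fix b assume "b \<in> {push a}"
      then show "b \<in> push ` (N #>\<^bsub>?\<pi>\<^esub> a)" using P.rcos_self[OF a N.subgroup_axioms] by blast
    qed
    then show ?thesis by (simp add: \<theta>_def)
  qed
  have \<psi>_push: "\<psi> (push a) = N #>\<^bsub>?\<pi>\<^esub> a" if a: "a \<in> carrier ?\<pi>" for a
  proof -
    have "inj_on \<theta> (carrier ?M)" using \<theta> by (simp add: iso_def bij_betw_def)
    then show ?thesis unfolding \<psi>_def \<theta>_coset[OF a, symmetric] using coset[OF a] by (rule inv_into_f_f)
  qed
  \<comment> \<open>With this the images of the elements of a coset lie in a single coset, as
    \<open>the_elem\<close> in \<open>stable_endo\<close> requires.\<close>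
  have FN: "F n \<in> N" if n: "n \<in> N" for n
  proof -
    from n obtain m where m: "m \<ge> 1" "n \<in> carrier ?\<pi>" "(F ^^ m) n = \<one>\<^bsub>?\<pi>\<^esub>"
      unfolding N_def stable_kernel_def kernel_def by auto
    have "(F ^^ m) (F n) = F ((F ^^ m) n)" by (simp only: funpow_swap1)
    also have "\<dots> = \<one>\<^bsub>?\<pi>\<^esub>" using m(3) hom_one[OF Fhom P.group_axioms P.group_axioms] by simp
    finally show ?thesis
      unfolding N_def stable_kernel_def kernel_def using m(1) hom_in_carrier[OF Fhom m(2)] by auto
  qed
  define \<phi> where "\<phi> = stable_endo ?\<pi> F"
  have \<phi>_coset: "\<phi> (N #>\<^bsub>?\<pi>\<^esub> a) = N #>\<^bsub>?\<pi>\<^esub> F a" if a: "a \<in> carrier ?\<pi>" for a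
  proof -
    have Fa: "F a \<in> carrier ?\<pi>" by (rule hom_in_carrier[OF Fhom a])
    have "N #>\<^bsub>?\<pi>\<^esub> F b = N #>\<^bsub>?\<pi>\<^esub> F a" if b: "b \<in> N #>\<^bsub>?\<pi>\<^esub> a" for b
    proof -
      obtain n where n: "n \<in> N" "b = n \<otimes>\<^bsub>?\<pi>\<^esub> a" using b unfolding r_coset_def by blast
      have nc: "n \<in> carrier ?\<pi>" using n(1) N.subset by blast
      have "F b = F n \<otimes>\<^bsub>?\<pi>\<^esub> F a" unfolding n(2) by (rule hom_mult[OF Fhom nc a])
      then have "F b \<in> N #>\<^bsub>?\<pi>\<^esub> F a" using FN[OF n(1)] unfolding r_coset_def by blast
      from P.repr_independence[OF this Fa N.subgroup_axioms] show ?thesis by simp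
    qed
    moreover have "a \<in> N #>\<^bsub>?\<pi>\<^esub> a" by (rule P.rcos_self[OF a N.subgroup_axioms])
    ultimately have "(\<lambda>b. N #>\<^bsub>?\<pi>\<^esub> F b) ` (N #>\<^bsub>?\<pi>\<^esub> a) = {N #>\<^bsub>?\<pi>\<^esub> F a}" by blast
    then show ?thesis unfolding \<phi>_def stable_endo_def N_def[symmetric] by simp
  qed
  have push_F: "push (F a) = F' (push a)" if a: "a \<in> carrier ?\<pi>" for a
  proof -
    obtain p where p: "path_from_to ?X x x p" "a = path_class ?X p" using a by (rule pi1_cases)
    have p': "path_from_to (gtop ?Q) y y (?\<Phi> \<circ> p)" unfolding y_def by (rule S.cls_path_from_to[OF p(1)])
    have pp: "pathin ?X p" using p(1) by (simp add: path_from_to_def)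
    have fp: "path_homotopic (gtop ?Q) (?\<Phi> \<circ> (f \<circ> p)) (?h \<circ> (?\<Phi> \<circ> p))"
    proof (rule path_homotopic_eq)
      show "pathin (gtop ?Q) (?\<Phi> \<circ> (f \<circ> p))"
        by (intro pathin_compose[OF _ S.F.continuous_cls] pathin_compose[OF pp S.f_continuous])
      fix t :: real assume "t \<in> {0..1}"
      then have "p t \<in> topspace ?X" using funcset_mem[OF path_image_subset_topspace[OF pp]] by blast
      then show "(?\<Phi> \<circ> (f \<circ> p)) t = (?h \<circ> (?\<Phi> \<circ> p)) t" by (simp add: S.fold_map_cls)
    qed
    have "path_homotopic (gtop ?Q) (path_join (path_join \<tau> (?\<Phi> \<circ> (f \<circ> p))) (path_reverse \<tau>))
        (path_join (path_join \<tau> (?h \<circ> (?\<Phi> \<circ> p))) (path_reverse \<tau>))"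
      using \<tau> p(1) hy by (intro path_homotopic_join fp path_homotopic_refl pathin_reverse) (simp_all add: path_from_to_def)
    then show ?thesis
      unfolding p(2) F_def F'_def pi1_endo_class[OF assms(8) S.f_continuous p(1)] push[OF p(1)]
        push[OF conjugate_loop[OF assms(8) S.f_continuous p(1)]] pi1_endo_class[OF \<tau> hc p']
        comp_path_join comp_path_reverse \<tau>_def[symmetric]
      by (rule path_class_eqI)
  qed
  have semi: "\<psi> (F' b) = \<one>\<^bsub>?M\<^esub> \<otimes>\<^bsub>?M\<^esub> \<phi> (\<psi> b) \<otimes>\<^bsub>?M\<^esub> inv\<^bsub>?M\<^esub> \<one>\<^bsub>?M\<^esub>" if b: "b \<in> carrier ?\<rho>" for b
  proof -
    obtain a where a: "a \<in> carrier ?\<pi>" "b = push a" using b surj by blast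
    have Fa: "F a \<in> carrier ?\<pi>" by (rule hom_in_carrier[OF Fhom a(1)])
    have "\<psi> (F' b) = N #>\<^bsub>?\<pi>\<^esub> F a" unfolding a(2) push_F[OF a(1), symmetric] by (rule \<psi>_push[OF Fa])
    moreover have "\<phi> (\<psi> b) = N #>\<^bsub>?\<pi>\<^esub> F a" unfolding a(2) \<psi>_push[OF a(1)] by (rule \<phi>_coset[OF a(1)])
    ultimately show ?thesis using coset[OF Fa] by (simp only: M.inv_one M.r_one M.l_one)
  qed
  have maps: "(\<forall>z\<in>topspace ?X. ?h (?\<Phi> z) = ?\<Phi> (f z)) \<and> (\<forall>w\<in>topspace (gtop ?Q). ?p (?h w) = f (?p w)) \<and>
      (\<exists>K\<ge>1. (\<forall>z\<in>topspace ?X. ?p (?\<Phi> z) = (f ^^ K) z) \<and> (\<forall>w\<in>topspace (gtop ?Q). ?\<Phi> (?p w) = (?h ^^ K) w))"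
    using S.fold_map_cls S.proj_fold_map S.F.proj_cls S.cls_proj k by blast
  have groups: "\<exists>y \<tau> \<psi>. y \<in> topspace (gtop ?Q) \<and> path_from_to (gtop ?Q) y (?h y) \<tau> \<and>
      \<psi> \<in> iso (pi1 (gtop ?Q) y) ?M \<and>
      (\<exists>c\<in>carrier ?M. \<forall>a\<in>carrier (pi1 (gtop ?Q) y).
         \<psi> (pi1_endo (gtop ?Q) \<tau> ?h a) = c \<otimes>\<^bsub>?M\<^esub> \<phi> (\<psi> a) \<otimes>\<^bsub>?M\<^esub> inv\<^bsub>?M\<^esub> c)"
    using y \<tau> \<psi> M.one_closed semi unfolding F'_def by blast
  have fin: "finite_graph ?Q" by (rule S.F.Q.finite_graph)
  have nv: "no_valence_one ?Q" by (rule S.F.Q.no_valence_one_train_track[OF tt ex irr])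
  show ?thesis
    unfolding Let_def stable_quotient_def F_def[symmetric] N_def[symmetric] \<phi>_def[symmetric]
    by (rule exI[of _ ?Q], rule exI[of _ ?h])
      (intro conjI fin conn nv tt ex irr groups exI[of _ ?p] exI[of _ ?\<Phi>] S.F.graph_map_proj S.F.graph_map_cls maps[THEN conjunct1] maps[THEN conjunct2, THEN conjunct1] maps[THEN conjunct2, THEN conjunct2])
qed

end
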